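(* Let $R\ge\frac12$, let $z\in\mathbb{K}$, and let $\Lambda,\Lambda'\colon V\times V\to\mathbb{K}$ be even continuous bilinear forms such that their antisymmetric parts coincide. Then the Weyl algebras $\widehat{\mathcal{W}}_R(V,\star_{z\Lambda})$ and $\widehat{\mathcal{W}}_R(V,\star_{z\Lambda'})$ are isomorphic via the continuous equivalence transformation $$\mathrm{e}^{z\Delta_g}(a\star_{z\Lambda}b)=\left(\mathrm{e}^{z\Delta_g}a\right)\star_{z\Lambda'}\left(\mathrm{e}^{z\Delta_g}b\right),$$ where $g=\Lambda'-\Lambda=\Lambda'_+-\Lambda_+$ and $a,b\in\widehat{\mathcal{W}}_R(V)$.
   Context: $\mathbb{K}=\mathbb{R}$ or $\mathbb{C}$, and $V=V_{\mathbf 0}\oplus V_{\mathbf 1}$ is a $\mathbb{Z}_2$-graded Hausdorff locally convex $\mathbb{K}$-vector space with continuous projections onto $V_{\mathbf 0}$, $V_{\mathbf 1}$. In exponents of $-1$ a homogeneous vector denotes its parity. Symmetric algebra: $S_n$ acts from the right on $V^{\otimes n}$ by $(v_1\otimes\cdots\otimes v_n)\triangleleft\sigma=\pm\, v_{\sigma(1)}\otimes\cdots\otimes v_{\sigma(n)}$ for homogeneous $v_i$, where $\pm$ is the Koszul sign ($-1$ to the number of pairs $i<j$ with $\sigma(i)>\sigma(j)$ and $v_{\sigma(i)},v_{\sigma(j)}$ both odd). $\mathcal{S}_n(v)=\frac1{n!}\sum_{\sigma} v\triangleleft\sigma$, $\mathrm{S}^n(V)=\operatorname{im}\mathcal{S}_n\subseteq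 V^{\otimes n}$, $\mathrm{S}^0(V)=\mathbb{K}$, $\mathrm{S}^\bullet(V)=\bigoplus_n \mathrm{S}^n(V)$, with product $\mu(v\otimes w)=vw=\mathcal{S}(v\otimes w)$, $\mathcal{S}=\bigoplus_n\mathcal{S}_n$. $\Lambda$ is even if $\Lambda(v,w)=0$ for homogeneous $v,w$ of different parity; $\Lambda_\pm(v,w)=\frac12(\Lambda(v,w)\pm(-1)^{vw}\Lambda(w,v))$ are the symmetric and antisymmetric parts. $P_\Lambda$ is the linear extension of $$P_\Lambda(v_1\cdots v_n\otimes w_1\cdots w_m)=\sum_{k=1}^n\sum_{\ell=1}^m(-1)^{v_k(v_{k+1}+\cdots+v_n)+w_\ell(w_1+\cdots+w_{\ell-1})}\Lambda(v_k,w_\ell)\,v_1\cdots\widehat{v_k}\cdots v_n\otimes w_1\cdots\widehat{w_\ell}\cdots w_m$$ on $\mathrm{S}^\bullet(V)\otimes \mathrm{S}^\bullet(V)$ (homogeneous vectors; hats denote omission; $P_\Lambda$ vanishes if one factor is in $\mathrm{S}^0(V)$), and $a\star_{z\Lambda}b=\sum_{k\ge0}\frac{z^k}{k!}\mu(P_\Lambda^k(a\otimes b))$. For a symmetric even bilinear form $g$ ($g(v,w)=(-1)^{vw}g(w,v)$), $\Delta_g\colon \mathrm{S}^\bullet(V)\to \mathrm{S}^{\bullet-2}(V)$ is the linear extension of $$\Delta_g(v_1\cdots v_n)=\sum_{i<j}(-1)^{v_i(v_1+\cdots+v_{i-1})}(-1)^{v_j(v_1+\cdots+v_{i-1}+v_{i+1}+\cdots+v_{j-1})}g(v_i,v_j)\,v_1\cdots\widehat{v_i}\cdots\widehat{v_j}\cdots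 v_n$$ for homogeneous $v_i$. $\mathrm{e}^{z\Delta_g}=\sum_k\frac{z^k}{k!}\Delta_g^k$ on $\mathrm{S}^\bullet(V)$ (locally finite sum), and it denotes also its continuous extension to the completion below. Topology: for a continuous seminorm $p$ on $V$ let $p^n$ be the projective tensor seminorm on $V^{\otimes n}$ ($p^0=|\cdot|$) and $p_R(v)=\sum_np^n(v_n)\,n!^R$ for $v=\sum_nv_n$. $\mathcal{W}_R(V,\star_{z\Lambda})$ is $\mathrm{S}^\bullet(V)$ with product $\star_{z\Lambda}$ and the topology of all $p_R$ ($p$ a continuous seminorm on $V$). For $R\ge\frac12$ the product is continuous and extends to the completion $\widehat{\mathcal{W}}_R(V,\star_{z\Lambda})$, whose underlying space is $\widehat{\mathcal{W}}_R(V)$. *)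

theory Defs
  imports "HOL-Analysis.Analysis" "HOL-Library.Function_Algebras" "HOL-Library.Groups_Big_Fun"
begin

text \<open>
  The ground field is a type of class \<^class>\<open>real_normed_field\<close>. By Gelfand--Mazur (or Ostrowski)
  the only such fields are the real and the complex numbers with their usual absolute value.
\<close>


section \<open>Locally convex spaces\<close>

definition seminorm :: "('k::real_normed_field \<Rightarrow> 'v::ab_group_add \<Rightarrow> 'v) \<Rightarrow> ('v \<Rightarrow> real) \<Rightarrow> bool"
  where "seminorm scl p \<longleftrightarrow>
    (\<forall>v. 0 \<le> p v) \<and> (\<forall>v w. p (v + w) \<le> p v + p w) \<and> (\<forall>c v. p (scl c v) = norm c * p v)"

definition cont_seminorm ::
    "('k::real_normed_field \<Rightarrow> 'v::topological_ab_group_add \<Rightarrow> 'v) \<Rightarrow> ('v \<Rightarrow> real) \<Rightarrow> bool"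
  where "cont_seminorm scl p \<longleftrightarrow> seminorm scl p \<and> continuous_on UNIV p"

locale lc_space = vector_space scl
  for scl :: "'k::real_normed_field \<Rightarrow> 'v::{topological_ab_group_add, t2_space} \<Rightarrow> 'v" +
  assumes continuous_scale: "continuous_on UNIV (\<lambda>(c, v). scl c v)"
    and locally_convex:
      "open U \<Longrightarrow> 0 \<in> U \<Longrightarrow> \<exists>p. cont_seminorm scl p \<and> {v. p v < 1} \<subseteq> U"

definition proj0 :: "'v::ab_group_add set \<Rightarrow> 'v set \<Rightarrow> 'v \<Rightarrow> 'v"
  where "proj0 V0 V1 v = (THE x. x \<in> V0 \<and> v - x \<in> V1)"

definition proj1 :: "'v::ab_group_add set \<Rightarrow> 'v set \<Rightarrow> 'v \<Rightarrow> 'v"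
  where "proj1 V0 V1 v = (THE x. x \<in> V1 \<and> v - x \<in> V0)"

locale graded_lc_space = lc_space scl
  for scl :: "'k::real_normed_field \<Rightarrow> 'v::{topological_ab_group_add, t2_space} \<Rightarrow> 'v" +
  fixes V0 V1 :: "'v set"
  assumes subspace_V0: "subspace V0" and subspace_V1: "subspace V1"
    and V0_Int_V1: "V0 \<inter> V1 = {0}"
    and V0_plus_V1: "\<And>v. \<exists>x\<in>V0. \<exists>y\<in>V1. v = x + y"
    and continuous_proj0: "continuous_on UNIV (proj0 V0 V1)"
    and continuous_proj1: "continuous_on UNIV (proj1 V0 V1)"


section \<open>Bilinear forms\<close>

definition bilinear_form :: "('k::field \<Rightarrow> 'v::ab_group_add \<Rightarrow> 'v) \<Rightarrow> ('v \<Rightarrow> 'v \<Rightarrow> 'k) \<Rightarrow> bool"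
  where "bilinear_form scl B \<longleftrightarrow>
    (\<forall>v. Vector_Spaces.linear scl (*) (B v)) \<and> (\<forall>w. Vector_Spaces.linear scl (*) (\<lambda>v. B v w))"

definition even_form :: "'v set \<Rightarrow> 'v set \<Rightarrow> ('v \<Rightarrow> 'v \<Rightarrow> 'k::zero) \<Rightarrow> bool"
  where "even_form V0 V1 B \<longleftrightarrow> (\<forall>v\<in>V0. \<forall>w\<in>V1. B v w = 0 \<and> B w v = 0)"

text \<open>The bilinear form that maps homogeneous \<open>(v, w)\<close> to \<open>(-1)\<^bsup>vw\<^esup> B(w, v)\<close>.\<close>

definition graded_flip ::
    "'v::ab_group_add set \<Rightarrow> 'v set \<Rightarrow> ('v \<Rightarrow> 'v \<Rightarrow> 'k::field) \<Rightarrow> 'v \<Rightarrow> 'v \<Rightarrow> 'k"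
  where "graded_flip V0 V1 B v w =
    B (proj0 V0 V1 w) (proj0 V0 V1 v) + B (proj1 V0 V1 w) (proj0 V0 V1 v)
    + B (proj0 V0 V1 w) (proj1 V0 V1 v) - B (proj1 V0 V1 w) (proj1 V0 V1 v)"

definition sym_part ::
    "'v::ab_group_add set \<Rightarrow> 'v set \<Rightarrow> ('v \<Rightarrow> 'v \<Rightarrow> 'k::field) \<Rightarrow> 'v \<Rightarrow> 'v \<Rightarrow> 'k"
  where "sym_part V0 V1 B v w = (B v w + graded_flip V0 V1 B v w) / 2"

definition antisym_part ::
    "'v::ab_group_add set \<Rightarrow> 'v set \<Rightarrow> ('v \<Rightarrow> 'v \<Rightarrow> 'k::field) \<Rightarrow> 'v \<Rightarrow> 'v \<Rightarrow> 'k"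
  where "antisym_part V0 V1 B v w = (B v w - graded_flip V0 V1 B v w) / 2"


section \<open>Tensor products\<close>

text \<open>
  Tensors are realised as linear functionals on multilinear forms, with pointwise operations:
  a multilinear form of degree \<open>n\<close> on \<open>V\<close> is a function on lists of length \<open>n\<close>, and
  \<open>v\<^sub>1 \<otimes> \<dots> \<otimes> v\<^sub>n\<close> is evaluation at \<open>[v\<^sub>1, \<dots>, v\<^sub>n]\<close>. A \<open>\<phi>\<close> with \<open>multilinear scl \<phi>\<close> is a family of
  multilinear forms, one in each degree, hence an arbitrary linear functional on the tensor algebra.
  Over a field such functionals separate points, so the span of these evaluations is the tensor
  algebra (lemma \<open>tens_universal\<close> below).
\<close>

definition fscale :: "'k::field \<Rightarrow> ('x \<Rightarrow> 'k) \<Rightarrow> 'x \<Rightarrow> 'k"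
  where "fscale c f = (\<lambda>x. c * f x)"

lemma vector_space_fscale: "vector_space fscale"
  by unfold_locales (auto simp: fscale_def plus_fun_def algebra_simps)

type_synonym ('k, 'v) tensor = "('v list \<Rightarrow> 'k) \<Rightarrow> 'k"

definition multilinear ::
    "('k::field \<Rightarrow> 'v::ab_group_add \<Rightarrow> 'v) \<Rightarrow> ('k \<Rightarrow> 'w::ab_group_add \<Rightarrow> 'w) \<Rightarrow> ('v list \<Rightarrow> 'w) \<Rightarrow> bool"
  where "multilinear scl sclW f \<longleftrightarrow>
    (\<forall>us ws. Vector_Spaces.linear scl sclW (\<lambda>v. f (us @ v # ws)))"

definition tens :: "('k::field \<Rightarrow> 'v::ab_group_add \<Rightarrow> 'v) \<Rightarrow> 'v list \<Rightarrow> ('k, 'v) tensor"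
  where "tens scl vs = (\<lambda>\<phi>. if multilinear scl (*) \<phi> then \<phi> vs else 0)"

lemma tens_universal:
  assumes V: "vector_space scl" and W: "vector_space sclW" and f: "multilinear scl sclW f"
  shows "\<exists>F. Vector_Spaces.linear fscale sclW F \<and> (\<forall>vs. F (tens scl vs) = f vs)"
proof -
  interpret V: vector_space scl by (fact V)
  interpret W: vector_space sclW by (fact W)
  interpret T: vector_space "fscale :: _ \<Rightarrow> ('a, 'b) tensor \<Rightarrow> _" by (fact vector_space_fscale)
  interpret TW: vector_space_pair "fscale :: _ \<Rightarrow> ('a, 'b) tensor \<Rightarrow> _" sclW ..
  interpret K: vector_space "(*) :: 'a \<Rightarrow> 'a \<Rightarrow> 'a" by unfold_locales (auto simp: algebra_simps)
  interpret TK: vector_space_pair "fscale :: _ \<Rightarrow> ('a, 'b) tensor \<Rightarrow> _" "(*) :: 'a \<Rightarrow> 'a \<Rightarrow> 'a" ..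
  obtain B where B: "W.independent B" "W.span B = UNIV"
    by (metis W.maximal_independent_subset top.extremum_uniqueI)
  define \<phi> where "\<phi> b vs = W.representation B (f vs) b" for b vs
  have lin: "Vector_Spaces.linear sclW (*) (\<lambda>w. W.representation B w b)" for b
    by (rule W.linear_representation[OF B])
  have \<phi>: "multilinear scl (*) (\<phi> b)" for b
    unfolding multilinear_def \<phi>_def
  proof (intro allI)
    fix us ws
    have "Vector_Spaces.linear scl sclW (\<lambda>v. f (us @ v # ws))"
      using f by (simp add: multilinear_def)
    from Vector_Spaces.linear_compose[OF this lin[of b]]
    show "Vector_Spaces.linear scl (*) (\<lambda>v. W.representation B (f (us @ v # ws)) b)"
      by (simp add: o_def)
  qed
  have tens_\<phi>: "tens scl vs (\<phi> b) = W.representation B (f vs) b" for vs b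
    using \<phi> by (simp add: tens_def \<phi>_def)
  obtain C where C: "C \<subseteq> range (tens scl)" "T.independent C" "range (tens scl) \<subseteq> T.span C"
    by (metis T.maximal_independent_subset)
  obtain pick where pick: "\<And>c. c \<in> C \<Longrightarrow> c = tens scl (pick c)"
    using C(1) by (metis image_iff subsetD)
  obtain F where F: "Vector_Spaces.linear fscale sclW F" "\<forall>c\<in>C. F c = f (pick c)"
    using TW.linear_independent_extend[OF C(2), of "\<lambda>c. f (pick c)"] by blast
  have "F (tens scl vs) = f vs" for vs
  proof -
    have "W.representation B (F (tens scl vs)) b = tens scl vs (\<phi> b)" for b
    proof (rule TK.linear_eq_on_span[where B = C and x = "tens scl vs"
          and f = "\<lambda>t. W.representation B (F t) b" and g = "\<lambda>t. t (\<phi> b)"])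
      show "Vector_Spaces.linear fscale (*) (\<lambda>t. W.representation B (F t) b)"
        using Vector_Spaces.linear_compose[OF F(1) lin[of b]] by (simp add: o_def)
      show "Vector_Spaces.linear fscale (*) (\<lambda>t :: ('a, 'b) tensor. t (\<phi> b))"
        by unfold_locales (auto simp: fscale_def plus_fun_def algebra_simps)
      show "W.representation B (F c) b = c (\<phi> b)" if "c \<in> C" for c
        proof -
        have "c (\<phi> b) = tens scl (pick c) (\<phi> b)" by (rule fun_cong[OF pick[OF that]])
        moreover have "F c = f (pick c)" using F(2) that by blast
        ultimately show ?thesis by (simp only: tens_\<phi>)
      qed
      show "tens scl vs \<in> T.span C" using C(3) by auto
    qed
    then have eq: "W.representation B (F (tens scl vs)) = W.representation B (f vs)"
      by (simp only: tens_\<phi> fun_eq_iff) simp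
    have sum: "(\<Sum>b | W.representation B w b \<noteq> 0. sclW (W.representation B w b) b) = w" for w
      by (rule W.sum_nonzero_representation_eq[OF B(1)]) (simp add: B(2))
    show ?thesis
      using sum[of "F (tens scl vs)"] unfolding eq sum by (rule sym)
  qed
  with F(1) show ?thesis by blast
qed

lemma multilinear_tens:
  assumes "vector_space scl"
  shows "multilinear scl fscale (tens scl)"
proof -
  interpret V: vector_space scl by fact
  interpret T: vector_space "fscale :: _ \<Rightarrow> ('a, 'b) tensor \<Rightarrow> _" by (fact vector_space_fscale)
  show ?thesis
    unfolding multilinear_def
  proof (intro allI)
    fix us ws
    have a: "\<phi> (us @ (v + w) # ws) = \<phi> (us @ v # ws) + \<phi> (us @ w # ws)"
      and s: "\<phi> (us @ scl c v # ws) = c * \<phi> (us @ v # ws)"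
      if "multilinear scl (*) \<phi>" for \<phi> v w c
      using that by (simp_all add: multilinear_def Vector_Spaces.linear_iff)
    show "Vector_Spaces.linear scl fscale (\<lambda>v. tens scl (us @ v # ws))"
      by (auto simp: Vector_Spaces.linear_iff assms vector_space_fscale tens_def fscale_def plus_fun_def a s)
  qed
qed

definition tensor_power :: "('k::field \<Rightarrow> 'v::ab_group_add \<Rightarrow> 'v) \<Rightarrow> nat \<Rightarrow> ('k, 'v) tensor set"
  where "tensor_power scl n = module.span fscale {tens scl vs | vs. length vs = n}"

text \<open>The component of degree \<open>n\<close>, and the concatenation product of the tensor algebra.\<close>

definition homog_comp :: "('k::field \<Rightarrow> 'v::ab_group_add \<Rightarrow> 'v) \<Rightarrow> nat \<Rightarrow> ('k, 'v) tensor \<Rightarrow> ('k, 'v) tensor"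
  where "homog_comp scl n t =
    (\<lambda>\<phi>. if multilinear scl (*) \<phi> then t (\<lambda>vs. if length vs = n then \<phi> vs else 0) else 0)"

definition tprod ::
    "('k::field \<Rightarrow> 'v::ab_group_add \<Rightarrow> 'v) \<Rightarrow> ('k, 'v) tensor \<Rightarrow> ('k, 'v) tensor \<Rightarrow> ('k, 'v) tensor"
  where "tprod scl s t =
    (\<lambda>\<phi>. if multilinear scl (*) \<phi> then s (\<lambda>vs. t (\<lambda>ws. \<phi> (vs @ ws))) else 0)"

lemma tprod_tens: "tprod scl (tens scl vs) (tens scl ws) = tens scl (vs @ ws)"
proof
  fix \<phi>
  have "multilinear scl (*) (\<lambda>ws. \<phi> (vs @ ws))" "multilinear scl (*) (\<lambda>vs. \<phi> (vs @ ws))"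
    if "multilinear scl (*) \<phi>" for vs ws
  proof -
    have lin: "Vector_Spaces.linear scl (*) (\<lambda>v. \<phi> (us @ v # xs))" for us xs
      using that unfolding multilinear_def by blast
    show "multilinear scl (*) (\<lambda>ws. \<phi> (vs @ ws))"
      unfolding multilinear_def using lin[of "vs @ _"] by simp
    show "multilinear scl (*) (\<lambda>vs. \<phi> (vs @ ws))"
      unfolding multilinear_def using lin[of _ "_ @ ws"] by simp
  qed
  then show "tprod scl (tens scl vs) (tens scl ws) \<phi> = tens scl (vs @ ws) \<phi>"
    by (simp add: tprod_def tens_def)
qed

lemma homog_comp_tens:
  assumes "vector_space scl"
  shows "homog_comp scl n (tens scl vs) = (if length vs = n then tens scl vs else 0)"
proof
  fix \<phi>
  have "multilinear scl (*) (\<lambda>vs. if length vs = n then \<phi> vs else 0)"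
    if \<phi>: "multilinear scl (*) \<phi>"
    unfolding multilinear_def
  proof (intro allI)
    fix us ws
    have "Vector_Spaces.linear scl (*) (\<lambda>v. \<phi> (us @ v # ws))"
      using \<phi> by (simp add: multilinear_def)
    moreover have "Vector_Spaces.linear scl (*) (\<lambda>v. 0 :: 'a)"
      using assms by (auto simp: Vector_Spaces.linear_iff vector_space_def algebra_simps)
    ultimately show "Vector_Spaces.linear scl (*) (\<lambda>v. if length (us @ v # ws) = n then \<phi> (us @ v # ws) else 0)"
      by (cases "length us + Suc (length ws) = n") simp_all
  qed
  then show "homog_comp scl n (tens scl vs) \<phi> = (if length vs = n then tens scl vs else 0) \<phi>"
    by (simp add: homog_comp_def tens_def)
qed

text \<open>
  The element \<open>a \<otimes> b\<close> of the tensor product of two copies of a function space, again as an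
  evaluation functional. It is used for the outer tensor product of the symmetric algebra with itself.
\<close>

definition tensor2 :: "('x \<Rightarrow> 'k::field) \<Rightarrow> ('x \<Rightarrow> 'k) \<Rightarrow> (('x \<Rightarrow> 'k) \<Rightarrow> ('x \<Rightarrow> 'k) \<Rightarrow> 'k) \<Rightarrow> 'k"
  where "tensor2 a b = (\<lambda>B. if bilinear_form fscale B then B a b else 0)"

text \<open>
  \<open>lin_ext I e f\<close> is ``the linear extension of \<open>e i \<mapsto> f i\<close> for \<open>i \<in> I\<close>''. It is uniquely determined
  on the span of \<open>e ` I\<close> and arbitrary outside; below it is only evaluated on that span.
\<close>

definition lin_ext :: "'i set \<Rightarrow> ('i \<Rightarrow> 'x \<Rightarrow> 'k::field) \<Rightarrow> ('i \<Rightarrow> 'y \<Rightarrow> 'k) \<Rightarrow> ('x \<Rightarrow> 'k) \<Rightarrow> 'y \<Rightarrow> 'k"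
  where "lin_ext I e f = (SOME F. Vector_Spaces.linear fscale fscale F \<and> (\<forall>i\<in>I. F (e i) = f i))"


section \<open>The symmetric algebra\<close>

text \<open>
  The parity of a homogeneous vector. The zero vector counts as even, which is immaterial since every
  term in which the choice matters vanishes.
\<close>

definition par :: "'v set \<Rightarrow> 'v \<Rightarrow> nat"
  where "par V0 v = (if v \<in> V0 then 0 else 1)"

definition parl :: "'v set \<Rightarrow> 'v list \<Rightarrow> nat"
  where "parl V0 vs = sum_list (map (par V0) vs)"

definition koszul :: "'v set \<Rightarrow> (nat \<Rightarrow> nat) \<Rightarrow> 'v list \<Rightarrow> 'k::field"
  where "koszul V0 \<sigma> vs = (-1) ^ card {(i, j). i < j \<and> j < length vs \<and> \<sigma> i > \<sigma> j \<and>
    par V0 (vs ! \<sigma> i) = 1 \<and> par V0 (vs ! \<sigma> j) = 1}"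

text \<open>\<open>omit k vs\<close> deletes the entry with index \<open>k\<close>; indices start at \<open>0\<close>.\<close>

definition omit :: "nat \<Rightarrow> 'a list \<Rightarrow> 'a list"
  where "omit k vs = take k vs @ drop (Suc k) vs"

context
  fixes scl :: "'k::real_normed_field \<Rightarrow> 'v::ab_group_add \<Rightarrow> 'v"
    and V0 V1 :: "'v set"
begin

definition perm_act :: "nat \<Rightarrow> (nat \<Rightarrow> nat) \<Rightarrow> ('k, 'v) tensor \<Rightarrow> ('k, 'v) tensor"
  where "perm_act n \<sigma> = lin_ext {vs \<in> lists (V0 \<union> V1). length vs = n} (tens scl)
    (\<lambda>vs. fscale (koszul V0 \<sigma> vs) (tens scl (map (\<lambda>i. vs ! \<sigma> i) [0..<n])))"

definition sym_n :: "nat \<Rightarrow> ('k, 'v) tensor \<Rightarrow> ('k, 'v) tensor"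
  where "sym_n n t = fscale (1 / fact n) (\<Sum>\<sigma> | \<sigma> permutes {..<n}. perm_act n \<sigma> t)"

definition symmetrizer :: "('k, 'v) tensor \<Rightarrow> ('k, 'v) tensor"
  where "symmetrizer t = Sum_any (\<lambda>n. sym_n n (homog_comp scl n t))"

definition sym_power :: "nat \<Rightarrow> ('k, 'v) tensor set"
  where "sym_power n = sym_n n ` tensor_power scl n"

definition sym_alg :: "('k, 'v) tensor set"
  where "sym_alg = module.span fscale (\<Union>n. sym_power n)"

definition smul :: "('k, 'v) tensor \<Rightarrow> ('k, 'v) tensor \<Rightarrow> ('k, 'v) tensor"
  where "smul a b = symmetrizer (tprod scl a b)"

definition sprod :: "'v list \<Rightarrow> ('k, 'v) tensor"
  where "sprod vs = foldr (\<lambda>v a. smul (tens scl [v]) a) vs (tens scl [])"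


section \<open>The star product and the equivalence transformation\<close>

definition mu :: "((('k, 'v) tensor \<Rightarrow> ('k, 'v) tensor \<Rightarrow> 'k) \<Rightarrow> 'k) \<Rightarrow> ('k, 'v) tensor"
  where "mu = lin_ext (sym_alg \<times> sym_alg) (\<lambda>(a, b). tensor2 a b) (\<lambda>(a, b). smul a b)"

definition P_op :: "('v \<Rightarrow> 'v \<Rightarrow> 'k) \<Rightarrow> ((('k, 'v) tensor \<Rightarrow> ('k, 'v) tensor \<Rightarrow> 'k) \<Rightarrow> 'k)
    \<Rightarrow> (('k, 'v) tensor \<Rightarrow> ('k, 'v) tensor \<Rightarrow> 'k) \<Rightarrow> 'k"
  where "P_op B = lin_ext (lists (V0 \<union> V1) \<times> lists (V0 \<union> V1))
    (\<lambda>(vs, ws). tensor2 (sprod vs) (sprod ws))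
    (\<lambda>(vs, ws). \<Sum>k<length vs. \<Sum>l<length ws.
       fscale ((-1) ^ (par V0 (vs ! k) * parl V0 (drop (Suc k) vs)
                       + par V0 (ws ! l) * parl V0 (take l ws)) * B (vs ! k) (ws ! l))
         (tensor2 (sprod (omit k vs)) (sprod (omit l ws))))"

definition star :: "('v \<Rightarrow> 'v \<Rightarrow> 'k) \<Rightarrow> 'k \<Rightarrow> ('k, 'v) tensor \<Rightarrow> ('k, 'v) tensor \<Rightarrow> ('k, 'v) tensor"
  where "star B z a b =
    Sum_any (\<lambda>k. fscale (z ^ k / fact k) (mu ((P_op B ^^ k) (tensor2 a b))))"

text \<open>For \<open>i < j\<close>, \<open>omit i (omit j vs)\<close> deletes both entries and \<open>omit i (take j vs)\<close>
  lists the entries before the one with index \<open>j\<close> except the one with index \<open>i\<close>.\<close>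

definition Delta :: "('v \<Rightarrow> 'v \<Rightarrow> 'k) \<Rightarrow> ('k, 'v) tensor \<Rightarrow> ('k, 'v) tensor"
  where "Delta g = lin_ext (lists (V0 \<union> V1)) sprod
    (\<lambda>vs. \<Sum>j<length vs. \<Sum>i<j.
       fscale ((-1) ^ (par V0 (vs ! i) * parl V0 (take i vs))
               * (-1) ^ (par V0 (vs ! j) * parl V0 (omit i (take j vs))) * g (vs ! i) (vs ! j))
         (sprod (omit i (omit j vs))))"

definition exp_Delta :: "('v \<Rightarrow> 'v \<Rightarrow> 'k) \<Rightarrow> 'k \<Rightarrow> ('k, 'v) tensor \<Rightarrow> ('k, 'v) tensor"
  where "exp_Delta g z a = Sum_any (\<lambda>k. fscale (z ^ k / fact k) ((Delta g ^^ k) a))"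

end


section \<open>The topology\<close>

text \<open>The projective tensor seminorm; the coefficients only matter in degree \<open>0\<close>.\<close>

definition proj_seminorm ::
    "('k::real_normed_field \<Rightarrow> 'v::ab_group_add \<Rightarrow> 'v) \<Rightarrow> ('v \<Rightarrow> real) \<Rightarrow> nat \<Rightarrow> ('k, 'v) tensor \<Rightarrow> real"
  where "proj_seminorm scl p n t =
    Inf {(\<Sum>(c, vs)\<leftarrow>L. norm c * prod_list (map p vs)) | L.
          (\<forall>(c, vs)\<in>set L. length vs = n) \<and> (\<Sum>(c, vs)\<leftarrow>L. fscale c (tens scl vs)) = t}"

definition weyl_seminorm ::
    "('k::real_normed_field \<Rightarrow> 'v::ab_group_add \<Rightarrow> 'v) \<Rightarrow> real \<Rightarrow> ('v \<Rightarrow> real) \<Rightarrow> ('k, 'v) tensor \<Rightarrow> real"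
  where "weyl_seminorm scl R p t = Sum_any (\<lambda>n. proj_seminorm scl p n (homog_comp scl n t) * fact n powr R)"

definition seminorm_topology :: "'a::ab_group_add set \<Rightarrow> ('a \<Rightarrow> real) set \<Rightarrow> 'a topology"
  where "seminorm_topology S Q = topology (\<lambda>U. U \<subseteq> S \<and>
    (\<forall>x\<in>U. \<exists>F \<epsilon>. finite F \<and> F \<subseteq> Q \<and> 0 < \<epsilon> \<and> {y \<in> S. \<forall>q\<in>F. q (y - x) < \<epsilon>} \<subseteq> U))"

lemma openin_seminorm_topology:
  "openin (seminorm_topology S Q) U \<longleftrightarrow> U \<subseteq> S \<and>
    (\<forall>x\<in>U. \<exists>F \<epsilon>. finite F \<and> F \<subseteq> Q \<and> 0 < \<epsilon> \<and> {y \<in> S. \<forall>q\<in>F. q (y - x) < \<epsilon>} \<subseteq> U)"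
proof -
  define nb where "nb x U \<longleftrightarrow> (\<exists>F \<epsilon>. finite F \<and> F \<subseteq> Q \<and> 0 < \<epsilon> \<and> {y \<in> S. \<forall>q\<in>F. q (y - x) < \<epsilon>} \<subseteq> U)"
    for x U
  have inter: "nb x (U \<inter> W)" if U: "nb x U" and W: "nb x W" for x U W
  proof -
    obtain F \<epsilon> where 1: "finite F" "F \<subseteq> Q" "0 < \<epsilon>" "{y \<in> S. \<forall>q\<in>F. q (y - x) < \<epsilon>} \<subseteq> U"
      using U unfolding nb_def by blast
    obtain F' \<epsilon>' where 2: "finite F'" "F' \<subseteq> Q" "0 < \<epsilon>'" "{y \<in> S. \<forall>q\<in>F'. q (y - x) < \<epsilon>'} \<subseteq> W"
      using W unfolding nb_def by blast
    have "finite (F \<union> F')" "F \<union> F' \<subseteq> Q" "0 < min \<epsilon> \<epsilon>'"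
      using 1 2 by simp_all
    moreover have "{y \<in> S. \<forall>q\<in>F \<union> F'. q (y - x) < min \<epsilon> \<epsilon>'} \<subseteq> U \<inter> W"
    proof
      fix y assume "y \<in> {y \<in> S. \<forall>q\<in>F \<union> F'. q (y - x) < min \<epsilon> \<epsilon>'}"
      then have "y \<in> {y \<in> S. \<forall>q\<in>F. q (y - x) < \<epsilon>}" "y \<in> {y \<in> S. \<forall>q\<in>F'. q (y - x) < \<epsilon>'}"
        by simp_all
      with 1(4) 2(4) show "y \<in> U \<inter> W" by (meson IntI subsetD)
    qed
    ultimately show ?thesis
      unfolding nb_def by (intro exI conjI)
  qed
  have mono: "nb x W" if "nb x U" "U \<subseteq> W" for x U W
    using that unfolding nb_def by (meson subset_trans)
  have "istopology (\<lambda>U. U \<subseteq> S \<and> (\<forall>x\<in>U. nb x U))"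
    unfolding istopology_def
  proof (intro conjI allI impI)
    fix U W assume U: "U \<subseteq> S \<and> (\<forall>x\<in>U. nb x U)" and W: "W \<subseteq> S \<and> (\<forall>x\<in>W. nb x W)"
    show "U \<inter> W \<subseteq> S" using U by blast
    show "\<forall>x\<in>U \<inter> W. nb x (U \<inter> W)" using U W inter by (meson IntE)
  next
    fix \<K> assume *: "\<forall>K\<in>\<K>. K \<subseteq> S \<and> (\<forall>x\<in>K. nb x K)"
    then show "\<Union>\<K> \<subseteq> S" by blast
    show "\<forall>x\<in>\<Union>\<K>. nb x (\<Union>\<K>)" using * mono by (meson UnionE Union_upper)
  qed
  then show ?thesis
    unfolding seminorm_topology_def nb_def by (simp only: topology_inverse')
qed

definition weyl_topology ::
    "('k::real_normed_field \<Rightarrow> 'v::topological_ab_group_add \<Rightarrow> 'v) \<Rightarrow> 'v set \<Rightarrow> 'v set \<Rightarrow> real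
     \<Rightarrow> ('k, 'v) tensor topology"
  where "weyl_topology scl V0 V1 R =
    seminorm_topology (sym_alg scl V0 V1) {weyl_seminorm scl R p | p. cont_seminorm scl p}"


section \<open>Completion and continuous extensions\<close>

text \<open>
  A completion of the locally convex space \<open>sym_alg\<close>: a complete Hausdorff locally convex space with
  a linear topological embedding of \<open>sym_alg\<close> onto a dense subspace. By the class
  \<^class>\<open>uniform_topological_group_add\<close>, the uniformity underlying completeness is the one given by
  the additive group.
\<close>

definition is_weyl_completion ::
    "('k::real_normed_field \<Rightarrow> 'v::topological_ab_group_add \<Rightarrow> 'v) \<Rightarrow> 'v set \<Rightarrow> 'v set \<Rightarrow> real
     \<Rightarrow> ('k \<Rightarrow> 'w \<Rightarrow> 'w) \<Rightarrow> (('k, 'v) tensor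
     \<Rightarrow> 'w::{topological_ab_group_add, uniform_topological_group_add, complete_uniform_space, t2_space})
     \<Rightarrow> bool"
  where "is_weyl_completion scl V0 V1 R sclW \<iota> \<longleftrightarrow>
    lc_space sclW
    \<and> (\<forall>a\<in>sym_alg scl V0 V1. \<forall>b\<in>sym_alg scl V0 V1. \<iota> (a + b) = \<iota> a + \<iota> b)
    \<and> (\<forall>c. \<forall>a\<in>sym_alg scl V0 V1. \<iota> (fscale c a) = sclW c (\<iota> a))
    \<and> embedding_map (weyl_topology scl V0 V1 R) euclidean \<iota>
    \<and> closure (\<iota> ` sym_alg scl V0 V1) = UNIV"

definition is_cont_ext ::
    "('a \<Rightarrow> 'w::topological_space) \<Rightarrow> 'a set \<Rightarrow> ('a \<Rightarrow> 'a) \<Rightarrow> ('w \<Rightarrow> 'w) \<Rightarrow> bool"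
  where "is_cont_ext \<iota> S f F \<longleftrightarrow> continuous_on UNIV F \<and> (\<forall>a\<in>S. F (\<iota> a) = \<iota> (f a))"

definition cont_ext :: "('a \<Rightarrow> 'w::topological_space) \<Rightarrow> 'a set \<Rightarrow> ('a \<Rightarrow> 'a) \<Rightarrow> 'w \<Rightarrow> 'w"
  where "cont_ext \<iota> S f = (THE F. is_cont_ext \<iota> S f F)"

definition is_cont_ext2 ::
    "('a \<Rightarrow> 'w::topological_space) \<Rightarrow> 'a set \<Rightarrow> ('a \<Rightarrow> 'a \<Rightarrow> 'a) \<Rightarrow> ('w \<Rightarrow> 'w \<Rightarrow> 'w) \<Rightarrow> bool"
  where "is_cont_ext2 \<iota> S f F \<longleftrightarrow>
    continuous_on UNIV (\<lambda>(x, y). F x y) \<and> (\<forall>a\<in>S. \<forall>b\<in>S. F (\<iota> a) (\<iota> b) = \<iota> (f a b))"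

definition cont_ext2 ::
    "('a \<Rightarrow> 'w::topological_space) \<Rightarrow> 'a set \<Rightarrow> ('a \<Rightarrow> 'a \<Rightarrow> 'a) \<Rightarrow> 'w \<Rightarrow> 'w \<Rightarrow> 'w"
  where "cont_ext2 \<iota> S f = (THE F. is_cont_ext2 \<iota> S f F)"

text \<open>\<open>E\<close> is an isomorphism from the topological algebra with product \<open>m\<close> to the one with product
  \<open>m'\<close> on the same underlying space.\<close>

definition lc_algebra_iso :: "('k::field \<Rightarrow> 'w \<Rightarrow> 'w) \<Rightarrow> ('w \<Rightarrow> 'w \<Rightarrow> 'w) \<Rightarrow> ('w \<Rightarrow> 'w \<Rightarrow> 'w)
    \<Rightarrow> ('w::{ab_group_add, topological_space} \<Rightarrow> 'w) \<Rightarrow> bool"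
  where "lc_algebra_iso sclW m m' E \<longleftrightarrow>
    Vector_Spaces.linear sclW sclW E \<and> homeomorphic_map euclidean euclidean E
    \<and> (\<forall>x y. E (m x y) = m' (E x) (E y))"

end

theory Submission imports Defs "HOL-Combinatorics.Permutations"
begin

text \<open>Write \<open>L v\<close> for multiplication by \<open>v\<close>.  An operator on the symmetric algebra is determined by its
  value at the unit and its (twisted) commutation rule with all \<open>L v\<close>, so operator identities can be checked on
  the unit and on commutators.  In this way \<open>\<Delta>\<^sub>g \<circ> \<mu> = \<mu> \<circ> (\<Delta>\<^sub>g \<otimes> 1 + 1 \<otimes> \<Delta>\<^sub>g + P\<^sub>g)\<close> holds, and
  \<open>\<Delta>\<^sub>g \<otimes> 1\<close>, \<open>1 \<otimes> \<Delta>\<^sub>g\<close>, \<open>P\<^sub>g\<close>, \<open>P\<^sub>\<Lambda>\<close> commute.  Since all these operators are locally nilpotent,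
  exponentiating and using \<open>P\<^sub>\<Lambda> + P\<^sub>g = P\<^sub>h\<close> for \<open>h = \<Lambda>'\<close> gives the equivalence on the symmetric algebra, with inverse
  \<open>exp (- z \<Delta>\<^sub>g)\<close>.

  For continuity choose a seminorm \<open>p\<close> with \<open>|g v w| \<le> p v * p w\<close>.  On degree \<open>n\<close> the \<open>k\<close>-th power of \<open>\<Delta>\<^sub>g\<close>
  costs \<open>n! / m!\<close> with \<open>m = n - 2 k\<close>, and \<open>R \<ge> 1/2\<close> gives \<open>m!\<^sup>R * (n! / m!) \<le> n!\<^sup>R * sqrt (n! / m!)\<close>, where
  \<open>sqrt (n! / m!) \<le> 2\<^sup>n * 2\<^sup>k * k!\<close>: the \<open>k!\<close> cancels against the exponential series and rescaling \<open>p\<close> absorbs the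
  geometric factors.  The star product is estimated likewise.  Both maps then extend from the dense subalgebra to
  the completion.\<close>

text \<open>Every operator in the definitions is some linear map with prescribed values on words of
  homogeneous vectors, and these words are far from independent. The obstacle is that such a map
  must first be shown to exist. This takes two stages: a signed expression in homogeneous entries
  extends to a multilinear map by splitting each entry into its even and odd part, and a multilinear
  map that respects adjacent swaps up to the Koszul sign factors through the symmetrised words.
  Recursions along \<open>L v\<close> settle the second stage once and for all: it reduces to a
  condition on two leading vectors. For the contraction with \<open>g\<close> this condition is the
  graded symmetry of \<open>g\<close>, and here the equality of the antisymmetric parts enters.

  The estimates meet the same gap: the projective seminorm admits arbitrary words, the formulas hold
  for homogeneous ones. Replacing \<open>p\<close> by \<open>p \<circ> p0 + p \<circ> p1\<close>,
  continuous because the projections are, makes the splitting free of cost. On the completion, a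
  product is in general not uniformly continuous, so the extension argument only asks for Cauchy
  images near each point.\<close>

text \<open>Tensors are functions; pointwise evaluation of sums would destroy equations between them.\<close>

declare plus_fun_apply [simp del] zero_fun_apply [simp del] minus_apply [simp del] uminus_apply [simp del]

section \<open>Linear maps between spaces of functions\<close>

interpretation FS: vector_space "fscale :: 'k::field \<Rightarrow> ('x \<Rightarrow> 'k) \<Rightarrow> 'x \<Rightarrow> 'k"
  by (rule vector_space_fscale)

interpretation FSP: vector_space_pair "fscale :: 'k::field \<Rightarrow> ('x \<Rightarrow> 'k) \<Rightarrow> 'x \<Rightarrow> 'k"
    "fscale :: 'k::field \<Rightarrow> ('y \<Rightarrow> 'k) \<Rightarrow> 'y \<Rightarrow> 'k"
  by unfold_locales

abbreviation flinear :: "(('x \<Rightarrow> 'k::field) \<Rightarrow> 'y \<Rightarrow> 'k) \<Rightarrow> bool"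
  where "flinear \<equiv> Vector_Spaces.linear fscale fscale"

lemma flinearI:
  assumes "\<And>a b. F (a + b) = F a + F b" "\<And>c a. F (fscale c a) = fscale c (F a)"
  shows "flinear F"
  using assms by (simp add: Vector_Spaces.linear_iff vector_space_fscale)

lemma flinearD:
  assumes "flinear F"
  shows "F (a + b) = F a + F b" "F (fscale c a) = fscale c (F a)" "F 0 = 0"
    "F (- a) = - F a" "F (a - b) = F a - F b"
  using assms FSP.linear_add FSP.linear_scale FSP.linear_0 FSP.linear_diff FSP.linear_neg
  by blast+

lemma flinear_sum_arg: "flinear F \<Longrightarrow> F (sum f I) = (\<Sum>i\<in>I. F (f i))"
  by (rule FSP.linear_sum)

lemma flinear_compose: "flinear F \<Longrightarrow> flinear G \<Longrightarrow> flinear (\<lambda>x. F (G x))"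
  by (intro flinearI) (simp_all add: flinearD)

lemma flinear_add: "flinear F \<Longrightarrow> flinear G \<Longrightarrow> flinear (\<lambda>x. F x + G x)"
  by (intro flinearI) (simp_all add: flinearD FS.scale_right_distrib)

lemma flinear_scale: "flinear F \<Longrightarrow> flinear (\<lambda>x. fscale c (F x))"
  by (intro flinearI) (simp_all add: flinearD FS.scale_right_distrib mult.commute)

lemma flinear_id: "flinear (\<lambda>x. x)"
  by (intro flinearI) auto

lemma flinear_zero: "flinear (\<lambda>x. 0)"
  by (intro flinearI) auto

lemma flinear_sum: "(\<And>i. i \<in> I \<Longrightarrow> flinear (F i)) \<Longrightarrow> flinear (\<lambda>x. \<Sum>i\<in>I. F i x)"
  by (induction I rule: infinite_finite_induct) (auto intro: flinear_zero flinear_add)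

lemma flinear_fscale: "flinear (fscale c)"
  by (intro flinearI) (simp_all add: FS.scale_right_distrib mult.commute)

lemma flinear_funpow: "flinear (X :: ('x \<Rightarrow> 'k::field) \<Rightarrow> 'x \<Rightarrow> 'k) \<Longrightarrow> flinear (X ^^ n)"
proof (induction n)
  case 0
  then show ?case using flinear_id by (simp add: id_def)
next
  case (Suc n)
  then show ?case using flinear_compose[of X "X ^^ n"] by (simp add: o_def)
qed

text \<open>The step keeps \<open>y\<close> in the span as a hypothesis, because
  \<open>symmetrizer\<close> and \<open>tprod\<close> are shown to be additive only on the span of
  the elementary tensors.\<close>

lemma fspan_induct [consumes 1, case_names base step]:
  assumes "x \<in> FS.span B" "P 0"
    "\<And>c b y. b \<in> B \<Longrightarrow> y \<in> FS.span B \<Longrightarrow> P y \<Longrightarrow> P (fscale c b + y)"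
  shows "P x"
proof -
  have "x \<in> FS.span B \<and> P x"
    using assms(1)
    by (induction rule: FS.span_induct_alt)
      (use assms FS.span_zero in \<open>auto intro: FS.span_add FS.span_scale FS.span_base\<close>)
  then show ?thesis ..
qed

lemma flinear_eq_on_span:
  assumes "flinear F" "flinear G" "\<And>x. x \<in> B \<Longrightarrow> F x = G x" "a \<in> FS.span B"
  shows "F a = G a"
  using FSP.linear_eq_on_span[OF assms(1,2)] assms(3,4) by blast

lemma flinear_span_image:
  assumes "flinear F" "\<And>x. x \<in> B \<Longrightarrow> F x \<in> FS.span C" "a \<in> FS.span B"
  shows "F a \<in> FS.span C"
  using assms(3)
proof (induction rule: FS.span_induct_alt)
  case base
  then show ?case unfolding flinearD(3)[OF assms(1)] by (rule FS.span_zero)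
next
  case (step c x y)
  then show ?case by (simp add: flinearD[OF assms(1)] FS.span_add FS.span_scale assms(2))
qed

text \<open>\<open>lin_ext\<close> is a choice among linear maps with the given values, so
  exhibiting one such map pins down its values on the generators. The well-definedness of every
  operator below is reduced to finding this \<open>F\<close>.\<close>

lemma lin_ext_eqI:
  assumes "flinear F" "\<And>i. i \<in> I \<Longrightarrow> F (e i) = f i"
  shows "flinear (lin_ext I e f)" "i \<in> I \<Longrightarrow> lin_ext I e f (e i) = f i"
proof -
  have "\<exists>F. flinear F \<and> (\<forall>i\<in>I. F (e i) = f i)" using assms by blast
  from someI_ex[OF this] show "flinear (lin_ext I e f)" "i \<in> I \<Longrightarrow> lin_ext I e f (e i) = f i"
    unfolding lin_ext_def by blast+
qed

text \<open>A tensor is a functional on forms, so it can be applied to each coordinate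
  \<open>\<lambda>vs. f vs y\<close> of a vector-valued map. This is linear in \<open>t\<close> by
  construction and involves no choice; multilinearity of \<open>f\<close> matters for the values on
  elementary tensors.\<close>

definition tens_ext :: "('v list \<Rightarrow> 'y \<Rightarrow> 'k::field) \<Rightarrow> ('k, 'v) tensor \<Rightarrow> 'y \<Rightarrow> 'k"
  where "tens_ext f t = (\<lambda>y. t (\<lambda>vs. f vs y))"

lemma flinear_tens_ext: "flinear (tens_ext f)"
  by (intro flinearI) (auto simp: tens_ext_def fscale_def plus_fun_def)

lemma multilinearD:
  assumes "multilinear scl fscale f"
  shows "f (us @ (v + w) # ws) = f (us @ v # ws) + f (us @ w # ws)"
    "f (us @ scl c v # ws) = fscale c (f (us @ v # ws))"
  using assms by (simp_all add: multilinear_def Vector_Spaces.linear_iff)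

lemma multilinearD_Cons:
  assumes "multilinear scl fscale f"
  shows "f ((v + w) # ws) = f (v # ws) + f (w # ws)"
    "f (scl c v # ws) = fscale c (f (v # ws))"
  using multilinearD[OF assms, of "[]"] by simp_all

lemma multilinearI:
  assumes "vector_space scl"
    "\<And>us v w ws. f (us @ (v + w) # ws) = f (us @ v # ws) + f (us @ w # ws)"
    "\<And>us c v ws. f (us @ scl c v # ws) = fscale c (f (us @ v # ws))"
  shows "multilinear scl fscale f"
  using assms by (simp add: multilinear_def Vector_Spaces.linear_iff vector_space_fscale)

lemma multilinear_zero_arg:
  assumes "multilinear scl fscale f"
  shows "f (us @ 0 # ws) = 0"
  using multilinearD(1)[OF assms, of us 0 0 ws] by simp

lemma multilinear_compose:
  assumes "multilinear scl fscale f" "flinear F"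
  shows "multilinear scl fscale (\<lambda>vs. F (f vs))"
  using assms by (simp add: multilinear_def Vector_Spaces.linear_iff vector_space_fscale)

lemma multilinear_add:
  assumes "multilinear scl fscale f" "multilinear scl fscale g"
  shows "multilinear scl fscale (\<lambda>vs. f vs + g vs)"
  using assms by (simp add: multilinear_def Vector_Spaces.linear_iff vector_space_fscale FS.scale_right_distrib)

lemma tens_ext_tens:
  assumes "multilinear scl fscale f"
  shows "tens_ext f (tens scl vs) = f vs"
proof
  fix y
  have vs: "vector_space scl" using assms by (simp add: multilinear_def Vector_Spaces.linear_iff)
  then have "multilinear scl (*) (\<lambda>vs. f vs y)"
    using assms vector_space_fscale
    by (auto simp: multilinear_def Vector_Spaces.linear_iff fscale_def plus_fun_def vector_space_def algebra_simps)
  then show "tens_ext f (tens scl vs) y = f vs y" by (simp add: tens_ext_def tens_def)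
qed

section \<open>The Koszul sign of a permutation\<close>

text \<open>A permutation acts bijectively on unordered pairs. The map \<open>h\<close> realises
  this action on pairs \<open>i < j\<close> by sorting the image, and the symmetry of
  \<open>c\<close> makes the sorting invisible.\<close>

lemma prod_symmetric_permute:
  fixes c :: "nat \<Rightarrow> nat \<Rightarrow> 'a::comm_monoid_mult"
  assumes sym: "\<And>i j. c i j = c j i" and t: "\<tau> permutes {..<n}"
  shows "(\<Prod>(i,j)\<in>{(i,j). i < j \<and> j < n}. c (\<tau> i) (\<tau> j)) = (\<Prod>(i,j)\<in>{(i,j). i < j \<and> j < n}. c i j)"
proof -
  let ?D = "{(i,j). i < j \<and> j < n}"
  define h where "h = (\<lambda>(i::nat,j::nat). (min (\<tau> i) (\<tau> j), max (\<tau> i) (\<tau> j)))"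
  have fin: "finite ?D" by (rule finite_subset[of _ "{..<n} \<times> {..<n}"]) auto
  have inj\<tau>: "\<tau> x = \<tau> y \<longleftrightarrow> x = y" for x y using permutes_inj[OF t] by (simp add: inj_eq)
  have lt: "\<tau> x < n \<longleftrightarrow> x < n" for x using permutes_in_image[OF t, of x] by simp
  have inj: "inj_on h ?D"
  proof (intro inj_onI, clarify)
    fix i j i' j' assume *: "i < j" "i' < j'" and e: "h (i, j) = h (i', j')"
    have "{\<tau> i, \<tau> j} = {\<tau> i', \<tau> j'}"
      using e unfolding h_def by (auto simp: min_def max_def split: if_splits)
    then have "{i, j} = {i', j'}" by (auto simp: doubleton_eq_iff inj\<tau>)
    with * show "i = i' \<and> j = j'" by (auto simp: doubleton_eq_iff)
  qed
  have "h ` ?D \<subseteq> ?D"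
  proof (rule image_subsetI)
    fix x assume "x \<in> ?D"
    then obtain i j where ij: "x = (i, j)" "i < j" "j < n" by auto
    have "\<tau> i < n" "\<tau> j < n" "\<tau> i \<noteq> \<tau> j" using ij inj\<tau>[of i j] lt[of i] lt[of j] by auto
    then show "h x \<in> ?D" by (auto simp: ij(1) h_def min_def max_def)
  qed
  with inj fin have bij: "bij_betw h ?D ?D"
    by (simp add: bij_betw_def endo_inj_surj)
  have "(\<Prod>(i,j)\<in>?D. c i j) = (\<Prod>x\<in>?D. case h x of (i,j) \<Rightarrow> c i j)"
    by (rule prod.reindex_bij_betw[OF bij, symmetric])
  also have "\<dots> = (\<Prod>(i,j)\<in>?D. c (\<tau> i) (\<tau> j))"
    by (rule prod.cong) (auto simp: h_def min_def max_def sym)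
  finally show ?thesis by simp
qed

text \<open>Writing inversion as \<open>(i < j) \<noteq> (\<sigma> i < \<sigma> j)\<close> makes the
  factor symmetric in \<open>i\<close> and \<open>j\<close>, which is what the reindexing over pairs
  requires. The clause \<open>\<sigma> i \<noteq> \<sigma> j\<close> is there because
  \<open>\<sigma>\<close> is arbitrary here and a collision is no inversion.\<close>

lemma koszul_eq_prod:
  "(koszul V0 \<sigma> vs :: 'k::field) = (\<Prod>(i,j)\<in>{(i,j). i < j \<and> j < length vs}.
     if (i < j) \<noteq> (\<sigma> i < \<sigma> j) \<and> \<sigma> i \<noteq> \<sigma> j \<and> par V0 (vs ! \<sigma> i) = 1 \<and> par V0 (vs ! \<sigma> j) = 1 then -1 else 1)"
proof -
  let ?D = "{(i,j). i < j \<and> j < length vs}"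
  let ?E = "{(i, j). i < j \<and> j < length vs \<and> \<sigma> i > \<sigma> j \<and> par V0 (vs ! \<sigma> i) = 1 \<and> par V0 (vs ! \<sigma> j) = 1}"
  have fin: "finite ?D" by (rule finite_subset[of _ "{..<length vs} \<times> {..<length vs}"]) auto
  have "koszul V0 \<sigma> vs = (\<Prod>x\<in>?E. -1 :: 'k)" by (simp add: koszul_def)
  also have "\<dots> = (\<Prod>x\<in>?D. if x \<in> ?E then -1 else 1)"
    using prod.mono_neutral_cong_left[OF fin, of ?E "\<lambda>x. if x \<in> ?E then -1 else 1" "\<lambda>x. -1 :: 'k"] by auto
  also have "\<dots> = (\<Prod>(i,j)\<in>?D.
     if (i < j) \<noteq> (\<sigma> i < \<sigma> j) \<and> \<sigma> i \<noteq> \<sigma> j \<and> par V0 (vs ! \<sigma> i) = 1 \<and> par V0 (vs ! \<sigma> j) = 1 then -1 else 1)"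
    by (rule prod.cong) (auto split: if_splits)
  finally show ?thesis .
qed

text \<open>A pair is inverted by the composite exactly when one, but not both, of the following
  happens: \<open>\<tau>\<close> inverts it, or \<open>\<sigma>\<close> inverts its image under
  \<open>\<tau>\<close>. So the signs multiply pair by pair, and the factors of
  \<open>\<sigma>\<close> at \<open>\<tau>\<close>-images are reindexed by
  \<open>prod_symmetric_permute\<close>.\<close>

lemma koszul_compose:
  assumes s: "\<sigma> permutes {..<length vs}" and t: "\<tau> permutes {..<length vs}"
  shows "(koszul V0 (\<sigma> \<circ> \<tau>) vs :: 'k::field) = koszul V0 \<sigma> vs * koszul V0 \<tau> (permute_list \<sigma> vs)"
proof -
  let ?n = "length vs"
  let ?D = "{(i,j). i < j \<and> j < ?n}"
  define o' where "o' i \<longleftrightarrow> par V0 (vs ! i) = 1" for i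
  define c where "c i j = (if (i < j) \<noteq> (\<sigma> i < \<sigma> j) \<and> \<sigma> i \<noteq> \<sigma> j \<and> o' (\<sigma> i) \<and> o' (\<sigma> j) then -1 else 1 :: 'k)" for i j
  have inj\<sigma>: "\<sigma> x = \<sigma> y \<longleftrightarrow> x = y" for x y using permutes_inj[OF s] by (simp add: inj_eq)
  have inj\<tau>: "\<tau> x = \<tau> y \<longleftrightarrow> x = y" for x y using permutes_inj[OF t] by (simp add: inj_eq)
  have ltt: "\<tau> x < ?n \<longleftrightarrow> x < ?n" for x using permutes_in_image[OF t, of x] by simp
  have sym: "c i j = c j i" for i j unfolding c_def using inj\<sigma>[of i j] by (auto simp: not_less le_less)
  have "koszul V0 (\<sigma> \<circ> \<tau>) vs = (\<Prod>(i,j)\<in>?D. c (\<tau> i) (\<tau> j) *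
      (if (i < j) \<noteq> (\<tau> i < \<tau> j) \<and> \<tau> i \<noteq> \<tau> j \<and> o' (\<sigma> (\<tau> i)) \<and> o' (\<sigma> (\<tau> j)) then -1 else 1))"
    unfolding koszul_eq_prod
  proof (rule prod.cong[OF refl], clarify)
    fix i j assume "i < j" "j < ?n"
    moreover have "\<sigma> (\<tau> i) \<noteq> \<sigma> (\<tau> j)" "\<tau> i \<noteq> \<tau> j" using \<open>i < j\<close> by (auto simp: inj\<sigma> inj\<tau>)
    ultimately show "(if (i < j) \<noteq> ((\<sigma> \<circ> \<tau>) i < (\<sigma> \<circ> \<tau>) j) \<and> (\<sigma> \<circ> \<tau>) i \<noteq> (\<sigma> \<circ> \<tau>) j \<and>
           par V0 (vs ! (\<sigma> \<circ> \<tau>) i) = 1 \<and> par V0 (vs ! (\<sigma> \<circ> \<tau>) j) = 1 then - 1 else 1) =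
       c (\<tau> i) (\<tau> j) *
       (if (i < j) \<noteq> (\<tau> i < \<tau> j) \<and> \<tau> i \<noteq> \<tau> j \<and> o' (\<sigma> (\<tau> i)) \<and> o' (\<sigma> (\<tau> j)) then -1 else 1)"
      unfolding c_def o'_def by (auto simp: not_less le_less)
  qed
  also have "\<dots> = (\<Prod>(i,j)\<in>?D. c (\<tau> i) (\<tau> j)) *
      (\<Prod>(i,j)\<in>?D. if (i < j) \<noteq> (\<tau> i < \<tau> j) \<and> \<tau> i \<noteq> \<tau> j \<and> o' (\<sigma> (\<tau> i)) \<and> o' (\<sigma> (\<tau> j)) then -1 else 1)"
    by (simp add: prod.distrib[symmetric] case_prod_unfold)
  also have "(\<Prod>(i,j)\<in>?D. c (\<tau> i) (\<tau> j)) = koszul V0 \<sigma> vs"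
    by (subst prod_symmetric_permute[of c, OF sym t]) (unfold koszul_eq_prod, rule prod.cong, auto simp: c_def o'_def)
  also have "(\<Prod>(i,j)\<in>?D. if (i < j) \<noteq> (\<tau> i < \<tau> j) \<and> \<tau> i \<noteq> \<tau> j \<and> o' (\<sigma> (\<tau> i)) \<and> o' (\<sigma> (\<tau> j)) then -1 else 1)
      = (koszul V0 \<tau> (permute_list \<sigma> vs) :: 'k)"
    unfolding koszul_eq_prod length_permute_list
  proof (rule prod.cong[OF refl], clarify)
    fix i j assume "i < j" "j < ?n"
    then have "permute_list \<sigma> vs ! \<tau> i = vs ! \<sigma> (\<tau> i)" "permute_list \<sigma> vs ! \<tau> j = vs ! \<sigma> (\<tau> j)"
      by (simp_all add: permute_list_nth[OF s] ltt)
    then show "(if (i < j) \<noteq> (\<tau> i < \<tau> j) \<and> \<tau> i \<noteq> \<tau> j \<and> o' (\<sigma> (\<tau> i)) \<and> o' (\<sigma> (\<tau> j)) then -1 else 1 :: 'k)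
     = (if (i < j) \<noteq> (\<tau> i < \<tau> j) \<and> \<tau> i \<noteq> \<tau> j \<and> par V0 (permute_list \<sigma> vs ! \<tau> i) = 1 \<and>
           par V0 (permute_list \<sigma> vs ! \<tau> j) = 1 then - 1 else 1)"
      by (simp add: o'_def)
  qed
  finally show ?thesis .
qed

lemma koszul_id [simp]: "koszul V0 id vs = (1 :: 'k::field)"
proof -
  have "{(i, j). i < j \<and> j < length vs \<and> id i > id j \<and> par V0 (vs ! id i) = 1 \<and> par V0 (vs ! id j) = 1} = {}"
    by auto
  then show ?thesis unfolding koszul_def by (simp only: card.empty power_0)
qed

text \<open>The pair \<open>(i, Suc i)\<close> is the only inversion, and since parities are 0 or 1
  the exponent is 1 exactly if both entries are odd.\<close>

lemma koszul_transpose: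
  assumes "Suc i < length vs"
  shows "koszul V0 (Transposition.transpose i (Suc i)) vs = ((-1) ^ (par V0 (vs ! i) * par V0 (vs ! Suc i)) :: 'k::field)"
proof -
  have "{(a, b). a < b \<and> b < length vs \<and> Transposition.transpose i (Suc i) a > Transposition.transpose i (Suc i) b \<and>
    par V0 (vs ! Transposition.transpose i (Suc i) a) = 1 \<and> par V0 (vs ! Transposition.transpose i (Suc i) b) = 1}
    = (if par V0 (vs ! i) = 1 \<and> par V0 (vs ! Suc i) = 1 then {(i, Suc i)} else {})"
    (is "?L = ?R")
  proof -
    have key: "a = i \<and> b = Suc i" if "a < b"
      "Transposition.transpose i (Suc i) a > Transposition.transpose i (Suc i) b" for a b
      using that by (auto simp: Transposition.transpose_def split: if_splits)
    show ?thesis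
    proof (rule set_eqI, clarify)
      fix a b show "(a, b) \<in> ?L \<longleftrightarrow> (a, b) \<in> ?R"
        using key[of a b] assms by auto
    qed
  qed
  then show ?thesis unfolding koszul_def by (auto simp: par_def)
qed

lemma permute_list_transpose:
  "permute_list (Transposition.transpose (length us) (Suc (length us))) (us @ a # b # ws) = us @ b # a # ws"
proof (rule nth_equalityI)
  fix i assume "i < length (permute_list (Transposition.transpose (length us) (Suc (length us))) (us @ a # b # ws))"
  moreover have "Transposition.transpose (length us) (Suc (length us)) permutes {..<length (us @ a # b # ws)}"
    by (rule permutes_swap_id) auto
  ultimately show "permute_list (Transposition.transpose (length us) (Suc (length us))) (us @ a # b # ws) ! i = (us @ b # a # ws) ! i"
    by (subst permute_list_nth) (auto simp: Transposition.transpose_def nth_append nth_Cons' split: if_splits)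
qed simp

text \<open>Adjacent transpositions suffice: every transposition is a conjugate of one by adjacent ones.\<close>

lemma permutes_adjacent_induct [consumes 1, case_names id adj comp]:
  assumes "p permutes {..<n}" "P id"
    and adj: "\<And>i. Suc i < n \<Longrightarrow> P (Transposition.transpose i (Suc i))"
    and comp: "\<And>\<sigma> \<tau>. \<sigma> permutes {..<n} \<Longrightarrow> \<tau> permutes {..<n} \<Longrightarrow> P \<sigma> \<Longrightarrow> P \<tau> \<Longrightarrow> P (\<sigma> \<circ> \<tau>)"
  shows "P p"
proof -
  have tr: "P (Transposition.transpose a (Suc (a + k)))" if "Suc (a + k) < n" for a k
    using that
  proof (induction k)
    case 0
    then show ?case using adj by simp
  next
    case (Suc k)
    let ?b = "Suc (a + k)"
    have eq: "Transposition.transpose a (Suc ?b) = Transposition.transpose ?b (Suc ?b) \<circ> Transposition.transpose a ?b \<circ> Transposition.transpose ?b (Suc ?b)"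
      by (auto simp: Transposition.transpose_def fun_eq_iff)
    have "Transposition.transpose ?b (Suc ?b) permutes {..<n}" "Transposition.transpose a ?b permutes {..<n}"
      using Suc.prems by (auto intro!: permutes_swap_id)
    then show ?case unfolding add_Suc_right eq using Suc adj
      by (intro comp permutes_compose) auto
  qed
  have tr': "P (Transposition.transpose a b)" if "a < n" "b < n" "a \<noteq> b" for a b
  proof (cases "a < b")
    case True
    then show ?thesis using tr[of a "b - Suc a"] that by simp
  next
    case False
    then show ?thesis using tr[of b "a - Suc b"] that by (simp add: transpose_commute)
  qed
  show ?thesis
    using assms(1) finite_lessThan
  proof (induction rule: permutes_induct)
    case id
    then show ?case by fact
  next
    case (swap a b p)
    then show ?case using tr'[of a b] by (intro comp permutes_swap_id) auto
  qed
qed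

section \<open>The graded vector space and its projections\<close>

text \<open>The algebraic content of \<open>graded_lc_space\<close>; the identities and the
  estimates are proved here, and \<open>graded_lc_space\<close> becomes a sublocale when continuity
  comes in.\<close>

locale super_space = vector_space scl
  for scl :: "'k::real_normed_field \<Rightarrow> 'v::ab_group_add \<Rightarrow> 'v" +
  fixes V0 V1 :: "'v set"
  assumes subspace_V0: "subspace V0" and subspace_V1: "subspace V1"
    and V0_Int_V1: "V0 \<inter> V1 = {0}"
    and V0_plus_V1: "\<And>v. \<exists>x\<in>V0. \<exists>y\<in>V1. v = x + y"
begin

abbreviation "p0 \<equiv> proj0 V0 V1"
abbreviation "p1 \<equiv> proj1 V0 V1"
abbreviation "HL \<equiv> lists (V0 \<union> V1)"
abbreviation "T \<equiv> FS.span (range (tens scl))"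
abbreviation "A \<equiv> sym_alg scl V0 V1"

definition koszul_sign :: "'v \<Rightarrow> 'v \<Rightarrow> 'k"
  where "koszul_sign a b = (-1) ^ (par V0 a * par V0 b)"

text \<open>It will be identified with \<open>sprod\<close> in \<open>sprod_eq\<close>. As the image
  of one elementary tensor it is more convenient: multilinearity and graded symmetry can be read off
  from the sum over permutations.\<close>

definition sym_tens :: "'v list \<Rightarrow> ('k, 'v) tensor"
  where "sym_tens vs = symmetrizer scl V0 V1 (tens scl vs)"

lemma vs_scl: "vector_space scl" by (rule vector_space_axioms)

lemma zero_V0 [simp]: "0 \<in> V0" and zero_V1 [simp]: "0 \<in> V1"
  using subspace_V0 subspace_V1 by (auto simp: subspace_def)

lemma decomp_unique:
  assumes "x \<in> V0" "y \<in> V1" "x' \<in> V0" "y' \<in> V1" "x + y = x' + y'"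
  shows "x = x'" "y = y'"
proof -
  have e: "x - x' = y' - y" using assms(5) by (simp add: algebra_simps)
  have "x - x' \<in> V0" "y' - y \<in> V1"
    using assms subspace_diff subspace_V0 subspace_V1 by auto
  then have "x - x' \<in> V0 \<inter> V1" using e by simp
  then have "x - x' = 0" using V0_Int_V1 by blast
  with e show "x = x'" "y = y'" by auto
qed

lemma proj_eqI:
  assumes "x \<in> V0" "y \<in> V1"
  shows "p0 (x + y) = x" "p1 (x + y) = y"
proof -
  show "p0 (x + y) = x"
    unfolding proj0_def
  proof (rule the_equality)
    show "x \<in> V0 \<and> x + y - x \<in> V1" using assms by simp
    fix x' assume "x' \<in> V0 \<and> x + y - x' \<in> V1"
    then show "x' = x" using decomp_unique[of x' "x + y - x'" x y] assms by simp
  qed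
  show "p1 (x + y) = y"
    unfolding proj1_def
  proof (rule the_equality)
    show "y \<in> V1 \<and> x + y - y \<in> V0" using assms by simp
    fix y' assume "y' \<in> V1 \<and> x + y - y' \<in> V0"
    then show "y' = y" using decomp_unique[of "x + y - y'" y' x y] assms by simp
  qed
qed

lemma p0_in [simp]: "p0 v \<in> V0" and p1_in [simp]: "p1 v \<in> V1" and p_sum: "p0 v + p1 v = v"
  using V0_plus_V1[of v] by (auto simp: proj_eqI)

lemma p0_V0 [simp]: "v \<in> V0 \<Longrightarrow> p0 v = v" and p1_V0 [simp]: "v \<in> V0 \<Longrightarrow> p1 v = 0"
  and p0_V1 [simp]: "v \<in> V1 \<Longrightarrow> p0 v = 0" and p1_V1 [simp]: "v \<in> V1 \<Longrightarrow> p1 v = v"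
  using proj_eqI[of v 0] proj_eqI[of 0 v] by simp_all

lemma p0_add: "p0 (v + w) = p0 v + p0 w" and p1_add: "p1 (v + w) = p1 v + p1 w"
proof -
  have "v + w = (p0 v + p0 w) + (p1 v + p1 w)"
    using p_sum[of v] p_sum[of w] by (simp add: add.assoc add.left_commute)
  moreover have "p0 v + p0 w \<in> V0" "p1 v + p1 w \<in> V1"
    by (simp_all add: subspace_add subspace_V0 subspace_V1)
  ultimately show "p0 (v + w) = p0 v + p0 w" "p1 (v + w) = p1 v + p1 w"
    by (simp_all add: proj_eqI)
qed

lemma p0_scl: "p0 (scl c v) = scl c (p0 v)" and p1_scl: "p1 (scl c v) = scl c (p1 v)"
proof -
  have "scl c v = scl c (p0 v) + scl c (p1 v)"
    using p_sum[of v] by (simp flip: scale_right_distrib)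
  moreover have "scl c (p0 v) \<in> V0" "scl c (p1 v) \<in> V1"
    by (simp_all add: subspace_scale subspace_V0 subspace_V1)
  ultimately show "p0 (scl c v) = scl c (p0 v)" "p1 (scl c v) = scl c (p1 v)"
    by (simp_all add: proj_eqI)
qed

lemma p0_HL [simp]: "p0 v \<in> V0 \<union> V1" and p1_HL [simp]: "p1 v \<in> V0 \<union> V1"
  by (simp_all del: Un_iff add: UnI1 UnI2)

lemma par_V1: "v \<in> V1 \<Longrightarrow> v \<noteq> 0 \<Longrightarrow> par V0 v = 1"
  using V0_Int_V1 by (auto simp: par_def)

lemma par_V0: "v \<in> V0 \<Longrightarrow> par V0 v = 0"
  by (simp add: par_def)

lemma par_eq: "U = V0 \<or> U = V1 \<Longrightarrow> v \<in> U \<Longrightarrow> w \<in> U \<Longrightarrow> v \<noteq> 0 \<Longrightarrow> w \<noteq> 0 \<Longrightarrow> par V0 v = par V0 w"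
  using par_V0 par_V1 by metis

subsection \<open>Multilinear maps given on homogeneous vectors\<close>

text \<open>Expressions with Koszul signs depend on the parities of the entries, so they can only be
  expected to be linear within one graded component and with homogeneous entries in the other
  slots.\<close>

definition hmultilinear :: "('v list \<Rightarrow> 'y \<Rightarrow> 'k) \<Rightarrow> bool"
  where "hmultilinear f \<longleftrightarrow> (\<forall>us\<in>HL. \<forall>ws\<in>HL. \<forall>U\<in>{V0, V1}. \<forall>v\<in>U.
    (\<forall>w\<in>U. f (us @ (v + w) # ws) = f (us @ v # ws) + f (us @ w # ws)) \<and>
    (\<forall>c. f (us @ scl c v # ws) = fscale c (f (us @ v # ws))))"

text \<open>The only candidate for a multilinear map that agrees with \<open>f\<close> on
  homogeneous words: the sum over all choices of the even or the odd part in each slot.\<close>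

fun hext :: "'v list \<Rightarrow> ('v list \<Rightarrow> 'y \<Rightarrow> 'k) \<Rightarrow> 'y \<Rightarrow> 'k"
  where "hext [] f = f []"
  | "hext (v # vs) f = hext vs (\<lambda>ws. f (p0 v # ws)) + hext vs (\<lambda>ws. f (p1 v # ws))"

lemma hext_cong: "(\<And>ws. ws \<in> HL \<Longrightarrow> f ws = f' ws) \<Longrightarrow> hext vs f = hext vs f'"
proof (induction vs arbitrary: f f')
  case Nil
  then show ?case by simp
next
  case (Cons v vs)
  have "f (p0 v # ws) = f' (p0 v # ws)" "f (p1 v # ws) = f' (p1 v # ws)" if "ws \<in> HL" for ws
    using Cons.prems[of "_ # ws"] that by simp_all
  then show ?case using Cons.IH[of "\<lambda>ws. f (p0 v # ws)" "\<lambda>ws. f' (p0 v # ws)"]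
    Cons.IH[of "\<lambda>ws. f (p1 v # ws)" "\<lambda>ws. f' (p1 v # ws)"] by simp
qed

lemma hext_add: "hext vs (\<lambda>ws. f ws + f' ws) = hext vs f + hext vs f'"
  by (induction vs arbitrary: f f') (simp_all add: algebra_simps)

lemma hext_fscale: "hext vs (\<lambda>ws. fscale c (f ws)) = fscale c (hext vs f)"
  by (induction vs arbitrary: f) (simp_all add: FS.scale_right_distrib)

lemma hext_zero: "hext vs (\<lambda>ws. 0) = 0"
  by (induction vs) simp_all

lemma hmultilinear_Cons:
  assumes "hmultilinear f" "v \<in> V0 \<union> V1"
  shows "hmultilinear (\<lambda>ws. f (v # ws))"
  unfolding hmultilinear_def
proof (intro ballI)
  fix us ws U x assume *: "us \<in> HL" "ws \<in> HL" "U \<in> {V0, V1}" "x \<in> U"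
  then have "v # us \<in> HL" using assms(2) by simp
  from assms(1)[unfolded hmultilinear_def, rule_format, OF this *(2,3,4)]
  show "(\<forall>w\<in>U. f (v # us @ (x + w) # ws) = f (v # us @ x # ws) + f (v # us @ w # ws)) \<and>
       (\<forall>c. f (v # us @ scl c x # ws) = fscale c (f (v # us @ x # ws)))"
    by simp
qed

lemma hmultilinearD:
  assumes "hmultilinear f" "us \<in> HL" "ws \<in> HL" "U = V0 \<or> U = V1" "v \<in> U"
  shows "w \<in> U \<Longrightarrow> f (us @ (v + w) # ws) = f (us @ v # ws) + f (us @ w # ws)"
    "f (us @ scl c v # ws) = fscale c (f (us @ v # ws))"
  using assms(1)[unfolded hmultilinear_def, rule_format, OF assms(2,3), of U v] assms(4,5) by auto

lemma hext_multilinear: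
  assumes "hmultilinear f"
  shows "multilinear scl fscale (\<lambda>vs. hext vs f)"
proof (rule multilinearI[OF vs_scl])
  fix us ws :: "'v list" and v w :: 'v and c
  show "hext (us @ (v + w) # ws) f = hext (us @ v # ws) f + hext (us @ w # ws) f"
    using assms
  proof (induction us arbitrary: f)
    case Nil
    have "hext ws (\<lambda>xs. f (p0 (v + w) # xs)) = hext ws (\<lambda>xs. f (p0 v # xs) + f (p0 w # xs))"
      "hext ws (\<lambda>xs. f (p1 (v + w) # xs)) = hext ws (\<lambda>xs. f (p1 v # xs) + f (p1 w # xs))"
      using hmultilinearD(1)[OF Nil, of "[]" _ V0 "p0 v" "p0 w"]
        hmultilinearD(1)[OF Nil, of "[]" _ V1 "p1 v" "p1 w"]
      by (auto simp: p0_add p1_add intro!: hext_cong)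
    then show ?case by (simp add: hext_add algebra_simps)
  next
    case (Cons u us)
    show ?case
      using Cons.IH[OF hmultilinear_Cons[OF Cons.prems p0_HL]] Cons.IH[OF hmultilinear_Cons[OF Cons.prems p1_HL]]
      by (simp add: algebra_simps)
  qed
  show "hext (us @ scl c v # ws) f = fscale c (hext (us @ v # ws) f)"
    using assms
  proof (induction us arbitrary: f)
    case Nil
    have "hext ws (\<lambda>xs. f (p0 (scl c v) # xs)) = hext ws (\<lambda>xs. fscale c (f (p0 v # xs)))"
      "hext ws (\<lambda>xs. f (p1 (scl c v) # xs)) = hext ws (\<lambda>xs. fscale c (f (p1 v # xs)))"
      using hmultilinearD(2)[OF Nil, of "[]" _ V0 "p0 v" c]
        hmultilinearD(2)[OF Nil, of "[]" _ V1 "p1 v" c]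
      by (auto simp: p0_scl p1_scl intro!: hext_cong)
    then show ?case by (simp add: hext_fscale FS.scale_right_distrib)
  next
    case (Cons u us)
    show ?case
      using Cons.IH[OF hmultilinear_Cons[OF Cons.prems p0_HL]] Cons.IH[OF hmultilinear_Cons[OF Cons.prems p1_HL]]
      by (simp add: FS.scale_right_distrib)
  qed
qed

text \<open>A homogeneous entry has one vanishing part, and \<open>f\<close> vanishes on words that
  begin with 0 (scale by 0), so a single summand survives.\<close>

lemma hext_hom:
  assumes "hmultilinear f" "vs \<in> HL"
  shows "hext vs f = f vs"
  using assms
proof (induction vs arbitrary: f)
  case Nil
  then show ?case by simp
next
  case (Cons v vs)
  have v: "v \<in> V0 \<union> V1" and vs: "vs \<in> HL" using Cons.prems(2) by auto
  have zero: "f (0 # ws) = 0" if "ws \<in> HL" for ws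
    using hmultilinearD(2)[OF Cons.prems(1), of "[]" ws V0 0 0] that by simp
  have z: "hext vs (\<lambda>ws. f (0 # ws)) = 0"
    using hext_cong[of "\<lambda>ws. f (0 # ws)" "\<lambda>ws. 0" vs] zero by (simp add: hext_zero)
  have "hext vs (\<lambda>ws. f (v # ws)) = f (v # vs)"
    by (rule Cons.IH[OF hmultilinear_Cons[OF Cons.prems(1) v] vs])
  with z v show ?case by (cases "v \<in> V0") auto
qed

lemma multilinear_eqI:
  assumes "multilinear scl fscale f" "multilinear scl fscale g"
    "\<And>vs. vs \<in> HL \<Longrightarrow> f vs = (g vs :: 'y \<Rightarrow> 'k)"
  shows "f vs = g vs"
proof -
  \<comment> \<open>The entries are split from left to right; the generalised prefix
    \<open>us\<close> is the part that is already homogeneous.\<close>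
  have "f (us @ vs) = g (us @ vs)" if "us \<in> HL" for us
    using that
  proof (induction vs arbitrary: us)
    case Nil
    then show ?case using assms(3) by simp
  next
    case (Cons v vs)
    have "f (us @ (p0 v + p1 v) # vs) = g (us @ (p0 v + p1 v) # vs)"
      unfolding multilinearD(1)[OF assms(1)] multilinearD(1)[OF assms(2)]
      using Cons.IH[of "us @ [p0 v]"] Cons.IH[of "us @ [p1 v]"] Cons.prems by simp
    then show ?case by (simp add: p_sum)
  qed
  from this[of "[]"] show ?thesis by simp
qed

subsection \<open>Permutations\<close>

lemma koszul_cong:
  assumes "map (par V0) vs = map (par V0) vs'" "\<sigma> permutes {..<length vs}"
  shows "(koszul V0 \<sigma> vs :: 'k) = koszul V0 \<sigma> vs'"
proof -
  have len: "length vs = length vs'" using assms(1) map_eq_imp_length_eq by blast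
  have lt: "\<sigma> x < length vs \<longleftrightarrow> x < length vs" for x using permutes_in_image[OF assms(2), of x] by simp
  have "par V0 (vs ! i) = par V0 (vs' ! i)" if "i < length vs" for i
    using assms(1) len that by (metis nth_map)
  then have eq: "par V0 (vs ! \<sigma> i) = par V0 (vs' ! \<sigma> i)" if "i < length vs" for i
    using that lt[of i] by blast
  have "{(i, j). i < j \<and> j < length vs \<and> \<sigma> i > \<sigma> j \<and> par V0 (vs ! \<sigma> i) = 1 \<and> par V0 (vs ! \<sigma> j) = 1}
    = {(i, j). i < j \<and> j < length vs' \<and> \<sigma> i > \<sigma> j \<and> par V0 (vs' ! \<sigma> i) = 1 \<and> par V0 (vs' ! \<sigma> j) = 1}"
    (is "?L = ?R")
  proof (rule set_eqI, clarify)
    fix i j show "(i, j) \<in> ?L \<longleftrightarrow> (i, j) \<in> ?R"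
      using eq[of i] eq[of j] by (cases "i < j \<and> j < length vs") (auto simp: len[symmetric])
  qed
  then show ?thesis by (simp add: koszul_def)
qed

text \<open>The slot after \<open>us\<close> reappears at the position that \<open>\<sigma>\<close>
  sends to \<open>length us\<close>, and the entries around it do not depend on \<open>v\<close>.
  Hence linearity of a permuted word in one slot follows from that of \<open>tens\<close>.\<close>

lemma permute_list_insert:
  assumes "\<sigma> permutes {..<length (us @ x # ws)}"
  obtains us' ws' where "\<And>v. permute_list \<sigma> (us @ v # ws) = us' @ v # ws'"
proof -
  let ?k = "length us" and ?n = "Suc (length us + length ws)"
  have sg: "\<sigma> permutes {..<?n}" using assms by simp
  define j where "j = inv \<sigma> ?k"
  have j: "\<sigma> j = ?k" "j < ?n"
    using permutes_inverses(1)[OF sg] permutes_in_image[OF permutes_inv[OF sg], of ?k]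
    by (simp_all add: j_def)
  have ne: "\<sigma> i \<noteq> ?k" if "i \<noteq> j" for i
    using that j permutes_inj[OF sg] by (metis injD)
  have up: "[0..<?n] = [0..<j] @ j # [Suc j..<?n]"
    unfolding upt_conv_Cons[OF j(2), symmetric]
    using upt_add_eq_append[of 0 j "?n - j"] le_add_diff_inverse[OF less_imp_le[OF j(2)]] by (simp only: le0)
  have "permute_list \<sigma> (us @ v # ws)
      = map (\<lambda>i. (us @ x # ws) ! \<sigma> i) [0..<j] @ v # map (\<lambda>i. (us @ x # ws) ! \<sigma> i) [Suc j..<?n]" for v
  proof -
    have *: "(us @ v # ws) ! \<sigma> i = (us @ x # ws) ! \<sigma> i" if "i \<noteq> j" for i
      using ne[OF that] by (auto simp: nth_append nth_Cons')
    have "length (us @ v # ws) = ?n" by simp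
    then have "permute_list \<sigma> (us @ v # ws) = map (\<lambda>i. (us @ v # ws) ! \<sigma> i) ([0..<j] @ j # [Suc j..<?n])"
      unfolding permute_list_def up[symmetric] by simp
    also have "\<dots> = map (\<lambda>i. (us @ v # ws) ! \<sigma> i) [0..<j] @ v # map (\<lambda>i. (us @ v # ws) ! \<sigma> i) [Suc j..<?n]"
      using j(1) by simp
    also have "map (\<lambda>i. (us @ v # ws) ! \<sigma> i) [0..<j] = map (\<lambda>i. (us @ x # ws) ! \<sigma> i) [0..<j]"
      by (rule map_cong[OF refl]) (simp add: *)
    also have "map (\<lambda>i. (us @ v # ws) ! \<sigma> i) [Suc j..<?n] = map (\<lambda>i. (us @ x # ws) ! \<sigma> i) [Suc j..<?n]"
      by (rule map_cong[OF refl]) (simp add: * del: upt_Suc)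
    finally show ?thesis .
  qed
  then show thesis using that by blast
qed

definition perm_term :: "nat \<Rightarrow> (nat \<Rightarrow> nat) \<Rightarrow> 'v list \<Rightarrow> ('k, 'v) tensor"
  where "perm_term n \<sigma> vs =
    (if length vs = n then fscale (koszul V0 \<sigma> vs) (tens scl (permute_list \<sigma> vs)) else 0)"

lemma tens_multilinear: "multilinear scl fscale (tens scl)"
  by (rule multilinear_tens[OF vs_scl])

lemma hmultilinear_perm_term:
  assumes "\<sigma> permutes {..<n}"
  shows "hmultilinear (perm_term n \<sigma>)"
  unfolding hmultilinear_def
proof (intro ballI)
  fix us ws U v assume us: "us \<in> HL" "ws \<in> HL" and U: "U \<in> {V0, V1}" and v: "v \<in> U"
  show "(\<forall>w\<in>U. perm_term n \<sigma> (us @ (v + w) # ws) = perm_term n \<sigma> (us @ v # ws) + perm_term n \<sigma> (us @ w # ws)) \<and>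
      (\<forall>c. perm_term n \<sigma> (us @ scl c v # ws) = fscale c (perm_term n \<sigma> (us @ v # ws)))"
  proof (cases "n = Suc (length us + length ws)")
    case False
    then show ?thesis by (simp add: perm_term_def)
  next
    case True
    then have sg: "\<sigma> permutes {..<length (us @ x # ws)}" for x using assms by simp
    obtain us' ws' where pl: "\<And>v. permute_list \<sigma> (us @ v # ws) = us' @ v # ws'"
      by (rule permute_list_insert[OF sg[of 0]], rule that, simp)
    \<comment> \<open>Parity is constant on the nonzero vectors of \<open>U\<close>, hence so is the
      sign. The zero vector counts as even and may produce another sign, but then the tensor itself
      vanishes. If \<open>U\<close> is trivial, any \<open>K\<close> will do.\<close>
    obtain K where K: "\<And>x. x \<in> U \<Longrightarrow> x \<noteq> 0 \<Longrightarrow> koszul V0 \<sigma> (us @ x # ws) = (K :: 'k)"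
    proof (cases "\<exists>y\<in>U. y \<noteq> 0")
      case True
      then obtain y where y: "y \<in> U" "y \<noteq> 0" by blast
      have "koszul V0 \<sigma> (us @ x # ws) = (koszul V0 \<sigma> (us @ y # ws) :: 'k)" if "x \<in> U" "x \<noteq> 0" for x
        using par_eq[of U x y] that y U by (intro koszul_cong[OF _ sg]) auto
      then show ?thesis using that by blast
    next
      case False
      then show ?thesis using that by blast
    qed
    have eq: "perm_term n \<sigma> (us @ x # ws) = fscale K (tens scl (us' @ x # ws'))" if "x \<in> U" for x
      using K[OF that] that True pl[of x] multilinear_zero_arg[OF tens_multilinear, of us' ws']
      by (cases "x = 0") (simp_all add: perm_term_def)
    have cl: "v + w \<in> U" "scl c v \<in> U" if "w \<in> U" for w c
      using U v that subspace_V0 subspace_V1 subspace_add subspace_scale by auto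
    show ?thesis
      using v cl by (auto simp: eq multilinearD[OF tens_multilinear] FS.scale_right_distrib mult.commute)
  qed
qed

lemma perm_act:
  assumes "\<sigma> permutes {..<n}"
  shows "flinear (perm_act scl V0 V1 n \<sigma>)"
    "vs \<in> HL \<Longrightarrow> length vs = n \<Longrightarrow>
      perm_act scl V0 V1 n \<sigma> (tens scl vs) = fscale (koszul V0 \<sigma> vs) (tens scl (permute_list \<sigma> vs))"
proof -
  let ?F = "tens_ext (\<lambda>vs. hext vs (perm_term n \<sigma>))"
  have ml: "multilinear scl fscale (\<lambda>vs. hext vs (perm_term n \<sigma>))"
    by (intro hext_multilinear hmultilinear_perm_term assms)
  have e: "?F (tens scl vs) = fscale (koszul V0 \<sigma> vs) (tens scl (map (\<lambda>i. vs ! \<sigma> i) [0..<n]))"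
    if "vs \<in> {vs \<in> HL. length vs = n}" for vs
    using that by (simp add: tens_ext_tens[OF ml] hext_hom hmultilinear_perm_term assms)
      (auto simp: perm_term_def permute_list_def)
  note * = lin_ext_eqI[of ?F "{vs \<in> HL. length vs = n}" "tens scl", OF flinear_tens_ext e]
  show "flinear (perm_act scl V0 V1 n \<sigma>)" unfolding perm_act_def by (rule *(1))
  show "vs \<in> HL \<Longrightarrow> length vs = n \<Longrightarrow>
      perm_act scl V0 V1 n \<sigma> (tens scl vs) = fscale (koszul V0 \<sigma> vs) (tens scl (permute_list \<sigma> vs))"
    unfolding perm_act_def by (subst *(2)) (auto simp: permute_list_def)
qed

section \<open>The symmetriser and the universal property of symmetrised words\<close>

lemma flinear_sym_n: "flinear (sym_n scl V0 V1 n)"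
  unfolding sym_n_def by (intro flinear_scale flinear_sum) (auto intro: perm_act)

lemma sym_n_tens:
  assumes "vs \<in> HL" "length vs = n"
  shows "sym_n scl V0 V1 n (tens scl vs)
    = fscale (1 / fact n) (\<Sum>\<sigma> | \<sigma> permutes {..<n}. fscale (koszul V0 \<sigma> vs) (tens scl (permute_list \<sigma> vs)))"
  unfolding sym_n_def by (auto intro!: sum.cong arg_cong[where f = "fscale _"] simp: perm_act assms)

lemma flinear_homog_comp: "flinear (homog_comp scl n)"
  by (intro flinearI) (auto simp: homog_comp_def fscale_def plus_fun_def)

lemma homog_comp_tens': "homog_comp scl n (tens scl vs) = (if length vs = n then tens scl vs else 0)"
  by (rule homog_comp_tens[OF vs_scl])

text \<open>\<open>symmetrizer\<close> is a \<open>Sum_any\<close>, which is 0 when the support is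
  infinite. Bounded degree turns it into a finite sum, and linearity on \<open>T\<close> follows
  from that of the summands.\<close>

lemma T_bounded_degree:
  assumes "t \<in> T"
  shows "\<exists>N. \<forall>n\<ge>N. homog_comp scl n t = 0"
  using assms
proof (induction rule: fspan_induct)
  case base
  then show ?case by (auto simp: flinearD(3)[OF flinear_homog_comp])
next
  case (step c x y)
  obtain vs where x: "x = tens scl vs" using step by blast
  obtain N where "\<forall>n\<ge>N. homog_comp scl n y = 0" using step by blast
  then have "\<forall>n\<ge>max N (Suc (length vs)). homog_comp scl n (fscale c x + y) = 0"
    by (simp add: flinearD[OF flinear_homog_comp] x homog_comp_tens')
  then show ?case by blast
qed

lemma symmetrizer_eq_sum:
  assumes "\<forall>n\<ge>N. homog_comp scl n t = 0"
  shows "symmetrizer scl V0 V1 t = (\<Sum>n<N. sym_n scl V0 V1 n (homog_comp scl n t))"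
  unfolding symmetrizer_def
proof (rule Sum_any.expand_superset)
  show "{n. sym_n scl V0 V1 n (homog_comp scl n t) \<noteq> 0} \<subseteq> {..<N}"
    using assms flinearD(3)[OF flinear_sym_n] by (metis (mono_tags, lifting) lessThan_iff mem_Collect_eq not_less subsetI)
qed simp

lemma symmetrizer_add:
  assumes "t \<in> T" "u \<in> T"
  shows "symmetrizer scl V0 V1 (t + u) = symmetrizer scl V0 V1 t + symmetrizer scl V0 V1 u"
proof -
  obtain N M where *: "\<forall>n\<ge>N. homog_comp scl n t = 0" "\<forall>n\<ge>M. homog_comp scl n u = 0"
    using assms T_bounded_degree by meson
  then have "\<forall>n\<ge>max N M. homog_comp scl n t = 0" "\<forall>n\<ge>max N M. homog_comp scl n u = 0"
    "\<forall>n\<ge>max N M. homog_comp scl n (t + u) = 0"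
    by (simp_all add: flinearD[OF flinear_homog_comp])
  note this[THEN symmetrizer_eq_sum]
  then show ?thesis
    by (simp only: flinearD[OF flinear_homog_comp] flinearD[OF flinear_sym_n] sum.distrib)
qed

lemma symmetrizer_fscale:
  assumes "t \<in> T"
  shows "symmetrizer scl V0 V1 (fscale c t) = fscale c (symmetrizer scl V0 V1 t)"
proof -
  obtain N where *: "\<forall>n\<ge>N. homog_comp scl n t = 0"
    using assms T_bounded_degree by meson
  then have "\<forall>n\<ge>N. homog_comp scl n (fscale c t) = 0"
    by (simp add: flinearD[OF flinear_homog_comp])
  note this[THEN symmetrizer_eq_sum] *[THEN symmetrizer_eq_sum]
  then show ?thesis
    by (simp only: flinearD[OF flinear_homog_comp] flinearD[OF flinear_sym_n] FS.scale_sum_right)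
qed

lemma sym_tens_eq: "sym_tens vs = sym_n scl V0 V1 (length vs) (tens scl vs)"
proof -
  have "sym_tens vs = (\<Sum>n<Suc (length vs). sym_n scl V0 V1 n (homog_comp scl n (tens scl vs)))"
    unfolding sym_tens_def by (rule symmetrizer_eq_sum) (simp add: homog_comp_tens')
  also have "\<dots> = (\<Sum>n<Suc (length vs). if n = length vs then sym_n scl V0 V1 n (tens scl vs) else 0)"
    by (rule sum.cong) (auto simp: homog_comp_tens' flinearD(3)[OF flinear_sym_n])
  finally show ?thesis by simp
qed

lemma sym_tens_multilinear: "multilinear scl fscale sym_tens"
  by (rule multilinearI[OF vs_scl])
    (simp_all add: sym_tens_eq multilinearD[OF tens_multilinear] flinearD[OF flinear_sym_n])

lemma sym_tens_hom:
  assumes "vs \<in> HL" "length vs = n"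
  shows "sym_tens vs
    = fscale (1 / fact n) (\<Sum>\<sigma> | \<sigma> permutes {..<n}. fscale (koszul V0 \<sigma> vs) (tens scl (permute_list \<sigma> vs)))"
  using sym_n_tens[OF assms] assms(2) by (simp add: sym_tens_eq)

text \<open>A globally linear stand-in for \<open>symmetrizer\<close>, with which it agrees on
  \<open>T\<close>.\<close>

definition sym_op :: "('k, 'v) tensor \<Rightarrow> ('k, 'v) tensor"
  where "sym_op = tens_ext sym_tens"

lemma flinear_sym_op: "flinear sym_op"
  unfolding sym_op_def by (rule flinear_tens_ext)

lemma sym_op_tens [simp]: "sym_op (tens scl vs) = sym_tens vs"
  unfolding sym_op_def by (rule tens_ext_tens[OF sym_tens_multilinear])

lemma symmetrizer_eq_sym_op: "t \<in> T \<Longrightarrow> symmetrizer scl V0 V1 t = sym_op t"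
proof (induction rule: fspan_induct)
  case base
  have "symmetrizer scl V0 V1 (fscale 0 0) = 0"
    by (subst symmetrizer_fscale) (simp_all add: FS.span_zero)
  then show ?case by (simp add: flinearD[OF flinear_sym_op])
next
  case (step c x y)
  then show ?case
    by (auto simp: symmetrizer_add symmetrizer_fscale FS.span_scale FS.span_base flinearD[OF flinear_sym_op]
      sym_tens_def)
qed

lemma sym_tens_T: "sym_tens vs \<in> T"
proof -
  have "sym_tens vs \<in> T" if "vs \<in> HL" for vs
    unfolding sym_tens_hom[OF that refl] by (intro FS.span_scale FS.span_sum FS.span_base) auto
  moreover have "f vs \<in> T" if f: "multilinear scl fscale f" and h: "\<And>vs. vs \<in> HL \<Longrightarrow> f vs \<in> T"
    for f :: "'v list \<Rightarrow> ('k, 'v) tensor" and vs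
  proof -
    have "f (us @ vs) \<in> T" if "us \<in> HL" for us
      using that
    proof (induction vs arbitrary: us)
      case Nil
      then show ?case using h by simp
    next
      case (Cons v vs)
      have "f (us @ (p0 v + p1 v) # vs) \<in> T"
        unfolding multilinearD(1)[OF f]
        using Cons.IH[of "us @ [p0 v]"] Cons.IH[of "us @ [p1 v]"] Cons.prems by (simp add: FS.span_add)
      then show ?case by (simp add: p_sum)
    qed
    from this[of "[]"] show ?thesis by simp
  qed
  ultimately show ?thesis using sym_tens_multilinear by blast
qed

lemma koszul_sign_sq [simp]: "koszul_sign a b * koszul_sign a b = 1"
  by (simp add: koszul_sign_def flip: power_add mult_2)

lemma koszul_sign_commute: "koszul_sign a b = koszul_sign b a"
  by (simp add: koszul_sign_def mult.commute)

text \<open>By \<open>koszul_compose\<close>, permuting the word first replaces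
  \<open>\<sigma>\<close> by \<open>\<tau> \<circ> \<sigma>\<close> in the sum over the symmetric
  group, and left translation by \<open>\<tau>\<close> is a bijection of that group.\<close>

lemma sym_tens_permute:
  assumes vs: "vs \<in> HL" and t: "\<tau> permutes {..<length vs}"
  shows "fscale (koszul V0 \<tau> vs) (sym_tens (permute_list \<tau> vs)) = sym_tens vs"
proof -
  let ?n = "length vs" and ?P = "{\<sigma>. \<sigma> permutes {..<length vs}}"
  have pv: "permute_list \<tau> vs \<in> HL" using vs t by (simp add: lists_eq_set)
  have "fscale (koszul V0 \<tau> vs) (sym_tens (permute_list \<tau> vs)) = fscale (1 / fact ?n)
    (\<Sum>\<sigma>\<in>?P. fscale (koszul V0 \<tau> vs * koszul V0 \<sigma> (permute_list \<tau> vs)) (tens scl (permute_list \<sigma> (permute_list \<tau> vs))))"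
    by (simp add: sym_tens_hom[OF pv length_permute_list] FS.scale_sum_right mult.left_commute)
  also have "\<dots> = fscale (1 / fact ?n)
    (\<Sum>\<sigma>\<in>?P. fscale (koszul V0 (\<tau> \<circ> \<sigma>) vs) (tens scl (permute_list (\<tau> \<circ> \<sigma>) vs)))"
    using t by (auto intro!: arg_cong[where f = "fscale _"] sum.cong simp: koszul_compose permute_list_compose)
  also have "\<dots> = sym_tens vs"
  proof -
    have bij: "bij_betw (\<lambda>\<sigma>. \<tau> \<circ> \<sigma>) ?P ?P"
      by (rule bij_betwI[where g = "\<lambda>\<sigma>. inv \<tau> \<circ> \<sigma>"])
        (auto simp: permutes_compose t permutes_inv o_assoc permutes_inv_o[OF t])
    show ?thesis
      unfolding sym_tens_hom[OF vs refl] by (subst sum.reindex_bij_betw[OF bij]) simp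
  qed
  finally show ?thesis .
qed

lemma sym_tens_swap:
  assumes "us @ a # b # ws \<in> HL"
  shows "sym_tens (us @ a # b # ws) = fscale (koszul_sign a b) (sym_tens (us @ b # a # ws))"
proof -
  have tr: "Transposition.transpose (length us) (Suc (length us)) permutes {..<length (us @ a # b # ws)}"
    by (rule permutes_swap_id) auto
  have "koszul V0 (Transposition.transpose (length us) (Suc (length us))) (us @ a # b # ws) = koszul_sign a b"
    by (subst koszul_transpose) (simp_all add: koszul_sign_def nth_append)
  then show ?thesis using sym_tens_permute[OF assms tr] by (simp add: permute_list_transpose)
qed

text \<open>Graded symmetry tested on neighbours only. This is the form in which it can be checked
  by induction on words.\<close>

definition swap_compatible :: "('v list \<Rightarrow> 'y \<Rightarrow> 'k) \<Rightarrow> bool"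
  where "swap_compatible f \<longleftrightarrow> (\<forall>us a b ws. us @ a # b # ws \<in> HL \<longrightarrow>
    f (us @ a # b # ws) = fscale (koszul_sign a b) (f (us @ b # a # ws)))"

text \<open>The permutations that satisfy the rule contain the adjacent transpositions and are
  closed under composition by the cocycle identity \<open>koszul_compose\<close>.\<close>

lemma swap_compatible_permute:
  assumes f: "swap_compatible f" and vs: "vs \<in> HL" and s: "\<sigma> permutes {..<length vs}"
  shows "fscale (koszul V0 \<sigma> vs) (f (permute_list \<sigma> vs)) = f vs"
proof -
  have "\<forall>vs\<in>HL. length vs = n \<longrightarrow> fscale (koszul V0 \<sigma> vs) (f (permute_list \<sigma> vs)) = f vs"
    if "\<sigma> permutes {..<n}" for n \<sigma>
    using that
  proof (induction rule: permutes_adjacent_induct)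
    case id
    show ?case by (intro ballI impI) (simp only: koszul_id permute_list_id FS.scale_one)
  next
    case (adj i)
    show ?case
    proof (intro ballI impI)
      fix vs assume vs: "vs \<in> HL" "length vs = n"
      define us where "us = take i vs"
      define a where "a = vs ! i"
      define b where "b = vs ! Suc i"
      define ws where "ws = drop (Suc (Suc i)) vs"
      have e: "vs = us @ a # b # ws" and l: "length us = i"
        using adj vs by (auto simp: us_def a_def b_def ws_def Cons_nth_drop_Suc)
      have "koszul V0 (Transposition.transpose i (Suc i)) vs = koszul_sign a b"
        using adj vs by (subst koszul_transpose) (simp_all add: koszul_sign_def a_def b_def)
      moreover have "permute_list (Transposition.transpose i (Suc i)) vs = us @ b # a # ws"
        unfolding e l[symmetric] by (rule permute_list_transpose)
      moreover have "f vs = fscale (koszul_sign a b) (f (us @ b # a # ws))"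
        using f vs(1) unfolding e swap_compatible_def by blast
      ultimately show "fscale (koszul V0 (Transposition.transpose i (Suc i)) vs)
          (f (permute_list (Transposition.transpose i (Suc i)) vs)) = f vs" by simp
    qed
  next
    case (comp \<sigma> \<tau>)
    show ?case
    proof (intro ballI impI)
      fix vs assume vs: "vs \<in> HL" "length vs = n"
      have pv: "permute_list \<sigma> vs \<in> HL" using vs comp(1) by (simp add: lists_eq_set)
      show "fscale (koszul V0 (\<sigma> \<circ> \<tau>) vs) (f (permute_list (\<sigma> \<circ> \<tau>) vs)) = f vs"
        using comp vs pv by (simp add: koszul_compose permute_list_compose FS.scale_scale[symmetric] del: FS.scale_scale)
    qed
  qed
  then show ?thesis using vs s by blast
qed

text \<open>The symmetrised word is an average of \<open>n!\<close> signed words, and on homogeneous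
  words graded symmetry gives each of them the value \<open>f vs\<close>. Multilinearity does the
  rest.\<close>

lemma sym_tens_universal:
  assumes ml: "multilinear scl fscale f" and sw: "swap_compatible f"
  shows "tens_ext f (sym_tens vs) = f vs"
proof (rule multilinear_eqI[where vs = vs])
  show "multilinear scl fscale (\<lambda>vs. tens_ext f (sym_tens vs))"
    by (rule multilinear_compose[OF sym_tens_multilinear flinear_tens_ext])
  show "multilinear scl fscale f" by fact
  fix vs assume vs: "vs \<in> HL"
  let ?P = "{\<sigma>. \<sigma> permutes {..<length vs}}"
  have "tens_ext f (sym_tens vs) = fscale (1 / fact (length vs))
      (\<Sum>\<sigma>\<in>?P. fscale (koszul V0 \<sigma> vs) (f (permute_list \<sigma> vs)))"
    unfolding sym_tens_hom[OF vs refl]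
    by (simp add: flinearD[OF flinear_tens_ext] flinear_sum_arg[OF flinear_tens_ext] tens_ext_tens[OF ml])
  also have "(\<Sum>\<sigma>\<in>?P. fscale (koszul V0 \<sigma> vs) (f (permute_list \<sigma> vs))) = (\<Sum>\<sigma>\<in>?P. f vs)"
    by (rule sum.cong) (auto simp: swap_compatible_permute[OF sw vs])
  also have "\<dots> = fscale (fact (length vs)) (f vs)"
    by (simp only: FS.sum_constant_scale card_permutations[OF card_lessThan finite_lessThan] of_nat_fact)
  finally show "tens_ext f (sym_tens vs) = f vs" by simp
qed

lemma swap_compatible_sym_tens: "swap_compatible sym_tens"
  unfolding swap_compatible_def using sym_tens_swap by blast

subsection \<open>The symmetric algebra\<close>

lemma T_eq_hom: "FS.span {tens scl vs | vs. vs \<in> HL \<and> length vs = n} = tensor_power scl n"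
proof -
  let ?B = "{tens scl vs | vs. vs \<in> HL \<and> length vs = n}"
  have "tens scl vs \<in> FS.span ?B" if "length vs = n" for vs
  proof -
    have "tens scl (us @ vs) \<in> FS.span ?B" if "us \<in> HL" "length (us @ vs) = n" for us
      using that
    proof (induction vs arbitrary: us)
      case Nil
      then show ?case by (auto intro!: FS.span_base)
    next
      case (Cons v vs)
      have "tens scl (us @ (p0 v + p1 v) # vs) \<in> FS.span ?B"
        unfolding multilinearD(1)[OF tens_multilinear]
        using Cons.IH[of "us @ [p0 v]"] Cons.IH[of "us @ [p1 v]"] Cons.prems by (simp add: FS.span_add)
      then show ?case by (simp add: p_sum)
    qed
    from this[of "[]"] show ?thesis using that by simp
  qed
  then have "{tens scl vs | vs. length vs = n} \<subseteq> FS.span ?B" by blast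
  then show ?thesis unfolding tensor_power_def
    by (intro equalityI FS.span_mono FS.span_minimal) (auto simp: FS.subspace_span)
qed

lemma A_eq_span: "A = FS.span (sym_tens ` HL)"
proof -
  have 1: "sym_power scl V0 V1 n \<subseteq> FS.span (sym_tens ` HL)" for n
  proof
    fix x assume "x \<in> sym_power scl V0 V1 n"
    then obtain t where x: "x = sym_n scl V0 V1 n t" and t: "t \<in> FS.span {tens scl vs | vs. vs \<in> HL \<and> length vs = n}"
      unfolding sym_power_def T_eq_hom by blast
    show "x \<in> FS.span (sym_tens ` HL)" unfolding x
      by (rule flinear_span_image[OF flinear_sym_n _ t]) (auto intro!: FS.span_base simp: sym_tens_eq)
  qed
  have 2: "sym_tens vs \<in> sym_power scl V0 V1 (length vs)" for vs
    unfolding sym_power_def sym_tens_eq tensor_power_def by (auto intro!: imageI FS.span_base)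
  show ?thesis unfolding sym_alg_def
    using 1 2 by (intro equalityI FS.span_minimal FS.span_mono) (auto simp: FS.subspace_span)
qed

lemma subspace_A: "FS.subspace A"
  unfolding A_eq_span by (rule FS.subspace_span)

lemma sym_tens_A [simp]: "sym_tens vs \<in> A"
proof -
  have "sym_tens vs \<in> sym_power scl V0 V1 (length vs)" for vs
    unfolding sym_power_def sym_tens_eq tensor_power_def by (auto intro!: imageI FS.span_base)
  then show ?thesis unfolding sym_alg_def by (intro FS.span_base) blast
qed

lemma A_subset_T: "A \<subseteq> T"
  unfolding A_eq_span using sym_tens_T by (intro FS.span_minimal) (auto simp: FS.subspace_span)

lemma tprod_add_left: "tprod scl (s + s') t = tprod scl s t + tprod scl s' t"
  and tprod_fscale_left: "tprod scl (fscale c s) t = fscale c (tprod scl s t)"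
  by (auto simp: tprod_def plus_fun_def fscale_def)

text \<open>\<open>tens scl vs\<close> returns 0 on forms that are not multilinear, so the form
  obtained by inserting \<open>t\<close> must be shown to be multilinear; this is an induction over
  \<open>t\<close> in \<open>T\<close>. For a form \<open>\<phi>\<close> that is not multilinear,
  the right side evaluates \<open>t\<close> at the zero form, where elements of \<open>T\<close>
  vanish.\<close>

lemma tprod_tens_sum:
  assumes "t \<in> T"
  shows "tprod scl (tens scl vs) t = tens_ext (\<lambda>ws. tens scl (vs @ ws)) t"
proof
  fix \<phi>
  show "tprod scl (tens scl vs) t \<phi> = tens_ext (\<lambda>ws. tens scl (vs @ ws)) t \<phi>"
  proof (cases "multilinear scl (*) \<phi>")
    case False
    have "tens_ext (\<lambda>ws. tens scl (vs @ ws)) t \<phi> = t (\<lambda>ws. 0)" using False by (simp add: tens_ext_def tens_def)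
    also have "\<dots> = 0" using assms
    proof (induction rule: fspan_induct)
      case (step c x y)
      then show ?case by (auto simp: plus_fun_def fscale_def tens_def)
    qed (simp add: zero_fun_def)
    finally show ?thesis using False by (simp add: tprod_def)
  next
    case True
    have ml2: "multilinear scl (*) (\<lambda>ws. \<phi> (vs @ ws))" for vs
    proof -
      have "Vector_Spaces.linear scl (*) (\<lambda>v. \<phi> (us @ v # xs))" for us xs
        using True unfolding multilinear_def by blast
      from this[of "vs @ _"] show ?thesis unfolding multilinear_def by simp
    qed
    have "multilinear scl (*) (\<lambda>vs. t (\<lambda>ws. \<phi> (vs @ ws)))"
      using assms
    proof (induction rule: fspan_induct)
      case base
      have "multilinear scl (*) (\<lambda>vs. 0 :: 'k)"
        using vs_scl by (auto simp: multilinear_def Vector_Spaces.linear_iff vector_space_def algebra_simps)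
      then show ?case by (simp add: zero_fun_def)
    next
      case (step c x y)
      obtain xs where x: "x = tens scl xs" using step by blast
      have e: "(fscale c x + y) (\<lambda>ws. \<phi> (vs @ ws)) = c * \<phi> (vs @ xs) + y (\<lambda>ws. \<phi> (vs @ ws))" for vs
        by (simp add: x plus_fun_def fscale_def tens_def ml2)
      have l: "Vector_Spaces.linear scl (*) (\<lambda>v. \<phi> (us @ v # xs))" for us xs
        using True unfolding multilinear_def by blast
      show ?case
        unfolding multilinear_def e
      proof (intro allI)
        fix us ws
        have 1: "Vector_Spaces.linear scl (*) (\<lambda>v. \<phi> ((us @ v # ws) @ xs))" using l[of us "ws @ xs"] by simp
        have 2: "Vector_Spaces.linear scl (*) (\<lambda>v. y (\<lambda>xs. \<phi> ((us @ v # ws) @ xs)))"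
          using step(3) unfolding multilinear_def by blast
        show "Vector_Spaces.linear scl (*) (\<lambda>v. c * \<phi> ((us @ v # ws) @ xs) + y (\<lambda>xs. \<phi> ((us @ v # ws) @ xs)))"
          using 1 2 unfolding Vector_Spaces.linear_iff by (simp add: distrib_left mult.left_commute)
      qed
    qed
    then show ?thesis by (simp add: tprod_def tens_def tens_ext_def True)
  qed
qed

lemma concat_multilinear:
  "multilinear scl fscale (\<lambda>ws. tens scl (vs @ ws))" "multilinear scl fscale (\<lambda>vs. tens scl (vs @ ws))"
  using multilinearD[OF tens_multilinear, of "vs @ _"] multilinearD[OF tens_multilinear, of _ _ _ "_ @ ws"]
  by (auto intro!: multilinearI[OF vs_scl])

text \<open>Linearity in the left factor is built into \<open>tprod\<close>. In the right factor it
  would need \<open>s\<close> to be additive as a functional, so \<open>s\<close> is first reduced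
  to words.\<close>

lemma tprod_right_add:
  assumes "s \<in> T" "t \<in> T" "u \<in> T"
  shows "tprod scl s (t + u) = tprod scl s t + tprod scl s u"
    and "tprod scl s (fscale c t) = fscale c (tprod scl s t)"
  using assms(1)
proof (induction rule: fspan_induct)
  case base
  { case 1 show ?case by (auto simp: tprod_def zero_fun_def plus_fun_def) }
  { case 2 show ?case by (auto simp: tprod_def zero_fun_def fscale_def) }
next
  case (step d x y)
  then obtain xs where x: "x = tens scl xs" by blast
  { case 1 show ?case using step assms
      by (simp add: tprod_add_left tprod_fscale_left x tprod_tens_sum FS.span_add flinearD[OF flinear_tens_ext]
        FS.scale_right_distrib algebra_simps) }
  { case 2 show ?case using step assms
      by (simp add: tprod_add_left tprod_fscale_left x tprod_tens_sum FS.span_scale flinearD[OF flinear_tens_ext]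
        FS.scale_right_distrib mult.commute) }
qed

lemma tprod_T:
  assumes "s \<in> T" "t \<in> T" shows "tprod scl s t \<in> T"
proof -
  have 1: "tprod scl (tens scl vs) t \<in> T" for vs
    using assms(2)
  proof (induction rule: fspan_induct)
    case base
    then show ?case by (simp add: tprod_tens_sum FS.span_zero flinearD[OF flinear_tens_ext])
  next
    case (step c x y)
    show ?case using step
      by (auto simp: tprod_tens_sum FS.span_add FS.span_scale FS.span_base flinearD[OF flinear_tens_ext] tens_ext_tens[OF concat_multilinear(1)])
  qed
  show ?thesis using assms(1)
  proof (induction rule: fspan_induct)
    case base
    then show ?case using FS.span_zero by (auto simp: tprod_def zero_fun_def)
  next
    case (step c x y)
    then show ?case using 1
      by (auto simp: tprod_add_left tprod_fscale_left FS.span_add FS.span_scale)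
  qed
qed

lemma smul_bilinear:
  assumes "a \<in> T" "b \<in> T" "a' \<in> T" "b' \<in> T"
  shows "smul scl V0 V1 (a + a') b = smul scl V0 V1 a b + smul scl V0 V1 a' b"
    "smul scl V0 V1 (fscale c a) b = fscale c (smul scl V0 V1 a b)"
    "smul scl V0 V1 a (b + b') = smul scl V0 V1 a b + smul scl V0 V1 a b'"
    "smul scl V0 V1 a (fscale c b) = fscale c (smul scl V0 V1 a b)"
proof -
  note T = assms FS.span_add[of _ "range (tens scl)"] FS.span_scale[of _ "range (tens scl)"] tprod_T
  show "smul scl V0 V1 (a + a') b = smul scl V0 V1 a b + smul scl V0 V1 a' b"
    "smul scl V0 V1 (fscale c a) b = fscale c (smul scl V0 V1 a b)"
    "smul scl V0 V1 a (b + b') = smul scl V0 V1 a b + smul scl V0 V1 a b'"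
    "smul scl V0 V1 a (fscale c b) = fscale c (smul scl V0 V1 a b)"
    using T by (simp_all add: smul_def tprod_right_add tprod_add_left tprod_fscale_left symmetrizer_eq_sym_op flinearD[OF flinear_sym_op])
qed

end

section \<open>Products of symmetrised words and operators defined by recursion on words\<close>

text \<open>\<open>N v\<close> is the inhomogeneous term. It sees the remaining word only through
  its class \<open>s vs\<close>, where \<open>s\<close> will be \<open>sym_tens\<close>; this is
  what lets the recursion descend to the symmetric algebra.\<close>

primrec rec_list_op :: "('y \<Rightarrow> 'k::field) \<Rightarrow> ('v \<Rightarrow> ('y \<Rightarrow> 'k) \<Rightarrow> 'y \<Rightarrow> 'k)
    \<Rightarrow> ('v \<Rightarrow> ('k, 'v) tensor \<Rightarrow> 'y \<Rightarrow> 'k) \<Rightarrow> ('v list \<Rightarrow> ('k, 'v) tensor) \<Rightarrow> 'v list \<Rightarrow> 'y \<Rightarrow> 'k" where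
  "rec_list_op y0 L' N s [] = y0"
| "rec_list_op y0 L' N s (v # vs) = L' v (rec_list_op y0 L' N s vs) + N v (s vs)"

lemma multilinear_prefix:
  assumes "multilinear scl fscale f" shows "multilinear scl fscale (\<lambda>ws. f (vs @ ws))"
proof -
  have "Vector_Spaces.linear scl fscale (\<lambda>v. f (us @ v # ws))" for us ws
    using assms unfolding multilinear_def by blast
  from this[of "vs @ _"] show ?thesis unfolding multilinear_def by simp
qed

lemma multilinear_suffix:
  assumes "multilinear scl fscale f" shows "multilinear scl fscale (\<lambda>vs. f (vs @ ws))"
proof -
  have "Vector_Spaces.linear scl fscale (\<lambda>v. f (us @ v # ws))" for us ws
    using assms unfolding multilinear_def by blast
  from this[of _ "_ @ ws"] show ?thesis unfolding multilinear_def by simp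
qed

context super_space
begin

lemmas sym_tens_prefix = multilinear_prefix[OF sym_tens_multilinear]
lemmas sym_tens_suffix = multilinear_suffix[OF sym_tens_multilinear]

lemma swap_compatible_suffix: "ws \<in> HL \<Longrightarrow> swap_compatible (\<lambda>vs. sym_tens (vs @ ws))"
  unfolding swap_compatible_def
proof (intro allI impI)
  fix us a b xs assume "ws \<in> HL" "us @ a # b # xs \<in> HL"
  then show "sym_tens ((us @ a # b # xs) @ ws) = fscale (koszul_sign a b) (sym_tens ((us @ b # a # xs) @ ws))"
    using sym_tens_swap[of us a b "xs @ ws"] by simp
qed

lemma swap_compatible_prefix: "vs \<in> HL \<Longrightarrow> swap_compatible (\<lambda>ws. sym_tens (vs @ ws))"
  unfolding swap_compatible_def
proof (intro allI impI)
  fix us a b xs assume "vs \<in> HL" "us @ a # b # xs \<in> HL"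
  then show "sym_tens (vs @ us @ a # b # xs) = fscale (koszul_sign a b) (sym_tens (vs @ us @ b # a # xs))"
    using sym_tens_swap[of "vs @ us" a b xs] by simp
qed

text \<open>The outer symmetrisation absorbs the inner ones: with one word fixed and homogeneous,
  \<open>sym_tens (vs @ ws)\<close> is multilinear and swap compatible in the other word, so the
  universal property applies to each factor in turn.\<close>

lemma smul_sym_tens: "smul scl V0 V1 (sym_tens vs) (sym_tens ws) = sym_tens (vs @ ws)"
proof -
  have 1: "tens_ext (\<lambda>vs. sym_tens (vs @ ws)) (sym_tens vs) = sym_tens (vs @ ws)" for vs ws
  proof (rule multilinear_eqI[where vs = ws and f = "\<lambda>ws. tens_ext (\<lambda>vs. sym_tens (vs @ ws)) (sym_tens vs)"
      and g = "\<lambda>ws. sym_tens (vs @ ws)"])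
    note ml = sym_tens_prefix sym_tens_suffix
    show "multilinear scl fscale (\<lambda>ws. sym_tens (vs @ ws))" by (rule ml(1))
    have eq: "tens_ext (\<lambda>vs. sym_tens (vs @ ws)) (sym_tens vs) = sym_tens (vs @ ws)" if "ws \<in> HL" for ws vs
    proof (rule sym_tens_universal[OF ml(2)])
      show "swap_compatible (\<lambda>vs. sym_tens (vs @ ws))" by (rule swap_compatible_suffix[OF that])
    qed
    show "ws \<in> HL \<Longrightarrow> tens_ext (\<lambda>vs. sym_tens (vs @ ws)) (sym_tens vs) = sym_tens (vs @ ws)" for ws
      by (rule eq)
    \<comment> \<open>\<open>tens_ext\<close> is linear in the map only when evaluated at tensors
      from \<open>T\<close>. This gives multilinearity in \<open>ws\<close>, so that
      \<open>ws\<close> can be assumed homogeneous.\<close>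
    have add: "tens_ext (\<lambda>vs. f vs + g vs) t = tens_ext f t + tens_ext g t"
      and sc: "tens_ext (\<lambda>vs. fscale c (f vs)) t = fscale c (tens_ext f t)"
      if "multilinear scl fscale f" "multilinear scl fscale g" "t \<in> T"
      for f g :: "'v list \<Rightarrow> ('k, 'v) tensor" and t c
      using that(3)
    proof (induction rule: fspan_induct)
      case base
      { case 1 show ?case by (simp add: flinearD[OF flinear_tens_ext]) }
      { case 2 show ?case by (simp add: flinearD[OF flinear_tens_ext]) }
    next
      case (step d x y)
      then obtain xs where x: "x = tens scl xs" by blast
      note te = tens_ext_tens[OF that(1)] tens_ext_tens[OF that(2)] tens_ext_tens[OF multilinear_add[OF that(1,2)]]
        tens_ext_tens[OF multilinear_compose[OF that(1) flinear_fscale]]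
      { case 1 show ?case using step
          by (simp add: x flinearD[OF flinear_tens_ext] te FS.scale_right_distrib) }
      { case 2 show ?case using step
          by (simp add: x flinearD[OF flinear_tens_ext] te FS.scale_right_distrib mult.commute) }
    qed
    show "multilinear scl fscale (\<lambda>ws. tens_ext (\<lambda>vs. sym_tens (vs @ ws)) (sym_tens vs))"
    proof (rule multilinearI[OF vs_scl])
      fix us v w c ws
      have "sym_tens (vs @ us @ (v + w) # ws) = sym_tens (vs @ us @ v # ws) + sym_tens (vs @ us @ w # ws)"
        "sym_tens (vs @ us @ scl c v # ws) = fscale c (sym_tens (vs @ us @ v # ws))" for vs
        using multilinearD[OF sym_tens_multilinear, of "vs @ us"] by simp_all
      then show "tens_ext (\<lambda>vs. sym_tens (vs @ us @ (v + w) # ws)) (sym_tens vs)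
        = tens_ext (\<lambda>vs. sym_tens (vs @ us @ v # ws)) (sym_tens vs) + tens_ext (\<lambda>vs. sym_tens (vs @ us @ w # ws)) (sym_tens vs)"
        "tens_ext (\<lambda>vs. sym_tens (vs @ us @ scl c v # ws)) (sym_tens vs)
        = fscale c (tens_ext (\<lambda>vs. sym_tens (vs @ us @ v # ws)) (sym_tens vs))"
        using add[OF ml(2) ml(2) sym_tens_T] sc[OF ml(2) ml(2) sym_tens_T] by simp_all
    qed
  qed
  have 2: "sym_op (tprod scl (sym_tens vs) (tens scl ws)) = sym_tens (vs @ ws)" for vs ws
  proof -
    note ml = sym_tens_suffix
    have "sym_op (tprod scl t (tens scl ws)) = tens_ext (\<lambda>vs. sym_tens (vs @ ws)) t" if "t \<in> T" for t
      using that
    proof (induction rule: fspan_induct)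
      case base
      have "tprod scl 0 (tens scl ws) = 0" by (auto simp: tprod_def zero_fun_def)
      then show ?case by (simp add: flinearD[OF flinear_tens_ext] flinearD[OF flinear_sym_op])
    next
      case (step c x y)
      then show ?case
        by (auto simp: tprod_add_left tprod_fscale_left flinearD[OF flinear_tens_ext] flinearD[OF flinear_sym_op]
          tprod_tens tens_ext_tens[OF ml])
    qed
    then show ?thesis using 1 sym_tens_T by simp
  qed
  have left: "tens_ext (\<lambda>ws. sym_tens (vs @ ws)) (sym_tens ws) = sym_tens (vs @ ws)" if "vs \<in> HL" for vs ws
  proof (rule sym_tens_universal)
    show "multilinear scl fscale (\<lambda>ws. sym_tens (vs @ ws))" by (rule sym_tens_prefix)
    show "swap_compatible (\<lambda>ws. sym_tens (vs @ ws))" by (rule swap_compatible_prefix[OF that])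
  qed
  have 3: "sym_op (tprod scl (sym_tens vs) t) = tens_ext (\<lambda>ws. sym_tens (vs @ ws)) t" if "t \<in> T" for t vs
    using that
  proof (induction rule: fspan_induct)
    case base
    have "tprod scl (sym_tens vs) 0 = 0"
      using tprod_right_add(2)[OF sym_tens_T FS.span_zero FS.span_zero, of vs 0] by simp
    then show ?case by (simp add: flinearD[OF flinear_tens_ext] flinearD[OF flinear_sym_op])
  next
    case (step c x y)
    note ml = sym_tens_prefix
    from step show ?case
      by (auto simp: tprod_right_add sym_tens_T FS.span_scale FS.span_base flinearD[OF flinear_tens_ext]
        flinearD[OF flinear_sym_op] 2 tens_ext_tens[OF ml])
  qed
  have "smul scl V0 V1 (sym_tens vs) (sym_tens ws) = tens_ext (\<lambda>ws. sym_tens (vs @ ws)) (sym_tens ws)"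
    by (simp add: smul_def symmetrizer_eq_sym_op tprod_T sym_tens_T 3)
  moreover have "multilinear scl fscale (\<lambda>vs. smul scl V0 V1 (sym_tens vs) (sym_tens ws))"
    by (rule multilinearI[OF vs_scl])
      (simp_all add: multilinearD[OF sym_tens_multilinear] smul_bilinear[OF sym_tens_T sym_tens_T sym_tens_T sym_tens_T])
  moreover note sym_tens_suffix
  moreover have "smul scl V0 V1 (sym_tens vs) (sym_tens ws) = sym_tens (vs @ ws)" if "vs \<in> HL" for vs
    using left[OF that]
    by (simp add: smul_def symmetrizer_eq_sym_op tprod_T sym_tens_T 3)
  ultimately show ?thesis using multilinear_eqI by blast
qed

lemma sym_tens_Nil: "sym_tens [] = tens scl []" and sym_tens_single: "sym_tens [v] = tens scl [v]"
proof -
  have P: "{\<sigma>. \<sigma> permutes {..<0::nat}} = {id}" "{\<sigma>. \<sigma> permutes {..<Suc 0}} = {id}"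
    by (auto simp: lessThan_Suc)
  show "sym_tens [] = tens scl []" using sym_tens_hom[of "[]" 0] P by simp
  have "sym_tens vs = tens scl vs" if "vs \<in> HL" "length vs = Suc 0" for vs
    using sym_tens_hom[OF that] P by simp
  then have "sym_tens [p0 v] = tens scl [p0 v]" "sym_tens [p1 v] = tens scl [p1 v]" by simp_all
  then show "sym_tens [v] = tens scl [v]"
    using multilinearD(1)[OF sym_tens_multilinear, of "[]" "p0 v" "p1 v" "[]"]
      multilinearD(1)[OF tens_multilinear, of "[]" "p0 v" "p1 v" "[]"] by (simp add: p_sum)
qed

lemma sprod_eq: "sprod scl V0 V1 vs = sym_tens vs"
proof (induction vs)
  case Nil
  then show ?case by (simp add: sprod_def sym_tens_Nil)
next
  case (Cons v vs)
  then show ?case using smul_sym_tens[of "[v]" vs] by (simp add: sprod_def sym_tens_single)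
qed

lemma A_add [simp]: "a \<in> A \<Longrightarrow> b \<in> A \<Longrightarrow> a + b \<in> A"
  and A_scale [simp]: "a \<in> A \<Longrightarrow> fscale c a \<in> A"
  and A_zero [simp]: "0 \<in> A"
  and A_diff [simp]: "a \<in> A \<Longrightarrow> b \<in> A \<Longrightarrow> a - b \<in> A"
  using subspace_A FS.subspace_add FS.subspace_scale FS.subspace_0 FS.subspace_diff by blast+

lemma A_sum [simp]: "(\<And>i. i \<in> I \<Longrightarrow> f i \<in> A) \<Longrightarrow> sum f I \<in> A"
  using FS.subspace_sum[OF subspace_A] by blast

lemma smul_A [simp]:
  assumes "a \<in> A" "b \<in> A" shows "smul scl V0 V1 a b \<in> A"
proof -
  have 1: "smul scl V0 V1 (sym_tens vs) b \<in> A" for vs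
    using assms(2)[unfolded A_eq_span]
  proof (induction rule: fspan_induct)
    case base
    show ?case using smul_bilinear(4)[OF sym_tens_T FS.span_zero sym_tens_T FS.span_zero, of vs 0] by simp
  next
    case (step c x y)
    then have "y \<in> T" using A_subset_T A_eq_span by blast
    then show ?case using step by (auto simp: smul_bilinear sym_tens_T FS.span_scale smul_sym_tens)
  qed
  have b: "b \<in> T" using assms A_subset_T by blast
  show ?thesis using assms(1)[unfolded A_eq_span]
  proof (induction rule: fspan_induct)
    case base
    show ?case using smul_bilinear(2)[OF FS.span_zero b FS.span_zero b, of 0] by simp
  next
    case (step c x y)
    then have "y \<in> T" using A_subset_T A_eq_span by blast
    then show ?case using step 1 by (auto simp: smul_bilinear sym_tens_T b FS.span_scale smul_sym_tens)
  qed
qed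

lemma smul_add_left: "a \<in> A \<Longrightarrow> a' \<in> A \<Longrightarrow> b \<in> A \<Longrightarrow>
      smul scl V0 V1 (a + a') b = smul scl V0 V1 a b + smul scl V0 V1 a' b"
  and smul_scale_left: "a \<in> A \<Longrightarrow> b \<in> A \<Longrightarrow> smul scl V0 V1 (fscale c a) b = fscale c (smul scl V0 V1 a b)"
  and smul_add_right: "a \<in> A \<Longrightarrow> b \<in> A \<Longrightarrow> b' \<in> A \<Longrightarrow>
      smul scl V0 V1 a (b + b') = smul scl V0 V1 a b + smul scl V0 V1 a b'"
  and smul_scale_right: "a \<in> A \<Longrightarrow> b \<in> A \<Longrightarrow> smul scl V0 V1 a (fscale c b) = fscale c (smul scl V0 V1 a b)"
  using smul_bilinear(1)[of a b a' b] smul_bilinear(2)[of a b a b] smul_bilinear(3)[of a b a b']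
    smul_bilinear(4)[of a b a b] subsetD[OF A_subset_T] by simp_all

section \<open>Multiplication by a vector and the recursion principle\<close>

definition L :: "'v \<Rightarrow> ('k, 'v) tensor \<Rightarrow> ('k, 'v) tensor"
  where "L v = tens_ext (\<lambda>ws. sym_tens (v # ws))"

lemma flinear_L: "flinear (L v)"
  unfolding L_def by (rule flinear_tens_ext)

lemmas L_lin [simp] = flinearD[OF flinear_L]

lemma sym_tens_Cons_multilinear: "multilinear scl fscale (\<lambda>ws. sym_tens (v # ws))"
  using sym_tens_prefix[of "[v]"] by simp

lemma fspan_A_induct [consumes 1, case_names base step]:
  assumes "x \<in> A" "P 0"
    "\<And>c vs y. vs \<in> HL \<Longrightarrow> y \<in> A \<Longrightarrow> P y \<Longrightarrow> P (fscale c (sym_tens vs) + y)"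
  shows "P x"
  using assms(1)[unfolded A_eq_span]
  by (induction rule: fspan_induct) (use assms in \<open>auto simp flip: A_eq_span\<close>)

lemma L_T_lin:
  assumes "t \<in> T"
  shows "L (v + w) t = L v t + L w t" "L (scl c v) t = fscale c (L v t)"
  using assms
proof (induction rule: fspan_induct)
  case base
  { case 1 show ?case by simp }
  { case 2 show ?case by simp }
next
  case (step d x y)
  then obtain xs where x: "x = tens scl xs" by blast
  have e: "L v (tens scl xs) = sym_tens (v # xs)" for v
    unfolding L_def by (rule tens_ext_tens[OF sym_tens_Cons_multilinear])
  { case 1 show ?case using step
      by (simp add: x e multilinearD_Cons[OF sym_tens_multilinear] FS.scale_right_distrib algebra_simps) }
  { case 2 show ?case using step
      by (simp add: x e multilinearD_Cons[OF sym_tens_multilinear] FS.scale_right_distrib mult.commute) }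
qed

lemma L_sym_tens [simp]: "L v (sym_tens ws) = sym_tens (v # ws)"
proof -
  have hom: "L v (sym_tens ws) = sym_tens (v # ws)" if "v \<in> V0 \<union> V1" for v
    unfolding L_def
  proof (rule sym_tens_universal[OF sym_tens_Cons_multilinear])
    show "swap_compatible (\<lambda>ws. sym_tens (v # ws))"
      using swap_compatible_prefix[of "[v]"] that by simp
  qed
  have "L (p0 v + p1 v) (sym_tens ws) = L (p0 v) (sym_tens ws) + L (p1 v) (sym_tens ws)"
    by (rule L_T_lin[OF sym_tens_T])
  also have "\<dots> = sym_tens ((p0 v + p1 v) # ws)"
    by (simp only: hom p0_HL p1_HL multilinearD_Cons[OF sym_tens_multilinear])
  finally show ?thesis by (simp add: p_sum)
qed

lemma L_add_left: "a \<in> A \<Longrightarrow> L (v + w) a = L v a + L w a"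
  and L_scl_left: "a \<in> A \<Longrightarrow> L (scl c v) a = fscale c (L v a)"
  using L_T_lin A_subset_T by blast+

lemma L_A [simp]: "a \<in> A \<Longrightarrow> L v a \<in> A"
  by (induction rule: fspan_A_induct) auto

lemma A_eqI:
  assumes F: "flinear F" and G: "flinear G"
    and nil: "F (sym_tens []) = G (sym_tens [])"
    and L: "\<And>v x. v \<in> V0 \<union> V1 \<Longrightarrow> x \<in> A \<Longrightarrow> F x = G x \<Longrightarrow> F (L v x) = G (L v x)"
    and a: "a \<in> A"
  shows "F a = (G a :: 'y \<Rightarrow> 'k)"
proof (rule flinear_eq_on_span[OF F G _ a[unfolded A_eq_span]])
  have "vs \<in> HL \<Longrightarrow> F (sym_tens vs) = G (sym_tens vs)" for vs
  proof (induction vs)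
    case Nil
    then show ?case using nil by simp
  next
    case (Cons v vs)
    then show ?case using L[of v "sym_tens vs"] by simp
  qed
  then show "\<And>x. x \<in> sym_tens ` HL \<Longrightarrow> F x = G x" by blast
qed

lemma L_commute:
  assumes "v \<in> V0 \<union> V1" "w \<in> V0 \<union> V1" "a \<in> A"
  shows "L v (L w a) = fscale (koszul_sign v w) (L w (L v a))"
  using assms(3)
proof (induction rule: fspan_A_induct)
  case base
  then show ?case by simp
next
  case (step c vs y)
  have "sym_tens (v # w # vs) = fscale (koszul_sign v w) (sym_tens (w # v # vs))"
    using sym_tens_swap[of "[]" v w vs] step assms by simp
  with step show ?case by (simp add: FS.scale_right_distrib mult.commute)
qed

definition rec_op :: "('y \<Rightarrow> 'k) \<Rightarrow> ('v \<Rightarrow> ('y \<Rightarrow> 'k) \<Rightarrow> 'y \<Rightarrow> 'k)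
    \<Rightarrow> ('v \<Rightarrow> ('k, 'v) tensor \<Rightarrow> 'y \<Rightarrow> 'k) \<Rightarrow> ('k, 'v) tensor \<Rightarrow> 'y \<Rightarrow> 'k"
  where "rec_op y0 L' N = tens_ext (rec_list_op y0 L' N sym_tens)"

lemma flinear_rec_op: "flinear (rec_op y0 L' N)"
  unfolding rec_op_def by (rule flinear_tens_ext)

text \<open>The extension principle behind all operators below: an operator on the symmetric algebra is
  determined by its value at the unit and a twisted Leibniz rule for multiplication by a vector,
  and it exists as soon as the rule is compatible with graded commutativity.\<close>

lemma rec_op:
  assumes Z: "FS.subspace Z" and y0: "y0 \<in> Z"
    and L': "\<And>v. flinear (L' v)" and N: "\<And>v. flinear (N v)"
    and L'Z: "\<And>v z. z \<in> Z \<Longrightarrow> L' v z \<in> Z" and NZ: "\<And>v x. x \<in> A \<Longrightarrow> N v x \<in> Z"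
    and L'_add: "\<And>v w z. z \<in> Z \<Longrightarrow> L' (v + w) z = L' v z + L' w z"
    and L'_scl: "\<And>c v z. z \<in> Z \<Longrightarrow> L' (scl c v) z = fscale c (L' v z)"
    and N_add: "\<And>v w x. x \<in> A \<Longrightarrow> N (v + w) x = N v x + N w x"
    and N_scl: "\<And>c v x. x \<in> A \<Longrightarrow> N (scl c v) x = fscale c (N v x)"
    and L'_comm: "\<And>a b z. a \<in> V0 \<union> V1 \<Longrightarrow> b \<in> V0 \<union> V1 \<Longrightarrow> z \<in> Z \<Longrightarrow>
      L' a (L' b z) = fscale (koszul_sign a b) (L' b (L' a z))"
    and N_comm: "\<And>a b x. a \<in> V0 \<union> V1 \<Longrightarrow> b \<in> V0 \<union> V1 \<Longrightarrow> x \<in> A \<Longrightarrow>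
      N a (L b x) + L' a (N b x) = fscale (koszul_sign a b) (N b (L a x) + L' b (N a x))"
  shows "rec_op y0 L' N (sym_tens []) = y0"
    and "x \<in> A \<Longrightarrow> rec_op y0 L' N (L v x) = L' v (rec_op y0 L' N x) + N v x"
    and "x \<in> A \<Longrightarrow> rec_op y0 L' N x \<in> Z"
    and "rec_op y0 L' N (sym_tens vs) = rec_list_op y0 L' N sym_tens vs"
proof -
  let ?f = "rec_list_op y0 L' N sym_tens"
  have fZ: "?f vs \<in> Z" for vs
    by (induction vs) (simp_all add: y0 L'Z NZ FS.subspace_add[OF Z])
  have ml: "multilinear scl fscale ?f"
  proof (rule multilinearI[OF vs_scl])
    fix us ws v w c
    show "?f (us @ (v + w) # ws) = ?f (us @ v # ws) + ?f (us @ w # ws)"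
      by (induction us)
        (simp_all add: L'_add N_add fZ flinearD[OF L'] flinearD[OF N] multilinearD[OF sym_tens_multilinear] algebra_simps)
    show "?f (us @ scl c v # ws) = fscale c (?f (us @ v # ws))"
      by (induction us)
        (simp_all add: L'_scl N_scl fZ flinearD[OF L'] flinearD[OF N] multilinearD[OF sym_tens_multilinear] FS.scale_right_distrib)
  qed
  \<comment> \<open>A swap of the two leading letters is governed by \<open>L'_comm\<close> and
    \<open>N_comm\<close>. A swap further inside reduces to it by induction, since the inhomogeneous
    terms depend on \<open>sym_tens\<close> of the rest, which is itself swap compatible.\<close>
  have sw: "swap_compatible ?f"
    unfolding swap_compatible_def
  proof (intro allI impI)
    fix us a b ws assume "us @ a # b # ws \<in> HL"
    then show "?f (us @ a # b # ws) = fscale (koszul_sign a b) (?f (us @ b # a # ws))"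
    proof (induction us)
      case Nil
      then have ab: "a \<in> V0 \<union> V1" "b \<in> V0 \<union> V1" by auto
      have "?f (a # b # ws) = L' a (L' b (?f ws)) + (N a (L b (sym_tens ws)) + L' a (N b (sym_tens ws)))"
        by (simp add: flinearD[OF L'] algebra_simps)
      also have "\<dots> = fscale (koszul_sign a b) (L' b (L' a (?f ws))) +
          fscale (koszul_sign a b) (N b (L a (sym_tens ws)) + L' b (N a (sym_tens ws)))"
        using L'_comm[OF ab fZ[of ws]] N_comm[OF ab sym_tens_A[of ws]] by (simp only:)
      also have "\<dots> = fscale (koszul_sign a b) (?f (b # a # ws))"
        by (simp add: flinearD[OF L'] FS.scale_right_distrib algebra_simps)
      finally show ?case by simp
    next
      case (Cons u us)
      then have "us @ a # b # ws \<in> HL" by simp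
      then show ?case using Cons.IH sym_tens_swap[of us a b ws]
        by (simp add: flinearD[OF L'] flinearD[OF N] FS.scale_right_distrib)
    qed
  qed
  show f: "rec_op y0 L' N (sym_tens vs) = ?f vs" for vs
    unfolding rec_op_def by (rule sym_tens_universal[OF ml sw])
  show "rec_op y0 L' N (sym_tens []) = y0" by (simp add: f)
  show "rec_op y0 L' N (L v x) = L' v (rec_op y0 L' N x) + N v x" if "x \<in> A"
    using that
    by (induction rule: fspan_A_induct)
      (simp_all add: f flinearD[OF flinear_rec_op] flinearD[OF L'] flinearD[OF N] FS.scale_right_distrib algebra_simps)
  show "rec_op y0 L' N x \<in> Z" if "x \<in> A"
    using that
    by (induction rule: fspan_A_induct)
      (simp_all add: f fZ flinearD[OF flinear_rec_op] FS.subspace_add[OF Z] FS.subspace_scale[OF Z] FS.subspace_0[OF Z])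
qed

section \<open>Graded contractions, the parity automorphism and right multiplication\<close>

definition sg :: "nat \<Rightarrow> nat \<Rightarrow> 'k" where "sg e f = (-1) ^ (e * f)"

lemma sg_sq [simp]: "sg e f * sg e f = 1" "sg e f * (sg e f * x) = x"
  by (simp_all add: sg_def flip: power_add mult_2 mult.assoc)

lemma sg_commute: "sg e f = sg f e"
  by (simp add: sg_def mult.commute)

lemma sg_0 [simp]: "sg 0 f = 1" "sg f 0 = 1"
  by (simp_all add: sg_def)

lemma sg_add: "sg e (f + f') = sg e f * sg e f'"
  by (simp add: sg_def distrib_left power_add)

lemma koszul_sign_sg: "koszul_sign a b = sg (par V0 a) (par V0 b)"
  by (simp add: koszul_sign_def sg_def)

text \<open>The \<open>e\<close>-th power of the parity automorphism of the space. Defining it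
  through the projections makes it linear in \<open>v\<close>, as \<open>rec_op\<close> demands of
  its coefficients.\<close>

definition gam :: "nat \<Rightarrow> 'v \<Rightarrow> 'v"
  where "gam e v = p0 v + scl (sg e 1) (p1 v)"

lemma gam_hom: "v \<in> V0 \<union> V1 \<Longrightarrow> gam e v = scl (sg e (par V0 v)) v"
  using par_V0[of v] par_V1[of v] by (cases "v = 0") (auto simp: gam_def)

lemma gam_add: "gam e (v + w) = gam e v + gam e w" and gam_scl: "gam e (scl c v) = scl c (gam e v)"
  by (simp_all add: gam_def p0_add p1_add p0_scl p1_scl scale_right_distrib mult.commute algebra_simps)

lemma L_gam: "v \<in> V0 \<union> V1 \<Longrightarrow> x \<in> A \<Longrightarrow> L (gam e v) x = fscale (sg e (par V0 v)) (L v x)"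
  by (simp only: gam_hom L_scl_left)

text \<open>A homogeneous element of parity \<open>e\<close> in the algebraic dual.\<close>

definition hfun :: "('v \<Rightarrow> 'k) \<Rightarrow> nat \<Rightarrow> bool"
  where "hfun \<phi> e \<longleftrightarrow> (\<forall>v w. \<phi> (v + w) = \<phi> v + \<phi> w) \<and> (\<forall>c v. \<phi> (scl c v) = c * \<phi> v)
    \<and> (\<forall>v\<in>V0 \<union> V1. \<phi> v \<noteq> 0 \<longrightarrow> par V0 v = e)"

text \<open>The third rule trades the parity of \<open>v\<close> for \<open>e\<close> next to
  \<open>\<phi> v\<close>, since otherwise both sides are 0. The sign computations for contractions
  rest on it.\<close>

lemma hfunD:
  assumes "hfun \<phi> e"
  shows "\<phi> (v + w) = \<phi> v + \<phi> w" "\<phi> (scl c v) = c * \<phi> v"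
    "v \<in> V0 \<union> V1 \<Longrightarrow> \<phi> v * f (par V0 v) = \<phi> v * f e"
  using assms unfolding hfun_def by auto

lemma L_gam_commute:
  assumes "a \<in> V0 \<union> V1" "b \<in> V0 \<union> V1" "z \<in> A"
  shows "L (gam e a) (L (gam e b) z) = fscale (koszul_sign a b) (L (gam e b) (L (gam e a) z))"
  using assms L_commute[OF assms] by (simp add: L_gam mult.left_commute mult.commute)

text \<open>The graded derivation of parity \<open>e\<close> that extends \<open>\<phi>\<close>,
  that is, contraction with \<open>\<phi>\<close>.\<close>

definition D :: "('v \<Rightarrow> 'k) \<Rightarrow> nat \<Rightarrow> ('k, 'v) tensor \<Rightarrow> ('k, 'v) tensor"
  where "D \<phi> e = rec_op 0 (\<lambda>v. L (gam e v)) (\<lambda>v. fscale (\<phi> v))"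

lemma flinear_D: "flinear (D \<phi> e)"
  unfolding D_def by (rule flinear_rec_op)

lemmas D_lin [simp] = flinearD[OF flinear_D]

lemma D:
  assumes "hfun \<phi> e"
  shows D_nil: "D \<phi> e (sym_tens []) = 0"
    and D_L: "v \<in> V0 \<union> V1 \<Longrightarrow> x \<in> A \<Longrightarrow>
      D \<phi> e (L v x) = fscale (sg e (par V0 v)) (L v (D \<phi> e x)) + fscale (\<phi> v) x"
    and D_A: "x \<in> A \<Longrightarrow> D \<phi> e x \<in> A"
proof -
  note h = hfunD[OF assms]
  have N_comm: "fscale (\<phi> a) (L b x) + L (gam e a) (fscale (\<phi> b) x)
      = fscale (koszul_sign a b) (fscale (\<phi> b) (L a x) + L (gam e b) (fscale (\<phi> a) x))"
    if "a \<in> V0 \<union> V1" "b \<in> V0 \<union> V1" "x \<in> A" for a b x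
  proof -
    \<comment> \<open>Where \<open>\<phi> b\<close> is nonzero, \<open>b\<close> has parity
      \<open>e\<close>, so the Koszul sign of \<open>a\<close> and \<open>b\<close> is the sign with
      which the contraction passes \<open>a\<close>. The same holds for \<open>\<phi> a\<close> in
      the next step, and the two rules match the four terms in pairs.\<close>
    have 1: "koszul_sign a b * (\<phi> b * y) = \<phi> b * (sg e (par V0 a) * y)" for y
      using h(3)[OF that(2), of "\<lambda>q. sg (par V0 a) q * y"] sg_commute
      by (simp add: koszul_sign_sg mult.left_commute mult.assoc mult.commute)
    have 2: "koszul_sign a b * (\<phi> a * (sg e (par V0 b) * y)) = \<phi> a * y" for y
      using h(3)[OF that(1), of "\<lambda>q. sg q (par V0 b) * (sg e (par V0 b) * y)"]
      by (simp add: koszul_sign_sg mult.left_commute mult.assoc mult.commute)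
    show ?thesis
      using that 1[of 1] 2[of 1] by (auto simp: L_gam FS.scale_right_distrib algebra_simps)
  qed
  note r = rec_op[of A 0 "\<lambda>v. L (gam e v)" "\<lambda>v. fscale (\<phi> v)", OF subspace_A _ flinear_L flinear_fscale _ _ _ _ _ _ L_gam_commute N_comm]
  have r': "rec_op 0 (\<lambda>v. L (gam e v)) (\<lambda>v. fscale (\<phi> v)) (sym_tens []) = 0"
    "x \<in> A \<Longrightarrow> rec_op 0 (\<lambda>v. L (gam e v)) (\<lambda>v. fscale (\<phi> v)) (L v x) =
      L (gam e v) (rec_op 0 (\<lambda>v. L (gam e v)) (\<lambda>v. fscale (\<phi> v)) x) + fscale (\<phi> v) x"
    "x \<in> A \<Longrightarrow> rec_op 0 (\<lambda>v. L (gam e v)) (\<lambda>v. fscale (\<phi> v)) x \<in> A" for v x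
    by (rule r; simp add: gam_add gam_scl L_add_left L_scl_left h FS.scale_left_distrib mult.commute)+
  show "D \<phi> e (sym_tens []) = 0" unfolding D_def by (rule r'(1))
  show A: "D \<phi> e x \<in> A" if "x \<in> A" for x unfolding D_def by (rule r'(3)[OF that])
  show "v \<in> V0 \<union> V1 \<Longrightarrow> x \<in> A \<Longrightarrow>
      D \<phi> e (L v x) = fscale (sg e (par V0 v)) (L v (D \<phi> e x)) + fscale (\<phi> v) x"
    using r'(2)[of x v] A[of x] unfolding D_def by (simp add: L_gam)
qed

text \<open>The extension of \<open>gam e\<close> to an algebra automorphism. It carries the sign of
  an operator of parity \<open>e\<close> moving past a factor that need not be homogeneous.\<close>

definition Gam :: "nat \<Rightarrow> ('k, 'v) tensor \<Rightarrow> ('k, 'v) tensor"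
  where "Gam e = rec_op (sym_tens []) (\<lambda>v. L (gam e v)) (\<lambda>v x. 0)"

lemma flinear_Gam: "flinear (Gam e)"
  unfolding Gam_def by (rule flinear_rec_op)

lemmas Gam_lin [simp] = flinearD[OF flinear_Gam]

lemma Gam:
  shows Gam_nil [simp]: "Gam e (sym_tens []) = sym_tens []"
    and Gam_L: "v \<in> V0 \<union> V1 \<Longrightarrow> x \<in> A \<Longrightarrow> Gam e (L v x) = fscale (sg e (par V0 v)) (L v (Gam e x))"
    and Gam_A [simp]: "x \<in> A \<Longrightarrow> Gam e x \<in> A"
proof -
  note r = rec_op[of A "sym_tens []" "\<lambda>v. L (gam e v)" "\<lambda>v x. 0", OF subspace_A _ flinear_L flinear_zero _ _ _ _ _ _ L_gam_commute]
  have r': "Gam e (sym_tens []) = sym_tens []"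
    "x \<in> A \<Longrightarrow> Gam e (L v x) = L (gam e v) (Gam e x) + 0"
    "x \<in> A \<Longrightarrow> Gam e x \<in> A" for v x
    unfolding Gam_def by (rule r; simp add: gam_add gam_scl L_add_left L_scl_left)+
  show "Gam e (sym_tens []) = sym_tens []" by (rule r'(1))
  show A: "Gam e x \<in> A" if "x \<in> A" for x by (rule r'(3)[OF that])
  show "v \<in> V0 \<union> V1 \<Longrightarrow> x \<in> A \<Longrightarrow> Gam e (L v x) = fscale (sg e (par V0 v)) (L v (Gam e x))"
    using r'(2)[of x v] A[of x] by (simp add: L_gam)
qed

lemma Gam_0 [simp]: "x \<in> A \<Longrightarrow> Gam 0 x = x"
  by (rule A_eqI[OF flinear_Gam flinear_id]) (simp_all add: Gam_L)

text \<open>Right multiplication by \<open>b\<close>, characterised by commuting with every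
  \<open>L v\<close>. In this form products become accessible to \<open>A_eqI\<close>.\<close>

definition Rmul :: "('k, 'v) tensor \<Rightarrow> ('k, 'v) tensor \<Rightarrow> ('k, 'v) tensor"
  where "Rmul b = rec_op b L (\<lambda>v x. 0)"

lemma flinear_Rmul: "flinear (Rmul b)"
  unfolding Rmul_def by (rule flinear_rec_op)

lemmas Rmul_lin [simp] = flinearD[OF flinear_Rmul]

lemma Rmul:
  assumes "b \<in> A"
  shows Rmul_nil: "Rmul b (sym_tens []) = b"
    and Rmul_L: "x \<in> A \<Longrightarrow> Rmul b (L v x) = L v (Rmul b x)"
    and Rmul_A: "x \<in> A \<Longrightarrow> Rmul b x \<in> A"
proof -
  note r = rec_op[of A b L "\<lambda>v x. 0", OF subspace_A assms flinear_L flinear_zero _ _ _ _ _ _ L_commute]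
  have r': "Rmul b (sym_tens []) = b" "x \<in> A \<Longrightarrow> Rmul b (L v x) = L v (Rmul b x) + 0" "x \<in> A \<Longrightarrow> Rmul b x \<in> A" for v x
    unfolding Rmul_def by (rule r; simp add: L_add_left L_scl_left)+
  then show "Rmul b (sym_tens []) = b" "x \<in> A \<Longrightarrow> Rmul b (L v x) = L v (Rmul b x)" "x \<in> A \<Longrightarrow> Rmul b x \<in> A"
    by simp_all
qed

lemma smul_sym_tens_left: "b \<in> A \<Longrightarrow> smul scl V0 V1 (sym_tens vs) b = Rmul b (sym_tens vs)"
proof (induction vs)
  case Nil
  then have "smul scl V0 V1 (sym_tens []) b = b"
    by (induction b rule: fspan_A_induct)
      (use smul_scale_right[of "sym_tens []" 0 0] in \<open>simp_all add: smul_add_right smul_scale_right smul_sym_tens\<close>)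
  then show ?case using Nil by (simp add: Rmul_nil)
next
  case (Cons v vs)
  have "smul scl V0 V1 (sym_tens (v # vs)) b = L v (smul scl V0 V1 (sym_tens vs) b)"
    using Cons.prems
    by (induction b rule: fspan_A_induct)
      (use smul_scale_right[of _ 0 0] in \<open>simp_all add: smul_add_right smul_scale_right smul_sym_tens\<close>)
  also have "\<dots> = Rmul b (L v (sym_tens vs))" using Cons by (simp only: Rmul_L sym_tens_A)
  finally show ?case by simp
qed

lemma smul_eq_Rmul:
  assumes "a \<in> A" "b \<in> A"
  shows "smul scl V0 V1 a b = Rmul b a"
  using assms(1)
proof (induction rule: fspan_A_induct)
  case base
  then show ?case using smul_scale_left[of 0 b 0] assms by simp
next
  case (step c vs y)
  then show ?case using assms by (simp add: smul_add_left smul_scale_left smul_sym_tens_left)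
qed

text \<open>Moving \<open>L v\<close> out of either composite leaves the same two scalar terms,
  \<open>\<phi> v\<close> times \<open>D \<psi> f x\<close> and \<open>\<psi> v\<close> times
  \<open>D \<phi> e x\<close>; their signs agree because a nonzero coefficient fixes the parity of
  \<open>v\<close>.\<close>

lemma D_commute:
  assumes "hfun \<phi> e" "hfun \<psi> f" "x \<in> A"
  shows "D \<phi> e (D \<psi> f x) = fscale (sg e f) (D \<psi> f (D \<phi> e x))"
proof (rule A_eqI[where F = "\<lambda>x. D \<phi> e (D \<psi> f x)" and G = "\<lambda>x. fscale (sg e f) (D \<psi> f (D \<phi> e x))", OF _ _ _ _ assms(3)])
  show "flinear (\<lambda>x. D \<phi> e (D \<psi> f x))" "flinear (\<lambda>x. fscale (sg e f) (D \<psi> f (D \<phi> e x)))"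
    by (intro flinear_compose[OF flinear_D flinear_D] flinear_scale)+
  show "D \<phi> e (D \<psi> f (sym_tens [])) = fscale (sg e f) (D \<psi> f (D \<phi> e (sym_tens [])))"
    by (simp add: D_nil assms)
  fix v x assume v: "v \<in> V0 \<union> V1" and x: "x \<in> A"
    and IH: "D \<phi> e (D \<psi> f x) = fscale (sg e f) (D \<psi> f (D \<phi> e x))"
  have 1: "sg f (par V0 v) * \<phi> v = sg e f * \<phi> v"
    using hfunD(3)[OF assms(1) v, of "sg f"] by (simp add: sg_commute mult.commute)
  have 2: "sg e f * (sg e (par V0 v) * \<psi> v) = \<psi> v"
    using hfunD(3)[OF assms(2) v, of "\<lambda>q. sg e f * sg e q"] by (simp add: mult.left_commute mult.commute)
  show "D \<phi> e (D \<psi> f (L v x)) = fscale (sg e f) (D \<psi> f (D \<phi> e (L v x)))"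
    using v x assms 1 2
    by (simp add: D_L[OF assms(1)] D_L[OF assms(2)] D_A[OF assms(1)] D_A[OF assms(2)] IH FS.scale_right_distrib)
      (auto simp: algebra_simps)
qed

lemma Gam_D:
  assumes "hfun \<phi> f" "x \<in> A"
  shows "Gam e (D \<phi> f x) = fscale (sg e f) (D \<phi> f (Gam e x))"
proof (rule A_eqI[where F = "\<lambda>x. Gam e (D \<phi> f x)" and G = "\<lambda>x. fscale (sg e f) (D \<phi> f (Gam e x))", OF _ _ _ _ assms(2)])
  show "flinear (\<lambda>x. Gam e (D \<phi> f x))" "flinear (\<lambda>x. fscale (sg e f) (D \<phi> f (Gam e x)))"
    by (intro flinear_compose[OF flinear_D flinear_Gam] flinear_compose[OF flinear_Gam flinear_D] flinear_scale)+
  show "Gam e (D \<phi> f (sym_tens [])) = fscale (sg e f) (D \<phi> f (Gam e (sym_tens [])))"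
    by (simp add: D_nil assms)
  fix v x assume v: "v \<in> V0 \<union> V1" and x: "x \<in> A"
    and IH: "Gam e (D \<phi> f x) = fscale (sg e f) (D \<phi> f (Gam e x))"
  have 1: "sg e f * (sg e (par V0 v) * \<phi> v) = \<phi> v"
    using hfunD(3)[OF assms(1) v, of "\<lambda>q. sg e f * sg e q"] by (simp add: mult.left_commute mult.commute)
  show "Gam e (D \<phi> f (L v x)) = fscale (sg e f) (D \<phi> f (Gam e (L v x)))"
    using v x assms 1
    by (simp add: D_L[OF assms(1)] D_A[OF assms(1)] Gam_L IH FS.scale_right_distrib mult.assoc)
      (simp add: algebra_simps)
qed

lemma Gam_Gam: "x \<in> A \<Longrightarrow> Gam e (Gam f x) = Gam f (Gam e x)"
  by (rule A_eqI[where F = "\<lambda>x. Gam e (Gam f x)" and G = "\<lambda>x. Gam f (Gam e x)"])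
    (simp_all add: flinear_compose[OF flinear_Gam flinear_Gam] Gam_L mult.commute)

text \<open>The super Leibniz rule. \<open>Gam e a\<close> is the sign from moving the contraction
  past \<open>a\<close>, distributed over the parities that occur in \<open>a\<close>.\<close>

lemma D_Rmul:
  assumes "hfun \<phi> e" "a \<in> A" "b \<in> A"
  shows "D \<phi> e (Rmul b a) = Rmul b (D \<phi> e a) + Rmul (D \<phi> e b) (Gam e a)"
proof (rule A_eqI[where F = "\<lambda>a. D \<phi> e (Rmul b a)" and G = "\<lambda>a. Rmul b (D \<phi> e a) + Rmul (D \<phi> e b) (Gam e a)", OF _ _ _ _ assms(2)])
  show "flinear (\<lambda>a. D \<phi> e (Rmul b a))" "flinear (\<lambda>a. Rmul b (D \<phi> e a) + Rmul (D \<phi> e b) (Gam e a))"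
    by (intro flinear_add flinear_compose[OF flinear_D flinear_Rmul] flinear_compose[OF flinear_Rmul flinear_D]
      flinear_compose[OF flinear_Rmul flinear_Gam])+
  show "D \<phi> e (Rmul b (sym_tens [])) = Rmul b (D \<phi> e (sym_tens [])) + Rmul (D \<phi> e b) (Gam e (sym_tens []))"
    using assms by (simp add: Rmul_nil D_nil D_A)
  fix v x assume v: "v \<in> V0 \<union> V1" and x: "x \<in> A"
    and IH: "D \<phi> e (Rmul b x) = Rmul b (D \<phi> e x) + Rmul (D \<phi> e b) (Gam e x)"
  show "D \<phi> e (Rmul b (L v x)) = Rmul b (D \<phi> e (L v x)) + Rmul (D \<phi> e b) (Gam e (L v x))"
    using v x assms
    by (simp add: D_L[OF assms(1)] D_A[OF assms(1)] Rmul_L Rmul_A Gam_L IH FS.scale_right_distrib algebra_simps)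
qed

subsection \<open>Contraction with an even form\<close>

definition eform :: "('v \<Rightarrow> 'v \<Rightarrow> 'k) \<Rightarrow> bool"
  where "eform B \<longleftrightarrow> bilinear_form scl B \<and> even_form V0 V1 B"

lemma eformD:
  assumes "eform B"
  shows "B (v + v') w = B v w + B v' w" "B (scl c v) w = c * B v w"
    "B v (w + w') = B v w + B v w'" "B v (scl c w) = c * B v w"
  using assms by (auto simp: eform_def bilinear_form_def Vector_Spaces.linear_iff)

lemma eform_zero: "eform B \<Longrightarrow> B 0 w = 0" "eform B \<Longrightarrow> B w 0 = 0"
  using eformD(2)[of B 0 0 w] eformD(4)[of B w 0 0] by simp_all

lemma eform_par:
  assumes "eform B" "v \<in> V0 \<union> V1" "w \<in> V0 \<union> V1" "B v w \<noteq> 0"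
  shows "par V0 v = par V0 w"
proof -
  have "v \<noteq> 0" "w \<noteq> 0" using assms eform_zero by auto
  moreover have "(v \<in> V0 \<and> w \<in> V0) \<or> (v \<in> V1 \<and> w \<in> V1)"
    using assms unfolding eform_def even_form_def by blast
  ultimately show ?thesis using par_V0 par_V1 by auto
qed

lemma hfun_eform: "eform B \<Longrightarrow> v \<in> V0 \<union> V1 \<Longrightarrow> hfun (B v) (par V0 v)"
  unfolding hfun_def using eform_par[of B v] by (auto simp: eformD)

lemma hfun_p0: "eform B \<Longrightarrow> hfun (B (p0 v)) 0"
  and hfun_p1: "eform B \<Longrightarrow> hfun (B (p1 v)) (Suc 0)"
proof -
  assume B: "eform B"
  show "hfun (B (p0 v)) 0" using hfun_eform[OF B, of "p0 v"] par_V0[of "p0 v"] by simp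
  show "hfun (B (p1 v)) (Suc 0)"
  proof (cases "p1 v = 0")
    case True
    then show ?thesis using B by (auto simp: hfun_def eform_zero)
  next
    case False
    then show ?thesis using hfun_eform[OF B, of "p1 v"] par_V1[of "p1 v"] by simp
  qed
qed

text \<open>Contraction with \<open>B v\<close>. The parity of a contraction makes sense for
  homogeneous \<open>v\<close> only, so \<open>v\<close> is split; this keeps the operator linear in
  \<open>v\<close>.\<close>

definition Dv :: "('v \<Rightarrow> 'v \<Rightarrow> 'k) \<Rightarrow> 'v \<Rightarrow> ('k, 'v) tensor \<Rightarrow> ('k, 'v) tensor"
  where "Dv B v x = D (B (p0 v)) 0 x + D (B (p1 v)) 1 x"

lemma flinear_Dv: "flinear (Dv B v)"
  unfolding Dv_def[abs_def] by (intro flinear_add flinear_D)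

lemmas Dv_lin [simp] = flinearD[OF flinear_Dv]

lemma hfun_zero: "hfun (\<lambda>w. 0) e"
  by (simp add: hfun_def)

lemma D_zero: "x \<in> A \<Longrightarrow> D (\<lambda>w. 0) e x = 0"
  by (rule A_eqI[OF flinear_D flinear_zero]) (simp_all add: D_nil[OF hfun_zero] D_L[OF hfun_zero])

lemma Dv_hom:
  assumes "eform B" "v \<in> V0 \<union> V1" "x \<in> A"
  shows "Dv B v x = D (B v) (par V0 v) x"
proof -
  have z: "B 0 = (\<lambda>w. 0)" using eform_zero[OF assms(1)] by auto
  show ?thesis
  proof (cases "v \<in> V0")
    case True
    then show ?thesis using assms by (simp add: Dv_def z D_zero par_V0)
  next
    case False
    then show ?thesis using assms by (auto simp: Dv_def z D_zero par_def)
  qed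
qed

lemma Dv_nil: "eform B \<Longrightarrow> Dv B v (sym_tens []) = 0"
  by (simp add: Dv_def D_nil hfun_p0 hfun_p1)

lemma Dv_A: "eform B \<Longrightarrow> x \<in> A \<Longrightarrow> Dv B v x \<in> A"
  by (simp add: Dv_def D_A hfun_p0 hfun_p1)

lemma Dv_L:
  assumes "eform B" "v \<in> V0 \<union> V1" "u \<in> V0 \<union> V1" "x \<in> A"
  shows "Dv B v (L u x) = fscale (koszul_sign v u) (L u (Dv B v x)) + fscale (B v u) x"
  using assms by (simp add: Dv_hom D_L[OF hfun_eform] koszul_sign_sg)

lemma D_add_fun:
  assumes "hfun \<phi> e" "hfun \<psi> e" "x \<in> A"
  shows "D (\<lambda>w. \<phi> w + \<psi> w) e x = D \<phi> e x + D \<psi> e x"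
proof -
  have "par V0 v = e" if "v \<in> V0 \<union> V1" "\<phi> v + \<psi> v \<noteq> 0" for v
    using that assms unfolding hfun_def by (cases "\<phi> v = 0") auto
  then have h: "hfun (\<lambda>w. \<phi> w + \<psi> w) e"
    using hfunD(1,2)[OF assms(1)] hfunD(1,2)[OF assms(2)] unfolding hfun_def by (simp add: algebra_simps)
  show ?thesis
    by (rule A_eqI[where G = "\<lambda>x. D \<phi> e x + D \<psi> e x", OF flinear_D flinear_add[OF flinear_D flinear_D] _ _ assms(3)])
      (simp_all add: D_nil[OF h] D_nil[OF assms(1)] D_nil[OF assms(2)] D_L[OF h] D_L[OF assms(1)] D_L[OF assms(2)]
        FS.scale_right_distrib FS.scale_left_distrib algebra_simps)
qed

lemma D_scale_fun:
  assumes "hfun \<phi> e" "x \<in> A"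
  shows "D (\<lambda>w. c * \<phi> w) e x = fscale c (D \<phi> e x)"
proof -
  have h: "hfun (\<lambda>w. c * \<phi> w) e" using assms unfolding hfun_def by (auto simp: algebra_simps)
  show ?thesis
    by (rule A_eqI[where G = "\<lambda>x. fscale c (D \<phi> e x)", OF flinear_D flinear_scale[OF flinear_D] _ _ assms(2)])
      (simp_all add: D_nil[OF h] D_nil[OF assms(1)] D_L[OF h] D_L[OF assms(1)] FS.scale_right_distrib mult.commute)
qed

lemma eform_add_fun: "eform B \<Longrightarrow> B (v + w) = (\<lambda>x. B v x + B w x)"
  and eform_scl_fun: "eform B \<Longrightarrow> B (scl c v) = (\<lambda>x. c * B v x)"
  using eformD by auto

lemma Dv_add: "eform B \<Longrightarrow> x \<in> A \<Longrightarrow> Dv B (v + w) x = Dv B v x + Dv B w x"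
  using D_add_fun[OF hfun_p0 hfun_p0, of B B x v w] D_add_fun[OF hfun_p1 hfun_p1, of B B x v w]
  by (simp add: Dv_def p0_add p1_add eform_add_fun algebra_simps)

lemma Dv_scl: "eform B \<Longrightarrow> x \<in> A \<Longrightarrow> Dv B (scl c v) x = fscale c (Dv B v x)"
  using D_scale_fun[OF hfun_p0, of B x c v] D_scale_fun[OF hfun_p1, of B x c v]
  by (simp add: Dv_def p0_scl p1_scl eform_scl_fun FS.scale_right_distrib)

lemma Dv_D:
  assumes "eform B" "hfun \<phi> e" "v \<in> V0 \<union> V1" "x \<in> A"
  shows "Dv B v (D \<phi> e x) = fscale (sg e (par V0 v)) (D \<phi> e (Dv B v x))"
  using assms D_commute[OF hfun_eform[OF assms(1,3)] assms(2,4)] by (simp add: Dv_hom D_A sg_commute)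

lemma Gam_Dv:
  assumes "eform B" "v \<in> V0 \<union> V1" "x \<in> A"
  shows "Gam e (Dv B v x) = fscale (sg e (par V0 v)) (Dv B v (Gam e x))"
  using assms by (simp add: Dv_hom Gam_D[OF hfun_eform])

definition gsym :: "('v \<Rightarrow> 'v \<Rightarrow> 'k) \<Rightarrow> bool"
  where "gsym g \<longleftrightarrow> (\<forall>a\<in>V0 \<union> V1. \<forall>b\<in>V0 \<union> V1. g a b = koszul_sign a b * g b a)"

text \<open>The pairs of entries of \<open>v # vs\<close> are those of \<open>vs\<close> together
  with those that involve \<open>v\<close>, and the latter add up to the contraction of
  \<open>v\<close> with the rest: hence the inhomogeneous term \<open>Dv g\<close>.\<close>

definition Delta_op :: "('v \<Rightarrow> 'v \<Rightarrow> 'k) \<Rightarrow> ('k, 'v) tensor \<Rightarrow> ('k, 'v) tensor"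
  where "Delta_op g = rec_op 0 L (Dv g)"

lemma flinear_Delta_op: "flinear (Delta_op g)"
  unfolding Delta_op_def by (rule flinear_rec_op)

lemma Delta_op:
  assumes "eform g" "gsym g"
  shows Delta_op_nil: "Delta_op g (sym_tens []) = 0"
    and Delta_op_L: "x \<in> A \<Longrightarrow> Delta_op g (L v x) = L v (Delta_op g x) + Dv g v x"
    and Delta_op_A: "x \<in> A \<Longrightarrow> Delta_op g x \<in> A"
proof -
  have N_comm: "Dv g a (L b x) + L a (Dv g b x) = fscale (koszul_sign a b) (Dv g b (L a x) + L b (Dv g a x))"
    if "a \<in> V0 \<union> V1" "b \<in> V0 \<union> V1" "x \<in> A" for a b x
  proof -
    \<comment> \<open>Exchanging \<open>a\<close> and \<open>b\<close> in the recursion is harmless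
      apart from the scalar terms \<open>g a b\<close> and \<open>g b a\<close>; graded symmetry of
      \<open>g\<close> is what makes them match.\<close>
    have 1: "g a b = koszul_sign a b * g b a" using assms(2) that unfolding gsym_def by blast
    show ?thesis
      unfolding Dv_L[OF assms(1) that] Dv_L[OF assms(1) that(2,1,3)] 1 koszul_sign_commute[of b a]
      by (simp add: FS.scale_right_distrib add_ac)
  qed
  note r = rec_op[of A 0 L "Dv g", OF subspace_A A_zero flinear_L flinear_Dv _ _ _ _ _ _ L_commute N_comm]
  have r': "Delta_op g (sym_tens []) = 0" "x \<in> A \<Longrightarrow> Delta_op g (L v x) = L v (Delta_op g x) + Dv g v x"
    "x \<in> A \<Longrightarrow> Delta_op g x \<in> A" for v x
    unfolding Delta_op_def by (rule r; simp add: L_add_left L_scl_left Dv_add Dv_scl Dv_A assms)+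
  then show "Delta_op g (sym_tens []) = 0" "x \<in> A \<Longrightarrow> Delta_op g (L v x) = L v (Delta_op g x) + Dv g v x"
    "x \<in> A \<Longrightarrow> Delta_op g x \<in> A" by simp_all
qed

text \<open>The second-order operator is even, so no sign appears: the contraction
  \<open>Dv g v\<close> left behind by \<open>L v\<close> passes \<open>D \<phi> e\<close> with the
  same sign as \<open>L v\<close> does.\<close>

lemma Delta_op_D:
  assumes g: "eform g" "gsym g" and \<phi>: "hfun \<phi> e" and x: "x \<in> A"
  shows "Delta_op g (D \<phi> e x) = D \<phi> e (Delta_op g x)"
proof (rule A_eqI[where F = "\<lambda>x. Delta_op g (D \<phi> e x)" and G = "\<lambda>x. D \<phi> e (Delta_op g x)", OF _ _ _ _ x])
  show "flinear (\<lambda>x. Delta_op g (D \<phi> e x))" "flinear (\<lambda>x. D \<phi> e (Delta_op g x))"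
    by (intro flinear_compose[OF flinear_Delta_op flinear_D] flinear_compose[OF flinear_D flinear_Delta_op])+
  note l = flinearD[OF flinear_Delta_op]
  show "Delta_op g (D \<phi> e (sym_tens [])) = D \<phi> e (Delta_op g (sym_tens []))"
    by (simp add: l D_nil[OF \<phi>] Delta_op_nil[OF g])
  fix v x assume "v \<in> V0 \<union> V1" "x \<in> A" "Delta_op g (D \<phi> e x) = D \<phi> e (Delta_op g x)"
  then show "Delta_op g (D \<phi> e (L v x)) = D \<phi> e (Delta_op g (L v x))"
    by (simp add: l D_L[OF \<phi>] D_A[OF \<phi>] Delta_op_L[OF g] Delta_op_A[OF g] Dv_D[OF g(1) \<phi>] FS.scale_right_distrib
      algebra_simps)
qed

lemma Delta_op_Dv:
  assumes "eform g" "gsym g" "eform B" "v \<in> V0 \<union> V1" "x \<in> A"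
  shows "Delta_op g (Dv B v x) = Dv B v (Delta_op g x)"
  using assms by (simp add: Dv_hom Delta_op_D[OF assms(1,2) hfun_eform] Delta_op_A)

lemma Delta_op_Gam:
  assumes g: "eform g" "gsym g" and x: "x \<in> A"
  shows "Delta_op g (Gam e x) = Gam e (Delta_op g x)"
proof (rule A_eqI[where F = "\<lambda>x. Delta_op g (Gam e x)" and G = "\<lambda>x. Gam e (Delta_op g x)", OF _ _ _ _ x])
  show "flinear (\<lambda>x. Delta_op g (Gam e x))" "flinear (\<lambda>x. Gam e (Delta_op g x))"
    by (intro flinear_compose[OF flinear_Delta_op flinear_Gam] flinear_compose[OF flinear_Gam flinear_Delta_op])+
  note l = flinearD[OF flinear_Delta_op]
  show "Delta_op g (Gam e (sym_tens [])) = Gam e (Delta_op g (sym_tens []))"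
    by (simp add: l Delta_op_nil[OF g])
  fix v x assume "v \<in> V0 \<union> V1" "x \<in> A" "Delta_op g (Gam e x) = Gam e (Delta_op g x)"
  then show "Delta_op g (Gam e (L v x)) = Gam e (Delta_op g (L v x))"
    by (simp add: l Gam_L Delta_op_L[OF g] Delta_op_A[OF g] Gam_Dv[OF g(1)] FS.scale_right_distrib)
qed

subsection \<open>Comparison with the explicit sums\<close>

lemma omit_Cons: "omit 0 (v # vs) = vs" "omit (Suc k) (v # vs) = v # omit k vs"
  by (simp_all add: omit_def)

lemma parl_Cons: "parl V0 (v # vs) = par V0 v + parl V0 vs" and parl_Nil: "parl V0 [] = 0"
  by (simp_all add: parl_def)

lemma D_sym_tens:
  assumes "hfun \<phi> e" "ws \<in> HL"
  shows "D \<phi> e (sym_tens ws) =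
    (\<Sum>k<length ws. fscale (sg e (parl V0 (take k ws)) * \<phi> (ws ! k)) (sym_tens (omit k ws)))"
  using assms(2)
proof (induction ws)
  case Nil
  then show ?case by (simp add: D_nil assms)
next
  case (Cons w ws)
  have "D \<phi> e (sym_tens (w # ws)) = fscale (sg e (par V0 w)) (L w (D \<phi> e (sym_tens ws))) + fscale (\<phi> w) (sym_tens ws)"
    using D_L[OF assms(1), of w "sym_tens ws"] Cons.hyps by simp
  also have "\<dots> = (\<Sum>k<length (w # ws). fscale (sg e (parl V0 (take k (w # ws))) * \<phi> ((w # ws) ! k)) (sym_tens (omit k (w # ws))))"
    using Cons
    by (simp add: sum.lessThan_Suc_shift omit_Cons parl_Cons parl_Nil sg_add flinear_sum_arg[OF flinear_L]
      FS.scale_sum_right mult.assoc del: sum.lessThan_Suc)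
  finally show ?case .
qed

lemma Dv_sym_tens:
  assumes "eform B" "v \<in> V0 \<union> V1" "ws \<in> HL"
  shows "Dv B v (sym_tens ws) =
    (\<Sum>k<length ws. fscale ((-1) ^ (par V0 (ws ! k) * parl V0 (take k ws)) * B v (ws ! k)) (sym_tens (omit k ws)))"
proof -
  \<comment> \<open>The derivation produces a sign with the parity of \<open>v\<close>, the explicit
    sum one with the parity of the contracted entry. An even form is nonzero only where these
    coincide.\<close>
  have "sg (par V0 v) q * B v (ws ! k) = (-1) ^ (par V0 (ws ! k) * q) * B v (ws ! k)" if "k < length ws" for k q
  proof (cases "B v (ws ! k) = 0")
    case False
    have "ws ! k \<in> V0 \<union> V1" using in_listsD[OF assms(3)] nth_mem[OF that] by blast
    then show ?thesis using eform_par[OF assms(1,2) _ False] by (simp add: sg_def)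
  qed simp
  then show ?thesis
    using assms by (simp only: Dv_hom D_sym_tens hfun_eform sym_tens_A) (auto intro!: sum.cong)
qed

text \<open>For the word \<open>v # vs\<close>, the pairs with \<open>i = 0\<close> give the
  contraction of \<open>v\<close>, and all other pairs are the pairs of \<open>vs\<close> with both
  indices shifted by one.\<close>

lemma Delta_op_sym_tens:
  assumes g: "eform g" "gsym g" and vs: "vs \<in> HL"
  shows "Delta_op g (sym_tens vs) = (\<Sum>j<length vs. \<Sum>i<j.
       fscale ((-1) ^ (par V0 (vs ! i) * parl V0 (take i vs))
               * (-1) ^ (par V0 (vs ! j) * parl V0 (omit i (take j vs))) * g (vs ! i) (vs ! j))
         (sym_tens (omit i (omit j vs))))"
  using vs
proof (induction vs)
  case Nil
  then show ?case by (simp add: Delta_op_nil g)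
next
  case (Cons v vs)
  have v: "v \<in> V0 \<union> V1" and vs: "vs \<in> HL" using Cons.hyps by simp_all
  define c where "c i j = (-1) ^ (par V0 (vs ! i) * parl V0 (take i vs))
               * (-1) ^ (par V0 (vs ! j) * parl V0 (omit i (take j vs))) * g (vs ! i) (vs ! j)" for i j
  \<comment> \<open>In the longer word \<open>v\<close> stands before both contracted entries and
    contributes a sign for each. The two signs cancel, since an even form pairs equal
    parities.\<close>
  have sgn: "(-1) ^ (par V0 (vs ! i) * (par V0 v + parl V0 (take i vs)))
               * (-1) ^ (par V0 (vs ! j) * (par V0 v + parl V0 (omit i (take j vs)))) * g (vs ! i) (vs ! j) = c i j"
    if "j < length vs" "i < j" for i j
  proof (cases "g (vs ! i) (vs ! j) = 0")
    case False
    have "vs ! i \<in> V0 \<union> V1" "vs ! j \<in> V0 \<union> V1" 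
      using in_listsD[OF vs] nth_mem[of i vs] nth_mem[of j vs] that by auto
    then have e: "par V0 (vs ! i) = par V0 (vs ! j)" using eform_par[OF g(1) _ _ False] by blast
    have "((-1) ^ (par V0 (vs ! j) * par V0 v) * (-1) ^ (par V0 (vs ! j) * par V0 v) :: 'k) = 1"
      by (simp flip: power_add mult_2)
    then show ?thesis unfolding c_def e
      by (simp add: distrib_left power_add)
  qed (simp add: c_def)
  have "Delta_op g (sym_tens (v # vs)) = L v (Delta_op g (sym_tens vs)) + Dv g v (sym_tens vs)"
    using Delta_op_L[OF g, of "sym_tens vs" v] by simp
  also have "L v (Delta_op g (sym_tens vs)) = (\<Sum>j<length vs. \<Sum>i<j. fscale (c i j) (sym_tens (v # omit i (omit j vs))))"
    by (simp add: Cons.IH flinear_sum_arg[OF flinear_L] c_def)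
  finally have 1: "Delta_op g (sym_tens (v # vs)) = (\<Sum>j<length vs.
      fscale ((-1) ^ (par V0 (vs ! j) * parl V0 (take j vs)) * g v (vs ! j)) (sym_tens (omit j vs)) +
      (\<Sum>i<j. fscale (c i j) (sym_tens (v # omit i (omit j vs)))))"
    by (simp add: Dv_sym_tens[OF g(1) v vs] sum.distrib add.commute)
  have 2: "(\<Sum>i<Suc j. fscale ((-1) ^ (par V0 ((v # vs) ! i) * parl V0 (take i (v # vs)))
               * (-1) ^ (par V0 ((v # vs) ! Suc j) * parl V0 (omit i (take (Suc j) (v # vs)))) * g ((v # vs) ! i) ((v # vs) ! Suc j))
         (sym_tens (omit i (omit (Suc j) (v # vs)))))
    = fscale ((-1) ^ (par V0 (vs ! j) * parl V0 (take j vs)) * g v (vs ! j)) (sym_tens (omit j vs)) +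
      (\<Sum>i<j. fscale (c i j) (sym_tens (v # omit i (omit j vs))))" if "j < length vs" for j
    unfolding sum.lessThan_Suc_shift using sgn[OF that]
    by (simp add: omit_Cons parl_Cons parl_Nil)
  show ?case
    unfolding 1 length_Cons sum.lessThan_Suc_shift[of _ "length vs"] using 2 by simp
qed

lemma Delta:
  assumes g: "eform g" "gsym g"
  shows flinear_Delta: "flinear (Delta scl V0 V1 g)"
    and Delta_eq: "x \<in> A \<Longrightarrow> Delta scl V0 V1 g x = Delta_op g x"
proof -
  note l = lin_ext_eqI[of "Delta_op g" HL "sprod scl V0 V1", OF flinear_Delta_op, unfolded sprod_eq, OF Delta_op_sym_tens[OF g]]
  show lin: "flinear (Delta scl V0 V1 g)"
    unfolding Delta_def sprod_eq by (rule l(1))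
  have "Delta scl V0 V1 g (sym_tens vs) = Delta_op g (sym_tens vs)" if "vs \<in> HL" for vs
    unfolding Delta_op_sym_tens[OF g that] Delta_def sprod_eq by (rule l(2)[OF _ that])
  then show "x \<in> A \<Longrightarrow> Delta scl V0 V1 g x = Delta_op g x"
    unfolding A_eq_span using flinear_eq_on_span[OF lin flinear_Delta_op, where B = "sym_tens ` HL" and a = x] by blast
qed

end

subsection \<open>Operators on the tensor square\<close>

lemma bilinear_form_fscaleD:
  assumes "bilinear_form fscale B"
  shows "B (a + a') b = B a b + B a' b" "B (fscale c a) b = c * B a b"
    "B a (b + b') = B a b + B a b'" "B a (fscale c b) = c * B a b"
  using assms by (auto simp: bilinear_form_def Vector_Spaces.linear_iff)

lemma fscale_apply: "fscale c f x = c * f x"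
  by (simp add: fscale_def)

lemma tensor2_lin:
  "tensor2 (a + a') b = tensor2 a b + tensor2 a' b"
  "tensor2 (fscale c a) b = fscale c (tensor2 a b)"
  "tensor2 a (b + b') = tensor2 a b + tensor2 a b'"
  "tensor2 a (fscale c b) = fscale c (tensor2 a b)"
  by (rule ext; simp add: tensor2_def bilinear_form_fscaleD plus_fun_apply fscale_apply)+

lemma tensor2_zero: "tensor2 0 b = 0" "tensor2 a 0 = 0"
  using tensor2_lin(2)[of 0 0 b] tensor2_lin(4)[of a 0 0] by simp_all

definition fbilinear :: "(('x \<Rightarrow> 'k::field) \<Rightarrow> ('x \<Rightarrow> 'k) \<Rightarrow> 'y \<Rightarrow> 'k) \<Rightarrow> bool"
  where "fbilinear \<beta> \<longleftrightarrow> (\<forall>b. flinear (\<lambda>a. \<beta> a b)) \<and> (\<forall>a. flinear (\<beta> a))"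

definition ext2 :: "(('x \<Rightarrow> 'k::field) \<Rightarrow> ('x \<Rightarrow> 'k) \<Rightarrow> 'y \<Rightarrow> 'k)
    \<Rightarrow> ((('x \<Rightarrow> 'k) \<Rightarrow> ('x \<Rightarrow> 'k) \<Rightarrow> 'k) \<Rightarrow> 'k) \<Rightarrow> 'y \<Rightarrow> 'k"
  where "ext2 \<beta> t = (\<lambda>y. t (\<lambda>a b. \<beta> a b y))"

lemma flinear_ext2: "flinear (ext2 \<beta>)"
  by (intro flinearI) (auto simp: ext2_def fscale_def plus_fun_def)

lemma ext2_tensor2:
  assumes "fbilinear \<beta>"
  shows "ext2 \<beta> (tensor2 a b) = \<beta> a b"
proof
  fix y
  have a: "\<beta> (a + a') b = \<beta> a b + \<beta> a' b" "\<beta> (fscale c a) b = fscale c (\<beta> a b)"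
    "\<beta> a (b + b') = \<beta> a b + \<beta> a b'" "\<beta> a (fscale c b) = fscale c (\<beta> a b)" for a a' b b' c
    using assms flinearD(1,2)[of "\<lambda>a. \<beta> a b"] flinearD(1,2)[of "\<beta> a"] unfolding fbilinear_def by auto
  have "bilinear_form fscale (\<lambda>a b. \<beta> a b y)"
    unfolding bilinear_form_def Vector_Spaces.linear_iff
    by (auto simp: vector_space_fscale a plus_fun_apply fscale_apply)
      (auto simp: vector_space_def algebra_simps)
  then show "ext2 \<beta> (tensor2 a b) y = \<beta> a b y" by (simp add: ext2_def tensor2_def)
qed

text \<open>The operator \<open>X \<otimes> Y\<close> without any sign; the signs of the graded
  tensor product are inserted by hand through \<open>Gam\<close>.\<close>

definition op2 :: "(('x \<Rightarrow> 'k::field) \<Rightarrow> 'x \<Rightarrow> 'k) \<Rightarrow> (('x \<Rightarrow> 'k) \<Rightarrow> 'x \<Rightarrow> 'k)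
    \<Rightarrow> ((('x \<Rightarrow> 'k) \<Rightarrow> ('x \<Rightarrow> 'k) \<Rightarrow> 'k) \<Rightarrow> 'k) \<Rightarrow> (('x \<Rightarrow> 'k) \<Rightarrow> ('x \<Rightarrow> 'k) \<Rightarrow> 'k) \<Rightarrow> 'k"
  where "op2 X Y = ext2 (\<lambda>a b. tensor2 (X a) (Y b))"

lemma flinear_op2: "flinear (op2 X Y)"
  unfolding op2_def by (rule flinear_ext2)

lemmas op2_lin [simp] = flinearD[OF flinear_op2]

lemma op2_tensor2:
  assumes "flinear X" "flinear Y"
  shows "op2 X Y (tensor2 a b) = tensor2 (X a) (Y b)"
  unfolding op2_def
proof (rule ext2_tensor2)
  show "fbilinear (\<lambda>a b. tensor2 (X a) (Y b))"
    unfolding fbilinear_def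
    by (auto intro!: flinearI simp: flinearD[OF assms(1)] flinearD[OF assms(2)] tensor2_lin)
qed

text \<open>\<open>ext2\<close> wants maps that are bilinear on the whole function space, whereas
  the operations are controlled on the symmetric algebra only. Composing with a linear projection
  onto it closes the gap.\<close>

lemma ex_subspace_projection:
  assumes "FS.subspace (S :: ('x \<Rightarrow> 'k::field) set)"
  shows "\<exists>\<pi>. flinear \<pi> \<and> (\<forall>x. \<pi> x \<in> S) \<and> (\<forall>x\<in>S. \<pi> x = x)"
proof -
  obtain g where "range g \<subseteq> S" "flinear g" "\<forall>v\<in>S. g v = v"
    using FSP.linear_exists_left_inverse_on[OF flinear_id assms inj_on_id2] by auto
  then show ?thesis by blast
qed

context super_space
begin

definition "proj_A = (SOME \<pi>. flinear \<pi> \<and> (\<forall>x. \<pi> x \<in> A) \<and> (\<forall>x\<in>A. \<pi> x = x))"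

lemma proj_A:
  shows flinear_proj_A: "flinear proj_A"
    and proj_A_in [simp]: "proj_A x \<in> A"
    and proj_A_id [simp]: "x \<in> A \<Longrightarrow> proj_A x = x"
  using someI_ex[OF ex_subspace_projection[OF subspace_A]] unfolding proj_A_def by blast+

lemmas proj_A_lin [simp] = flinearD[OF flinear_proj_A]

definition A2 :: "((('k, 'v) tensor \<Rightarrow> ('k, 'v) tensor \<Rightarrow> 'k) \<Rightarrow> 'k) set"
  where "A2 = FS.span {tensor2 a b | a b. a \<in> A \<and> b \<in> A}"

lemma subspace_A2: "FS.subspace A2"
  unfolding A2_def by (rule FS.subspace_span)

lemma A2_add [simp]: "a \<in> A2 \<Longrightarrow> b \<in> A2 \<Longrightarrow> a + b \<in> A2"
  and A2_scale [simp]: "a \<in> A2 \<Longrightarrow> fscale c a \<in> A2"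
  and A2_zero [simp]: "0 \<in> A2"
  using subspace_A2 FS.subspace_add FS.subspace_scale FS.subspace_0 by blast+

lemma tensor2_A2 [simp]: "a \<in> A \<Longrightarrow> b \<in> A \<Longrightarrow> tensor2 a b \<in> A2"
  unfolding A2_def by (intro FS.span_base) blast

lemma A2_induct [consumes 1, case_names base step]:
  assumes "t \<in> A2" "P 0"
    "\<And>c a b y. a \<in> A \<Longrightarrow> b \<in> A \<Longrightarrow> y \<in> A2 \<Longrightarrow> P y \<Longrightarrow> P (fscale c (tensor2 a b) + y)"
  shows "P t"
  using assms(1)[unfolded A2_def]
proof (induction rule: fspan_induct)
  case base
  then show ?case by fact
next
  case (step c x y)
  then show ?case using assms(3) unfolding A2_def by blast
qed

lemma A2_gen_eqI:
  assumes "flinear F" "flinear G" "\<And>a b. a \<in> A \<Longrightarrow> b \<in> A \<Longrightarrow> F (tensor2 a b) = G (tensor2 a b)" "t \<in> A2"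
  shows "F t = G t"
  by (rule flinear_eq_on_span[OF assms(1,2) _ assms(4)[unfolded A2_def]]) (use assms(3) in blast)

lemma A2_image:
  assumes "flinear F" "FS.subspace Z" "\<And>a b. a \<in> A \<Longrightarrow> b \<in> A \<Longrightarrow> F (tensor2 a b) \<in> Z" "t \<in> A2"
  shows "F t \<in> Z"
  using assms(4)
  by (induction rule: A2_induct)
    (simp_all add: flinearD[OF assms(1)] FS.subspace_0[OF assms(2)] FS.subspace_add[OF assms(2)] FS.subspace_scale[OF assms(2)] assms(3))

lemma op2_A2:
  assumes "flinear X" "flinear Y" "\<And>a. a \<in> A \<Longrightarrow> X a \<in> A" "\<And>a. a \<in> A \<Longrightarrow> Y a \<in> A" "t \<in> A2"
  shows "op2 X Y t \<in> A2"
  by (rule A2_image[OF flinear_op2 subspace_A2 _ assms(5)]) (simp add: op2_tensor2 assms)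

definition L1 :: "'v \<Rightarrow> ((('k, 'v) tensor \<Rightarrow> ('k, 'v) tensor \<Rightarrow> 'k) \<Rightarrow> 'k) \<Rightarrow> (('k, 'v) tensor \<Rightarrow> ('k, 'v) tensor \<Rightarrow> 'k) \<Rightarrow> 'k"
  where "L1 v = op2 (L v) (\<lambda>x. x)"

text \<open>\<open>M_op\<close> contracts \<open>v\<close> with the second tensor factor and
  \<open>N_op\<close> with the first. To reach the second factor \<open>v\<close> has to pass the
  first one, whence the \<open>Gam\<close>.\<close>

definition M_op where "M_op B v = op2 (Gam (par V0 v)) (Dv B v)"
definition N_op where "N_op B v = op2 (Dv B v) (\<lambda>x. x)"
definition D1 where "D1 g = op2 (Delta_op g) (\<lambda>x. x)"
definition D2 where "D2 g = op2 (\<lambda>x. x) (Delta_op g)"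

lemma flinear_ops: "flinear (L1 v)" "flinear (M_op B v)" "flinear (N_op B v)" "flinear (D1 g)" "flinear (D2 g)"
  by (simp_all add: L1_def M_op_def N_op_def D1_def D2_def flinear_op2)

lemmas L1_lin [simp] = flinearD[OF flinear_ops(1)]
lemmas M_lin [simp] = flinearD[OF flinear_ops(2)]
lemmas N_lin [simp] = flinearD[OF flinear_ops(3)]
lemmas D1_lin [simp] = flinearD[OF flinear_ops(4)]
lemmas D2_lin [simp] = flinearD[OF flinear_ops(5)]

lemma ops_tensor2:
  "L1 v (tensor2 a b) = tensor2 (L v a) b"
  "M_op B v (tensor2 a b) = tensor2 (Gam (par V0 v) a) (Dv B v b)"
  "N_op B v (tensor2 a b) = tensor2 (Dv B v a) b"
  "D1 g (tensor2 a b) = tensor2 (Delta_op g a) b"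
  "D2 g (tensor2 a b) = tensor2 a (Delta_op g b)"
  by (simp_all add: L1_def M_op_def N_op_def D1_def D2_def op2_tensor2 flinear_L flinear_id flinear_Gam flinear_Dv flinear_Delta_op)

lemma L1_A2 [simp]: "t \<in> A2 \<Longrightarrow> L1 v t \<in> A2"
  unfolding L1_def by (rule op2_A2) (simp_all add: flinear_L flinear_id)

lemma M_A2: "eform B \<Longrightarrow> t \<in> A2 \<Longrightarrow> M_op B v t \<in> A2"
  unfolding M_op_def by (rule op2_A2) (simp_all add: flinear_Gam flinear_Dv Dv_A)

lemma N_A2: "eform B \<Longrightarrow> t \<in> A2 \<Longrightarrow> N_op B v t \<in> A2"
  unfolding N_op_def by (rule op2_A2) (simp_all add: flinear_id flinear_Dv Dv_A)

lemma D1_A2: "eform g \<Longrightarrow> gsym g \<Longrightarrow> t \<in> A2 \<Longrightarrow> D1 g t \<in> A2"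
  unfolding D1_def by (rule op2_A2) (simp_all add: flinear_id flinear_Delta_op Delta_op_A)

lemma D2_A2: "eform g \<Longrightarrow> gsym g \<Longrightarrow> t \<in> A2 \<Longrightarrow> D2 g t \<in> A2"
  unfolding D2_def by (rule op2_A2) (simp_all add: flinear_id flinear_Delta_op Delta_op_A)

lemma A2_eqI:
  assumes F: "flinear F" and G: "flinear G"
    and nil: "\<And>b. b \<in> A \<Longrightarrow> F (tensor2 (sym_tens []) b) = G (tensor2 (sym_tens []) b)"
    and L1: "\<And>v t. v \<in> V0 \<union> V1 \<Longrightarrow> t \<in> A2 \<Longrightarrow> F t = G t \<Longrightarrow> F (L1 v t) = G (L1 v t)"
    and t: "t \<in> A2"
  shows "F t = (G t :: 'y \<Rightarrow> 'k)"
proof (rule A2_gen_eqI[OF F G _ t])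
  fix a b assume a: "a \<in> A" and b: "b \<in> A"
  show "F (tensor2 a b) = G (tensor2 a b)"
  proof (rule A_eqI[where F = "\<lambda>a. F (tensor2 a b)" and G = "\<lambda>a. G (tensor2 a b)", OF _ _ _ _ a])
    show "flinear (\<lambda>a. F (tensor2 a b))" "flinear (\<lambda>a. G (tensor2 a b))"
      by (rule flinearI; simp add: tensor2_lin flinearD[OF F] flinearD[OF G])+
    show "F (tensor2 (sym_tens []) b) = G (tensor2 (sym_tens []) b)" by (rule nil[OF b])
    fix v x assume "v \<in> V0 \<union> V1" "x \<in> A" "F (tensor2 x b) = G (tensor2 x b)"
    then show "F (tensor2 (L v x) b) = G (tensor2 (L v x) b)"
      using L1[of v "tensor2 x b"] b by (simp add: ops_tensor2)
  qed
qed

lemma M_L1: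
  assumes "eform B" "v \<in> V0 \<union> V1" "u \<in> V0 \<union> V1" "t \<in> A2"
  shows "M_op B v (L1 u t) = fscale (koszul_sign v u) (L1 u (M_op B v t))"
  by (rule A2_gen_eqI[where F = "\<lambda>t. M_op B v (L1 u t)" and G = "\<lambda>t. fscale (koszul_sign v u) (L1 u (M_op B v t))", OF _ _ _ assms(4)])
    (use assms in \<open>simp_all add: flinear_compose[OF flinear_ops(2) flinear_ops(1)]
      flinear_scale[OF flinear_compose[OF flinear_ops(1) flinear_ops(2)]] ops_tensor2 Gam_L tensor2_lin koszul_sign_sg\<close>)

lemma M_M:
  assumes "eform B" "eform B'" "v \<in> V0 \<union> V1" "u \<in> V0 \<union> V1" "t \<in> A2"
  shows "M_op B v (M_op B' u t) = fscale (koszul_sign v u) (M_op B' u (M_op B v t))"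
proof (rule A2_gen_eqI[where F = "\<lambda>t. M_op B v (M_op B' u t)" and G = "\<lambda>t. fscale (koszul_sign v u) (M_op B' u (M_op B v t))", OF _ _ _ assms(5)])
  fix a b assume ab: "a \<in> A" "b \<in> A"
  have "Dv B v (Dv B' u b) = fscale (koszul_sign v u) (Dv B' u (Dv B v b))"
    using assms ab Dv_D[OF assms(1) hfun_eform[OF assms(2,4)] assms(3) ab(2)]
    by (simp add: Dv_hom[OF assms(2)] Dv_A koszul_sign_sg sg_commute)
  then show "M_op B v (M_op B' u (tensor2 a b)) = fscale (koszul_sign v u) (M_op B' u (M_op B v (tensor2 a b)))"
    using ab Gam_Gam[of a "par V0 v" "par V0 u"] by (simp add: ops_tensor2 tensor2_lin)
qed (simp_all add: flinear_compose[OF flinear_ops(2) flinear_ops(2)] flinear_scale)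

lemma N_L1:
  assumes "eform B" "v \<in> V0 \<union> V1" "u \<in> V0 \<union> V1" "t \<in> A2"
  shows "N_op B v (L1 u t) = fscale (koszul_sign v u) (L1 u (N_op B v t)) + fscale (B v u) t"
  by (rule A2_gen_eqI[where F = "\<lambda>t. N_op B v (L1 u t)" and G = "\<lambda>t. fscale (koszul_sign v u) (L1 u (N_op B v t)) + fscale (B v u) t", OF _ _ _ assms(4)])
    (use assms in \<open>simp_all add: flinear_compose[OF flinear_ops(3) flinear_ops(1)] flinear_add flinear_fscale
      flinear_scale[OF flinear_compose[OF flinear_ops(1) flinear_ops(3)]] ops_tensor2 Dv_L tensor2_lin\<close>)

lemma N_M:
  assumes "eform B" "eform B'" "v \<in> V0 \<union> V1" "u \<in> V0 \<union> V1" "t \<in> A2"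
  shows "N_op B v (M_op B' u t) = fscale (koszul_sign v u) (M_op B' u (N_op B v t))"
proof (rule A2_gen_eqI[where F = "\<lambda>t. N_op B v (M_op B' u t)" and G = "\<lambda>t. fscale (koszul_sign v u) (M_op B' u (N_op B v t))", OF _ _ _ assms(5)])
  fix a b assume ab: "a \<in> A" "b \<in> A"
  have "Gam (par V0 u) (Dv B v a) = fscale (koszul_sign v u) (Dv B v (Gam (par V0 u) a))"
    using Gam_Dv[OF assms(1,3) ab(1), of "par V0 u"] by (simp add: koszul_sign_sg sg_commute)
  then have "Dv B v (Gam (par V0 u) a) = fscale (koszul_sign v u) (Gam (par V0 u) (Dv B v a))" by simp
  then show "N_op B v (M_op B' u (tensor2 a b)) = fscale (koszul_sign v u) (M_op B' u (N_op B v (tensor2 a b)))"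
    by (simp add: ops_tensor2 tensor2_lin)
qed (simp_all add: flinear_compose[OF flinear_ops(3) flinear_ops(2)] flinear_compose[OF flinear_ops(2) flinear_ops(3)] flinear_scale)

lemma D1_L1:
  assumes "eform g" "gsym g" "t \<in> A2"
  shows "D1 g (L1 v t) = L1 v (D1 g t) + N_op g v t"
  by (rule A2_gen_eqI[where F = "\<lambda>t. D1 g (L1 v t)" and G = "\<lambda>t. L1 v (D1 g t) + N_op g v t", OF _ _ _ assms(3)])
    (use assms in \<open>simp_all add: flinear_compose[OF flinear_ops(4) flinear_ops(1)] flinear_add flinear_ops
      flinear_compose[OF flinear_ops(1) flinear_ops(4)] ops_tensor2 Delta_op_L tensor2_lin\<close>)

lemma D1_M:
  assumes "eform g" "gsym g" "t \<in> A2"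
  shows "D1 g (M_op B v t) = M_op B v (D1 g t)"
  by (rule A2_gen_eqI[where F = "\<lambda>t. D1 g (M_op B v t)" and G = "\<lambda>t. M_op B v (D1 g t)", OF _ _ _ assms(3)])
    (use assms in \<open>simp_all add: flinear_compose[OF flinear_ops(4) flinear_ops(2)]
      flinear_compose[OF flinear_ops(2) flinear_ops(4)] ops_tensor2 Delta_op_Gam\<close>)

lemma D2_L1: "t \<in> A2 \<Longrightarrow> D2 g (L1 v t) = L1 v (D2 g t)"
  by (rule A2_gen_eqI[where F = "\<lambda>t. D2 g (L1 v t)" and G = "\<lambda>t. L1 v (D2 g t)"])
    (simp_all add: flinear_compose[OF flinear_ops(5) flinear_ops(1)] flinear_compose[OF flinear_ops(1) flinear_ops(5)] ops_tensor2)

lemma D2_M: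
  assumes "eform g" "gsym g" "eform B" "v \<in> V0 \<union> V1" "t \<in> A2"
  shows "D2 g (M_op B v t) = M_op B v (D2 g t)"
  by (rule A2_gen_eqI[where F = "\<lambda>t. D2 g (M_op B v t)" and G = "\<lambda>t. M_op B v (D2 g t)", OF _ _ _ assms(5)])
    (use assms in \<open>simp_all add: flinear_compose[OF flinear_ops(5) flinear_ops(2)]
      flinear_compose[OF flinear_ops(2) flinear_ops(5)] ops_tensor2 Delta_op_Dv\<close>)

lemma D1_D2: "t \<in> A2 \<Longrightarrow> D1 g (D2 g t) = D2 g (D1 g t)"
  by (rule A2_gen_eqI[where F = "\<lambda>t. D1 g (D2 g t)" and G = "\<lambda>t. D2 g (D1 g t)"])
    (simp_all add: flinear_compose[OF flinear_ops(5) flinear_ops(4)] flinear_compose[OF flinear_ops(4) flinear_ops(5)] ops_tensor2)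

section \<open>The bidifferential operator \<open>P\<close> and its commutation relations\<close>

text \<open>For homogeneous \<open>v\<close> this is \<open>M_op B v\<close> on
  \<open>x \<otimes> b\<close> (see \<open>N_P_hom\<close>). It is written through the even and odd
  part of \<open>v\<close> to be linear in \<open>v\<close>, and then drives a recursion in the
  first factor with the second factor \<open>b\<close> fixed.\<close>

definition N_P where "N_P B b v x = tensor2 x (D (B (p0 v)) 0 b) + tensor2 (Gam 1 x) (D (B (p1 v)) 1 b)"

definition P_at where "P_at B b = rec_op 0 L1 (N_P B b)"

lemma flinear_N_P: "flinear (N_P B b v)"
  by (rule flinearI) (simp_all add: N_P_def tensor2_lin FS.scale_right_distrib algebra_simps)

lemma N_P_hom:
  assumes "eform B" "v \<in> V0 \<union> V1" "x \<in> A" "b \<in> A"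
  shows "N_P B b v x = tensor2 (Gam (par V0 v) x) (Dv B v b)"
proof -
  have z: "B 0 = (\<lambda>w. 0)" using eform_zero[OF assms(1)] by auto
  show ?thesis
  proof (cases "v \<in> V0")
    case True
    then show ?thesis using assms by (simp add: N_P_def Dv_hom z D_zero par_V0 tensor2_zero)
  next
    case False
    then show ?thesis using assms by (auto simp: N_P_def Dv_hom z D_zero par_def tensor2_zero)
  qed
qed

lemma P_at:
  assumes B: "eform B" and b: "b \<in> A"
  shows P_at_nil: "P_at B b (sym_tens []) = 0"
    and P_at_L: "x \<in> A \<Longrightarrow> P_at B b (L v x) = L1 v (P_at B b x) + N_P B b v x"
    and P_at_A2: "x \<in> A \<Longrightarrow> P_at B b x \<in> A2"
proof -
  \<comment> \<open>The contraction acts on the factor \<open>b\<close>, so passing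
    \<open>L b'\<close> through it yields a sign but no scalar term.\<close>
  have c: "N_P B b a (L b' x) + L1 a (N_P B b b' x) = fscale (koszul_sign a b') (N_P B b b' (L a x) + L1 b' (N_P B b a x))"
    if "a \<in> V0 \<union> V1" "b' \<in> V0 \<union> V1" "x \<in> A" for a b' x
    using that
    by (simp add: N_P_hom B b Gam_L ops_tensor2 tensor2_lin koszul_sign_sg sg_commute[of "par V0 b'" "par V0 a"]
      FS.scale_right_distrib add.commute)
  have add: "L1 (v + w) z = L1 v z + L1 w z" if "z \<in> A2" for v w z
    using that
    by (induction rule: A2_induct)
      (simp_all add: ops_tensor2 L_add_left tensor2_lin FS.scale_right_distrib algebra_simps)
  have scl: "L1 (scl c v) z = fscale c (L1 v z)" if "z \<in> A2" for v c z
    using that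
    by (induction rule: A2_induct)
      (simp_all add: ops_tensor2 L_scl_left tensor2_lin FS.scale_right_distrib algebra_simps)
  have comm: "L1 a (L1 b' z) = fscale (koszul_sign a b') (L1 b' (L1 a z))"
    if "a \<in> V0 \<union> V1" "b' \<in> V0 \<union> V1" "z \<in> A2" for a b' z
    using that(3)
    by (induction rule: A2_induct)
      (simp_all add: ops_tensor2 L_commute[OF that(1,2)] tensor2_lin FS.scale_right_distrib mult.commute)
  have NA2: "N_P B b v x \<in> A2" if "x \<in> A" for v x
    using that b by (simp add: N_P_def D_A hfun_p0[OF B] hfun_p1[OF B])
  have Nadd: "N_P B b (v + w) x = N_P B b v x + N_P B b w x" "N_P B b (scl c v) x = fscale c (N_P B b v x)"
    if "x \<in> A" for v w x c
    using that b D_add_fun[OF hfun_p0[OF B] hfun_p0[OF B], of b v w] D_add_fun[OF hfun_p1[OF B] hfun_p1[OF B], of b v w]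
      D_scale_fun[OF hfun_p0[OF B], of b c v] D_scale_fun[OF hfun_p1[OF B], of b c v]
    by (simp_all add: N_P_def p0_add p1_add p0_scl p1_scl eform_add_fun[OF B] eform_scl_fun[OF B] tensor2_lin
      FS.scale_right_distrib algebra_simps)
  note r = rec_op[of A2 0 L1 "N_P B b", OF subspace_A2 A2_zero flinear_ops(1) flinear_N_P L1_A2 NA2 add scl Nadd comm c]
  show "P_at B b (sym_tens []) = 0" "x \<in> A \<Longrightarrow> P_at B b (L v x) = L1 v (P_at B b x) + N_P B b v x"
    "x \<in> A \<Longrightarrow> P_at B b x \<in> A2"
    unfolding P_at_def by (rule r; assumption)+
qed

lemma flinear_P_at: "flinear (P_at B b)"
  unfolding P_at_def by (rule flinear_rec_op)

lemmas P_at_lin [simp] = flinearD[OF flinear_P_at]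

lemma P_at_lin_right:
  assumes B: "eform B" and "b \<in> A" "b' \<in> A" "x \<in> A"
  shows "P_at B (b + b') x = P_at B b x + P_at B b' x" "P_at B (fscale c b) x = fscale c (P_at B b x)"
proof -
  have N_op: "N_P B (b + b') v x = N_P B b v x + N_P B b' v x" "N_P B (fscale c b) v x = fscale c (N_P B b v x)" for v x
    by (simp_all add: N_P_def tensor2_lin FS.scale_right_distrib algebra_simps)
  show "P_at B (b + b') x = P_at B b x + P_at B b' x"
    by (rule A_eqI[where G = "\<lambda>x. P_at B b x + P_at B b' x", OF flinear_P_at flinear_add[OF flinear_P_at flinear_P_at] _ _ assms(4)])
      (simp_all add: assms P_at_nil P_at_L N_op algebra_simps)
  show "P_at B (fscale c b) x = fscale c (P_at B b x)"
    by (rule A_eqI[where G = "\<lambda>x. fscale c (P_at B b x)", OF flinear_P_at flinear_scale[OF flinear_P_at] _ _ assms(4)])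
      (simp_all add: assms P_at_nil P_at_L N_op FS.scale_right_distrib)
qed

definition P where "P B = ext2 (\<lambda>a b. P_at B (proj_A b) (proj_A a))"

lemma flinear_P: "flinear (P B)"
  unfolding P_def by (rule flinear_ext2)

lemmas P_lin [simp] = flinearD[OF flinear_P]

lemma P_tensor2:
  assumes "eform B" "a \<in> A" "b \<in> A"
  shows "P B (tensor2 a b) = P_at B b a"
proof -
  have "fbilinear (\<lambda>a b. P_at B (proj_A b) (proj_A a))"
    unfolding fbilinear_def using assms(1)
    by (auto intro!: flinearI simp: P_at_lin_right(1) P_at_lin_right(2)[where b' = 0])
  from ext2_tensor2[OF this, of a b] assms show ?thesis by (simp add: P_def)
qed

lemma P_A2: "eform B \<Longrightarrow> t \<in> A2 \<Longrightarrow> P B t \<in> A2"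
  by (rule A2_image[OF flinear_P subspace_A2]) (simp_all add: P_tensor2 P_at_A2)

lemma P_nil: "eform B \<Longrightarrow> b \<in> A \<Longrightarrow> P B (tensor2 (sym_tens []) b) = 0"
  by (simp add: P_tensor2 P_at_nil)

lemma P_L1:
  assumes "eform B" "v \<in> V0 \<union> V1" "t \<in> A2"
  shows "P B (L1 v t) = L1 v (P B t) + M_op B v t"
  by (rule A2_gen_eqI[where F = "\<lambda>t. P B (L1 v t)" and G = "\<lambda>t. L1 v (P B t) + M_op B v t", OF _ _ _ assms(3)])
    (use assms in \<open>simp_all add: flinear_compose[OF flinear_P flinear_ops(1)] flinear_compose[OF flinear_ops(1) flinear_P]
      flinear_add flinear_ops ops_tensor2 P_tensor2 P_at_L N_P_hom\<close>)

lemma P_M: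
  assumes B: "eform B" "eform B'" and v: "v \<in> V0 \<union> V1" and t: "t \<in> A2"
  shows "P B (M_op B' v t) = M_op B' v (P B t)"
proof (rule A2_eqI[where F = "\<lambda>t. P B (M_op B' v t)" and G = "\<lambda>t. M_op B' v (P B t)", OF _ _ _ _ t])
  show "flinear (\<lambda>t. P B (M_op B' v t))" "flinear (\<lambda>t. M_op B' v (P B t))"
    by (intro flinear_compose[OF flinear_P flinear_ops(2)] flinear_compose[OF flinear_ops(2) flinear_P])+
  show "P B (M_op B' v (tensor2 (sym_tens []) b)) = M_op B' v (P B (tensor2 (sym_tens []) b))" if "b \<in> A" for b
    using that B by (simp add: ops_tensor2 P_nil Dv_A)
  fix u t assume u: "u \<in> V0 \<union> V1" and t: "t \<in> A2" and IH: "P B (M_op B' v t) = M_op B' v (P B t)"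
  show "P B (M_op B' v (L1 u t)) = M_op B' v (P B (L1 u t))"
    using u v t B by (simp add: M_L1 P_L1 M_A2 P_A2 IH FS.scale_right_distrib M_M[of B' B v u])
qed

text \<open>When \<open>L1 u\<close> is moved out, both orders leave
  \<open>M_op B u (P B' t)\<close> and \<open>M_op B' u (P B t)\<close>, because by
  \<open>P_M\<close> either \<open>P\<close> commutes with the \<open>M_op\<close> of the other
  form.\<close>

lemma P_P:
  assumes B: "eform B" "eform B'" and t: "t \<in> A2"
  shows "P B (P B' t) = P B' (P B t)"
proof (rule A2_eqI[where F = "\<lambda>t. P B (P B' t)" and G = "\<lambda>t. P B' (P B t)", OF _ _ _ _ t])
  show "flinear (\<lambda>t. P B (P B' t))" "flinear (\<lambda>t. P B' (P B t))"
    by (intro flinear_compose[OF flinear_P flinear_P])+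
  show "P B (P B' (tensor2 (sym_tens []) b)) = P B' (P B (tensor2 (sym_tens []) b))" if "b \<in> A" for b
    using that B by (simp add: P_nil)
  fix u t assume "u \<in> V0 \<union> V1" "t \<in> A2" "P B (P B' t) = P B' (P B t)"
  then show "P B (P B' (L1 u t)) = P B' (P B (L1 u t))"
    using B by (simp add: P_L1 P_A2 M_A2 P_M algebra_simps)
qed

lemma P_N:
  assumes B: "eform B" "eform B'" and v: "v \<in> V0 \<union> V1" and t: "t \<in> A2"
  shows "P B (N_op B' v t) = N_op B' v (P B t)"
proof (rule A2_eqI[where F = "\<lambda>t. P B (N_op B' v t)" and G = "\<lambda>t. N_op B' v (P B t)", OF _ _ _ _ t])
  show "flinear (\<lambda>t. P B (N_op B' v t))" "flinear (\<lambda>t. N_op B' v (P B t))"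
    by (intro flinear_compose[OF flinear_P flinear_ops(3)] flinear_compose[OF flinear_ops(3) flinear_P])+
  show "P B (N_op B' v (tensor2 (sym_tens []) b)) = N_op B' v (P B (tensor2 (sym_tens []) b))" if "b \<in> A" for b
    using that B by (simp add: ops_tensor2 P_nil Dv_nil tensor2_zero)
  fix u t assume u: "u \<in> V0 \<union> V1" and t: "t \<in> A2" and IH: "P B (N_op B' v t) = N_op B' v (P B t)"
  show "P B (N_op B' v (L1 u t)) = N_op B' v (P B (L1 u t))"
    using u v t B by (simp add: N_L1 P_L1 N_A2 P_A2 IH FS.scale_right_distrib N_M[of B' B v u])
qed

lemma D1_P:
  assumes B: "eform B" and g: "eform g" "gsym g" and t: "t \<in> A2"
  shows "D1 g (P B t) = P B (D1 g t)"
proof (rule A2_eqI[where F = "\<lambda>t. D1 g (P B t)" and G = "\<lambda>t. P B (D1 g t)", OF _ _ _ _ t])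
  show "flinear (\<lambda>t. D1 g (P B t))" "flinear (\<lambda>t. P B (D1 g t))"
    by (intro flinear_compose[OF flinear_P flinear_ops(4)] flinear_compose[OF flinear_ops(4) flinear_P])+
  show "D1 g (P B (tensor2 (sym_tens []) b)) = P B (D1 g (tensor2 (sym_tens []) b))" if "b \<in> A" for b
    using that B g by (simp add: ops_tensor2 P_nil Delta_op_nil tensor2_zero)
  fix u t assume "u \<in> V0 \<union> V1" "t \<in> A2" "D1 g (P B t) = P B (D1 g t)"
  then show "D1 g (P B (L1 u t)) = P B (D1 g (L1 u t))"
    using B g by (simp add: D1_L1 P_L1 P_A2 D1_A2 N_A2 P_N D1_M algebra_simps)
qed

lemma D2_P:
  assumes B: "eform B" and g: "eform g" "gsym g" and t: "t \<in> A2"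
  shows "D2 g (P B t) = P B (D2 g t)"
proof (rule A2_eqI[where F = "\<lambda>t. D2 g (P B t)" and G = "\<lambda>t. P B (D2 g t)", OF _ _ _ _ t])
  show "flinear (\<lambda>t. D2 g (P B t))" "flinear (\<lambda>t. P B (D2 g t))"
    by (intro flinear_compose[OF flinear_P flinear_ops(5)] flinear_compose[OF flinear_ops(5) flinear_P])+
  show "D2 g (P B (tensor2 (sym_tens []) b)) = P B (D2 g (tensor2 (sym_tens []) b))" if "b \<in> A" for b
    using that B g by (simp add: ops_tensor2 P_nil Delta_op_A)
  fix u t assume "u \<in> V0 \<union> V1" "t \<in> A2" "D2 g (P B t) = P B (D2 g t)"
  then show "D2 g (P B (L1 u t)) = P B (D2 g (L1 u t))"
    using B g by (simp add: D2_L1 P_L1 P_A2 D2_A2 D2_M)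
qed

lemma eform_plus: "eform B \<Longrightarrow> eform B' \<Longrightarrow> eform (B + B')"
  unfolding eform_def bilinear_form_def even_form_def Vector_Spaces.linear_iff
  by (auto simp: plus_fun_def algebra_simps)

lemma P_plus:
  assumes B: "eform B" "eform B'" and t: "t \<in> A2"
  shows "P (B + B') t = P B t + P B' t"
proof (rule A2_eqI[where G = "\<lambda>t. P B t + P B' t", OF flinear_P flinear_add[OF flinear_P flinear_P] _ _ t])
  note B' = eform_plus[OF B]
  show "P (B + B') (tensor2 (sym_tens []) b) = P B (tensor2 (sym_tens []) b) + P B' (tensor2 (sym_tens []) b)"
    if "b \<in> A" for b using that B B' by (simp add: P_nil)
  fix v t assume v: "v \<in> V0 \<union> V1" and t: "t \<in> A2" and IH: "P (B + B') t = P B t + P B' t"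
  have "M_op (B + B') v t = M_op B v t + M_op B' v t"
    using t
  proof (induction rule: A2_induct)
    case base
    then show ?case by simp
  next
    case (step c a b y)
    have "D (\<lambda>w. B v w + B' v w) (par V0 v) b = D (B v) (par V0 v) b + D (B' v) (par V0 v) b"
      by (rule D_add_fun) (use step B v in \<open>simp_all add: hfun_eform\<close>)
    then have "Dv (B + B') v b = Dv B v b + Dv B' v b"
      using step B B' v by (simp add: Dv_hom plus_fun_def)
    then show ?case using step by (simp add: ops_tensor2 tensor2_lin FS.scale_right_distrib algebra_simps)
  qed
  then show "P (B + B') (L1 v t) = P B (L1 v t) + P B' (L1 v t)"
    using v t B B' IH by (simp add: P_L1 algebra_simps)
qed

section \<open>Multiplication as a map on the tensor square\<close>

definition mult where "mult = ext2 (\<lambda>a b. smul scl V0 V1 (proj_A a) (proj_A b))"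

lemma flinear_mult: "flinear mult"
  unfolding mult_def by (rule flinear_ext2)

lemmas mult_lin [simp] = flinearD[OF flinear_mult]

lemma mult_tensor2:
  assumes "a \<in> A" "b \<in> A"
  shows "mult (tensor2 a b) = smul scl V0 V1 a b"
proof -
  have "fbilinear (\<lambda>a b. smul scl V0 V1 (proj_A a) (proj_A b))"
    unfolding fbilinear_def
    by (auto intro!: flinearI simp: smul_add_left smul_add_right smul_scale_left smul_scale_right)
  from ext2_tensor2[OF this, of a b] assms show ?thesis by (simp add: mult_def)
qed

lemma mult_A: "t \<in> A2 \<Longrightarrow> mult t \<in> A"
  by (rule A2_image[OF flinear_mult subspace_A]) (simp_all add: mult_tensor2)

lemma mult_L1: "t \<in> A2 \<Longrightarrow> mult (L1 v t) = L v (mult t)"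
  by (rule A2_gen_eqI[where F = "\<lambda>t. mult (L1 v t)" and G = "\<lambda>t. L v (mult t)"])
    (simp_all add: flinear_compose[OF flinear_mult flinear_ops(1)] flinear_compose[OF flinear_L flinear_mult]
      ops_tensor2 mult_tensor2 smul_eq_Rmul Rmul_L)

lemma Dv_mult:
  assumes "eform B" "v \<in> V0 \<union> V1" "t \<in> A2"
  shows "Dv B v (mult t) = mult (N_op B v t) + mult (M_op B v t)"
  by (rule A2_gen_eqI[where F = "\<lambda>t. Dv B v (mult t)" and G = "\<lambda>t. mult (N_op B v t) + mult (M_op B v t)", OF _ _ _ assms(3)])
    (use assms in \<open>simp_all add: flinear_compose[OF flinear_mult flinear_ops(2)] flinear_compose[OF flinear_mult flinear_ops(3)]
      flinear_compose[OF flinear_Dv flinear_mult] flinear_add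
      ops_tensor2 mult_tensor2 smul_eq_Rmul Dv_A Rmul_A Dv_hom D_A hfun_eform D_Rmul\<close>)

text \<open>Moving \<open>L v\<close> out of the left side leaves a contraction of the product. By
  \<open>Dv_mult\<close> it splits into \<open>N_op\<close> and \<open>M_op\<close>; the first is
  the commutator term of \<open>D1\<close>, the second that of \<open>P\<close>, while
  \<open>D2\<close> commutes with \<open>L1 v\<close>.\<close>

lemma Delta_op_mult:
  assumes g: "eform g" "gsym g" and t: "t \<in> A2"
  shows "Delta_op g (mult t) = mult (D1 g t + D2 g t + P g t)"
proof (rule A2_eqI[where F = "\<lambda>t. Delta_op g (mult t)" and G = "\<lambda>t. mult (D1 g t + D2 g t + P g t)", OF _ _ _ _ t])
  show "flinear (\<lambda>t. Delta_op g (mult t))" "flinear (\<lambda>t. mult (D1 g t + D2 g t + P g t))"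
    by (intro flinear_compose[OF flinear_Delta_op flinear_mult] flinear_compose[OF flinear_mult]
      flinear_add flinear_ops flinear_P)+
  show "Delta_op g (mult (tensor2 (sym_tens []) b)) = mult (D1 g (tensor2 (sym_tens []) b) + D2 g (tensor2 (sym_tens []) b) + P g (tensor2 (sym_tens []) b))"
    if "b \<in> A" for b
    using that g by (simp add: ops_tensor2 P_nil Delta_op_nil tensor2_zero mult_tensor2 smul_eq_Rmul Rmul_nil Delta_op_A)
  note l = flinearD[OF flinear_Delta_op]
  fix v t assume "v \<in> V0 \<union> V1" "t \<in> A2" "Delta_op g (mult t) = mult (D1 g t + D2 g t + P g t)"
  then show "Delta_op g (mult (L1 v t)) = mult (D1 g (L1 v t) + D2 g (L1 v t) + P g (L1 v t))"
    using g by (simp add: mult_L1 Delta_op_L mult_A D1_L1 D2_L1 P_L1 Dv_mult D1_A2 D2_A2 P_A2 algebra_simps)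
qed

lemma mu: shows flinear_mu: "flinear (mu scl V0 V1)" and mu_eq: "t \<in> A2 \<Longrightarrow> mu scl V0 V1 t = mult t"
proof -
  note l = lin_ext_eqI[of mult "A \<times> A" "\<lambda>(a, b). tensor2 a b" "\<lambda>(a, b). smul scl V0 V1 a b", OF flinear_mult]
  show lin: "flinear (mu scl V0 V1)"
    unfolding mu_def by (rule l(1)) (auto simp: mult_tensor2)
  have 1: "mu scl V0 V1 (tensor2 a b) = mult (tensor2 a b)" if "a \<in> A" "b \<in> A" for a b
    using l(2)[of "(a, b)"] that unfolding mu_def by (auto simp: mult_tensor2)
  show "mu scl V0 V1 t = mult t" if "t \<in> A2"
    by (rule A2_gen_eqI[OF lin flinear_mult 1 that])
qed

lemma Gam_sym_tens: "vs \<in> HL \<Longrightarrow> Gam e (sym_tens vs) = fscale (sg e (parl V0 vs)) (sym_tens vs)"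
proof (induction vs)
  case Nil
  then show ?case by (simp add: parl_Nil)
next
  case (Cons v vs)
  then show ?case using Gam_L[of v "sym_tens vs" e] by (simp add: parl_Cons sg_add mult.commute)
qed

text \<open>For a contraction of the leading letter \<open>v\<close>, \<open>Gam\<close> supplies
  the sign of moving \<open>v\<close> past the rest of its own word and \<open>Dv\<close> that of
  bringing the partner to the front. Letters put in front later leave these signs unchanged, as the
  sign of \<open>vs ! k\<close> only looks to its right.\<close>

lemma P_sym_tens:
  assumes B: "eform B" and vs: "vs \<in> HL" and ws: "ws \<in> HL"
  shows "P B (tensor2 (sym_tens vs) (sym_tens ws)) = (\<Sum>k<length vs. \<Sum>l<length ws.
       fscale ((-1) ^ (par V0 (vs ! k) * parl V0 (drop (Suc k) vs)
                       + par V0 (ws ! l) * parl V0 (take l ws)) * B (vs ! k) (ws ! l))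
         (tensor2 (sym_tens (omit k vs)) (sym_tens (omit l ws))))"
  using vs
proof (induction vs)
  case Nil
  then show ?case using B by (simp add: P_nil)
next
  case (Cons v vs)
  have fs: "flinear (tensor2 a)" for a :: "('k, 'v) tensor" by (rule flinearI) (simp_all add: tensor2_lin)
  have "P B (tensor2 (sym_tens (v # vs)) (sym_tens ws)) = P B (L1 v (tensor2 (sym_tens vs) (sym_tens ws)))"
    by (simp add: ops_tensor2)
  also have "\<dots> = L1 v (P B (tensor2 (sym_tens vs) (sym_tens ws))) + tensor2 (Gam (par V0 v) (sym_tens vs)) (Dv B v (sym_tens ws))"
    using P_L1[OF B, of v "tensor2 (sym_tens vs) (sym_tens ws)"] Cons.hyps by (simp add: ops_tensor2)
  also have "tensor2 (Gam (par V0 v) (sym_tens vs)) (Dv B v (sym_tens ws)) = (\<Sum>l<length ws.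
       fscale ((-1) ^ (par V0 v * parl V0 vs + par V0 (ws ! l) * parl V0 (take l ws)) * B v (ws ! l))
         (tensor2 (sym_tens vs) (sym_tens (omit l ws))))"
    using Cons.hyps
    by (simp add: Gam_sym_tens Dv_sym_tens[OF B Cons.hyps(1) ws] tensor2_lin flinear_sum_arg[OF fs] FS.scale_sum_right
      sg_def power_add mult_ac)
  also have "L1 v (P B (tensor2 (sym_tens vs) (sym_tens ws))) = (\<Sum>k<length vs. \<Sum>l<length ws.
       fscale ((-1) ^ (par V0 (vs ! k) * parl V0 (drop (Suc k) vs)
                       + par V0 (ws ! l) * parl V0 (take l ws)) * B (vs ! k) (ws ! l))
         (tensor2 (sym_tens (v # omit k vs)) (sym_tens (omit l ws))))"
    by (simp add: Cons.IH flinear_sum_arg[OF flinear_ops(1)] ops_tensor2)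
  finally show ?case
    by (simp add: sum.lessThan_Suc_shift omit_Cons add.commute del: sum.lessThan_Suc)
qed

lemma P_op:
  assumes B: "eform B"
  shows flinear_P_op: "flinear (P_op scl V0 V1 B)"
    and P_op_eq: "t \<in> A2 \<Longrightarrow> P_op scl V0 V1 B t = P B t"
proof -
  define f where "f = (\<lambda>(vs, ws). \<Sum>k<length vs. \<Sum>l<length ws.
       fscale ((-1) ^ (par V0 (vs ! k) * parl V0 (drop (Suc k) vs)
                       + par V0 (ws ! l) * parl V0 (take l ws)) * B (vs ! k) (ws ! l))
         (tensor2 (sym_tens (omit k vs)) (sym_tens (omit l ws))))"
  have e: "P B (case i of (vs, ws) \<Rightarrow> tensor2 (sym_tens vs) (sym_tens ws)) = f i" if "i \<in> HL \<times> HL" for i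
    using that P_sym_tens[OF B] unfolding f_def by (cases i) (simp only: mem_Sigma_iff prod.case)
  note l = lin_ext_eqI[where F = "P B" and I = "HL \<times> HL" and f = f
      and e = "\<lambda>(vs, ws). tensor2 (sym_tens vs) (sym_tens ws)", OF flinear_P e]
  have P_op: "P_op scl V0 V1 B = lin_ext (HL \<times> HL) (\<lambda>(vs, ws). tensor2 (sym_tens vs) (sym_tens ws)) f"
    unfolding P_op_def sprod_eq f_def ..
  show lin: "flinear (P_op scl V0 V1 B)"
    unfolding P_op by (rule l(1))
  have 1: "P_op scl V0 V1 B (tensor2 (sym_tens vs) (sym_tens ws)) = P B (tensor2 (sym_tens vs) (sym_tens ws))"
    if "vs \<in> HL" "ws \<in> HL" for vs ws
    using l(2)[of "(vs, ws)"] e[of "(vs, ws)"] that unfolding P_op by simp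
  have fl: "flinear (tensor2 a)" "flinear (\<lambda>a. tensor2 a a')" for a a' :: "('k, 'v) tensor"
    by (rule flinearI; simp add: tensor2_lin)+
  show "P_op scl V0 V1 B t = P B t" if "t \<in> A2"
  proof (rule A2_gen_eqI[OF lin flinear_P _ that])
    fix a b assume a: "a \<in> A" and b: "b \<in> A"
    have 2: "P_op scl V0 V1 B (tensor2 (sym_tens vs) b) = P B (tensor2 (sym_tens vs) b)" if "vs \<in> HL" for vs
      by (rule flinear_eq_on_span[where F = "\<lambda>b. P_op scl V0 V1 B (tensor2 (sym_tens vs) b)"
          and G = "\<lambda>b. P B (tensor2 (sym_tens vs) b)",
          OF flinear_compose[OF lin fl(1)] flinear_compose[OF flinear_P fl(1)] _ b[unfolded A_eq_span]])
        (use 1[OF that] in auto)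
    show "P_op scl V0 V1 B (tensor2 a b) = P B (tensor2 a b)"
      by (rule flinear_eq_on_span[where F = "\<lambda>a. P_op scl V0 V1 B (tensor2 a b)"
          and G = "\<lambda>a. P B (tensor2 a b)",
          OF flinear_compose[OF lin fl(2)] flinear_compose[OF flinear_P fl(2)] _ a[unfolded A_eq_span]])
        (use 2 in auto)
  qed
qed

end

subsection \<open>Exponentials of locally nilpotent operators\<close>

definition nilp :: "(('x \<Rightarrow> 'k::field) \<Rightarrow> 'x \<Rightarrow> 'k) \<Rightarrow> ('x \<Rightarrow> 'k) \<Rightarrow> bool"
  where "nilp X a \<longleftrightarrow> (\<exists>N. \<forall>n\<ge>N. (X ^^ n) a = 0)"

lemma nilp_step:
  assumes "nilp X (X a)" shows "nilp X a"
proof -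
  obtain N where N: "\<forall>n\<ge>N. (X ^^ n) (X a) = 0" using assms unfolding nilp_def by blast
  have "(X ^^ n) a = 0" if "n \<ge> Suc N" for n
    using N that by (cases n) (simp_all add: funpow_swap1)
  then show ?thesis unfolding nilp_def by blast
qed

lemma nilp_zero: "flinear X \<Longrightarrow> nilp X 0"
  unfolding nilp_def using flinearD(3)[OF flinear_funpow] by blast

lemma nilp_add:
  assumes "flinear X" "nilp X a" "nilp X b" shows "nilp X (a + b)"
proof -
  obtain N M where "\<forall>n\<ge>N. (X ^^ n) a = 0" "\<forall>n\<ge>M. (X ^^ n) b = 0" using assms unfolding nilp_def by blast
  then have "\<forall>n\<ge>max N M. (X ^^ n) (a + b) = 0" by (simp add: flinearD[OF flinear_funpow[OF assms(1)]])
  then show ?thesis unfolding nilp_def by blast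
qed

lemma nilp_fscale:
  assumes "flinear X" "nilp X a" shows "nilp X (fscale c a)"
proof -
  obtain N where "\<forall>n\<ge>N. (X ^^ n) a = 0" using assms unfolding nilp_def by blast
  then have "\<forall>n\<ge>N. (X ^^ n) (fscale c a) = 0" by (simp add: flinearD[OF flinear_funpow[OF assms(1)]])
  then show ?thesis unfolding nilp_def by blast
qed

lemma nilp_sum:
  assumes "flinear X" "\<And>i. i \<in> I \<Longrightarrow> nilp X (f i)" shows "nilp X (sum f I)"
  using assms(2) by (induction I rule: infinite_finite_induct) (simp_all add: nilp_zero nilp_add assms(1))

lemma nilp_span:
  assumes "flinear X" "\<And>b. b \<in> B \<Longrightarrow> nilp X b" "a \<in> FS.span B"
  shows "nilp X a"
  using assms(3) by (induction rule: fspan_induct) (simp_all add: nilp_zero nilp_add nilp_fscale assms(1,2))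

definition fexp :: "'k::real_normed_field \<Rightarrow> (('x \<Rightarrow> 'k) \<Rightarrow> 'x \<Rightarrow> 'k) \<Rightarrow> ('x \<Rightarrow> 'k) \<Rightarrow> 'x \<Rightarrow> 'k"
  where "fexp z X a = Sum_any (\<lambda>k. fscale (z ^ k / fact k) ((X ^^ k) a))"

lemma fexp_eq_sum:
  assumes "\<forall>n\<ge>N. (X ^^ n) a = 0"
  shows "fexp z X a = (\<Sum>k<N. fscale (z ^ k / fact k) ((X ^^ k) a))"
  unfolding fexp_def
proof (rule Sum_any.expand_superset)
  show "{k. fscale (z ^ k / fact k) ((X ^^ k) a) \<noteq> 0} \<subseteq> {..<N}"
    using assms by (force simp: not_less[symmetric])
qed simp

lemma funpow_closed: "(\<And>t. t \<in> Z \<Longrightarrow> X t \<in> Z) \<Longrightarrow> t \<in> Z \<Longrightarrow> (X ^^ n) t \<in> Z"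
  by (induction n) auto

lemma funpow_intertwine:
  assumes "\<And>t. t \<in> Z \<Longrightarrow> X t \<in> Z" "\<And>t. t \<in> Z \<Longrightarrow> F (X t) = Y (F t)" "t \<in> Z"
  shows "F ((X ^^ n) t) = (Y ^^ n) (F t)"
  by (induction n) (simp_all add: assms funpow_closed[of Z X])

text \<open>With \<open>F = mult\<close> this lifts \<open>Delta_op_mult\<close> to exponentials;
  with \<open>F\<close> a partial application of \<open>tensor2\<close> it reduces an exponential on
  the tensor square to one on a single factor.\<close>

lemma fexp_intertwine:
  assumes "\<And>t. t \<in> Z \<Longrightarrow> X t \<in> Z" "\<And>t. t \<in> Z \<Longrightarrow> F (X t) = Y (F t)" "t \<in> Z" "flinear F" "nilp X t"
  shows "F (fexp z X t) = fexp z Y (F t)"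
proof -
  obtain N where N: "\<forall>n\<ge>N. (X ^^ n) t = 0" using assms(5) unfolding nilp_def by blast
  have e: "F ((X ^^ n) t) = (Y ^^ n) (F t)" for n
    by (rule funpow_intertwine[of Z X F Y t n]) (use assms in auto)
  then have "\<forall>n\<ge>N. (Y ^^ n) (F t) = 0" using N flinearD(3)[OF assms(4)] by metis
  then show ?thesis using N
    by (simp add: fexp_eq_sum flinear_sum_arg[OF assms(4)] flinearD[OF assms(4)] e)
qed

lemma fexp_cong:
  assumes "\<And>t. t \<in> Z \<Longrightarrow> X t \<in> Z" "\<And>t. t \<in> Z \<Longrightarrow> X t = Y t" "t \<in> Z"
  shows "fexp z X t = fexp z Y t"
proof -
  have "(X ^^ n) t = (Y ^^ n) t" for n
    using funpow_intertwine[of Z X "\<lambda>t. t" Y t n] assms by simp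
  then show ?thesis by (simp add: fexp_def)
qed

lemma fexp_closed:
  assumes "FS.subspace Z" "\<And>t. t \<in> Z \<Longrightarrow> X t \<in> Z" "t \<in> Z" "nilp X t"
  shows "fexp z X t \<in> Z"
proof -
  obtain N where N: "\<forall>n\<ge>N. (X ^^ n) t = 0" using assms(4) unfolding nilp_def by blast
  show ?thesis unfolding fexp_eq_sum[OF N]
    by (intro FS.subspace_sum[OF assms(1)] FS.subspace_scale[OF assms(1)] funpow_closed assms(2,3))
qed

lemma fexp_add_arg:
  assumes "flinear X" "nilp X a" "nilp X b"
  shows "fexp z X (a + b) = fexp z X a + fexp z X b"
proof -
  obtain N M where "\<forall>n\<ge>N. (X ^^ n) a = 0" "\<forall>n\<ge>M. (X ^^ n) b = 0" using assms unfolding nilp_def by blast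
  then have *: "\<forall>n\<ge>max N M. (X ^^ n) a = 0" "\<forall>n\<ge>max N M. (X ^^ n) b = 0" "\<forall>n\<ge>max N M. (X ^^ n) (a + b) = 0"
    by (simp_all add: flinearD[OF flinear_funpow[OF assms(1)]])
  show ?thesis unfolding *[THEN fexp_eq_sum]
    by (simp add: flinearD[OF flinear_funpow[OF assms(1)]] FS.scale_right_distrib sum.distrib)
qed

lemma fexp_fscale_arg:
  assumes "flinear X" "nilp X a"
  shows "fexp z X (fscale c a) = fscale c (fexp z X a)"
proof -
  obtain N where N: "\<forall>n\<ge>N. (X ^^ n) a = 0" using assms unfolding nilp_def by blast
  then have *: "\<forall>n\<ge>N. (X ^^ n) (fscale c a) = 0"
    by (simp add: flinearD[OF flinear_funpow[OF assms(1)]])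
  show ?thesis unfolding N[THEN fexp_eq_sum] *[THEN fexp_eq_sum]
    by (simp add: flinearD[OF flinear_funpow[OF assms(1)]] FS.scale_sum_right mult.commute)
qed

lemma funpow_binomial:
  assumes X: "flinear X" and Y: "flinear Y"
    and XZ: "\<And>t. t \<in> Z \<Longrightarrow> X t \<in> Z" and YZ: "\<And>t. t \<in> Z \<Longrightarrow> Y t \<in> Z"
    and comm: "\<And>t. t \<in> Z \<Longrightarrow> X (Y t) = Y (X t)" and t: "t \<in> Z"
  shows "((\<lambda>t. X t + Y t) ^^ n) t = (\<Sum>k\<le>n. fscale (of_nat (n choose k)) ((X ^^ k) ((Y ^^ (n - k)) t)))"
proof (induction n)
  case 0
  then show ?case by simp
next
  case (Suc n)
  define f where "f k j = (X ^^ k) ((Y ^^ j) t)" for k j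
  have Xf: "X (f k j) = f (Suc k) j" for k j by (simp add: f_def)
  have Yf: "Y (f k j) = f k (Suc j)" for k j
  proof -
    have "Y ((X ^^ k) u) = (X ^^ k) (Y u)" if "u \<in> Z" for u
      by (rule funpow_intertwine[of Z X Y X u k]) (use XZ comm that in auto)
    then show ?thesis unfolding f_def using funpow_closed[of Z Y t j] YZ t by simp
  qed
  have "((\<lambda>t. X t + Y t) ^^ Suc n) t = X (\<Sum>k\<le>n. fscale (of_nat (n choose k)) (f k (n - k)))
      + Y (\<Sum>k\<le>n. fscale (of_nat (n choose k)) (f k (n - k)))"
    by (simp add: Suc.IH f_def)
  also have "\<dots> = (\<Sum>k\<le>n. fscale (of_nat (n choose k)) (f (Suc k) (n - k)))
      + (\<Sum>k\<le>n. fscale (of_nat (n choose k)) (f k (Suc (n - k))))"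
    by (simp add: flinear_sum_arg[OF X] flinear_sum_arg[OF Y] flinearD[OF X] flinearD[OF Y] Xf Yf)
  also have "(\<Sum>k\<le>n. fscale (of_nat (n choose k)) (f k (Suc (n - k))))
      = (\<Sum>k\<le>n. fscale (of_nat (n choose k)) (f k (Suc n - k)))"
    by (rule sum.cong) (simp_all add: Suc_diff_le)
  \<comment> \<open>The new summand has coefficient 0. It is added so that after splitting off
    \<open>k = 0\<close> both sums run over the same range and Pascal's rule combines them.\<close>
  also have "\<dots> = (\<Sum>k\<le>Suc n. fscale (of_nat (n choose k)) (f k (Suc n - k)))"
    by (simp add: binomial_eq_0)
  also have "\<dots> = f 0 (Suc n) + (\<Sum>k\<le>n. fscale (of_nat (n choose Suc k)) (f (Suc k) (n - k)))"
    unfolding sum.atMost_Suc_shift by simp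
  finally have "((\<lambda>t. X t + Y t) ^^ Suc n) t = f 0 (Suc n) +
      (\<Sum>k\<le>n. fscale (of_nat (Suc n choose Suc k)) (f (Suc k) (n - k)))"
    by (simp add: FS.scale_left_distrib sum.distrib add_ac)
  also have "\<dots> = (\<Sum>k\<le>Suc n. fscale (of_nat (Suc n choose k)) (f k (Suc n - k)))"
    unfolding sum.atMost_Suc_shift[of _ n] by simp
  finally show ?case unfolding f_def .
qed

context
  fixes X Y :: "('x \<Rightarrow> 'k::real_normed_field) \<Rightarrow> 'x \<Rightarrow> 'k" and Z and t
  assumes X: "flinear X" and Y: "flinear Y"
    and XZ: "\<And>t. t \<in> Z \<Longrightarrow> X t \<in> Z" and YZ: "\<And>t. t \<in> Z \<Longrightarrow> Y t \<in> Z"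
    and comm: "\<And>t. t \<in> Z \<Longrightarrow> X (Y t) = Y (X t)" and t: "t \<in> Z"
    and nX: "nilp X t" and nY: "nilp Y t"
begin

text \<open>Since the operators commute, either can be applied first, so nilpotency of each one
  gives a bound that is uniform in the exponent of the other.\<close>

lemma commuting_vanish:
  "\<exists>N M. (\<forall>k\<ge>M. \<forall>j. (X ^^ k) ((Y ^^ j) t) = 0) \<and> (\<forall>j\<ge>N. \<forall>k. (X ^^ k) ((Y ^^ j) t) = 0) \<and> (\<forall>j\<ge>N. (Y ^^ j) t = 0)"
proof -
  obtain N M where N: "\<forall>n\<ge>N. (Y ^^ n) t = 0" and M: "\<forall>n\<ge>M. (X ^^ n) t = 0" using nX nY unfolding nilp_def by blast
  have "(X ^^ k) ((Y ^^ j) t) = (Y ^^ j) ((X ^^ k) t)" for k j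
  proof -
    have c: "X ((Y ^^ j) u) = (Y ^^ j) (X u)" if "u \<in> Z" for u
      by (rule funpow_intertwine[of Z Y X Y u j]) (use YZ comm that in auto)
    show ?thesis
      by (rule sym, rule funpow_intertwine[of Z X "Y ^^ j" X t k]) (use XZ c t in auto)
  qed
  then have "(X ^^ k) ((Y ^^ j) t) = 0" if "k \<ge> M" for k j
    using M that flinearD(3)[OF flinear_funpow[OF Y]] by simp
  moreover have "(X ^^ k) ((Y ^^ j) t) = 0" if "j \<ge> N" for k j
    using N that flinearD(3)[OF flinear_funpow[OF X]] by simp
  ultimately show ?thesis using N by blast
qed

lemma commuting_sum_vanish:
  assumes "\<And>k j. k \<ge> M \<Longrightarrow> (X ^^ k) ((Y ^^ j) t) = 0" "\<And>k j. j \<ge> N \<Longrightarrow> (X ^^ k) ((Y ^^ j) t) = 0"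
  shows "\<forall>n\<ge>N + M. ((\<lambda>t. X t + Y t) ^^ n) t = 0"
proof (intro allI impI)
  fix n assume n: "n \<ge> N + M"
  have "(X ^^ k) ((Y ^^ (n - k)) t) = 0" if "k \<le> n" for k
    using assms(1)[of k "n - k"] assms(2)[of "n - k" k] n that by (cases "k \<ge> M") auto
  then show "((\<lambda>t. X t + Y t) ^^ n) t = 0"
    by (simp add: funpow_binomial[OF X Y XZ YZ comm t])
qed

lemma nilp_plus: "nilp (\<lambda>t. X t + Y t) t"
proof -
  obtain N M where "\<forall>k\<ge>M. \<forall>j. (X ^^ k) ((Y ^^ j) t) = 0" "\<forall>j\<ge>N. \<forall>k. (X ^^ k) ((Y ^^ j) t) = 0"
    using commuting_vanish by blast
  then have "\<forall>n\<ge>N + M. ((\<lambda>t. X t + Y t) ^^ n) t = 0" by (intro commuting_sum_vanish) simp_all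
  then show ?thesis unfolding nilp_def by blast
qed

lemma fexp_plus: "fexp z (\<lambda>t. X t + Y t) t = fexp z X (fexp z Y t)"
proof -
  obtain N M where NM': "\<forall>k\<ge>M. \<forall>j. (X ^^ k) ((Y ^^ j) t) = 0" "\<forall>j\<ge>N. \<forall>k. (X ^^ k) ((Y ^^ j) t) = 0"
    "\<forall>j\<ge>N. (Y ^^ j) t = 0"
    using commuting_vanish by blast
  have NM: "k \<ge> M \<Longrightarrow> (X ^^ k) ((Y ^^ j) t) = 0" "j \<ge> N \<Longrightarrow> (X ^^ k) ((Y ^^ j) t) = 0"
    "j \<ge> N \<Longrightarrow> (Y ^^ j) t = 0" for k j
    using NM' by blast+
  define g where "g k j = fscale (z ^ k / fact k * (z ^ j / fact j)) ((X ^^ k) ((Y ^^ j) t))" for k j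
  have Yt: "fexp z Y t = (\<Sum>j<N. fscale (z ^ j / fact j) ((Y ^^ j) t))"
    using NM(3) by (intro fexp_eq_sum) blast
  have "(X ^^ k) (fexp z Y t) = (\<Sum>j<N. fscale (z ^ j / fact j) ((X ^^ k) ((Y ^^ j) t)))" for k
    unfolding Yt flinear_sum_arg[OF flinear_funpow[OF X]] flinearD[OF flinear_funpow[OF X]] ..
  note Xk = this
  then have "\<forall>n\<ge>M. (X ^^ n) (fexp z Y t) = 0" using NM(1) by simp
  then have R: "fexp z X (fexp z Y t) = (\<Sum>k<M. \<Sum>j<N. g k j)"
    by (simp add: fexp_eq_sum Xk g_def FS.scale_sum_right)
  have "fexp z (\<lambda>t. X t + Y t) t = (\<Sum>n<N + M. fscale (z ^ n / fact n) (((\<lambda>t. X t + Y t) ^^ n) t))"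
    by (rule fexp_eq_sum[OF commuting_sum_vanish[OF NM(1,2)]])
  also have "\<dots> = (\<Sum>n<N + M. \<Sum>k\<le>n. g k (n - k))"
  proof (rule sum.cong[OF refl])
    fix n
    have "z ^ n / fact n * of_nat (n choose k) = z ^ k / fact k * (z ^ (n - k) / fact (n - k))" if "k \<le> n" for k
      using that by (simp add: binomial_fact field_simps flip: power_add)
    then show "fscale (z ^ n / fact n) (((\<lambda>t. X t + Y t) ^^ n) t) = (\<Sum>k\<le>n. g k (n - k))"
      by (simp add: funpow_binomial[OF X Y XZ YZ comm t] FS.scale_sum_right g_def)
  qed
  also have "\<dots> = (\<Sum>(k, j)\<in>{(k, j). k + j < N + M}. g k j)"
    by (rule sum.triangle_reindex[symmetric])
  \<comment> \<open>The Cauchy product lives on a triangle large enough to contain the rectangle on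
    which terms can be nonzero.\<close>
  also have "\<dots> = (\<Sum>(k, j)\<in>{..<M} \<times> {..<N}. g k j)"
  proof (rule sum.mono_neutral_right)
    show "finite {(k, j). k + j < N + M}"
      by (rule finite_subset[of _ "{..<N + M} \<times> {..<N + M}"]) auto
    show "\<forall>i\<in>{(k, j). k + j < N + M} - {..<M} \<times> {..<N}. (case i of (k, j) \<Rightarrow> g k j) = 0"
      using NM by (auto simp: g_def not_less)
  qed auto
  also have "\<dots> = (\<Sum>k<M. \<Sum>j<N. g k j)" by (simp add: sum.cartesian_product)
  finally show ?thesis using R by simp
qed

end

lemma funpow_uminus:
  fixes X :: "('x \<Rightarrow> 'k::field) \<Rightarrow> 'x \<Rightarrow> 'k"
  assumes "flinear X" shows "((\<lambda>t. - X t) ^^ n) t = fscale ((-1) ^ n) ((X ^^ n) t)"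
  by (induction n) (simp_all add: flinearD[OF assms] FS.scale_minus_left)

text \<open>\<open>exp (- z X)\<close> is \<open>exp (z (- X))\<close>, and the sum of the commuting
  operators \<open>X\<close> and \<open>- X\<close> is zero, so only the term of order 0
  remains.\<close>

lemma fexp_inverse:
  assumes X: "flinear X" and n: "nilp X t"
  shows "fexp z X (fexp (- z) X t) = t"
proof -
  obtain N where N: "\<forall>n\<ge>N. (X ^^ n) t = 0" using n unfolding nilp_def by blast
  have Y: "flinear (\<lambda>t. - X t)" by (rule flinearI) (simp_all add: flinearD[OF X])
  have "\<forall>n\<ge>N. ((\<lambda>t. - X t) ^^ n) t = 0" using N by (simp add: funpow_uminus[OF X])
  then have nY: "nilp (\<lambda>t. - X t) t" unfolding nilp_def by blast
  have "fexp (- z) X t = fexp z (\<lambda>t. - X t) t"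
    unfolding fexp_def funpow_uminus[OF X] by (simp add: power_minus[of z] mult.commute)
  then have "fexp z X (fexp (- z) X t) = fexp z (\<lambda>t. X t + - X t) t"
    using fexp_plus[where Z = UNIV, OF X Y _ _ _ _ n nY, of z] by (simp add: flinearD[OF X])
  also have "\<dots> = (\<Sum>k<1. fscale (z ^ k / fact k) (((\<lambda>t. X t + - X t) ^^ k) t))"
    by (rule fexp_eq_sum) (auto simp: Suc_le_eq gr0_conv_Suc)
  finally show ?thesis by simp
qed

context super_space
begin

section \<open>Local nilpotency and the equivalence on the symmetric algebra\<close>

text \<open>Each application shortens every word, so induction on the length with
  \<open>nilp_step\<close> suffices. The argument for \<open>P\<close> is the same, with the length
  of the first word.\<close>

lemma nilp_Delta_op:
  assumes g: "eform g" "gsym g" and x: "x \<in> A"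
  shows "nilp (Delta_op g) x"
proof -
  have "nilp (Delta_op g) (sym_tens vs)" if "vs \<in> HL" for vs
    using that
  proof (induction "length vs" arbitrary: vs rule: less_induct)
    case less
    have "nilp (Delta_op g) (Delta_op g (sym_tens vs))"
      unfolding Delta_op_sym_tens[OF g less.prems]
    proof (intro nilp_sum[OF flinear_Delta_op] nilp_fscale[OF flinear_Delta_op] less.hyps)
      fix j i assume "j \<in> {..<length vs}" "i \<in> {..<j}"
      then show "length (omit i (omit j vs)) < length vs" by (simp add: omit_def)
      show "omit i (omit j vs) \<in> HL"
        using less.prems unfolding omit_def by (auto dest: in_set_takeD in_set_dropD)
    qed
    then show ?case by (rule nilp_step)
  qed
  then show ?thesis using nilp_span[OF flinear_Delta_op _ x[unfolded A_eq_span]] by blast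
qed

lemma nilp_A2:
  assumes "flinear X" "\<And>a b. a \<in> A \<Longrightarrow> b \<in> A \<Longrightarrow> nilp X (tensor2 a b)" "t \<in> A2"
  shows "nilp X t"
  using nilp_span[OF assms(1) _ assms(3)[unfolded A2_def]] assms(2) by blast

lemma nilp_D:
  assumes g: "eform g" "gsym g" and t: "t \<in> A2"
  shows "nilp (D1 g) t" "nilp (D2 g) t"
proof -
  have 1: "(D1 g ^^ n) (tensor2 a b) = tensor2 ((Delta_op g ^^ n) a) b" for a b n
    by (induction n) (simp_all add: ops_tensor2)
  have 2: "(D2 g ^^ n) (tensor2 a b) = tensor2 a ((Delta_op g ^^ n) b)" for a b n
    by (induction n) (simp_all add: ops_tensor2)
  have "nilp (D1 g) (tensor2 a b)" "nilp (D2 g) (tensor2 a b)" if "a \<in> A" "b \<in> A" for a b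
    using nilp_Delta_op[OF g that(1)] nilp_Delta_op[OF g that(2)] unfolding nilp_def 1 2
    by (metis tensor2_zero)+
  then show "nilp (D1 g) t" "nilp (D2 g) t"
    using nilp_A2[OF flinear_ops(4) _ t] nilp_A2[OF flinear_ops(5) _ t] by blast+
qed

lemma omit_HL: "vs \<in> HL \<Longrightarrow> omit i vs \<in> HL"
  unfolding omit_def by (auto dest: in_set_takeD in_set_dropD)

lemma nilp_P:
  assumes B: "eform B" and t: "t \<in> A2"
  shows "nilp (P B) t"
proof (rule nilp_A2[OF flinear_P _ t])
  have 1: "nilp (P B) (tensor2 (sym_tens vs) (sym_tens ws))" if "vs \<in> HL" "ws \<in> HL" for vs ws
    using that
  proof (induction "length vs" arbitrary: vs ws rule: less_induct)
    case less
    have "nilp (P B) (P B (tensor2 (sym_tens vs) (sym_tens ws)))"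
      unfolding P_sym_tens[OF B less.prems]
    proof (intro nilp_sum[OF flinear_P] nilp_fscale[OF flinear_P] less.hyps)
      fix k l assume "k \<in> {..<length vs}" "l \<in> {..<length ws}"
      then show "length (omit k vs) < length vs" by (simp add: omit_def)
    qed (use less.prems omit_HL in auto)
    then show ?case by (rule nilp_step)
  qed
  fix a b assume a: "a \<in> A" and b: "b \<in> A"
  have 2: "nilp (P B) (tensor2 (sym_tens vs) b)" if "vs \<in> HL" for vs
    using b
    by (induction rule: fspan_A_induct)
      (simp_all add: tensor2_zero tensor2_lin nilp_zero nilp_add nilp_fscale flinear_P 1 that)
  show "nilp (P B) (tensor2 a b)"
    using a
    by (induction rule: fspan_A_induct)
      (simp_all add: tensor2_zero tensor2_lin nilp_zero nilp_add nilp_fscale flinear_P 2)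
qed

lemma exp_Delta_eq:
  assumes g: "eform g" "gsym g" and a: "a \<in> A"
  shows "exp_Delta scl V0 V1 g z a = fexp z (Delta_op g) a"
proof -
  have "exp_Delta scl V0 V1 g z a = fexp z (Delta scl V0 V1 g) a"
    unfolding exp_Delta_def fexp_def ..
  also have "\<dots> = fexp z (Delta_op g) a"
    by (rule fexp_cong[where Z = A]) (simp_all add: Delta_eq g Delta_op_A a)
  finally show ?thesis .
qed

lemma star_eq:
  assumes B: "eform B" and a: "a \<in> A" "b \<in> A"
  shows "star scl V0 V1 B z a b = mult (fexp z (P B) (tensor2 a b))"
proof -
  have e: "(P_op scl V0 V1 B ^^ k) (tensor2 a b) = (P B ^^ k) (tensor2 a b)" for k
    by (rule funpow_intertwine[of A2 "P B" "\<lambda>t. t" "P_op scl V0 V1 B" "tensor2 a b" k, symmetric])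
      (use B a in \<open>simp_all add: P_A2 P_op_eq\<close>)
  have A2: "(P B ^^ k) (tensor2 a b) \<in> A2" for k
    by (rule funpow_closed[of A2 "P B"]) (simp_all add: P_A2 B a)
  obtain N where N: "\<forall>n\<ge>N. (P B ^^ n) (tensor2 a b) = 0"
    using nilp_P[OF B tensor2_A2[OF a]] unfolding nilp_def by blast
  have "star scl V0 V1 B z a b = Sum_any (\<lambda>k. fscale (z ^ k / fact k) (mult ((P B ^^ k) (tensor2 a b))))"
    unfolding star_def by (simp add: e mu_eq A2)
  also have "\<dots> = (\<Sum>k<N. fscale (z ^ k / fact k) (mult ((P B ^^ k) (tensor2 a b))))"
  proof (rule Sum_any.expand_superset)
    show "{k. fscale (z ^ k / fact k) (mult ((P B ^^ k) (tensor2 a b))) \<noteq> 0} \<subseteq> {..<N}"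
    proof
      fix k assume "k \<in> {k. fscale (z ^ k / fact k) (mult ((P B ^^ k) (tensor2 a b))) \<noteq> 0}"
      then show "k \<in> {..<N}" using N by (cases "k < N") simp_all
    qed
  qed simp
  also have "\<dots> = mult (fexp z (P B) (tensor2 a b))"
    by (simp add: fexp_eq_sum[OF N] flinear_sum_arg[OF flinear_mult])
  finally show ?thesis .
qed

lemma exp_Delta_A:
  assumes g: "eform g" "gsym g" and a: "a \<in> A"
  shows "exp_Delta scl V0 V1 g z a \<in> A"
  unfolding exp_Delta_eq[OF assms]
  by (rule fexp_closed) (simp_all add: subspace_A Delta_op_A g a nilp_Delta_op)

lemma exp_Delta_add:
  assumes "eform g" "gsym g" "a \<in> A" "b \<in> A"
  shows "exp_Delta scl V0 V1 g z (a + b) = exp_Delta scl V0 V1 g z a + exp_Delta scl V0 V1 g z b"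
  using assms by (simp add: exp_Delta_eq fexp_add_arg flinear_Delta_op nilp_Delta_op)

lemma exp_Delta_fscale:
  assumes "eform g" "gsym g" "a \<in> A"
  shows "exp_Delta scl V0 V1 g z (fscale c a) = fscale c (exp_Delta scl V0 V1 g z a)"
  using assms by (simp add: exp_Delta_eq fexp_fscale_arg flinear_Delta_op nilp_Delta_op)

lemma exp_Delta_inverse:
  assumes g: "eform g" "gsym g" and a: "a \<in> A"
  shows "exp_Delta scl V0 V1 g z (exp_Delta scl V0 V1 g (- z) a) = a"
  using exp_Delta_A[OF g a, of "- z"] assms
  by (simp add: exp_Delta_eq fexp_inverse flinear_Delta_op nilp_Delta_op)

lemma star_A:
  assumes B: "eform B" and a: "a \<in> A" "b \<in> A"
  shows "star scl V0 V1 B z a b \<in> A"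
  unfolding star_eq[OF assms]
  by (rule mult_A, rule fexp_closed) (simp_all add: subspace_A2 P_A2 B a nilp_P)

lemma star_lin:
  assumes "eform B" "a \<in> A" "b \<in> A" "c \<in> A"
  shows "star scl V0 V1 B z (a + c) b = star scl V0 V1 B z a b + star scl V0 V1 B z c b"
    "star scl V0 V1 B z (fscale r a) b = fscale r (star scl V0 V1 B z a b)"
    "star scl V0 V1 B z a (b + c) = star scl V0 V1 B z a b + star scl V0 V1 B z a c"
    "star scl V0 V1 B z a (fscale r b) = fscale r (star scl V0 V1 B z a b)"
  using assms by (simp_all add: star_eq tensor2_lin fexp_add_arg fexp_fscale_arg flinear_P nilp_P)

theorem exp_Delta_star:
  assumes L: "eform \<Lambda>" and g: "eform g" "gsym g" and a: "a \<in> A" "b \<in> A"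
  shows "exp_Delta scl V0 V1 g z (star scl V0 V1 \<Lambda> z a b)
    = star scl V0 V1 (\<Lambda> + g) z (exp_Delta scl V0 V1 g z a) (exp_Delta scl V0 V1 g z b)"
proof -
  note L' = eform_plus[OF L g(1)]
  define t where "t = tensor2 a b"
  define D12 where "D12 = (\<lambda>t. D1 g t + D2 g t)"
  define S where "S = (\<lambda>t. D12 t + P g t)"
  have t: "t \<in> A2" by (simp add: t_def a)
  have fl: "flinear D12" "flinear S" unfolding D12_def S_def by (intro flinear_add flinear_ops flinear_P)+
  note lin = flinearD[OF fl(1)] flinearD[OF fl(2)]
  have cl: "D12 u \<in> A2" "S u \<in> A2" "P \<Lambda> u \<in> A2" "P g u \<in> A2" "P (\<Lambda> + g) u \<in> A2" if "u \<in> A2" for u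
    unfolding D12_def S_def using that g L L' by (simp_all add: D1_A2 D2_A2 P_A2)
  have D12P: "D12 (P B u) = P B (D12 u)" if "eform B" "u \<in> A2" for B u
    using that g by (simp add: D12_def D1_P D2_P)
  have SP: "S (P \<Lambda> u) = P \<Lambda> (S u)" if "u \<in> A2" for u
    using that L g by (simp add: S_def D12P P_P)
  have nD: "nilp D12 u" if "u \<in> A2" for u
    unfolding D12_def
    by (rule nilp_plus[where Z = A2]) (use that g in \<open>simp_all add: flinear_ops D1_A2 D2_A2 D1_D2 nilp_D\<close>)
  have nS: "nilp S u" if "u \<in> A2" for u
    unfolding S_def
    by (rule nilp_plus[where Z = A2]) (use that g in \<open>simp_all add: fl flinear_P cl D12P nD nilp_P\<close>)
  have e1: "fexp z S (fexp z (P \<Lambda>) t) = fexp z (\<lambda>u. S u + P \<Lambda> u) t"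
    by (rule fexp_plus[where Z = A2, symmetric]) (use t L in \<open>simp_all add: fl flinear_P cl SP nS nilp_P\<close>)
  have e2: "fexp z (\<lambda>u. S u + P \<Lambda> u) t = fexp z (\<lambda>u. P (\<Lambda> + g) u + D12 u) t"
    by (rule fexp_cong[where Z = A2]) (use t L g in \<open>simp_all add: cl P_plus, simp_all add: S_def algebra_simps\<close>)
  \<comment> \<open>The factors are ordered so that the exponential of \<open>D12\<close> meets
    \<open>a \<otimes> b\<close> directly, where it splits into one exponential on each
    factor.\<close>
  have e3: "fexp z (\<lambda>u. P (\<Lambda> + g) u + D12 u) t = fexp z (P (\<Lambda> + g)) (fexp z D12 t)"
    by (rule fexp_plus[where Z = A2]) (use t L' in \<open>simp_all add: fl flinear_P cl D12P nD nilp_P\<close>)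
  have e4: "fexp z D12 t = fexp z (D1 g) (fexp z (D2 g) t)"
    unfolding D12_def
    by (rule fexp_plus[where Z = A2]) (use t g in \<open>simp_all add: flinear_ops D1_A2 D2_A2 D1_D2 nilp_D\<close>)
  have ft: "flinear (tensor2 x)" "flinear (\<lambda>x. tensor2 x y)" for x y :: "('k, 'v) tensor"
    by (rule flinearI; simp add: tensor2_lin)+
  have e5: "fexp z (D2 g) t = tensor2 a (fexp z (Delta_op g) b)"
    unfolding t_def
    by (rule fexp_intertwine[where Z = A and F = "tensor2 a", symmetric])
      (use a g in \<open>simp_all add: Delta_op_A ops_tensor2 ft nilp_Delta_op\<close>)
  have e6: "fexp z (D1 g) (tensor2 a y) = tensor2 (fexp z (Delta_op g) a) y" for y
    by (rule fexp_intertwine[where Z = A and F = "\<lambda>x. tensor2 x y", symmetric])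
      (use a g in \<open>simp_all add: Delta_op_A ops_tensor2 ft nilp_Delta_op\<close>)
  have PA2: "fexp z (P \<Lambda>) t \<in> A2"
    by (rule fexp_closed) (use t L in \<open>simp_all add: subspace_A2 cl nilp_P\<close>)
  have "exp_Delta scl V0 V1 g z (star scl V0 V1 \<Lambda> z a b) = fexp z (Delta_op g) (mult (fexp z (P \<Lambda>) t))"
    using star_A[OF L a] by (simp add: exp_Delta_eq g star_eq L a t_def)
  also have "\<dots> = mult (fexp z S (fexp z (P \<Lambda>) t))"
    by (rule fexp_intertwine[where Z = A2, symmetric])
      (use PA2 g in \<open>simp_all add: cl flinear_mult nS Delta_op_mult, simp_all add: S_def D12_def\<close>)
  also have "\<dots> = mult (fexp z (P (\<Lambda> + g)) (tensor2 (fexp z (Delta_op g) a) (fexp z (Delta_op g) b)))"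
    by (simp add: e1 e2 e3 e4 e5 e6)
  also have "\<dots> = star scl V0 V1 (\<Lambda> + g) z (exp_Delta scl V0 V1 g z a) (exp_Delta scl V0 V1 g z b)"
    using exp_Delta_A[OF g a(1), of z] exp_Delta_A[OF g a(2), of z] by (simp add: star_eq[OF L'] exp_Delta_eq[OF g] a)
  finally show ?thesis .
qed

end

subsection \<open>Projective seminorms\<close>

text \<open>Working with \<open>gball e w I x r\<close>, i.e. \<open>x = \<Sum> c\<^sub>i e\<^sub>i\<close> with \<open>\<Sum> |c\<^sub>i| w\<^sub>i \<le> r\<close>, avoids
  the infimum in the projective seminorm.\<close>

inductive gball :: "('i \<Rightarrow> 'x \<Rightarrow> 'k::real_normed_field) \<Rightarrow> ('i \<Rightarrow> real) \<Rightarrow> 'i set \<Rightarrow> ('x \<Rightarrow> 'k) \<Rightarrow> real \<Rightarrow> bool"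
  for e w I where
  gball_zero: "0 \<le> r \<Longrightarrow> gball e w I 0 r"
| gball_step: "gball e w I x r \<Longrightarrow> i \<in> I \<Longrightarrow> r + norm c * w i \<le> s \<Longrightarrow> gball e w I (x + fscale c (e i)) s"

lemma gball_mono:
  assumes "gball e w I x r" "r \<le> s" shows "gball e w I x s"
  using assms(1)
proof cases
  case gball_zero
  then show ?thesis using assms(2) by (simp add: gball.gball_zero)
next
  case (gball_step y q i c)
  then show ?thesis using assms(2) gball.gball_step[of e w I y q i c s] by simp
qed

lemma gball_base: "i \<in> I \<Longrightarrow> norm c * w i \<le> r \<Longrightarrow> gball e w I (fscale c (e i)) r"
  using gball_step[OF gball_zero[OF order_refl], of i I c w r e] by simp

lemma gball_add: 
  assumes "gball e w I x r" "gball e w I y s"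
  shows "gball e w I (x + y) (r + s)"
  using assms(2)
proof induction
  case (gball_zero s)
  then show ?case using gball_mono[OF assms(1)] by simp
next
  case (gball_step y s i c s')
  then show ?case using gball.gball_step[OF gball_step(4,2), of c "r + s'"] by (simp add: add.assoc)
qed

lemma gball_scale:
  assumes "gball e w I x r" shows "gball e w I (fscale c x) (norm c * r)"
  using assms
proof induction
  case (gball_zero s)
  then show ?case by (simp add: gball.gball_zero)
next
  case (gball_step x r i d s)
  have "norm c * r + norm (c * d) * w i \<le> norm c * s"
    using mult_left_mono[OF gball_step(3) norm_ge_zero[of c]] by (simp add: norm_mult algebra_simps)
  from gball.gball_step[OF gball_step(4,2) this] show ?case by (simp add: FS.scale_right_distrib)
qed

lemma gball_sum:
  assumes "finite J" "\<And>j. j \<in> J \<Longrightarrow> gball e w I (f j) (r j)"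
  shows "gball e w I (sum f J) (sum r J)"
  using assms by (induction J rule: finite_induct) (auto intro: gball_zero gball_add)

text \<open>This reduces estimates of linear operators to generators: only the cost of the image of
  a single word has to be computed.\<close>

lemma gball_map:
  assumes F: "flinear F" and e: "\<And>i. i \<in> I \<Longrightarrow> gball e' w' I' (F (e i)) (C * w i)" and "gball e w I x r" "C \<ge> 0"
  shows "gball e' w' I' (F x) (C * r)"
  using assms(3)
proof induction
  case (gball_zero s)
  then show ?case using assms(4) by (simp add: flinearD[OF F] gball.gball_zero)
next
  case (gball_step x r i c s)
  have "C * r + norm c * (C * w i) \<le> C * s"
    using mult_left_mono[OF gball_step(3) assms(4)] by (simp add: algebra_simps)
  with gball_add[OF gball_step(4) gball_scale[OF e[OF gball_step(2)], of c]]
  show ?case by (auto simp: flinearD[OF F] intro: gball_mono)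
qed

lemma gball_span: "x \<in> FS.span (e ` I) \<Longrightarrow> \<exists>r. gball e w I x r"
proof (induction rule: fspan_induct)
  case base
  then show ?case using gball_zero[of 0] by blast
next
  case (step c b y)
  then obtain i r where "b = e i" "i \<in> I" "gball e w I y r" by blast
  then show ?case using gball_step[of e w I y r i c "r + norm c * w i"] by (auto simp: add.commute)
qed

lemma gball_in:
  assumes "gball e w I x r" "FS.subspace Z" "\<And>i. i \<in> I \<Longrightarrow> e i \<in> Z"
  shows "x \<in> Z"
  using assms(1)
  by induction (simp_all add: FS.subspace_0[OF assms(2)] FS.subspace_add[OF assms(2)] FS.subspace_scale[OF assms(2)] assms(3))

lemma gball_nonneg: "gball e w I x r \<Longrightarrow> (\<And>i. i \<in> I \<Longrightarrow> w i \<ge> 0) \<Longrightarrow> 0 \<le> r"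
proof (induction rule: gball.induct)
  case (gball_step x r i c s)
  have "0 \<le> norm c * w i" using gball_step by simp
  moreover have "0 \<le> r" using gball_step(4,5) by blast
  ultimately show ?case using gball_step(3) by linarith
qed

lemma gball_bound:
  assumes "gball e w I x r" "FS.subspace Z" "\<And>i. i \<in> I \<Longrightarrow> e i \<in> Z"
    "\<And>x y. x \<in> Z \<Longrightarrow> y \<in> Z \<Longrightarrow> \<phi> (x + y) \<le> \<phi> x + \<phi> y"
    "\<And>c x. x \<in> Z \<Longrightarrow> \<phi> (fscale c x) \<le> norm c * (\<phi> x :: real)"
    "\<And>i. i \<in> I \<Longrightarrow> \<phi> (e i) \<le> C * w i" "C \<ge> 0"
  shows "\<phi> x \<le> C * r"
  using assms(1)
proof induction
  case (gball_zero s)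
  have "\<phi> 0 \<le> 0" using assms(5)[of 0 0] FS.subspace_0[OF assms(2)] by simp
  then show ?case using gball_zero assms(7) by (meson mult_nonneg_nonneg order_trans)
next
  case (gball_step x r i c s)
  have x: "x \<in> Z" by (rule gball_in[OF gball_step(1) assms(2,3)])
  have ei: "e i \<in> Z" "fscale c (e i) \<in> Z" using assms(3)[OF gball_step(2)] FS.subspace_scale[OF assms(2)] by auto
  have "\<phi> (x + fscale c (e i)) \<le> \<phi> x + \<phi> (fscale c (e i))" by (rule assms(4)[OF x ei(2)])
  also have "\<dots> \<le> C * r + norm c * (C * w i)"
    using gball_step(4) assms(5)[OF ei(1), of c] mult_left_mono[OF assms(6)[OF gball_step(2)] norm_ge_zero[of c]] by linarith
  also have "\<dots> \<le> C * s"
    using mult_left_mono[OF gball_step(3) assms(7)] by (simp add: algebra_simps)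
  finally show ?case .
qed

section \<open>Inequalities between factorials\<close>

text \<open>The left side is \<open>a powr R\<close> times \<open>(a / b) powr (1 - R)\<close>, and
  since \<open>a / b\<close> is at least 1, the exponent \<open>1 - R\<close> may be raised to
  \<open>1/2\<close>. This is where the threshold for \<open>R\<close> comes from.\<close>

lemma fact_ratio_powr:
  fixes a b R :: real
  assumes "0 < b" "b \<le> a" "R \<ge> 1/2"
  shows "a / b * b powr R \<le> a powr R * sqrt (a / b)"
proof -
  have "a / b * b powr R = a powr R * (a / b) powr (1 - R)"
    using assms by (simp add: powr_diff powr_divide)
  also have "\<dots> \<le> a powr R * (a / b) powr (1/2)"
    using assms by (intro mult_left_mono powr_mono) auto
  finally show ?thesis using assms by (simp add: powr_half_sqrt)
qed

text \<open>Each binomial coefficient is at least 1. The bound turns a geometric sum of length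
  \<open>n\<close> into an \<open>n\<close>-th power, which a rescaling of the seminorm
  absorbs.\<close>

lemma sum_power_le_binomial: "(x::real) \<ge> 0 \<Longrightarrow> (\<Sum>k\<le>n. x ^ k) \<le> (1 + x) ^ n"
proof -
  assume x: "x \<ge> 0"
  have "(\<Sum>k\<le>n. x ^ k) \<le> (\<Sum>k\<le>n. of_nat (n choose k) * x ^ k)"
  proof (rule sum_mono)
    fix k assume "k \<in> {..n}"
    then have "real (n choose k) \<ge> 1" by (simp add: Suc_le_eq)
    then show "x ^ k \<le> of_nat (n choose k) * x ^ k" using x by (simp add: mult_le_cancel_right1)
  qed
  also have "\<dots> = (x + 1) ^ n" by (simp add: binomial_ring)
  finally show ?thesis by (simp add: add.commute)
qed

lemma fact_ratio_le: "k \<le> n \<Longrightarrow> (fact n / fact (n - k) :: real) \<le> 2 ^ n * fact k"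
proof -
  assume "k \<le> n"
  then have "(fact n / fact (n - k) :: real) = real (n choose k) * fact k" by (simp add: binomial_fact)
  also have "real (n choose k) \<le> 2 ^ n"
    using binomial_le_pow2[of n k] by (metis of_nat_le_iff of_nat_numeral of_nat_power)
  finally show ?thesis by (simp add: mult_right_mono)
qed

lemma fact_add_le: "(fact (n + m) :: real) \<le> 2 ^ (n + m) * (fact n * fact m)"
  using fact_ratio_le[of m "n + m"] by (simp add: field_simps)

context super_space
begin

abbreviation "pl p vs \<equiv> prod_list (map p vs)"
abbreviation "HLn n \<equiv> {vs \<in> HL. length vs = n}"
abbreviation "tball p n \<equiv> gball (tens scl) (pl p) {vs. length vs = n}"
abbreviation "sball p n \<equiv> gball sym_tens (pl p) (HLn n)"

text \<open>For such seminorms, splitting an entry of a word into its parts preserves the total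
  weight, so restricting to homogeneous words does not make representations more expensive.\<close>

definition gseminorm :: "('v \<Rightarrow> real) \<Rightarrow> bool"
  where "gseminorm p \<longleftrightarrow> seminorm scl p \<and> (\<forall>v. p v = p (p0 v) + p (p1 v))"

lemma gseminormD:
  assumes "gseminorm p" shows "seminorm scl p" "p v = p (p0 v) + p (p1 v)"
  using assms unfolding gseminorm_def by blast+

lemma seminormD:
  assumes "seminorm scl p"
  shows "0 \<le> p v" "p (v + w) \<le> p v + p w" "p (scl c v) = norm c * p v"
  using assms by (auto simp: seminorm_def)

lemma pl_nonneg: "seminorm scl p \<Longrightarrow> 0 \<le> pl p vs"
  by (induction vs) (auto simp: seminormD)

lemma tball_iff_list:
  assumes "seminorm scl p"
  shows "tball p n t r \<longleftrightarrow> (\<exists>L. (\<forall>(c, vs)\<in>set L. length vs = n) \<and> (\<Sum>(c, vs)\<leftarrow>L. fscale c (tens scl vs)) = t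
    \<and> (\<Sum>(c, vs)\<leftarrow>L. norm c * pl p vs) \<le> r)"
proof
  assume "tball p n t r"
  then show "\<exists>L. (\<forall>(c, vs)\<in>set L. length vs = n) \<and> (\<Sum>(c, vs)\<leftarrow>L. fscale c (tens scl vs)) = t
    \<and> (\<Sum>(c, vs)\<leftarrow>L. norm c * pl p vs) \<le> r"
  proof induction
    case (gball_zero s)
    then show ?case by (intro exI[of _ "[]"]) simp
  next
    case (gball_step x r vs c s)
    then obtain L where "\<forall>(c, vs)\<in>set L. length vs = n" "(\<Sum>(c, vs)\<leftarrow>L. fscale c (tens scl vs)) = x"
      "(\<Sum>(c, vs)\<leftarrow>L. norm c * pl p vs) \<le> r" by blast
    then have "\<forall>(c, vs)\<in>set ((c, vs) # L). length vs = n"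
      "(\<Sum>(c, vs)\<leftarrow>(c, vs) # L. fscale c (tens scl vs)) = x + fscale c (tens scl vs)"
      "(\<Sum>(c, vs)\<leftarrow>(c, vs) # L. norm c * pl p vs) \<le> r + norm c * pl p vs"
      using gball_step(2) by (simp_all add: add.commute)
    with gball_step(3) show ?case by (meson order_trans)
  qed
next
  have *: "tball p n (\<Sum>(c, vs)\<leftarrow>L. fscale c (tens scl vs)) (\<Sum>(c, vs)\<leftarrow>L. norm c * pl p vs)"
    if "\<forall>(c, vs)\<in>set L. length vs = n" for L :: "('k \<times> 'v list) list"
    using that
  proof (induction L)
    case Nil
    then show ?case by (simp add: gball_zero)
  next
    case (Cons x L)
    obtain c vs where x: "x = (c, vs)" by (cases x)
    have "tball p n (fscale c (tens scl vs)) (norm c * pl p vs)"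
      by (rule gball_base) (use Cons.prems x in auto)
    from gball_add[OF this Cons.IH] Cons.prems show ?case by (simp add: x)
  qed
  assume "\<exists>L. (\<forall>(c, vs)\<in>set L. length vs = n) \<and> (\<Sum>(c, vs)\<leftarrow>L. fscale c (tens scl vs)) = t
    \<and> (\<Sum>(c, vs)\<leftarrow>L. norm c * pl p vs) \<le> r"
  then obtain L where L: "\<forall>(c, vs)\<in>set L. length vs = n" "(\<Sum>(c, vs)\<leftarrow>L. fscale c (tens scl vs)) = t"
    "(\<Sum>(c, vs)\<leftarrow>L. norm c * pl p vs) \<le> r" by blast
  from gball_mono[OF *[OF L(1)] L(3)] L(2) show "tball p n t r" by simp
qed

lemma list_cost_nonneg: "seminorm scl p \<Longrightarrow> 0 \<le> (\<Sum>(c, vs)\<leftarrow>xs. norm c * pl p vs)"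
  by (intro sum_list_nonneg) (auto simp: pl_nonneg)

lemma proj_seminorm_le:
  assumes p: "seminorm scl p" and t: "tball p n t r"
  shows "proj_seminorm scl p n t \<le> r"
proof -
  obtain L where L: "\<forall>(c, vs)\<in>set L. length vs = n" "(\<Sum>(c, vs)\<leftarrow>L. fscale c (tens scl vs)) = t"
    "(\<Sum>(c, vs)\<leftarrow>L. norm c * pl p vs) \<le> r" using t unfolding tball_iff_list[OF p] by blast
  have "proj_seminorm scl p n t \<le> (\<Sum>(c, vs)\<leftarrow>L. norm c * pl p vs)"
    unfolding proj_seminorm_def
    by (rule cInf_lower) (use L list_cost_nonneg[OF p] in \<open>auto intro!: bdd_belowI[of _ 0]\<close>)
  then show ?thesis using L by simp
qed

lemma tball_ex: "t \<in> tensor_power scl n \<Longrightarrow> \<exists>r. tball p n t r"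
proof -
  have e: "{tens scl vs | vs. length vs = n} = tens scl ` {vs. length vs = n}" by blast
  show "t \<in> tensor_power scl n \<Longrightarrow> \<exists>r. tball p n t r"
    unfolding tensor_power_def e by (rule gball_span)
qed

text \<open>Membership in the tensor power makes the set of costs nonempty. The infimum need not be
  attained, hence the strict inequality and the epsilons in what follows.\<close>

lemma proj_seminorm_less:
  assumes p: "seminorm scl p" and t: "t \<in> tensor_power scl n" and r: "proj_seminorm scl p n t < r"
  shows "tball p n t r"
proof -
  let ?S = "{(\<Sum>(c, vs)\<leftarrow>L. norm c * pl p vs) | L.
          (\<forall>(c, vs)\<in>set L. length vs = n) \<and> (\<Sum>(c, vs)\<leftarrow>L. fscale c (tens scl vs)) = t}"
  obtain r' where "tball p n t r'" using tball_ex[OF t] by blast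
  then have "?S \<noteq> {}" unfolding tball_iff_list[OF p] by blast
  from cInf_lessD[OF this r[unfolded proj_seminorm_def]]
  show ?thesis unfolding tball_iff_list[OF p] by (auto intro: less_imp_le)
qed

lemma proj_seminorm_nonneg:
  assumes p: "seminorm scl p" and t: "t \<in> tensor_power scl n"
  shows "0 \<le> proj_seminorm scl p n t"
proof (rule ccontr)
  assume "\<not> ?thesis"
  then have "tball p n t (proj_seminorm scl p n t / 2)" by (intro proj_seminorm_less[OF p t]) simp
  from gball_nonneg[OF this] pl_nonneg[OF p] \<open>\<not> ?thesis\<close> show False by simp
qed

lemma subspace_tensor_power: "FS.subspace (tensor_power scl n)"
  unfolding tensor_power_def by (rule FS.subspace_span)

lemma proj_seminorm_zero: "seminorm scl p \<Longrightarrow> proj_seminorm scl p n 0 = 0"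
  using proj_seminorm_le[OF _ gball_zero[OF order_refl]] proj_seminorm_nonneg[of p 0 n]
    FS.subspace_0[OF subspace_tensor_power] by (intro antisym) auto

lemma proj_seminorm_add:
  assumes p: "seminorm scl p" and t: "t \<in> tensor_power scl n" "u \<in> tensor_power scl n"
  shows "proj_seminorm scl p n (t + u) \<le> proj_seminorm scl p n t + proj_seminorm scl p n u"
proof (rule field_le_epsilon)
  fix \<epsilon> :: real assume "\<epsilon> > 0"
  then have "tball p n t (proj_seminorm scl p n t + \<epsilon> / 2)" "tball p n u (proj_seminorm scl p n u + \<epsilon> / 2)"
    by (intro proj_seminorm_less[OF p] t; simp)+
  from proj_seminorm_le[OF p gball_add[OF this]]
  show "proj_seminorm scl p n (t + u) \<le> proj_seminorm scl p n t + proj_seminorm scl p n u + \<epsilon>" by simp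
qed

lemma proj_seminorm_scale:
  assumes p: "seminorm scl p" and t: "t \<in> tensor_power scl n"
  shows "proj_seminorm scl p n (fscale c t) \<le> norm c * proj_seminorm scl p n t"
proof (rule field_le_epsilon)
  fix \<epsilon> :: real assume e: "\<epsilon> > 0"
  \<comment> \<open>The \<open>+ 1\<close> guards against \<open>c = 0\<close>.\<close>
  define \<delta> where "\<delta> = \<epsilon> / (norm c + 1)"
  have pos: "norm c + 1 > 0" using norm_ge_zero[of c] by linarith
  have d: "\<delta> > 0" "norm c * \<delta> \<le> \<epsilon>" using e pos
    by (auto simp: \<delta>_def field_simps)
  have "tball p n t (proj_seminorm scl p n t + \<delta>)" by (intro proj_seminorm_less[OF p] t) (simp add: d)
  from proj_seminorm_le[OF p gball_scale[OF this, of c]] d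
  show "proj_seminorm scl p n (fscale c t) \<le> norm c * proj_seminorm scl p n t + \<epsilon>" by (simp add: distrib_left)
qed

lemma pl_mono: "seminorm scl p \<Longrightarrow> (\<And>v. p v \<le> q v) \<Longrightarrow> pl p vs \<le> pl q vs"
  by (induction vs) (auto intro!: mult_mono simp: pl_nonneg seminormD intro: order_trans[OF seminormD(1)])

lemma proj_seminorm_mono:
  assumes p: "seminorm scl p" "seminorm scl q" "\<And>v. p v \<le> q v" and t: "t \<in> tensor_power scl n"
  shows "proj_seminorm scl p n t \<le> proj_seminorm scl q n t"
proof (rule field_le_epsilon)
  fix \<epsilon> :: real assume "\<epsilon> > 0"
  then have "tball q n t (proj_seminorm scl q n t + \<epsilon>)" by (intro proj_seminorm_less[OF p(2)] t) simp
  then have "tball p n t (1 * (proj_seminorm scl q n t + \<epsilon>))"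
  proof (rule gball_map[OF flinear_id, rotated])
    fix vs :: "'v list" assume "vs \<in> {vs. length vs = n}"
    then show "tball p n (tens scl vs) (1 * pl q vs)"
      using gball_base[of vs "{vs. length vs = n}" 1 "pl p" "1 * pl q vs" "tens scl"] pl_mono[OF p(1,3)] by simp
  qed simp
  then show "proj_seminorm scl p n t \<le> proj_seminorm scl q n t + \<epsilon>"
    using proj_seminorm_le[OF p(1)] by simp
qed

subsection \<open>The seminorms on the symmetric algebra\<close>

lemma sym_tens_tensor_power: "sym_tens vs \<in> tensor_power scl (length vs)"
proof -
  have 1: "sym_tens vs \<in> tensor_power scl (length vs)" if "vs \<in> HL" for vs
    unfolding sym_tens_hom[OF that refl] tensor_power_def
    by (intro FS.span_scale FS.span_sum FS.span_base) (use length_permute_list in blast)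
  have "sym_tens (us @ vs) \<in> tensor_power scl (length (us @ vs))" if "us \<in> HL" for us
    using that
  proof (induction vs arbitrary: us)
    case Nil
    then show ?case using 1 by simp
  next
    case (Cons v vs)
    have "sym_tens (us @ (p0 v + p1 v) # vs) \<in> tensor_power scl (length (us @ v # vs))"
      unfolding multilinearD(1)[OF sym_tens_multilinear]
      using Cons.IH[of "us @ [p0 v]"] Cons.IH[of "us @ [p1 v]"] Cons.prems
      by (simp add: FS.subspace_add[OF subspace_tensor_power])
    then show ?case by (simp add: p_sum)
  qed
  from this[of "[]"] show ?thesis by simp
qed

lemma homog_comp_tensor_power:
  assumes "t \<in> tensor_power scl m"
  shows "homog_comp scl n t = (if n = m then t else 0)"
  using assms[unfolded tensor_power_def]
  by (induction rule: fspan_induct) (auto simp: flinearD[OF flinear_homog_comp] homog_comp_tens')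

lemma homog_comp_sym_tens: "homog_comp scl n (sym_tens vs) = (if n = length vs then sym_tens vs else 0)"
  by (rule homog_comp_tensor_power[OF sym_tens_tensor_power])

lemma homog_comp_A:
  assumes "a \<in> A"
  shows "homog_comp scl n a \<in> A" "homog_comp scl n a \<in> tensor_power scl n"
proof -
  have "homog_comp scl n a \<in> A \<and> homog_comp scl n a \<in> tensor_power scl n"
    using assms
    by (induction rule: fspan_A_induct)
      (simp_all add: flinearD[OF flinear_homog_comp] homog_comp_sym_tens sym_tens_tensor_power
        FS.subspace_0[OF subspace_tensor_power] FS.subspace_add[OF subspace_tensor_power] FS.subspace_scale[OF subspace_tensor_power])
  then show "homog_comp scl n a \<in> A" "homog_comp scl n a \<in> tensor_power scl n" by auto
qed

lemma A_decompose:
  assumes "a \<in> A"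
  obtains N where "\<forall>n\<ge>N. homog_comp scl n a = 0" "a = (\<Sum>n<N. homog_comp scl n a)"
proof -
  \<comment> \<open>The decomposition is claimed for every larger bound as well, so that in the
    induction two bounds can be raised to a common one.\<close>
  have "\<exists>N. (\<forall>n\<ge>N. homog_comp scl n a = 0) \<and> (\<forall>M\<ge>N. a = (\<Sum>n<M. homog_comp scl n a))"
    using assms
  proof (induction rule: fspan_A_induct)
    case base
    then show ?case by (simp add: flinearD[OF flinear_homog_comp])
  next
    case (step c vs y)
    then obtain N where N: "\<forall>n\<ge>N. homog_comp scl n y = 0" "\<And>M. M\<ge>N \<Longrightarrow> (\<Sum>n<M. homog_comp scl n y) = y" by metis
    let ?N = "max N (Suc (length vs))"
    have "(\<Sum>n<M. homog_comp scl n (fscale c (sym_tens vs) + y)) = fscale c (sym_tens vs) + y" if "M \<ge> ?N" for M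
    proof -
      have "(\<Sum>n<M. homog_comp scl n (sym_tens vs)) = sym_tens vs"
        using that by (simp add: homog_comp_sym_tens)
      then show ?thesis using N(2)[of M] that
        by (simp add: flinearD[OF flinear_homog_comp] sum.distrib flip: FS.scale_sum_right)
    qed
    moreover have "\<forall>n\<ge>?N. homog_comp scl n (fscale c (sym_tens vs) + y) = 0"
      using N(1) by (simp add: flinearD[OF flinear_homog_comp] homog_comp_sym_tens)
    ultimately show ?case by metis
  qed
  then show thesis using that by blast
qed

lemma weyl_seminorm_eq_sum:
  assumes "seminorm scl p" "\<forall>n\<ge>N. homog_comp scl n a = 0"
  shows "weyl_seminorm scl R p a = (\<Sum>n<N. proj_seminorm scl p n (homog_comp scl n a) * fact n powr R)"
  unfolding weyl_seminorm_def
proof (rule Sum_any.expand_superset)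
  show "{n. proj_seminorm scl p n (homog_comp scl n a) * fact n powr R \<noteq> 0} \<subseteq> {..<N}"
    using assms(2) proj_seminorm_zero[OF assms(1)] by (auto simp: not_less[symmetric])
qed simp

lemma weyl_seminorm_nonneg:
  assumes "seminorm scl p" "a \<in> A" shows "0 \<le> weyl_seminorm scl R p a"
proof -
  obtain N where N: "\<forall>n\<ge>N. homog_comp scl n a = 0" by (rule A_decompose[OF assms(2)])
  show ?thesis unfolding weyl_seminorm_eq_sum[OF assms(1) N]
    by (intro sum_nonneg mult_nonneg_nonneg proj_seminorm_nonneg[OF assms(1)] homog_comp_A[OF assms(2)]) simp
qed

lemma weyl_seminorm_add:
  assumes p: "seminorm scl p" and a: "a \<in> A" "b \<in> A"
  shows "weyl_seminorm scl R p (a + b) \<le> weyl_seminorm scl R p a + weyl_seminorm scl R p b"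
proof -
  obtain N M where "\<forall>n\<ge>N. homog_comp scl n a = 0" "\<forall>n\<ge>M. homog_comp scl n b = 0"
    using A_decompose[OF a(1)] A_decompose[OF a(2)] by metis
  then have "\<forall>n\<ge>max N M. homog_comp scl n a = 0" "\<forall>n\<ge>max N M. homog_comp scl n b = 0"
    "\<forall>n\<ge>max N M. homog_comp scl n (a + b) = 0" by (simp_all add: flinearD[OF flinear_homog_comp])
  note e = this[THEN weyl_seminorm_eq_sum[OF p]]
  show ?thesis unfolding e sum.distrib[symmetric]
  proof (rule sum_mono)
    fix n
    show "proj_seminorm scl p n (homog_comp scl n (a + b)) * fact n powr R
      \<le> proj_seminorm scl p n (homog_comp scl n a) * fact n powr R + proj_seminorm scl p n (homog_comp scl n b) * fact n powr R"
      using proj_seminorm_add[OF p homog_comp_A(2)[OF a(1)] homog_comp_A(2)[OF a(2)], of n]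
      by (simp add: flinearD[OF flinear_homog_comp] mult_right_mono flip: distrib_right)
  qed
qed

lemma weyl_seminorm_scale_le:
  assumes p: "seminorm scl p" and a: "a \<in> A"
  shows "weyl_seminorm scl R p (fscale c a) \<le> norm c * weyl_seminorm scl R p a"
proof -
  obtain N where "\<forall>n\<ge>N. homog_comp scl n a = 0"
    using A_decompose[OF a] by metis
  then have "\<forall>n\<ge>N. homog_comp scl n a = 0" "\<forall>n\<ge>N. homog_comp scl n (fscale c a) = 0"
    by (simp_all add: flinearD[OF flinear_homog_comp])
  note e = this[THEN weyl_seminorm_eq_sum[OF p]]
  show ?thesis unfolding e sum_distrib_left
  proof (rule sum_mono)
    fix n
    show "proj_seminorm scl p n (homog_comp scl n (fscale c a)) * fact n powr R
      \<le> norm c * (proj_seminorm scl p n (homog_comp scl n a) * fact n powr R)"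
      using proj_seminorm_scale[OF p homog_comp_A(2)[OF a], of n c]
      by (simp add: flinearD[OF flinear_homog_comp] mult_right_mono flip: mult.assoc)
  qed
qed

lemma weyl_seminorm_mono:
  assumes p: "seminorm scl p" "seminorm scl q" "\<And>v. p v \<le> q v" and a: "a \<in> A"
  shows "weyl_seminorm scl R p a \<le> weyl_seminorm scl R q a"
proof -
  obtain N where N: "\<forall>n\<ge>N. homog_comp scl n a = 0"
    using A_decompose[OF a] by metis
  show ?thesis unfolding N[THEN weyl_seminorm_eq_sum[OF p(1)]] N[THEN weyl_seminorm_eq_sum[OF p(2)]]
    by (intro sum_mono mult_right_mono proj_seminorm_mono p homog_comp_A a) simp
qed

lemma norm_koszul: "norm (koszul V0 \<sigma> vs :: 'k) = 1"
  by (simp add: koszul_def norm_power)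

lemma pl_permute: "\<sigma> permutes {..<length vs} \<Longrightarrow> pl p (permute_list \<sigma> vs) = (pl p vs :: real)"
proof -
  assume "\<sigma> permutes {..<length vs}"
  then have "mset (map p (permute_list \<sigma> vs)) = mset (map p vs)" by (simp only: mset_map mset_permute_list)
  then have "prod_mset (mset (map p (permute_list \<sigma> vs))) = prod_mset (mset (map p vs))" by (rule arg_cong)
  then show ?thesis unfolding prod_mset_prod_list .
qed

text \<open>A symmetrised word is an average of \<open>n!\<close> words with signs of modulus 1, and
  permuting the letters does not change their weight.\<close>

lemma sball_imp_tball:
  assumes p: "seminorm scl p" and x: "sball p n x r"
  shows "tball p n x r"
proof -
  have "tball p n x (1 * r)"
    using x
  proof (rule gball_map[OF flinear_id, rotated])
    fix vs assume vs: "vs \<in> HLn n"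
    let ?P = "{\<sigma>. \<sigma> permutes {..<n}}"
    have "tball p n (\<Sum>\<sigma>\<in>?P. fscale (koszul V0 \<sigma> vs) (tens scl (permute_list \<sigma> vs))) (\<Sum>\<sigma>\<in>?P. pl p vs)"
      using vs by (intro gball_sum gball_base) (auto simp: norm_koszul pl_permute finite_permutations)
    from gball_scale[OF this, of "1 / fact n"]
    show "tball p n (sym_tens vs) (1 * pl p vs)"
      using vs by (simp add: sym_tens_hom[of vs n] card_permutations[OF card_lessThan finite_lessThan] norm_divide)
  qed simp
  then show ?thesis by simp
qed

lemma weyl_seminorm_sball:
  assumes p: "seminorm scl p" and x: "sball p n x r"
  shows "weyl_seminorm scl R p x \<le> fact n powr R * r"
proof -
  have tp: "x \<in> tensor_power scl n"
    by (rule gball_in[OF x subspace_tensor_power]) (use sym_tens_tensor_power in auto)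
  have "\<forall>m\<ge>Suc n. homog_comp scl m x = 0" by (simp add: homog_comp_tensor_power[OF tp])
  then have "weyl_seminorm scl R p x = (\<Sum>m<Suc n. proj_seminorm scl p m (homog_comp scl m x) * fact m powr R)"
    by (rule weyl_seminorm_eq_sum[OF p])
  also have "\<dots> = (\<Sum>m<Suc n. if m = n then proj_seminorm scl p n x * fact n powr R else 0)"
    by (rule sum.cong) (auto simp: homog_comp_tensor_power[OF tp] proj_seminorm_zero[OF p])
  also have "\<dots> = proj_seminorm scl p n x * fact n powr R" by simp
  also have "\<dots> \<le> r * fact n powr R"
    by (intro mult_right_mono proj_seminorm_le[OF p] sball_imp_tball[OF p] x) simp
  finally show ?thesis by (simp add: mult.commute)
qed

text \<open>By the defining equation of \<open>gseminorm\<close>, the weights of the two words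
  obtained from splitting one letter add up to the weight of the original word.\<close>

lemma tball_hom:
  assumes p: "gseminorm p" and t: "tball p n t r"
  shows "gball (tens scl) (pl p) (HLn n) t r"
proof -
  note sp = gseminormD(1)[OF p]
  have hom: "gball (tens scl) (pl p) (HLn n) (tens scl (us @ vs)) (pl p (us @ vs))" if "us \<in> HL" "length (us @ vs) = n" for us vs
    using that
  proof (induction vs arbitrary: us)
    case Nil
    then show ?case using gball_base[of us "HLn n" 1 "pl p" "pl p us" "tens scl"] by simp
  next
    case (Cons v vs)
    have "gball (tens scl) (pl p) (HLn n) (tens scl (us @ (p0 v + p1 v) # vs)) (pl p (us @ p0 v # vs) + pl p (us @ p1 v # vs))"
      unfolding multilinearD(1)[OF tens_multilinear]
      using Cons.IH[of "us @ [p0 v]"] Cons.IH[of "us @ [p1 v]"] Cons.prems by (intro gball_add) simp_all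
    also have "pl p (us @ p0 v # vs) + pl p (us @ p1 v # vs) = pl p (us @ v # vs)"
      using gseminormD(2)[OF p, of v] by (simp add: algebra_simps)
    finally show ?case by (simp add: p_sum)
  qed
  have "gball (tens scl) (pl p) (HLn n) t (1 * r)"
    using t by (rule gball_map[OF flinear_id, rotated]) (use hom[of "[]"] in auto)
  then show ?thesis by simp
qed

lemma sym_op_A: "a \<in> A \<Longrightarrow> sym_op a = a"
  by (induction rule: fspan_A_induct)
    (simp_all add: flinearD[OF flinear_sym_op], simp add: sym_op_def sym_tens_universal[OF sym_tens_multilinear swap_compatible_sym_tens])

text \<open>Apply \<open>sym_op\<close> to a homogeneous representation of almost minimal cost: it
  fixes \<open>t\<close> and turns every word into its symmetrisation at the same cost.\<close>

lemma proj_seminorm_less_sball: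
  assumes p: "gseminorm p" and t: "t \<in> A" "t \<in> tensor_power scl n" and r: "proj_seminorm scl p n t < r"
  shows "sball p n t r"
proof -
  note sp = gseminormD(1)[OF p]
  have "gball (tens scl) (pl p) (HLn n) t r"
    by (rule tball_hom[OF p proj_seminorm_less[OF sp t(2) r]])
  then have "sball p n (sym_op t) (1 * r)"
  proof (rule gball_map[OF flinear_sym_op, rotated])
    fix vs assume "vs \<in> HLn n"
    then show "sball p n (sym_op (tens scl vs)) (1 * pl p vs)"
      using gball_base[of vs "HLn n" 1 "pl p" "1 * pl p vs" sym_tens] by simp
  qed simp
  then show ?thesis using sym_op_A[OF t(1)] by simp
qed

text \<open>This reduces continuity estimates to words. The element is decomposed into degrees, and
  each component is written through symmetrised homogeneous words at nearly minimal cost, along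
  which subadditivity propagates the bound.\<close>

lemma dominated_by_weyl_seminorm:
  assumes p: "gseminorm p" and K: "K \<ge> 0"
    and add: "\<And>x y. x \<in> A \<Longrightarrow> y \<in> A \<Longrightarrow> \<phi> (x + y) \<le> \<phi> x + \<phi> y"
    and scale: "\<And>c x. x \<in> A \<Longrightarrow> \<phi> (fscale c x) \<le> norm c * (\<phi> x :: real)"
    and mono: "\<And>vs. vs \<in> HL \<Longrightarrow> \<phi> (sym_tens vs) \<le> K * fact (length vs) powr R * pl p vs"
    and a: "a \<in> A"
  shows "\<phi> a \<le> K * weyl_seminorm scl R p a"
proof -
  note sp = gseminormD(1)[OF p]
  obtain N where N: "\<forall>n\<ge>N. homog_comp scl n a = 0" "a = (\<Sum>n<N. homog_comp scl n a)" by (rule A_decompose[OF a])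
  have z: "\<phi> 0 \<le> 0" using scale[of 0 0] by simp
  have "\<phi> (\<Sum>n<M. homog_comp scl n a) \<le> (\<Sum>n<M. \<phi> (homog_comp scl n a))" for M
  proof (induction M)
    case 0
    then show ?case using z by simp
  next
    case (Suc M)
    then show ?case using add[of "\<Sum>n<M. homog_comp scl n a" "homog_comp scl M a"] homog_comp_A(1)[OF a] by simp
  qed
  then have "\<phi> a \<le> (\<Sum>n<N. \<phi> (homog_comp scl n a))" using N(2) by metis
  also have "\<dots> \<le> (\<Sum>n<N. K * (proj_seminorm scl p n (homog_comp scl n a) * fact n powr R))"
  proof (rule sum_mono)
    fix n
    let ?a = "homog_comp scl n a" and ?C = "K * fact n powr R"
    have C: "?C \<ge> 0" using K by simp
    have "\<phi> ?a \<le> ?C * proj_seminorm scl p n ?a"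
    proof (rule field_le_epsilon)
      fix \<epsilon> :: real assume e: "\<epsilon> > 0"
      \<comment> \<open>The \<open>+ 1\<close> covers \<open>K = 0\<close>.\<close>
      define \<delta> where "\<delta> = \<epsilon> / (?C + 1)"
      have d: "\<delta> > 0" "?C * \<delta> \<le> \<epsilon>" using e C by (auto simp: \<delta>_def field_simps intro: add_nonneg_pos)
      have "sball p n ?a (proj_seminorm scl p n ?a + \<delta>)"
        by (rule proj_seminorm_less_sball[OF p homog_comp_A[OF a]]) (simp add: d)
      then have "\<phi> ?a \<le> ?C * (proj_seminorm scl p n ?a + \<delta>)"
        by (rule gball_bound[OF _ subspace_A _ add scale _ C]) (use mono in auto)
      then show "\<phi> ?a \<le> ?C * proj_seminorm scl p n ?a + \<epsilon>" using d by (simp add: distrib_left)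
    qed
    then show "\<phi> ?a \<le> K * (proj_seminorm scl p n ?a * fact n powr R)" by (simp add: mult_ac)
  qed
  also have "\<dots> = K * weyl_seminorm scl R p a"
    by (simp add: weyl_seminorm_eq_sum[OF sp N(1)] sum_distrib_left)
  finally show ?thesis .
qed

end

lemma omit_nth_prod:
  fixes p :: "'v \<Rightarrow> real"
  assumes "i < length vs"
  shows "prod_list (map p vs) = p (vs ! i) * prod_list (map p (omit i vs))"
proof -
  have "vs = take i vs @ vs ! i # drop (Suc i) vs" using assms by (simp add: id_take_nth_drop)
  then have "prod_list (map p vs) = prod_list (map p (take i vs @ vs ! i # drop (Suc i) vs))" by simp
  also have "\<dots> = p (vs ! i) * prod_list (map p (omit i vs))" by (simp add: omit_def)
  finally show ?thesis .
qed

lemma length_omit: "i < length vs \<Longrightarrow> length (omit i vs) = length vs - 1"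
  by (simp add: omit_def)

lemma omit_nth: "i < j \<Longrightarrow> j < length vs \<Longrightarrow> omit j vs ! i = vs ! i"
  by (simp add: omit_def nth_append)

lemma central_fact_le: "(fact (2 * k) :: real) \<le> (2 ^ k * fact k)\<^sup>2"
proof -
  have "(2 ^ k * fact k)\<^sup>2 = (2 ^ (k + k) * (fact k * fact k) :: real)"
    by (simp add: power2_eq_square power_add mult_ac)
  then show ?thesis using fact_add_le[of k k] by (simp only: mult_2)
qed

context super_space
begin

section \<open>The estimate for the exponential\<close>

text \<open>Removing two letters costs at most their weights, because \<open>g\<close> is bounded by
  \<open>p\<close>. There are half of \<open>n * (n - 1)\<close> pairs; the factor 2 is given away
  so that iterates telescope to a quotient of factorials.\<close>

lemma Delta_op_sball:
  assumes g: "eform g" "gsym g" and p: "seminorm scl p" and b: "\<And>v w. norm (g v w) \<le> p v * p w"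
    and x: "sball p n x r"
  shows "sball p (n - 2) (Delta_op g x) (real n * real (n - 1) * r)"
proof (rule gball_map[OF flinear_Delta_op _ x])
  fix vs assume vs: "vs \<in> HLn n"
  then have hl: "vs \<in> HL" and len: "length vs = n" by auto
  have "sball p (n - 2) (Delta_op g (sym_tens vs)) (\<Sum>j<length vs. \<Sum>i<j. pl p vs)"
    unfolding Delta_op_sym_tens[OF g hl]
  proof (intro gball_sum gball_base)
    fix j i assume "j \<in> {..<length vs}" "i \<in> {..<j}"
    then have ij: "i < j" "j < length vs" by auto
    have "i < length (omit j vs)" using ij by (simp add: length_omit)
    then show "omit i (omit j vs) \<in> HLn (n - 2)"
      using omit_HL[OF omit_HL[OF hl]] ij len by (simp add: length_omit)
    have "pl p vs = p (vs ! j) * (p (vs ! i) * pl p (omit i (omit j vs)))"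
      using omit_nth_prod[of j vs p] omit_nth_prod[of i "omit j vs" p] ij \<open>i < length (omit j vs)\<close>
      by (simp add: omit_nth)
    moreover have "norm (g (vs ! i) (vs ! j)) * pl p (omit i (omit j vs)) \<le> p (vs ! i) * p (vs ! j) * pl p (omit i (omit j vs))"
      by (intro mult_right_mono b pl_nonneg p)
    ultimately show "norm ((- 1) ^ (par V0 (vs ! i) * parl V0 (take i vs)) * (- 1) ^ (par V0 (vs ! j) * parl V0 (omit i (take j vs))) *
        g (vs ! i) (vs ! j)) * pl p (omit i (omit j vs)) \<le> pl p vs"
      by (simp add: norm_mult norm_power mult_ac)
  qed auto
  moreover have "(\<Sum>j<length vs. \<Sum>i<j. pl p vs) \<le> real n * real (n - 1) * pl p vs"
  proof -
    have "(\<Sum>j<n. \<Sum>i<j. pl p vs) \<le> (\<Sum>j<n. real (n - 1) * pl p vs)"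
      by (intro sum_mono) (auto intro!: mult_right_mono pl_nonneg p)
    also have "\<dots> = real n * (real (n - 1) * pl p vs)" by (simp only: sum_constant card_lessThan)
    finally show ?thesis by (simp only: len mult.assoc)
  qed
  ultimately show "sball p (n - 2) (Delta_op g (sym_tens vs)) (real n * real (n - 1) * pl p vs)"
    by (rule gball_mono)
qed simp

lemma Delta_op_low:
  assumes g: "eform g" "gsym g" and x: "sball p n x r" and n: "n < 2"
  shows "Delta_op g x = 0"
proof (rule flinear_eq_on_span[OF flinear_Delta_op flinear_zero])
  show "x \<in> FS.span (sym_tens ` HLn n)"
    by (rule gball_in[OF x FS.subspace_span]) (auto intro: FS.span_base)
  fix y assume "y \<in> sym_tens ` HLn n"
  then obtain vs where vs: "y = sym_tens vs" "vs \<in> HL" "length vs = n" by auto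
  have "length vs = 0 \<or> length vs = Suc 0" using vs(3) n by linarith
  then show "Delta_op g y = 0" unfolding vs(1) Delta_op_sym_tens[OF g vs(2)] by (auto simp: lessThan_Suc)
qed

lemma funpow_Delta_op_sball:
  assumes g: "eform g" "gsym g" and p: "seminorm scl p" and b: "\<And>v w. norm (g v w) \<le> p v * p w"
    and x: "sball p n x r" and r: "0 \<le> r"
  shows "2 * k \<le> n \<Longrightarrow> sball p (n - 2 * k) ((Delta_op g ^^ k) x) (fact n / fact (n - 2 * k) * r)"
    and "2 * k > n \<Longrightarrow> (Delta_op g ^^ k) x = 0"
proof (induction k)
  case 0
  { case 1 then show ?case using x by simp }
  { case 2 then show ?case by simp }
next
  case (Suc k)
  { case 1
    then have "n - 2 * k = Suc (Suc (n - 2 * Suc k))" by simp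
    then obtain m where m: "n - 2 * k = Suc (Suc m)" "n - 2 * Suc k = m" by blast
    have "sball p (n - 2 * k) ((Delta_op g ^^ k) x) (fact n / fact (n - 2 * k) * r)" using Suc.IH(1) 1 by simp
    from Delta_op_sball[OF g p b this]
    have "sball p m (Delta_op g ((Delta_op g ^^ k) x)) (real (Suc (Suc m)) * real (Suc m) * (fact n / fact (Suc (Suc m)) * r))"
      unfolding m(1) by simp
    also have "real (Suc (Suc m)) * real (Suc m) * (fact n / fact (Suc (Suc m)) * r) = fact n / fact m * r"
      by (simp add: fact_Suc del: of_nat_Suc)
    finally show ?case by (simp add: m(2) del: mult_Suc_right)
  }
  { case 2
    show ?case
    proof (cases "2 * k > n")
      case True
      then show ?thesis using Suc.IH(2) flinearD(3)[OF flinear_Delta_op] by simp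
    next
      case False
      then have "sball p (n - 2 * k) ((Delta_op g ^^ k) x) (fact n / fact (n - 2 * k) * r)" using Suc.IH(1) by simp
      from Delta_op_low[OF g this] show ?thesis using 2 by simp
    qed
  }
qed

lemma sball_sym_tens: "vs \<in> HLn n \<Longrightarrow> sball p n (sym_tens vs) (pl p vs)"
  using gball_base[of vs "HLn n" 1 "pl p" "pl p vs" sym_tens] by simp

lemma weyl_seminorm_sum:
  assumes p: "seminorm scl p" and "finite J" "\<And>j. j \<in> J \<Longrightarrow> f j \<in> A"
  shows "weyl_seminorm scl R p (sum f J) \<le> (\<Sum>j\<in>J. weyl_seminorm scl R p (f j))"
  using assms(2,3)
proof (induction J rule: finite_induct)
  case empty
  then show ?case using weyl_seminorm_scale_le[OF p A_zero, of R 0] by simp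
next
  case (insert j J)
  then show ?case using weyl_seminorm_add[OF p, of "f j" "sum f J" R] by simp
qed

lemma pl_scale: "pl (\<lambda>v. c * p v) vs = c ^ length vs * (pl p vs :: real)"
  by (induction vs) (simp_all add: mult_ac)

text \<open>Of the constant, \<open>2\<close> is the base of the factor \<open>2 ^ n\<close> from
  the quotient of factorials, and \<open>1 + 2 * norm z\<close> comes from the geometric sum over
  \<open>(2 * norm z) ^ k\<close>, where \<open>2 ^ k\<close> stems from
  \<open>central_fact_le\<close> and \<open>k!\<close> has cancelled.\<close>

lemma exp_Delta_estimate_mono:
  assumes g: "eform g" "gsym g" and p: "seminorm scl p" and b: "\<And>v w. norm (g v w) \<le> p v * p w"
    and R: "R \<ge> 1/2" and vs: "vs \<in> HL"
  shows "weyl_seminorm scl R p (exp_Delta scl V0 V1 g z (sym_tens vs))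
    \<le> fact (length vs) powr R * pl (\<lambda>v. (2 * (1 + 2 * norm z)) * p v) vs"
proof -
  define n where "n = length vs"
  have x: "sball p n (sym_tens vs) (pl p vs)" using vs by (intro sball_sym_tens) (simp add: n_def)
  have pl: "0 \<le> pl p vs" by (rule pl_nonneg[OF p])
  note F = funpow_Delta_op_sball[OF g p b x pl]
  have A: "(Delta_op g ^^ k) (sym_tens vs) \<in> A" for k
    by (rule funpow_closed) (simp_all add: Delta_op_A g)
  \<comment> \<open>Powers beyond \<open>n / 2\<close> vanish; the generous range up to
    \<open>n\<close> fits \<open>sum_power_le_binomial\<close>.\<close>
  have e: "exp_Delta scl V0 V1 g z (sym_tens vs) = (\<Sum>k<Suc n. fscale (z ^ k / fact k) ((Delta_op g ^^ k) (sym_tens vs)))"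
    unfolding exp_Delta_eq[OF g sym_tens_A] by (rule fexp_eq_sum) (use F(2) in auto)
  have "weyl_seminorm scl R p (exp_Delta scl V0 V1 g z (sym_tens vs))
      \<le> (\<Sum>k<Suc n. weyl_seminorm scl R p (fscale (z ^ k / fact k) ((Delta_op g ^^ k) (sym_tens vs))))"
    unfolding e by (rule weyl_seminorm_sum[OF p]) (simp_all add: A)
  also have "\<dots> \<le> (\<Sum>k<Suc n. (2 * norm z) ^ k * (2 ^ n * fact n powr R * pl p vs))"
  proof (rule sum_mono)
    fix k
    have "weyl_seminorm scl R p ((Delta_op g ^^ k) (sym_tens vs)) \<le> 2 ^ k * fact k * (2 ^ n * fact n powr R * pl p vs)"
    proof (cases "2 * k \<le> n")
      case True
      have sb: "sball p (n - 2 * k) ((Delta_op g ^^ k) (sym_tens vs)) (fact n / fact (n - 2 * k) * pl p vs)"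
        using F(1) True by blast
      have "weyl_seminorm scl R p ((Delta_op g ^^ k) (sym_tens vs)) \<le> fact (n - 2 * k) powr R * (fact n / fact (n - 2 * k) * pl p vs)"
        by (rule weyl_seminorm_sball[OF p sb])
      also have "\<dots> = (fact n / fact (n - 2 * k) * fact (n - 2 * k) powr R) * pl p vs" by simp
      also have "\<dots> \<le> (fact n powr R * sqrt (fact n / fact (n - 2 * k))) * pl p vs"
        by (intro mult_right_mono fact_ratio_powr pl R) (simp_all add: fact_mono)
      also have "\<dots> \<le> (fact n powr R * (2 ^ n * (2 ^ k * fact k))) * pl p vs"
      proof (intro mult_right_mono mult_left_mono pl)
        have "(fact n / fact (n - 2 * k) :: real) \<le> 2 ^ n * fact (2 * k)" by (rule fact_ratio_le[OF True])
        \<comment> \<open>The factor \<open>2 ^ n\<close> is weakened to its square so that the root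
          can be taken exactly.\<close>
        also have "\<dots> \<le> (2 ^ n)\<^sup>2 * (2 ^ k * fact k)\<^sup>2"
        proof (intro mult_mono central_fact_le)
          have "(2::real) ^ n * 1 \<le> 2 ^ n * 2 ^ n" by (intro mult_left_mono) simp_all
          then show "(2::real) ^ n \<le> (2 ^ n)\<^sup>2" by (simp add: power2_eq_square)
        qed simp_all
        finally show "sqrt (fact n / fact (n - 2 * k)) \<le> 2 ^ n * (2 ^ k * fact k)"
          by (intro real_le_lsqrt) (simp_all add: power_mult_distrib)
      qed simp
      finally show ?thesis by (simp add: mult_ac)
    next
      case False
      then have "(Delta_op g ^^ k) (sym_tens vs) = 0" using F(2) by simp
      moreover have "weyl_seminorm scl R p 0 \<le> 0" using weyl_seminorm_scale_le[OF p A_zero, of R 0] by simp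
      moreover have "0 \<le> 2 ^ k * fact k * (2 ^ n * fact n powr R * pl p vs)" using pl by simp
      ultimately show ?thesis by simp
    qed
    from order_trans[OF weyl_seminorm_scale_le[OF p A[of k], of R "z ^ k / fact k"] mult_left_mono[OF this norm_ge_zero]]
    show "weyl_seminorm scl R p (fscale (z ^ k / fact k) ((Delta_op g ^^ k) (sym_tens vs)))
      \<le> (2 * norm z) ^ k * (2 ^ n * fact n powr R * pl p vs)"
      by (simp add: norm_divide norm_power power_mult_distrib mult_ac)
  qed
  also have "\<dots> = (\<Sum>k\<le>n. (2 * norm z) ^ k) * (2 ^ n * fact n powr R * pl p vs)"
    unfolding lessThan_Suc_atMost by (rule sum_distrib_right[symmetric])
  also have "\<dots> \<le> (1 + 2 * norm z) ^ n * (2 ^ n * fact n powr R * pl p vs)"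
    by (intro mult_right_mono sum_power_le_binomial) (simp_all add: pl)
  finally show ?thesis
    unfolding pl_scale by (simp only: n_def power_mult_distrib mult_ac)
qed

lemma seminorm_scale: "seminorm scl p \<Longrightarrow> 0 \<le> c \<Longrightarrow> seminorm scl (\<lambda>v. c * p v)"
  unfolding seminorm_def by (auto simp: mult_ac distrib_left[symmetric] intro!: mult_left_mono)

lemma gseminorm_scale: "gseminorm p \<Longrightarrow> 0 \<le> c \<Longrightarrow> gseminorm (\<lambda>v. c * p v)"
  using gseminormD(2)[of p] unfolding gseminorm_def[of "\<lambda>v. c * p v"]
  by (metis gseminormD(1) seminorm_scale distrib_left)

theorem exp_Delta_estimate:
  assumes g: "eform g" "gsym g" and p: "gseminorm p" and b: "\<And>v w. norm (g v w) \<le> p v * p w"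
    and R: "R \<ge> 1/2" and a: "a \<in> A"
  shows "weyl_seminorm scl R p (exp_Delta scl V0 V1 g z a)
    \<le> weyl_seminorm scl R (\<lambda>v. (2 * (1 + 2 * norm z)) * p v) a"
proof -
  note sp = gseminormD(1)[OF p]
  have "weyl_seminorm scl R p (exp_Delta scl V0 V1 g z a)
    \<le> 1 * weyl_seminorm scl R (\<lambda>v. (2 * (1 + 2 * norm z)) * p v) a"
  proof (rule dominated_by_weyl_seminorm[OF gseminorm_scale[OF p] _ _ _ _ a])
    show "weyl_seminorm scl R p (exp_Delta scl V0 V1 g z (x + y))
      \<le> weyl_seminorm scl R p (exp_Delta scl V0 V1 g z x) + weyl_seminorm scl R p (exp_Delta scl V0 V1 g z y)"
      if "x \<in> A" "y \<in> A" for x y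
      using that g by (simp add: exp_Delta_add weyl_seminorm_add[OF sp] exp_Delta_A)
    show "weyl_seminorm scl R p (exp_Delta scl V0 V1 g z (fscale c x)) \<le> norm c * weyl_seminorm scl R p (exp_Delta scl V0 V1 g z x)"
      if "x \<in> A" for c x
      using that g by (simp add: exp_Delta_fscale weyl_seminorm_scale_le[OF sp] exp_Delta_A)
    show "weyl_seminorm scl R p (exp_Delta scl V0 V1 g z (sym_tens vs))
      \<le> 1 * fact (length vs) powr R * pl (\<lambda>v. (2 * (1 + 2 * norm z)) * p v) vs" if "vs \<in> HL" for vs
      using exp_Delta_estimate_mono[OF g sp b R that] by simp
  qed simp_all
  then show ?thesis by simp
qed

subsection \<open>The estimate for the star product\<close>

abbreviation "s2ball p n m \<equiv> gball (\<lambda>(vs, ws). tensor2 (sym_tens vs) (sym_tens ws)) (\<lambda>(vs, ws). pl p vs * pl p ws) (HLn n \<times> HLn m)"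

lemma P_s2ball:
  assumes B: "eform B" and p: "seminorm scl p" and b: "\<And>v w. norm (B v w) \<le> p v * p w"
    and x: "s2ball p n m x r"
  shows "s2ball p (n - 1) (m - 1) (P B x) (real n * real m * r)"
proof (rule gball_map[OF flinear_P _ x])
  fix i assume "i \<in> HLn n \<times> HLn m"
  then obtain vs ws where i: "i = (vs, ws)" and hl: "vs \<in> HL" "ws \<in> HL" and len: "length vs = n" "length ws = m" by auto
  have "s2ball p (n - 1) (m - 1) (P B (tensor2 (sym_tens vs) (sym_tens ws))) (\<Sum>k<length vs. \<Sum>l<length ws. pl p vs * pl p ws)"
    unfolding P_sym_tens[OF B hl]
  proof (intro gball_sum)
    fix k l assume "k \<in> {..<length vs}" "l \<in> {..<length ws}"
    then have kl: "k < length vs" "l < length ws" by auto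
    let ?c = "(- 1) ^ (par V0 (vs ! k) * parl V0 (drop (Suc k) vs) + par V0 (ws ! l) * parl V0 (take l ws)) * B (vs ! k) (ws ! l)"
    have i: "(omit k vs, omit l ws) \<in> HLn (n - 1) \<times> HLn (m - 1)"
      using omit_HL hl kl len by (simp add: length_omit)
    have "norm (B (vs ! k) (ws ! l)) * (pl p (omit k vs) * pl p (omit l ws))
        \<le> p (vs ! k) * p (ws ! l) * (pl p (omit k vs) * pl p (omit l ws))"
      by (intro mult_right_mono b mult_nonneg_nonneg pl_nonneg p)
    then have "norm ?c * (pl p (omit k vs) * pl p (omit l ws)) \<le> pl p vs * pl p ws"
      using omit_nth_prod[OF kl(1), of p] omit_nth_prod[OF kl(2), of p] by (simp add: norm_mult norm_power mult_ac)
    then show "s2ball p (n - 1) (m - 1) (fscale ?c (tensor2 (sym_tens (omit k vs)) (sym_tens (omit l ws)))) (pl p vs * pl p ws)"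
      using gball_base[OF i, of ?c "\<lambda>(vs, ws). pl p vs * pl p ws" "pl p vs * pl p ws" "\<lambda>(vs, ws). tensor2 (sym_tens vs) (sym_tens ws)"] by simp
  qed auto
  then show "s2ball p (n - 1) (m - 1) (P B (case i of (vs, ws) \<Rightarrow> tensor2 (sym_tens vs) (sym_tens ws)))
      (real n * real m * (case i of (vs, ws) \<Rightarrow> pl p vs * pl p ws))"
    by (simp add: i len mult_ac)
qed simp

lemma P_low:
  assumes B: "eform B" and x: "s2ball p n m x r" and n: "n = 0 \<or> m = 0"
  shows "P B x = 0"
proof (rule flinear_eq_on_span[OF flinear_P flinear_zero])
  let ?e = "\<lambda>(vs, ws). tensor2 (sym_tens vs) (sym_tens ws)"
  show "x \<in> FS.span (?e ` (HLn n \<times> HLn m))"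
    by (rule gball_in[OF x FS.subspace_span]) (rule FS.span_base, rule imageI)
  fix y assume "y \<in> ?e ` (HLn n \<times> HLn m)"
  then obtain vs ws where vs: "y = tensor2 (sym_tens vs) (sym_tens ws)" "vs \<in> HL" "ws \<in> HL" "length vs = n" "length ws = m" by auto
  then show "P B y = 0" using n unfolding vs(1) P_sym_tens[OF B vs(2,3)] by auto
qed

lemma funpow_P_s2ball:
  assumes B: "eform B" and p: "seminorm scl p" and b: "\<And>v w. norm (B v w) \<le> p v * p w"
    and x: "s2ball p n m x r"
  shows "(k \<le> min n m \<longrightarrow>
      s2ball p (n - k) (m - k) ((P B ^^ k) x) (fact n / fact (n - k) * (fact m / fact (m - k)) * r))
    \<and> (k > min n m \<longrightarrow> (P B ^^ k) x = 0)"
proof -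
  define Q where "Q k \<longleftrightarrow> (k \<le> min n m \<longrightarrow>
      s2ball p (n - k) (m - k) ((P B ^^ k) x) (fact n / fact (n - k) * (fact m / fact (m - k)) * r))
    \<and> (k > min n m \<longrightarrow> (P B ^^ k) x = 0)" for k
  have "Q k"
  proof (induction k)
  case 0
  then show ?case using x by (simp add: Q_def)
next
  case (Suc k)
  note IH = Suc.IH[unfolded Q_def]
  show ?case unfolding Q_def
  proof (intro conjI impI)
    assume 1: "Suc k \<le> min n m"
    then have "k < n" "k < m" by auto
    then obtain n' m' where nm: "n - k = Suc n'" "m - k = Suc m'" by (metis Suc_diff_Suc)
    then have nm': "n - Suc k = n'" "m - Suc k = m'" by simp_all
    have "s2ball p (n - k) (m - k) ((P B ^^ k) x) (fact n / fact (n - k) * (fact m / fact (m - k)) * r)"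
      using IH 1 by simp
    from P_s2ball[OF B p b this]
    have "s2ball p n' m' (P B ((P B ^^ k) x)) (real (Suc n') * real (Suc m') * (fact n / fact (Suc n') * (fact m / fact (Suc m')) * r))"
      by (simp only: nm diff_Suc_1)
    also have "real (Suc n') * real (Suc m') * (fact n / fact (Suc n') * (fact m / fact (Suc m')) * r) = fact n / fact n' * (fact m / fact m') * r"
      by (simp add: fact_Suc del: of_nat_Suc)
    finally show "s2ball p (n - Suc k) (m - Suc k) ((P B ^^ Suc k) x) (fact n / fact (n - Suc k) * (fact m / fact (m - Suc k)) * r)"
      by (simp add: nm')
  next
    assume 2: "Suc k > min n m"
    show "(P B ^^ Suc k) x = 0"
    proof (cases "k > min n m")
      case True
      then show ?thesis using IH by simp
    next
      case False
      then have "k \<le> min n m" by linarith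
      with IH have "s2ball p (n - k) (m - k) ((P B ^^ k) x) (fact n / fact (n - k) * (fact m / fact (m - k)) * r)"
        by blast
      moreover have "n - k = 0 \<or> m - k = 0" using 2 False by auto
      ultimately show ?thesis using P_low[OF B] by simp
    qed
  qed
  qed
  then show ?thesis unfolding Q_def .
qed

lemma mult_s2ball:
  assumes "s2ball p n m x r"
  shows "sball p (n + m) (mult x) r"
proof -
  have "sball p (n + m) (mult x) (1 * r)"
  proof (rule gball_map[OF flinear_mult _ assms])
    fix i assume "i \<in> HLn n \<times> HLn m"
    then obtain vs ws where i: "i = (vs, ws)" and hl: "vs \<in> HL" "ws \<in> HL" and len: "length vs = n" "length ws = m" by auto
    have "sball p (n + m) (sym_tens (vs @ ws)) (pl p (vs @ ws))"
      using hl len by (intro sball_sym_tens) simp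
    then show "sball p (n + m) (mult (case i of (vs, ws) \<Rightarrow> tensor2 (sym_tens vs) (sym_tens ws))) (1 * (case i of (vs, ws) \<Rightarrow> pl p vs * pl p ws))"
      by (simp add: i mult_tensor2 smul_sym_tens)
  qed simp
  then show ?thesis by simp
qed

text \<open>The factorial of the total degree is split at the price of \<open>2 powr R\<close> per
  letter. Then \<open>fact_ratio_powr\<close> applies to each factor and leaves
  \<open>sqrt (k!)\<close> twice, so together one \<open>k!\<close>, which the exponential series
  can pay for.\<close>

lemma fact_weight_le:
  assumes R: "R \<ge> 1/2" and k: "k \<le> n" "k \<le> m"
  shows "(fact n / fact (n - k)) * (fact m / fact (m - k)) * fact (n - k + (m - k)) powr R
    \<le> (2 * 2 powr R) ^ (n + m) * fact k * (fact n powr R * (fact m powr R :: real))"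
proof -
  have h: "(fact n / fact (n - k)) * fact (n - k) powr R \<le> fact n powr R * (2 ^ n * sqrt (fact k))" if "k \<le> n" for n
  proof -
    have "(fact n / fact (n - k)) * fact (n - k) powr R \<le> fact n powr R * sqrt (fact n / fact (n - k))"
      by (intro fact_ratio_powr R) (simp_all add: fact_mono)
    also have "sqrt (fact n / fact (n - k)) \<le> sqrt (2 ^ n * fact k)"
      by (intro real_sqrt_le_mono fact_ratio_le that)
    also have "\<dots> \<le> sqrt ((2 ^ n)\<^sup>2 * fact k)"
    proof (intro real_sqrt_le_mono mult_right_mono)
      have "(2::real) ^ n * 1 \<le> 2 ^ n * 2 ^ n" by (intro mult_left_mono) simp_all
      then show "(2::real) ^ n \<le> (2 ^ n)\<^sup>2" by (simp add: power2_eq_square)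
    qed simp
    also have "\<dots> = 2 ^ n * sqrt (fact k)" by (simp add: real_sqrt_mult)
    finally show ?thesis by (simp add: mult_left_mono)
  qed
  have "(fact (n - k + (m - k)) :: real) \<le> 2 ^ (n - k + (m - k)) * (fact (n - k) * fact (m - k))" by (rule fact_add_le)
  also have "\<dots> \<le> 2 ^ (n + m) * (fact (n - k) * fact (m - k))"
    by (intro mult_right_mono power_increasing) simp_all
  finally have "fact (n - k + (m - k)) powr R \<le> (2 ^ (n + m) * (fact (n - k) * fact (m - k)) :: real) powr R"
    using R by (intro powr_mono2) simp_all
  also have "\<dots> = (2 powr R) ^ (n + m) * (fact (n - k) powr R * fact (m - k) powr R)"
    by (simp add: powr_mult powr_realpow[symmetric] powr_powr mult.commute)
  finally have "(fact n / fact (n - k)) * (fact m / fact (m - k)) * fact (n - k + (m - k)) powr R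
    \<le> (fact n / fact (n - k)) * (fact m / fact (m - k)) * ((2 powr R) ^ (n + m) * (fact (n - k) powr R * fact (m - k) powr R) :: real)"
    by (intro mult_left_mono) simp_all
  also have "\<dots> = (2 powr R) ^ (n + m) * ((fact n / fact (n - k) * fact (n - k) powr R) * (fact m / fact (m - k) * fact (m - k) powr R))"
    by simp
  also have "\<dots> \<le> (2 powr R) ^ (n + m) * ((fact n powr R * (2 ^ n * sqrt (fact k))) * (fact m powr R * (2 ^ m * sqrt (fact k))))"
    by (intro mult_left_mono mult_mono h k) simp_all
  also have "\<dots> = (2 * 2 powr R) ^ (n + m) * (sqrt (fact k) * sqrt (fact k)) * (fact n powr R * (fact m powr R :: real))"
    by (simp only: power_mult_distrib power_add mult_ac)
  finally show ?thesis by simp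
qed

text \<open>In \<open>c\<close>, the factor \<open>2 * 2 powr R\<close> is the price per letter in
  \<open>fact_weight_le\<close>, and \<open>1 + norm z\<close> absorbs the geometric sum over the
  powers of \<open>z\<close>.\<close>

lemma star_estimate_mono:
  fixes z :: 'k
  assumes B: "eform B" and p: "seminorm scl p" and b: "\<And>v w. norm (B v w) \<le> p v * p w"
    and R: "R \<ge> 1/2" and vs: "vs \<in> HL" "ws \<in> HL"
  defines "c \<equiv> (2 * 2 powr R) * (1 + norm z)"
  shows "weyl_seminorm scl R p (star scl V0 V1 B z (sym_tens vs) (sym_tens ws))
    \<le> (fact (length vs) powr R * pl (\<lambda>v. c * p v) vs) * (fact (length ws) powr R * pl (\<lambda>v. c * p v) ws)"
proof -
  define n m where "n = length vs" and "m = length ws"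
  define Q where "Q = pl p vs * pl p ws"
  have Q: "0 \<le> Q" unfolding Q_def by (intro mult_nonneg_nonneg pl_nonneg p)
  let ?t = "tensor2 (sym_tens vs) (sym_tens ws)"
  have x: "s2ball p n m ?t Q"
    using gball_base[of "(vs, ws)" "HLn n \<times> HLn m" 1 "\<lambda>(vs, ws). pl p vs * pl p ws" Q "\<lambda>(vs, ws). tensor2 (sym_tens vs) (sym_tens ws)"] vs
    by (simp add: n_def m_def Q_def)
  note F = funpow_P_s2ball[OF B p b x, THEN conjunct1, rule_format]
    funpow_P_s2ball[OF B p b x, THEN conjunct2, rule_format]
  have A2: "(P B ^^ k) ?t \<in> A2" for k
    by (rule funpow_closed) (simp_all add: P_A2 B)
  let ?W = "weyl_seminorm scl R p"
  have e: "star scl V0 V1 B z (sym_tens vs) (sym_tens ws) = (\<Sum>k<Suc n. fscale (z ^ k / fact k) (mult ((P B ^^ k) ?t)))"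
  proof -
    have "fexp z (P B) ?t = (\<Sum>k<Suc n. fscale (z ^ k / fact k) ((P B ^^ k) ?t))"
      by (rule fexp_eq_sum) (use F(2) in auto)
    then show ?thesis by (simp only: star_eq[OF B sym_tens_A sym_tens_A] flinear_sum_arg[OF flinear_mult] mult_lin)
  qed
  have "?W (star scl V0 V1 B z (sym_tens vs) (sym_tens ws)) \<le> (\<Sum>k<Suc n. ?W (fscale (z ^ k / fact k) (mult ((P B ^^ k) ?t))))"
    unfolding e by (rule weyl_seminorm_sum[OF p]) (simp_all add: A2 mult_A)
  also have "\<dots> \<le> (\<Sum>k<Suc n. norm z ^ k * ((2 * 2 powr R) ^ (n + m) * (fact n powr R * fact m powr R) * Q))"
  proof (rule sum_mono)
    fix k
    have "?W (mult ((P B ^^ k) ?t)) \<le> (2 * 2 powr R) ^ (n + m) * fact k * (fact n powr R * fact m powr R) * Q"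
    proof (cases "k \<le> n \<and> k \<le> m")
      case True
      then have k: "k \<le> n" "k \<le> m" by auto
      then have "k \<le> min n m" by simp
      then have sb: "s2ball p (n - k) (m - k) ((P B ^^ k) ?t) (fact n / fact (n - k) * (fact m / fact (m - k)) * Q)"
        using F(1) by blast
      have "?W (mult ((P B ^^ k) ?t)) \<le> fact (n - k + (m - k)) powr R * (fact n / fact (n - k) * (fact m / fact (m - k)) * Q)"
        by (rule weyl_seminorm_sball[OF p mult_s2ball[OF sb]])
      also have "\<dots> = (fact n / fact (n - k) * (fact m / fact (m - k)) * fact (n - k + (m - k)) powr R) * Q" by simp
      also have "\<dots> \<le> (2 * 2 powr R) ^ (n + m) * fact k * (fact n powr R * fact m powr R) * Q"
        by (intro mult_right_mono fact_weight_le R k Q)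
      finally show ?thesis .
    next
      case False
      then have "(P B ^^ k) ?t = 0" using F(2) by auto
      moreover have "?W 0 \<le> 0" using weyl_seminorm_scale_le[OF p A_zero, of R 0] by simp
      moreover have "0 \<le> (2 * 2 powr R) ^ (n + m) * fact k * (fact n powr R * fact m powr R) * Q" using Q by simp
      ultimately show ?thesis by simp
    qed
    from order_trans[OF weyl_seminorm_scale_le[OF p mult_A[OF A2[of k]], of R "z ^ k / fact k"] mult_left_mono[OF this norm_ge_zero]]
    show "?W (fscale (z ^ k / fact k) (mult ((P B ^^ k) ?t))) \<le> norm z ^ k * ((2 * 2 powr R) ^ (n + m) * (fact n powr R * fact m powr R) * Q)"
      by (simp add: norm_divide norm_power mult_ac)
  qed
  also have "\<dots> = (\<Sum>k\<le>n. norm z ^ k) * ((2 * 2 powr R) ^ (n + m) * (fact n powr R * fact m powr R) * Q)"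
    unfolding lessThan_Suc_atMost by (rule sum_distrib_right[symmetric])
  also have "\<dots> \<le> (1 + norm z) ^ (n + m) * ((2 * 2 powr R) ^ (n + m) * (fact n powr R * fact m powr R) * Q)"
  proof (intro mult_right_mono)
    have "(\<Sum>k\<le>n. norm z ^ k) \<le> (1 + norm z) ^ n" by (rule sum_power_le_binomial) simp
    also have "\<dots> \<le> (1 + norm z) ^ (n + m)" by (intro power_increasing) simp_all
    finally show "(\<Sum>k\<le>n. norm z ^ k) \<le> (1 + norm z) ^ (n + m)" .
  qed (use Q in simp)
  also have "\<dots> = c ^ (n + m) * (fact n powr R * fact m powr R) * Q"
    by (simp only: c_def power_mult_distrib mult_ac)
  finally show ?thesis
    by (simp add: pl_scale n_def m_def Q_def power_add mult_ac)
qed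

text \<open>The reduction to words is applied once in each argument: first with a word on the right,
  then with the resulting bound as the constant.\<close>

theorem star_estimate:
  fixes z :: 'k
  assumes B: "eform B" and p: "gseminorm p" and b: "\<And>v w. norm (B v w) \<le> p v * p w"
    and R: "R \<ge> 1/2" and a: "a \<in> A" "a' \<in> A"
  defines "c \<equiv> (2 * 2 powr R) * (1 + norm z)"
  shows "weyl_seminorm scl R p (star scl V0 V1 B z a a')
    \<le> weyl_seminorm scl R (\<lambda>v. c * p v) a * weyl_seminorm scl R (\<lambda>v. c * p v) a'"
proof -
  note sp = gseminormD(1)[OF p]
  have c: "0 \<le> c" by (simp add: c_def)
  note cp = gseminorm_scale[OF p c]
  let ?W = "weyl_seminorm scl R p" and ?V = "weyl_seminorm scl R (\<lambda>v. c * p v)"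
  note sA = star_A[OF B] and sl = star_lin[OF B]
  have V: "0 \<le> ?V x" if "x \<in> A" for x
    using weyl_seminorm_nonneg[OF seminorm_scale[OF sp c] that] .
  have 1: "?W (star scl V0 V1 B z a (sym_tens ws)) \<le> (fact (length ws) powr R * pl (\<lambda>v. c * p v) ws) * ?V a"
    if ws: "ws \<in> HL" for ws
  proof (rule dominated_by_weyl_seminorm[OF cp _ _ _ _ a(1)])
    show "0 \<le> fact (length ws) powr R * pl (\<lambda>v. c * p v) ws"
      by (intro mult_nonneg_nonneg pl_nonneg[OF seminorm_scale[OF sp c]]) simp
    show "?W (star scl V0 V1 B z (x + y) (sym_tens ws)) \<le> ?W (star scl V0 V1 B z x (sym_tens ws)) + ?W (star scl V0 V1 B z y (sym_tens ws))"
      if "x \<in> A" "y \<in> A" for x y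
      using weyl_seminorm_add[OF sp sA[OF that(1) sym_tens_A] sA[OF that(2) sym_tens_A]] by (simp add: sl(1) that)
    show "?W (star scl V0 V1 B z (fscale d x) (sym_tens ws)) \<le> norm d * ?W (star scl V0 V1 B z x (sym_tens ws))"
      if "x \<in> A" for d x
      using weyl_seminorm_scale_le[OF sp sA[OF that sym_tens_A]] sl(2)[OF that sym_tens_A that] by simp
    show "?W (star scl V0 V1 B z (sym_tens vs) (sym_tens ws))
      \<le> fact (length ws) powr R * pl (\<lambda>v. c * p v) ws * fact (length vs) powr R * pl (\<lambda>v. c * p v) vs" if "vs \<in> HL" for vs
      using star_estimate_mono[OF B sp b R that ws, of z] by (simp add: c_def mult_ac)
  qed
  show ?thesis
  proof (rule dominated_by_weyl_seminorm[OF cp _ _ _ _ a(2)])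
    show "0 \<le> ?V a" by (rule V[OF a(1)])
    show "?W (star scl V0 V1 B z a (x + y)) \<le> ?W (star scl V0 V1 B z a x) + ?W (star scl V0 V1 B z a y)"
      if "x \<in> A" "y \<in> A" for x y
      using weyl_seminorm_add[OF sp sA[OF a(1) that(1)] sA[OF a(1) that(2)]] by (simp add: sl(3) that a)
    show "?W (star scl V0 V1 B z a (fscale d x)) \<le> norm d * ?W (star scl V0 V1 B z a x)"
      if "x \<in> A" for d x
      using weyl_seminorm_scale_le[OF sp sA[OF a(1) that]] sl(4)[OF a(1) that that] by simp
    show "?W (star scl V0 V1 B z a (sym_tens vs)) \<le> ?V a * fact (length vs) powr R * pl (\<lambda>v. c * p v) vs" if "vs \<in> HL" for vs
      using 1[OF that] by (simp add: mult_ac)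
  qed
qed

end

subsection \<open>Extension to the completion\<close>

text \<open>The uniformity is invariant under translation, so an entourage can be tested at
  \<open>(0, y - x)\<close> and moved by \<open>x\<close>.\<close>

lemma entourage_from_zero_nhd:
  fixes E :: "'w::uniform_topological_group_add \<times> 'w \<Rightarrow> bool"
  assumes "eventually E uniformity"
  shows "\<exists>U. open U \<and> 0 \<in> U \<and> (\<forall>x y. y - x \<in> U \<longrightarrow> E (x, y))"
proof -
  obtain Q where Q: "eventually Q uniformity" "\<And>a b c. Q (a, b) \<Longrightarrow> E (a + c, b + c)"
    using uniformity_of_uniform_continuous_invariant[of "(+)", OF uniformly_continuous_add' assms] by metis
  have "eventually (\<lambda>d. Q (0, d)) (nhds 0)"
    unfolding eventually_nhds_uniformity using Q(1) by (rule eventually_mono) auto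
  then obtain U where U: "open U" "0 \<in> U" "\<And>d. d \<in> U \<Longrightarrow> Q (0, d)"
    unfolding eventually_nhds by blast
  have "E (x, y)" if "y - x \<in> U" for x y
    using Q(2)[OF U(3)[OF that], of x] by simp
  with U show ?thesis by blast
qed

text \<open>The images under \<open>f\<close> of the traces on \<open>D\<close> of the
  neighbourhoods of \<open>x\<close> form a filter, proper by density and Cauchy by assumption, and
  its limit is the value at \<open>x\<close>. The hypothesis is local in \<open>x\<close>; uniform
  continuity would be too much to ask of a bilinear product.\<close>

lemma continuous_extension_from_dense:
  fixes f :: "'x::topological_space \<Rightarrow> 'w::{complete_uniform_space, t2_space}"
  assumes dense: "closure D = UNIV"
    and cau: "\<And>x (E :: 'w \<times> 'w \<Rightarrow> bool). eventually E uniformity \<Longrightarrow>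
      \<exists>U. open U \<and> x \<in> U \<and> (\<forall>d\<in>U \<inter> D. \<forall>d'\<in>U \<inter> D. E (f d, f d'))"
  shows "\<exists>F. continuous_on UNIV F \<and> (\<forall>d\<in>D. F d = f d)"
proof -
  define G where "G x = filtermap f (inf (nhds x) (principal D))" for x
  have ev: "eventually P (G x) \<longleftrightarrow> (\<exists>U. open U \<and> x \<in> U \<and> (\<forall>d\<in>U \<inter> D. P (f d)))" for P x
    unfolding G_def eventually_filtermap eventually_inf_principal eventually_nhds by blast
  have ne: "U \<inter> D \<noteq> {}" if "open U" "x \<in> U" for U x
    using that dense open_Int_closure_eq_empty[of U D] by auto
  have "G x \<noteq> bot" for x
  proof
    assume "G x = bot"
    then have "eventually (\<lambda>_. False) (G x)" by simp
    then show False unfolding ev using ne by blast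
  qed
  moreover have "cauchy_filter (G x)" for x
    unfolding cauchy_filter_def le_filter_def
  proof (intro allI impI)
    fix E :: "'w \<times> 'w \<Rightarrow> bool" assume "eventually E uniformity"
    from cau[OF this, of x] obtain U where U: "open U" "x \<in> U" "\<forall>d\<in>U \<inter> D. \<forall>d'\<in>U \<inter> D. E (f d, f d')"
      by (elim exE conjE)
    have "eventually (\<lambda>w. w \<in> f ` (U \<inter> D)) (G x)"
      unfolding ev using U by (intro exI[of _ U] conjI) auto
    moreover have "\<forall>w w'. w \<in> f ` (U \<inter> D) \<longrightarrow> w' \<in> f ` (U \<inter> D) \<longrightarrow> E (w, w')"
      using U(3) by auto
    ultimately show "eventually E (G x \<times>\<^sub>F G x)"
      unfolding eventually_prod_same by (intro exI[of _ "\<lambda>w. w \<in> f ` (U \<inter> D)"] conjI)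
  qed
  ultimately have "\<exists>l. G x \<le> nhds l" for x
    using cauchy_filter_convergent' convergent_filter_iff by blast
  then obtain F where F: "\<And>x. G x \<le> nhds (F x)" by metis
  have ev_F: "\<exists>U. open U \<and> x \<in> U \<and> (\<forall>d\<in>U \<inter> D. P (f d))" if "eventually P (nhds (F x))" for P x
    using F[of x] that unfolding le_filter_def ev by blast
  have "F d = f d" if "d \<in> D" for d
  proof (rule ccontr)
    assume "F d \<noteq> f d"
    then obtain U where U: "open U" "F d \<in> U" "f d \<notin> U" using t1_space by blast
    then have "eventually (\<lambda>w. w \<in> U) (nhds (F d))" by (simp add: eventually_nhds) blast
    from ev_F[OF this] U that show False by blast
  qed
  moreover have "continuous_on UNIV F"
    unfolding continuous_on_def
  unfolding filterlim_iff proof (intro ballI allI impI)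
    fix x P assume "eventually P (nhds (F x))"
    then have E: "eventually (\<lambda>(x', y). x' = F x \<longrightarrow> P y) uniformity" by (simp add: eventually_nhds_uniformity)
    \<comment> \<open>The entourage is split twice to accommodate the chain from \<open>F x\<close>
      over \<open>f d\<close> and \<open>f d'\<close> to \<open>F y\<close>.\<close>
    obtain E1 where E1: "eventually E1 uniformity" "\<And>a b c. E1 (a, b) \<Longrightarrow> E1 (b, c) \<Longrightarrow> case (a, c) of (x', y) \<Rightarrow> x' = F x \<longrightarrow> P y"
      using uniformity_transE[OF E] by metis
    obtain E2 where E2: "eventually E2 uniformity" "\<And>a b c. E2 (a, b) \<Longrightarrow> E2 (b, c) \<Longrightarrow> E1 (a, c)"
      using uniformity_transE[OF E1(1)] by metis
    have E2_E1: "E1 (a, b)" if "E2 (a, b)" for a b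
      using E2(2)[OF that uniformity_refl[OF E2(1)]] .
    obtain U where U: "open U" "x \<in> U" "\<forall>d\<in>U \<inter> D. \<forall>d'\<in>U \<inter> D. E2 (f d, f d')" using cau[OF E2(1)] by blast
    have "P (F y)" if y: "y \<in> U" for y
    proof -
      have "eventually (\<lambda>w. E2 (F x, w)) (nhds (F x))"
        unfolding eventually_nhds_uniformity using E2(1) by (rule eventually_mono) auto
      from ev_F[OF this] obtain U1 where U1: "open U1" "x \<in> U1" "\<forall>d\<in>U1 \<inter> D. E2 (F x, f d)" by blast
      have "eventually (\<lambda>w. E2 (w, F y)) (nhds (F y))"
        unfolding eventually_nhds_uniformity using uniformity_sym[OF E2(1)] by (rule eventually_mono) auto
      from ev_F[OF this] obtain U2 where U2: "open U2" "y \<in> U2" "\<forall>d\<in>U2 \<inter> D. E2 (f d, F y)" by blast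
      obtain d where d: "d \<in> U \<inter> U1 \<inter> D" using ne[OF open_Int[OF U(1) U1(1)], of x] U(2) U1(2) by blast
      obtain d' where d': "d' \<in> U \<inter> U2 \<inter> D" using ne[OF open_Int[OF U(1) U2(1)], of y] U2(2) y by blast
      have "E1 (F x, f d')" using E2(2)[of "F x" "f d" "f d'"] d d' U(3) U1(3) by simp
      moreover have "E1 (f d', F y)" using E2_E1[of "f d'" "F y"] d' U2(3) by simp
      ultimately show ?thesis using E1(2)[of "F x" "f d'" "F y"] by simp
    qed
    then show "eventually (\<lambda>y. P (F y)) (at x within UNIV)"
      unfolding eventually_at_topological using U by blast
  qed
  ultimately show ?thesis by blast
qed

lemma continuous_eq_on_dense:
  fixes F G :: "'x::topological_space \<Rightarrow> 'w::t2_space"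
  assumes "continuous_on UNIV F" "continuous_on UNIV G" "closure D = UNIV" "\<And>d. d \<in> D \<Longrightarrow> F d = G d"
  shows "F x = G x"
proof -
  have "closed {x. F x = G x}" by (rule closed_Collect_eq[OF assms(1,2)])
  then have "closure D \<subseteq> {x. F x = G x}" using assms(4) by (intro closure_minimal) auto
  then show ?thesis using assms(3) by blast
qed

section \<open>Continuous seminorms and continuous bilinear forms\<close>

lemma seminorm_zero:
  assumes "seminorm scl p" "vector_space scl" shows "p 0 = 0"
proof -
  interpret vector_space scl by fact
  have "p (scl 0 0) = norm (0 :: 'a) * p 0" using assms(1) unfolding seminorm_def by blast
  then show ?thesis by simp
qed

lemma seminorm_minus:
  assumes "seminorm scl p" "vector_space scl" shows "p (v - w) = p (w - v)"
proof -
  interpret vector_space scl by fact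
  have "p (scl (-1) (w - v)) = norm (-1 :: 'a) * p (w - v)" using assms(1) unfolding seminorm_def by blast
  then show ?thesis by simp
qed

lemma cont_seminorm_add: "cont_seminorm scl p \<Longrightarrow> cont_seminorm scl q \<Longrightarrow> cont_seminorm scl (\<lambda>v. p v + q v)"
  unfolding cont_seminorm_def seminorm_def
  by (auto intro!: continuous_intros simp: distrib_left add_mono intro: order_trans[OF add_mono])
     (smt (verit))

lemma cont_seminorm_0: "cont_seminorm scl (\<lambda>v. 0)"
  by (simp add: cont_seminorm_def seminorm_def)

lemma cont_seminorm_sum:
  "finite J \<Longrightarrow> (\<And>j. j \<in> J \<Longrightarrow> cont_seminorm scl (p j)) \<Longrightarrow> cont_seminorm scl (\<lambda>v. \<Sum>j\<in>J. p j v)"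
  by (induction J rule: finite_induct) (simp_all add: cont_seminorm_0 cont_seminorm_add)

sublocale graded_lc_space \<subseteq> super_space scl V0 V1
  by unfold_locales (rule subspace_V0 subspace_V1 V0_Int_V1 V0_plus_V1)+

context graded_lc_space
begin

definition graded_hull :: "('v \<Rightarrow> real) \<Rightarrow> 'v \<Rightarrow> real"
  where "graded_hull p v = p (p0 v) + p (p1 v)"

text \<open>Continuity of the grading projections enters here: every continuous seminorm is
  dominated by a continuous one that is additive over the grading.\<close>

lemma graded_hull:
  assumes "cont_seminorm scl p"
  shows "cont_seminorm scl (graded_hull p)" "gseminorm (graded_hull p)" "p v \<le> graded_hull p v"
proof -
  have s: "seminorm scl p" and c: "continuous_on UNIV p" using assms by (auto simp: cont_seminorm_def)
  have "continuous_on UNIV (\<lambda>v. p (p0 v))" "continuous_on UNIV (\<lambda>v. p (p1 v))"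
    by (rule continuous_on_compose2[OF c continuous_proj0], simp)
      (rule continuous_on_compose2[OF c continuous_proj1], simp)
  moreover have "seminorm scl (\<lambda>v. p (p0 v))" "seminorm scl (\<lambda>v. p (p1 v))"
    using s by (auto simp: seminorm_def p0_add p1_add p0_scl p1_scl)
  ultimately show *: "cont_seminorm scl (graded_hull p)"
    unfolding graded_hull_def[abs_def] by (intro cont_seminorm_add) (auto simp: cont_seminorm_def)
  have "p 0 = 0" by (rule seminorm_zero[OF s vs_scl])
  then show "gseminorm (graded_hull p)"
    using * unfolding gseminorm_def cont_seminorm_def by (simp add: graded_hull_def)
  show "p v \<le> graded_hull p v"
    using seminormD(2)[OF s, of "p0 v" "p1 v"] by (simp add: graded_hull_def p_sum)
qed

lemma continuous_form_bound:
  assumes B: "bilinear_form scl B" and c: "continuous_on UNIV (\<lambda>(v, w). B v w)"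
  shows "\<exists>p. cont_seminorm scl p \<and> (\<forall>v w. norm (B v w) \<le> p v * p w)"
proof -
  have sc: "B (scl a v) (scl b w) = a * b * B v w" for a b v w
    using B by (simp add: bilinear_form_def Vector_Spaces.linear_iff)
  have z: "B 0 0 = 0" using sc[of 0 0 0 0] by simp
  have "open ((\<lambda>(v, w). B v w) -` ball 0 1)"
    using c by (intro continuous_open_vimage) (auto simp: continuous_on_eq_continuous_at)
  then obtain U U' where U: "open U" "open U'" "(0, 0) \<in> U \<times> U'" "U \<times> U' \<subseteq> (\<lambda>(v, w). B v w) -` ball 0 1"
    by (rule open_prod_elim[of _ "(0, 0)"]) (auto simp: z)
  then have "open (U \<inter> U')" "0 \<in> U \<inter> U'" by auto
  then obtain p where p: "cont_seminorm scl p" "{v. p v < 1} \<subseteq> U \<inter> U'" using locally_convex by blast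
  have s: "seminorm scl p" using p by (simp add: cont_seminorm_def)
  have lt: "norm (B v w) < 1" if "p v < 1" "p w < 1" for v w
  proof -
    have "(v, w) \<in> U \<times> U'" using that p(2) by blast
    then have "(v, w) \<in> (\<lambda>(v, w). B v w) -` ball 0 1" using U(4) by blast
    then show ?thesis by simp
  qed
  \<comment> \<open>Vectors are scaled into the unit ball by \<open>1 / (p v + e)\<close>; the
    summand \<open>e\<close> keeps the divisor positive when \<open>p v = 0\<close> and is sent to 0
    afterwards.\<close>
  have le: "norm (B v w) \<le> (p v + e) * (p w + e)" if e: "e > 0" for v w e
  proof -
    have pv: "p v + e > 0" "p w + e > 0" using seminormD(1)[OF s, of v] seminormD(1)[OF s, of w] e by auto
    have "p (scl (of_real (1 / (p v + e))) v) < 1" "p (scl (of_real (1 / (p w + e))) w) < 1"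
      unfolding seminormD(3)[OF s] norm_of_real using pv e by simp_all
    from lt[OF this] have "norm (of_real (1 / (p v + e)) * of_real (1 / (p w + e)) * B v w) < 1" by (simp only: sc)
    then have "norm (B v w) / ((p v + e) * (p w + e)) < 1"
      unfolding norm_mult norm_of_real using pv by simp
    then show ?thesis using pos_divide_less_eq[of "(p v + e) * (p w + e)" "norm (B v w)" 1] pv by simp
  qed
  have "norm (B v w) \<le> p v * p w" for v w
  proof (rule field_le_epsilon)
    fix d :: real assume d: "d > 0"
    have pv: "0 \<le> p v" "0 \<le> p w" using seminormD(1)[OF s] by auto
    \<comment> \<open>Expanding \<open>(p v + e) * (p w + e)\<close>, the error is
      \<open>e * (p v + p w + e)\<close>, which for \<open>e \<le> 1\<close> is at most
      \<open>d\<close>.\<close>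
    define e where "e = min 1 (d / (p v + p w + 1))"
    have K: "p v + p w + 1 > 0" using pv by linarith
    have "e * (p v + p w + 1) \<le> d / (p v + p w + 1) * (p v + p w + 1)"
      using K by (intro mult_right_mono) (simp_all add: e_def)
    then have e: "e > 0" "e \<le> 1" "e * (p v + p w + 1) \<le> d"
      using d K by (simp_all add: e_def)
    have "(p v + e) * (p w + e) = p v * p w + e * (p v + p w + e)" by (simp add: algebra_simps)
    also have "e * (p v + p w + e) \<le> e * (p v + p w + 1)" using e by (intro mult_left_mono) auto
    finally show "norm (B v w) \<le> p v * p w + d" using le[OF e(1), of v w] e(3) by linarith
  qed
  with p(1) show ?thesis by blast
qed

lemma graded_seminorm_for_form:
  assumes B: "bilinear_form scl B" "continuous_on UNIV (\<lambda>(v, w). B v w)" and p: "cont_seminorm scl p"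
  shows "\<exists>q. cont_seminorm scl q \<and> gseminorm q \<and> (\<forall>v. p v \<le> q v) \<and> (\<forall>v w. norm (B v w) \<le> q v * q w)"
proof -
  obtain b where b: "cont_seminorm scl b" "\<And>v w. norm (B v w) \<le> b v * b w"
    using continuous_form_bound[OF B] by blast
  define q where "q = graded_hull (\<lambda>v. p v + b v)"
  note pb = cont_seminorm_add[OF p b(1)]
  have nn: "0 \<le> p v" "0 \<le> b v" for v using p b by (auto simp: cont_seminorm_def seminorm_def)
  have q: "p v + b v \<le> q v" for v unfolding q_def by (rule graded_hull(3)[OF pb])
  have "b v \<le> q v" "p v \<le> q v" for v using q[of v] nn[of v] by auto
  moreover from this have "b v * b w \<le> q v * q w" for v w
    by (intro mult_mono) (auto intro: order_trans[OF nn(2)] nn)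
  ultimately have "\<forall>v. p v \<le> q v" "\<forall>v w. norm (B v w) \<le> q v * q w" using b(2) order_trans by blast+
  then show ?thesis
    using graded_hull(1,2)[OF pb] unfolding q_def[symmetric] by blast
qed

end

section \<open>Comparison of seminorms with the completion, and continuous extensions\<close>

locale weyl_completion = graded_lc_space scl V0 V1
  for scl :: "'k::real_normed_field \<Rightarrow> 'v::{topological_ab_group_add, t2_space} \<Rightarrow> 'v"
    and V0 V1 :: "'v set" +
  fixes R :: real and sclW :: "'k
      \<Rightarrow> 'w::{topological_ab_group_add, uniform_topological_group_add, complete_uniform_space, t2_space} \<Rightarrow> 'w"
    and \<iota> :: "('k, 'v) tensor \<Rightarrow> 'w"
  assumes R: "R \<ge> 1/2" and completion: "is_weyl_completion scl V0 V1 R sclW \<iota>"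
begin

abbreviation "wn \<equiv> weyl_seminorm scl R"

lemma lc_W: "lc_space sclW" and iota_add: "a \<in> A \<Longrightarrow> b \<in> A \<Longrightarrow> \<iota> (a + b) = \<iota> a + \<iota> b"
  and iota_scale: "a \<in> A \<Longrightarrow> \<iota> (fscale c a) = sclW c (\<iota> a)"
  and iota_embedding: "embedding_map (weyl_topology scl V0 V1 R) euclidean \<iota>"
  and iota_dense: "closure (\<iota> ` A) = UNIV"
  using completion unfolding is_weyl_completion_def by blast+

lemma vs_W: "vector_space sclW"
  using lc_W by (simp add: lc_space_def)

lemma W_locally_convex:
  assumes "open U" "0 \<in> U" obtains q where "cont_seminorm sclW q" "{v. q v < 1} \<subseteq> U"
  using lc_space.locally_convex[OF lc_W assms] by blast

lemma iota_diff: "a \<in> A \<Longrightarrow> b \<in> A \<Longrightarrow> \<iota> (a - b) = \<iota> a - \<iota> b"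
  using iota_add[of "a - b" b] by (simp add: algebra_simps)

lemma iota_0: "\<iota> 0 = 0"
  using iota_diff[of 0 0] by simp

lemma openin_weyl: "openin (weyl_topology scl V0 V1 R) U \<longleftrightarrow> U \<subseteq> A \<and>
    (\<forall>x\<in>U. \<exists>F \<epsilon>. finite F \<and> F \<subseteq> {wn p | p. cont_seminorm scl p} \<and> 0 < \<epsilon> \<and> {y \<in> A. \<forall>q\<in>F. q (y - x) < \<epsilon>} \<subseteq> U)"
  unfolding weyl_topology_def by (rule openin_seminorm_topology)

lemma topspace_weyl: "topspace (weyl_topology scl V0 V1 R) = A"
proof -
  have "openin (weyl_topology scl V0 V1 R) A"
    unfolding openin_weyl by (auto intro!: exI[of _ "{}"] exI[of _ "1::real"])
  moreover have "U \<subseteq> A" if "openin (weyl_topology scl V0 V1 R) U" for U using that unfolding openin_weyl by blast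
  ultimately show ?thesis by (metis openin_subset openin_topspace subset_antisym)
qed

lemma iota_homeo: "homeomorphic_map (weyl_topology scl V0 V1 R) (top_of_set (\<iota> ` A)) \<iota>"
  using iota_embedding unfolding embedding_map_def topspace_weyl by simp

lemma iota_inj: "inj_on \<iota> A"
  using iota_homeo homeomorphic_imp_injective_map topspace_weyl by metis

lemma wn_scale:
  assumes "seminorm scl p" "a \<in> A" shows "wn p (fscale c a) = norm c * wn p a"
proof (cases "c = 0")
  case True
  then show ?thesis using weyl_seminorm_scale_le[OF assms, of R 0] weyl_seminorm_nonneg[OF assms(1) A_zero, of R] by simp
next
  case False
  have "wn p a \<le> norm (inverse c) * wn p (fscale c a)"
    using weyl_seminorm_scale_le[OF assms(1) A_scale[OF assms(2)], of R "inverse c" c] False by simp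
  then have "norm c * wn p a \<le> norm c * (norm (inverse c) * wn p (fscale c a))" by (rule mult_left_mono) simp
  also have "\<dots> = wn p (fscale c a)" using False by (simp add: norm_inverse)
  finally have "norm c * wn p a \<le> wn p (fscale c a)" .
  then show ?thesis using weyl_seminorm_scale_le[OF assms, of R c] by simp
qed

text \<open>If the inequality failed at \<open>a\<close>, rescaling by \<open>1 / \<phi> a\<close>
  would give an element with \<open>\<phi>\<close> equal to 1 but \<open>\<psi>\<close> below
  \<open>\<epsilon>\<close>. This converts inclusions of balls into inequalities.\<close>

lemma homogeneous_domination:
  assumes "\<And>a t. a \<in> A \<Longrightarrow> t > 0 \<Longrightarrow> \<phi> (fscale (of_real t) a) = t * \<phi> a"
    "\<And>a t. a \<in> A \<Longrightarrow> t > 0 \<Longrightarrow> \<psi> (fscale (of_real t) a) = t * \<psi> a"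
    "\<And>a. a \<in> A \<Longrightarrow> 0 \<le> \<psi> a" "\<epsilon> > 0" "\<And>a. a \<in> A \<Longrightarrow> \<psi> a < \<epsilon> \<Longrightarrow> \<phi> a < 1" "a \<in> A"
  shows "\<phi> a \<le> (1 / \<epsilon>) * (\<psi> a :: real)"
proof (rule ccontr)
  assume n: "\<not> ?thesis"
  then have pos: "\<phi> a > 0" using assms(3)[OF assms(6)] assms(4) by (smt (verit) divide_nonneg_pos mult_nonneg_nonneg)
  have "1 / \<phi> a > 0" using pos by simp
  note * = assms(1)[OF assms(6) this] assms(2)[OF assms(6) this]
  have "\<psi> (fscale (of_real (1 / \<phi> a)) a) < \<epsilon>" using n pos assms(4) unfolding *(2) by (simp add: field_simps not_le)
  from assms(5)[OF A_scale[OF assms(6)] this] show False unfolding *(1) using pos by simp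
qed

text \<open>Continuity of the embedding in terms of seminorms.\<close>

lemma iota_seminorm_upper:
  assumes q: "cont_seminorm sclW q"
  shows "\<exists>C p. C > 0 \<and> cont_seminorm scl p \<and> (\<forall>a\<in>A. q (\<iota> a) \<le> C * wn p a)"
proof -
  have sq: "seminorm sclW q" and cq: "continuous_on UNIV q" using q by (auto simp: cont_seminorm_def)
  have "open (q -` {..<1})" using cq by (intro continuous_open_vimage) (auto simp: continuous_on_eq_continuous_at)
  then have "openin (weyl_topology scl V0 V1 R) {a \<in> topspace (weyl_topology scl V0 V1 R). \<iota> a \<in> q -` {..<1} \<inter> \<iota> ` A}"
    by (intro openin_continuous_map_preimage[OF homeomorphic_imp_continuous_map[OF iota_homeo]])
      (auto simp: openin_open)
  moreover have "0 \<in> {a \<in> topspace (weyl_topology scl V0 V1 R). \<iota> a \<in> q -` {..<1} \<inter> \<iota> ` A}"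
    using seminorm_zero[OF sq vs_W] imageI[OF A_zero, of \<iota>] by (simp add: topspace_weyl iota_0)
  ultimately obtain F \<epsilon> where F: "finite F" "F \<subseteq> {wn p | p. cont_seminorm scl p}" "0 < \<epsilon>"
    "{y \<in> A. \<forall>f\<in>F. f (y - 0) < \<epsilon>} \<subseteq> {a \<in> topspace (weyl_topology scl V0 V1 R). \<iota> a \<in> q -` {..<1} \<inter> \<iota> ` A}"
    unfolding openin_weyl by blast
  have "\<forall>f\<in>F. \<exists>p. cont_seminorm scl p \<and> f = wn p" using F(2) by blast
  then obtain pp where pp: "\<And>f. f \<in> F \<Longrightarrow> cont_seminorm scl (pp f)" "\<And>f. f \<in> F \<Longrightarrow> f = wn (pp f)" by metis
  \<comment> \<open>\<open>weyl_seminorm\<close> is monotone in \<open>p\<close>, so the finitely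
    many seminorms of a basic neighbourhood are dominated by the one built from their sum.\<close>
  define p where "p v = (\<Sum>f\<in>F. pp f v)" for v
  have p: "cont_seminorm scl p" unfolding p_def[abs_def] by (rule cont_seminorm_sum[OF F(1) pp(1)])
  then have sp: "seminorm scl p" by (simp add: cont_seminorm_def)
  have le: "wn (pp f) a \<le> wn p a" if "f \<in> F" "a \<in> A" for f a
  proof (rule weyl_seminorm_mono[OF _ sp _ that(2)])
    show "seminorm scl (pp f)" using pp(1)[OF that(1)] by (simp add: cont_seminorm_def)
    show "pp f v \<le> p v" for v
      unfolding p_def using pp(1) by (intro member_le_sum[OF that(1) _ F(1)]) (auto simp: cont_seminorm_def seminorm_def)
  qed
  have "q (\<iota> a) \<le> (1 / \<epsilon>) * wn p a" if "a \<in> A" for a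
  proof (rule homogeneous_domination[where \<phi> = "\<lambda>a. q (\<iota> a)", OF _ _ _ F(3) _ that])
    show "q (\<iota> (fscale (of_real t) a)) = t * q (\<iota> a)" if "a \<in> A" "t > 0" for a t
      using sq that by (simp add: iota_scale seminorm_def)
    show "wn p (fscale (of_real t) a) = t * wn p a" if "a \<in> A" "t > 0" for a t
      using that by (simp add: wn_scale[OF sp])
    show "0 \<le> wn p a" if "a \<in> A" for a by (rule weyl_seminorm_nonneg[OF sp that])
    fix a assume a: "a \<in> A" "wn p a < \<epsilon>"
    have "f a < \<epsilon>" if "f \<in> F" for f
      using le[OF that a(1)] pp(2)[OF that] a(2) by (metis le_less_trans)
    then have "a \<in> {y \<in> A. \<forall>f\<in>F. f (y - 0) < \<epsilon>}" using a by simp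
    then show "q (\<iota> a) < 1" using F(4) by blast
  qed
  moreover have "1 / \<epsilon> > 0" using F(3) by simp
  ultimately show ?thesis using p by blast
qed

text \<open>The embedding is open onto its image, so the open unit ball of \<open>wn p\<close> is
  the trace of an open set of the completion; injectivity leads back from the image to the
  element.\<close>

lemma iota_seminorm_lower:
  assumes p: "cont_seminorm scl p"
  shows "\<exists>q. cont_seminorm sclW q \<and> (\<forall>a\<in>A. wn p a \<le> q (\<iota> a))"
proof -
  have sp: "seminorm scl p" using p by (simp add: cont_seminorm_def)
  have w0: "wn p 0 = 0" using wn_scale[OF sp A_zero, of 0] by simp
  let ?S = "{a \<in> A. wn p a < 1}"
  have "openin (weyl_topology scl V0 V1 R) ?S"
    unfolding openin_weyl
  proof (intro conjI ballI)
    fix x assume x: "x \<in> ?S"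
    have "{y \<in> A. \<forall>q\<in>{wn p}. q (y - x) < 1 - wn p x} \<subseteq> ?S"
    proof clarify
      fix y assume y: "y \<in> A" "\<forall>q\<in>{wn p}. q (y - x) < 1 - wn p x"
      have "wn p y \<le> wn p (y - x) + wn p x" using weyl_seminorm_add[OF sp, of "y - x" x R] x y by simp
      then show "wn p y < 1" using y by simp
    qed
    then show "\<exists>F \<epsilon>. finite F \<and> F \<subseteq> {wn p | p. cont_seminorm scl p} \<and> 0 < \<epsilon> \<and> {y \<in> A. \<forall>q\<in>F. q (y - x) < \<epsilon>} \<subseteq> ?S"
      using x p by (intro exI[of _ "{wn p}"] exI[of _ "1 - wn p x"]) auto
  qed auto
  then have "openin (top_of_set (\<iota> ` A)) (\<iota> ` ?S)"
    using homeomorphic_imp_open_map[OF iota_homeo] unfolding open_map_def by (elim allE impE)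
  then obtain U where U: "open U" "\<iota> ` ?S = \<iota> ` A \<inter> U" by (auto simp: openin_open)
  have "0 \<in> \<iota> ` ?S" using iota_0 w0 by (intro image_eqI[of _ _ 0]) auto
  then have "0 \<in> U" using U by blast
  then obtain q where q: "cont_seminorm sclW q" "{v. q v < 1} \<subseteq> U" using W_locally_convex[OF U(1) \<open>0 \<in> U\<close>] by blast
  have sq: "seminorm sclW q" using q by (simp add: cont_seminorm_def)
  have "wn p a \<le> (1 / 1) * q (\<iota> a)" if "a \<in> A" for a
  proof (rule homogeneous_domination[where \<psi> = "\<lambda>a. q (\<iota> a)" and \<epsilon> = 1, OF _ _ _ _ _ that])
    show "q (\<iota> (fscale (of_real t) a)) = t * q (\<iota> a)" if "a \<in> A" "t > 0" for a t
      using sq that by (simp add: iota_scale seminorm_def)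
    show "wn p (fscale (of_real t) a) = t * wn p a" if "a \<in> A" "t > 0" for a t
      using that by (simp add: wn_scale[OF sp])
    show "0 \<le> q (\<iota> a)" for a using sq by (simp add: seminorm_def)
    fix a assume a: "a \<in> A" "q (\<iota> a) < 1"
    then have "\<iota> a \<in> \<iota> ` A \<inter> U" using q(2) by blast
    then obtain b where "b \<in> ?S" "\<iota> a = \<iota> b" using U(2) by blast
    then have "a = b" using iota_inj a by (auto dest: inj_onD)
    then show "wn p a < 1" using \<open>b \<in> ?S\<close> by simp
  qed simp
  then show ?thesis using q(1) by auto
qed

lemma W_entourage:
  fixes E :: "'w \<times> 'w \<Rightarrow> bool"
  assumes "eventually E uniformity"
  shows "\<exists>q. cont_seminorm sclW q \<and> (\<forall>x y. q (y - x) < 1 \<longrightarrow> E (x, y))"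
proof -
  obtain U where U: "open U" "0 \<in> U" "\<And>x y. y - x \<in> U \<Longrightarrow> E (x, y)"
    using entourage_from_zero_nhd[OF assms] by blast
  obtain q where "cont_seminorm sclW q" "{v. q v < 1} \<subseteq> U" using W_locally_convex[OF U(1,2)] by blast
  then show ?thesis using U(3) by blast
qed

lemma open_seminorm_ball: "cont_seminorm sclW q \<Longrightarrow> open {w. q (w - x) < \<delta>}"
proof -
  assume "cont_seminorm sclW q"
  then have "continuous_on UNIV q" by (simp add: cont_seminorm_def)
  then have "continuous_on UNIV (\<lambda>w. q (w - x))"
    by (rule continuous_on_compose2) (auto intro!: continuous_intros)
  then show ?thesis by (rule open_Collect_less) (rule continuous_on_const)
qed

text \<open>\<open>cont_ext\<close> is a definite description. Density gives uniqueness, and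
  existence follows since the estimate, transported along the embedding, makes \<open>f\<close>
  Cauchy near each point.\<close>

lemma is_cont_ext_cont_ext:
  assumes fA: "\<And>a. a \<in> A \<Longrightarrow> f a \<in> A" and add: "\<And>a b. a \<in> A \<Longrightarrow> b \<in> A \<Longrightarrow> f (a + b) = f a + f b"
    and est: "\<And>p. cont_seminorm scl p \<Longrightarrow> \<exists>p'. cont_seminorm scl p' \<and> (\<forall>a\<in>A. wn p (f a) \<le> wn p' a)"
  shows "is_cont_ext \<iota> A f (cont_ext \<iota> A f)"
proof -
  define h where "h w = \<iota> (f (inv_into A \<iota> w))" for w
  have h: "h (\<iota> a) = \<iota> (f a)" if "a \<in> A" for a using that by (simp add: h_def inv_into_f_f[OF iota_inj])
  have diff: "f (b - a) = f b - f a" if "a \<in> A" "b \<in> A" for a b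
    using add[of "b - a" a] that by (simp add: algebra_simps)
  have "\<exists>F. continuous_on UNIV F \<and> (\<forall>d\<in>\<iota> ` A. F d = h d)"
  proof (rule continuous_extension_from_dense[OF iota_dense])
    fix x :: 'w and E :: "'w \<times> 'w \<Rightarrow> bool" assume E: "eventually E uniformity"
    obtain q where q: "cont_seminorm sclW q" "\<And>x y. q (y - x) < 1 \<Longrightarrow> E (x, y)" using W_entourage[OF E] by blast
    obtain C p where C: "C > 0" "cont_seminorm scl p" "\<And>a. a \<in> A \<Longrightarrow> q (\<iota> a) \<le> C * wn p a"
      using iota_seminorm_upper[OF q(1)] by blast
    obtain p' where p': "cont_seminorm scl p'" "\<And>a. a \<in> A \<Longrightarrow> wn p (f a) \<le> wn p' a" using est[OF C(2)] by blast
    obtain r where r: "cont_seminorm sclW r" "\<And>a. a \<in> A \<Longrightarrow> wn p' a \<le> r (\<iota> a)" 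
      using iota_seminorm_lower[OF p'(1)] by blast
    have sr: "seminorm sclW r" using r by (simp add: cont_seminorm_def)
    \<comment> \<open>Two points of this ball differ by less than \<open>1 / C\<close> in
      \<open>r\<close>, hence their images by less than 1 in \<open>q\<close>.\<close>
    let ?U = "{w. r (w - x) < 1 / (2 * C)}"
    have "E (h d, h d')" if d: "d \<in> ?U \<inter> \<iota> ` A" "d' \<in> ?U \<inter> \<iota> ` A" for d d'
    proof -
      obtain a b where ab: "a \<in> A" "b \<in> A" "d = \<iota> a" "d' = \<iota> b" using d by blast
      have "h d' - h d = \<iota> (f (b - a))" using ab by (simp add: h diff iota_diff fA)
      then have "q (h d' - h d) \<le> C * wn p (f (b - a))" using C(3) fA ab by simp
      also have "\<dots> \<le> C * r (d' - d)"
      proof -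
        have ba: "b - a \<in> A" using ab by simp
        have "wn p (f (b - a)) \<le> r (\<iota> (b - a))" by (rule order_trans[OF p'(2)[OF ba] r(2)[OF ba]])
        then show ?thesis using ab C(1) by (simp add: iota_diff)
      qed
      also have "r (d' - d) \<le> r (d' - x) + r (x - d)"
        using sr unfolding seminorm_def by (metis diff_add_cancel add_diff_eq)
      also have "r (x - d) = r (d - x)" by (rule seminorm_minus[OF sr vs_W])
      finally have "q (h d' - h d) \<le> C * (r (d' - x) + r (d - x))" using C(1) by simp
      also have "\<dots> < C * (1 / (2 * C) + 1 / (2 * C))" using d C(1) by (intro mult_strict_left_mono add_strict_mono) auto
      finally show ?thesis using C(1) by (intro q(2)) simp
    qed
    moreover have "open ?U" by (rule open_seminorm_ball[OF r(1)])
    moreover have "x \<in> ?U" using seminorm_zero[OF sr vs_W] C(1) by simp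
    ultimately show "\<exists>U. open U \<and> x \<in> U \<and> (\<forall>d\<in>U \<inter> \<iota> ` A. \<forall>d'\<in>U \<inter> \<iota> ` A. E (h d, h d'))"
      by (intro exI[of _ ?U]) blast
  qed
  then obtain F where "continuous_on UNIV F" "\<forall>d\<in>\<iota> ` A. F d = h d" by (elim exE conjE)
  then have F: "continuous_on UNIV F" "\<And>a. a \<in> A \<Longrightarrow> F (\<iota> a) = \<iota> (f a)" by (simp_all add: h)
  have uniq: "G = F" if G: "is_cont_ext \<iota> A f G" for G
  proof
    fix x show "G x = F x"
    proof (rule continuous_eq_on_dense[where F = G and G = F, OF _ F(1) iota_dense])
      show "continuous_on UNIV G" using G by (simp add: is_cont_ext_def)
      fix d assume "d \<in> \<iota> ` A"
      then show "G d = F d" using G F(2) by (auto simp: is_cont_ext_def)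
    qed
  qed
  have "is_cont_ext \<iota> A f F" using F by (simp add: is_cont_ext_def)
  then show ?thesis unfolding cont_ext_def by (rule theI[of _ F]) (rule uniq)
qed

lemma is_cont_ext2_cont_ext2:
  assumes mA: "\<And>a b. a \<in> A \<Longrightarrow> b \<in> A \<Longrightarrow> m a b \<in> A"
    and addl: "\<And>a b c. a \<in> A \<Longrightarrow> b \<in> A \<Longrightarrow> c \<in> A \<Longrightarrow> m (a + c) b = m a b + m c b"
    and addr: "\<And>a b c. a \<in> A \<Longrightarrow> b \<in> A \<Longrightarrow> c \<in> A \<Longrightarrow> m a (b + c) = m a b + m a c"
    and est: "\<And>p. cont_seminorm scl p \<Longrightarrow> \<exists>p'. cont_seminorm scl p' \<and> (\<forall>a\<in>A. \<forall>b\<in>A. wn p (m a b) \<le> wn p' a * wn p' b)"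
  shows "is_cont_ext2 \<iota> A m (cont_ext2 \<iota> A m)"
proof -
  define h where "h = (\<lambda>(u, v). \<iota> (m (inv_into A \<iota> u) (inv_into A \<iota> v)))"
  have h: "h (\<iota> a, \<iota> b) = \<iota> (m a b)" if "a \<in> A" "b \<in> A" for a b using that by (simp add: h_def inv_into_f_f[OF iota_inj])
  have diffl: "m (b - a) c = m b c - m a c" if "a \<in> A" "b \<in> A" "c \<in> A" for a b c
    using addl[of "b - a" c a] that by (simp add: algebra_simps)
  have diffr: "m c (b - a) = m c b - m c a" if "a \<in> A" "b \<in> A" "c \<in> A" for a b c
    using addr[of c "b - a" a] that by (simp add: algebra_simps)
  have dense2: "closure (\<iota> ` A \<times> \<iota> ` A) = UNIV" by (simp add: closure_Times iota_dense)
  have "\<exists>F. continuous_on UNIV F \<and> (\<forall>d\<in>\<iota> ` A \<times> \<iota> ` A. F d = h d)"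
  proof (rule continuous_extension_from_dense[OF dense2])
    fix z :: "'w \<times> 'w" and E :: "'w \<times> 'w \<Rightarrow> bool" assume E: "eventually E uniformity"
    obtain x y where z: "z = (x, y)" by (cases z)
    obtain q where q: "cont_seminorm sclW q" "\<And>x y. q (y - x) < 1 \<Longrightarrow> E (x, y)" using W_entourage[OF E] by blast
    have sq: "seminorm sclW q" using q by (simp add: cont_seminorm_def)
    obtain C p where C: "C > 0" "cont_seminorm scl p" "\<And>a. a \<in> A \<Longrightarrow> q (\<iota> a) \<le> C * wn p a"
      using iota_seminorm_upper[OF q(1)] by blast
    obtain p' where p': "cont_seminorm scl p'" "\<And>a b. a \<in> A \<Longrightarrow> b \<in> A \<Longrightarrow> wn p (m a b) \<le> wn p' a * wn p' b"
      using est[OF C(2)] by blast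
    have sp': "seminorm scl p'" using p' by (simp add: cont_seminorm_def)
    obtain r where r: "cont_seminorm sclW r" "\<And>a. a \<in> A \<Longrightarrow> wn p' a \<le> r (\<iota> a)" 
      using iota_seminorm_lower[OF p'(1)] by blast
    have sr: "seminorm sclW r" using r by (simp add: cont_seminorm_def)
    have r0: "0 \<le> r w" and rtri: "r (u + w) \<le> r u + r w" for u w using sr by (auto simp: seminorm_def)
    have bound: "q (\<iota> (m a b)) \<le> C * (r (\<iota> a) * r (\<iota> b))" if "a \<in> A" "b \<in> A" for a b
    proof -
      have "q (\<iota> (m a b)) \<le> C * wn p (m a b)" using C(3) mA that by simp
      also have "\<dots> \<le> C * (wn p' a * wn p' b)" using p'(2) that C(1) by simp
      also have "\<dots> \<le> C * (r (\<iota> a) * r (\<iota> b))"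
        using r(2) that C(1) weyl_seminorm_nonneg[OF sp'] r0 by (intro mult_left_mono mult_mono) auto
      finally show ?thesis .
    qed
    \<comment> \<open>The difference \<open>m a' b' - m a b = m (a' - a) b' + m a (b' - b)\<close>
      will be bounded by \<open>2 * C * \<delta> * (r x + r y + 2 * \<delta>)\<close>. The choice of
      \<open>K\<close> and \<open>\<delta>\<close> makes this at most
      \<open>C / (C + 1)\<close>.\<close>
    define K where "K = r x + r y + 2"
    define \<delta> where "\<delta> = 1 / (2 * (C + 1) * K)"
    have K: "K \<ge> 2" using r0 by (simp add: K_def)
    have "2 * (C + 1) * K \<ge> 1 * 2" using K C(1) by (intro mult_mono) auto
    then have \<delta>: "\<delta> > 0" "\<delta> \<le> 1" "2 * C * \<delta> * K < 1" using K C(1) by (auto simp: \<delta>_def field_simps)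
    let ?U = "{w. r (w - x) < \<delta>} \<times> {w. r (w - y) < \<delta>}"
    have near: "r (w' - w) \<le> 2 * \<delta>" "r w \<le> r v + \<delta>" if "r (w - v) < \<delta>" "r (w' - v) < \<delta>" for w w' v
    proof -
      have "r (w' - w) \<le> r (w' - v) + r (v - w)" using rtri[of "w' - v" "v - w"] by simp
      also have "r (v - w) = r (w - v)" by (rule seminorm_minus[OF sr vs_W])
      finally show "r (w' - w) \<le> 2 * \<delta>" using that by simp
      show "r w \<le> r v + \<delta>" using rtri[of "w - v" v] that by simp
    qed
    have "E (h d, h d')" if d: "d \<in> ?U \<inter> \<iota> ` A \<times> \<iota> ` A" "d' \<in> ?U \<inter> \<iota> ` A \<times> \<iota> ` A" for d d'
    proof -
      obtain a b a' b' where ab: "a \<in> A" "b \<in> A" "a' \<in> A" "b' \<in> A" "d = (\<iota> a, \<iota> b)" "d' = (\<iota> a', \<iota> b')" using d by blast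
      have rd: "r (\<iota> a - x) < \<delta>" "r (\<iota> a' - x) < \<delta>" "r (\<iota> b - y) < \<delta>" "r (\<iota> b' - y) < \<delta>" using d ab by auto
      have "m a' b' - m a b = m (a' - a) b' + m a (b' - b)" using ab by (simp add: diffl diffr)
      then have "h d' - h d = \<iota> (m (a' - a) b') + \<iota> (m a (b' - b))"
        using ab by (metis h iota_diff iota_add mA A_diff)
      then have "q (h d' - h d) \<le> q (\<iota> (m (a' - a) b')) + q (\<iota> (m a (b' - b)))" using sq by (simp add: seminorm_def)
      also have "\<dots> \<le> C * (r (\<iota> a' - \<iota> a) * r (\<iota> b')) + C * (r (\<iota> a) * r (\<iota> b' - \<iota> b))"
        using bound[of "a' - a" b'] bound[of a "b' - b"] ab by (simp add: iota_diff)
      also have "\<dots> \<le> C * (2 * \<delta> * (r y + \<delta>)) + C * ((r x + \<delta>) * (2 * \<delta>))"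
        using near[OF rd(1,2)] near[OF rd(3,4)] near(2)[OF rd(4,3)] C(1) r0 \<delta>
        by (intro add_mono mult_left_mono mult_mono) (auto intro: add_nonneg_nonneg)
      also have "\<dots> = 2 * C * \<delta> * (r x + r y + 2 * \<delta>)" by (simp add: algebra_simps)
      also have "\<dots> \<le> 2 * C * \<delta> * K" using C(1) \<delta> by (intro mult_left_mono) (auto simp: K_def)
      also have "\<dots> < 1" by (rule \<delta>)
      finally show ?thesis by (rule q(2))
    qed
    moreover have "open ?U" by (intro open_Times open_seminorm_ball[OF r(1)])
    moreover have "z \<in> ?U" using seminorm_zero[OF sr vs_W] \<delta> by (simp add: z)
    ultimately show "\<exists>U. open U \<and> z \<in> U \<and> (\<forall>d\<in>U \<inter> \<iota> ` A \<times> \<iota> ` A. \<forall>d'\<in>U \<inter> \<iota> ` A \<times> \<iota> ` A. E (h d, h d'))"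
      by (intro exI[of _ ?U]) blast
  qed
  then obtain F0 where F0: "continuous_on UNIV F0" "\<forall>d\<in>\<iota> ` A \<times> \<iota> ` A. F0 d = h d" by (elim exE conjE)
  have "(\<lambda>(x, y). F0 (x, y)) = F0" by auto
  with F0 have F: "is_cont_ext2 \<iota> A m (\<lambda>x y. F0 (x, y))" by (simp add: is_cont_ext2_def h)
  have uniq: "G = (\<lambda>x y. F0 (x, y))" if G: "is_cont_ext2 \<iota> A m G" for G
  proof (intro ext)
    fix x y
    have "(\<lambda>(x, y). G x y) (x, y) = F0 (x, y)"
    proof (rule continuous_eq_on_dense[where F = "\<lambda>(x, y). G x y" and G = F0, OF _ F0(1) dense2])
      show "continuous_on UNIV (\<lambda>(x, y). G x y)" using G unfolding is_cont_ext2_def by blast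
      fix d assume "d \<in> \<iota> ` A \<times> \<iota> ` A"
      then obtain a b where "d = (\<iota> a, \<iota> b)" "a \<in> A" "b \<in> A" by blast
      then show "(case d of (x, y) \<Rightarrow> G x y) = F0 d" using G F0(2) h unfolding is_cont_ext2_def by auto
    qed
    then show "G x y = F0 (x, y)" by simp
  qed
  from F show ?thesis unfolding cont_ext2_def by (rule theI[of _ "\<lambda>x y. F0 (x, y)"]) (rule uniq)
qed

lemma is_cont_ext_exp_Delta:
  assumes g: "eform g" "gsym g" and c: "continuous_on UNIV (\<lambda>(v, w). g v w)"
  shows "is_cont_ext \<iota> A (exp_Delta scl V0 V1 g z) (cont_ext \<iota> A (exp_Delta scl V0 V1 g z))"
proof (rule is_cont_ext_cont_ext)
  fix p assume p: "cont_seminorm scl p"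
  have B: "bilinear_form scl g" using g by (simp add: eform_def)
  obtain q where q: "cont_seminorm scl q" "gseminorm q" "\<And>v. p v \<le> q v" "\<And>v w. norm (g v w) \<le> q v * q w"
    using graded_seminorm_for_form[OF B c p] by blast
  let ?q = "\<lambda>v. (2 * (1 + 2 * norm z)) * q v"
  have "cont_seminorm scl ?q"
    using q(1) unfolding cont_seminorm_def by (auto intro!: seminorm_scale continuous_intros)
  moreover have "wn p (exp_Delta scl V0 V1 g z a) \<le> wn ?q a" if a: "a \<in> A" for a
  proof -
    have "wn p (exp_Delta scl V0 V1 g z a) \<le> wn q (exp_Delta scl V0 V1 g z a)"
      using p q exp_Delta_A[OF g a] by (intro weyl_seminorm_mono) (auto simp: cont_seminorm_def)
    also have "\<dots> \<le> wn ?q a" by (rule exp_Delta_estimate[OF g q(2,4) R a])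
    finally show ?thesis .
  qed
  ultimately show "\<exists>p'. cont_seminorm scl p' \<and> (\<forall>a\<in>A. wn p (exp_Delta scl V0 V1 g z a) \<le> wn p' a)" by blast
qed (simp_all add: exp_Delta_A exp_Delta_add g)

lemma is_cont_ext2_star:
  assumes B: "eform B" and c: "continuous_on UNIV (\<lambda>(v, w). B v w)"
  shows "is_cont_ext2 \<iota> A (star scl V0 V1 B z) (cont_ext2 \<iota> A (star scl V0 V1 B z))"
proof (rule is_cont_ext2_cont_ext2)
  fix p assume p: "cont_seminorm scl p"
  have bB: "bilinear_form scl B" using B by (simp add: eform_def)
  obtain q where q: "cont_seminorm scl q" "gseminorm q" "\<And>v. p v \<le> q v" "\<And>v w. norm (B v w) \<le> q v * q w"
    using graded_seminorm_for_form[OF bB c p] by blast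
  let ?q = "\<lambda>v. ((2 * 2 powr R) * (1 + norm z)) * q v"
  have "cont_seminorm scl ?q"
    using q(1) unfolding cont_seminorm_def by (auto intro!: seminorm_scale continuous_intros)
  moreover have "wn p (star scl V0 V1 B z a b) \<le> wn ?q a * wn ?q b" if a: "a \<in> A" "b \<in> A" for a b
  proof -
    have "wn p (star scl V0 V1 B z a b) \<le> wn q (star scl V0 V1 B z a b)"
      using p q star_A[OF B a] by (intro weyl_seminorm_mono) (auto simp: cont_seminorm_def)
    also have "\<dots> \<le> wn ?q a * wn ?q b" by (rule star_estimate[OF B q(2,4) R a])
    finally show ?thesis .
  qed
  ultimately show "\<exists>p'. cont_seminorm scl p' \<and> (\<forall>a\<in>A. \<forall>b\<in>A. wn p (star scl V0 V1 B z a b) \<le> wn p' a * wn p' b)" by blast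
qed (simp_all add: star_A star_lin B)

text \<open>Each identity holds on the dense image by algebra, and both sides are continuous;
  identities in two variables use density of the product of the image with itself. The extension for
  \<open>- z\<close> is the continuous inverse.\<close>

theorem exp_Delta_iso:
  fixes z :: 'k
  assumes L: "eform \<Lambda>" "continuous_on UNIV (\<lambda>(v, w). \<Lambda> v w)"
    and g: "eform g" "gsym g" "continuous_on UNIV (\<lambda>(v, w). g v w)"
  defines "E \<equiv> cont_ext \<iota> A (exp_Delta scl V0 V1 g z)"
    and "m \<equiv> cont_ext2 \<iota> A (star scl V0 V1 \<Lambda> z)" and "m' \<equiv> cont_ext2 \<iota> A (star scl V0 V1 (\<Lambda> + g) z)"
  shows "lc_algebra_iso sclW m m' E"
proof -
  have L': "continuous_on UNIV (\<lambda>(v, w). (\<Lambda> + g) v w)"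
    using continuous_on_add[OF L(2) g(3)] by (simp add: case_prod_unfold plus_fun_apply)
  define E' where "E' = cont_ext \<iota> A (exp_Delta scl V0 V1 g (- z))"
  have E: "continuous_on UNIV E" "\<And>a. a \<in> A \<Longrightarrow> E (\<iota> a) = \<iota> (exp_Delta scl V0 V1 g z a)"
    using is_cont_ext_exp_Delta[OF g, of z] unfolding is_cont_ext_def E_def by auto
  have E': "continuous_on UNIV E'" "\<And>a. a \<in> A \<Longrightarrow> E' (\<iota> a) = \<iota> (exp_Delta scl V0 V1 g (- z) a)"
    using is_cont_ext_exp_Delta[OF g, of "- z"] unfolding is_cont_ext_def E'_def by auto
  have m: "continuous_on UNIV (\<lambda>(x, y). m x y)" "\<And>a b. a \<in> A \<Longrightarrow> b \<in> A \<Longrightarrow> m (\<iota> a) (\<iota> b) = \<iota> (star scl V0 V1 \<Lambda> z a b)"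
    using is_cont_ext2_star[OF L, of z] unfolding is_cont_ext2_def m_def by auto
  have m': "continuous_on UNIV (\<lambda>(x, y). m' x y)" "\<And>a b. a \<in> A \<Longrightarrow> b \<in> A \<Longrightarrow> m' (\<iota> a) (\<iota> b) = \<iota> (star scl V0 V1 (\<Lambda> + g) z a b)"
    using is_cont_ext2_star[OF eform_plus[OF L(1) g(1)] L', of z] unfolding is_cont_ext2_def m'_def by auto
  note X = exp_Delta_A[OF g(1,2)]
  have dense2: "closure (\<iota> ` A \<times> \<iota> ` A) = UNIV" by (simp add: closure_Times iota_dense)
  have Ec: "continuous_on UNIV (\<lambda>u. E (f u))" if "continuous_on UNIV f" for f :: "'b::topological_space \<Rightarrow> 'w"
    by (rule continuous_on_compose2[OF E(1) that]) simp
  have E'c: "continuous_on UNIV (\<lambda>u. E' (f u))" if "continuous_on UNIV f" for f :: "'b::topological_space \<Rightarrow> 'w"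
    by (rule continuous_on_compose2[OF E'(1) that]) simp
  have inv1: "E (E' x) = x" for x
    by (rule continuous_eq_on_dense[OF Ec[OF E'(1)] continuous_on_id iota_dense])
      (auto simp: E E' X exp_Delta_inverse[OF g(1,2)])
  have inv2: "E' (E x) = x" for x
    by (rule continuous_eq_on_dense[OF E'c[OF E(1)] continuous_on_id iota_dense])
      (use exp_Delta_inverse[OF g(1,2), of _ "- z"] in \<open>auto simp: E E' X\<close>)
  have "homeomorphic_map euclidean euclidean E"
    unfolding homeomorphic_map_maps homeomorphic_maps_def using E(1) E'(1) inv1 inv2 by auto
  moreover have "E (x + y) = E x + E y" for x y
  proof -
    have "E (fst (x, y) + snd (x, y)) = E (fst (x, y)) + E (snd (x, y))"
    proof (rule continuous_eq_on_dense[where F = "\<lambda>u. E (fst u + snd u)" and G = "\<lambda>u. E (fst u) + E (snd u)", OF _ _ dense2])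
      show "continuous_on UNIV (\<lambda>u. E (fst u + snd u))" by (intro Ec continuous_intros)
      show "continuous_on UNIV (\<lambda>u. E (fst u) + E (snd u))" by (intro continuous_on_add Ec continuous_intros)
      fix d assume "d \<in> \<iota> ` A \<times> \<iota> ` A"
      then obtain a b where "d = (\<iota> a, \<iota> b)" "a \<in> A" "b \<in> A" by blast
      then show "E (fst d + snd d) = E (fst d) + E (snd d)"
        by (simp add: E X exp_Delta_add[OF g(1,2)] flip: iota_add)
    qed
    then show ?thesis by simp
  qed
  moreover have "E (sclW c x) = sclW c (E x)" for c x
  proof (rule continuous_eq_on_dense[where F = "\<lambda>x. E (sclW c x)" and G = "\<lambda>x. sclW c (E x)", OF _ _ iota_dense])
    have "continuous_on UNIV (\<lambda>(c, v). sclW c v)" using lc_space.continuous_scale[OF lc_W] .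
    then have sc: "continuous_on UNIV (\<lambda>u. sclW c (f u))" if "continuous_on UNIV f" for f :: "'w \<Rightarrow> 'w"
      using continuous_on_compose2[of UNIV "\<lambda>(c, v). sclW c v" UNIV "\<lambda>u. (c, f u)"]
        continuous_on_Pair[OF continuous_on_const[of UNIV c] that] by simp
    show "continuous_on UNIV (\<lambda>x. E (sclW c x))" by (intro Ec sc continuous_on_id)
    show "continuous_on UNIV (\<lambda>x. sclW c (E x))" by (intro sc E)
    fix d assume "d \<in> \<iota> ` A"
    then obtain a where "d = \<iota> a" "a \<in> A" by blast
    then show "E (sclW c d) = sclW c (E d)"
      by (simp add: E X exp_Delta_fscale[OF g(1,2)] flip: iota_scale)
  qed
  moreover have "E (m x y) = m' (E x) (E y)" for x y
  proof -
    have "E (case (x, y) of (x, y) \<Rightarrow> m x y) = (\<lambda>(x, y). m' x y) (E (fst (x, y)), E (snd (x, y)))"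
    proof (rule continuous_eq_on_dense[where F = "\<lambda>u. E (case u of (x, y) \<Rightarrow> m x y)"
        and G = "\<lambda>u. (\<lambda>(x, y). m' x y) (E (fst u), E (snd u))", OF _ _ dense2])
      show "continuous_on UNIV (\<lambda>u. E (case u of (x, y) \<Rightarrow> m x y))" by (rule Ec[OF m(1)])
      show "continuous_on UNIV (\<lambda>u. (\<lambda>(x, y). m' x y) (E (fst u), E (snd u)))"
        by (rule continuous_on_compose2[OF m'(1)]) (auto intro!: Ec continuous_intros)
      fix d assume "d \<in> \<iota> ` A \<times> \<iota> ` A"
      then obtain a b where "d = (\<iota> a, \<iota> b)" "a \<in> A" "b \<in> A" by blast
      then show "E (case d of (x, y) \<Rightarrow> m x y) = (\<lambda>(x, y). m' x y) (E (fst d), E (snd d))"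
        by (simp add: E m m' X star_A[OF L(1)] exp_Delta_star[OF L(1) g(1,2)])
    qed
    then show ?thesis by simp
  qed
  ultimately show ?thesis
    unfolding lc_algebra_iso_def Vector_Spaces.linear_iff using vs_W by blast
qed

end

text \<open>The products and \<open>E\<close> are definite descriptions, so the clauses with
  \<open>is_cont_ext\<close> and \<open>is_cont_ext2\<close> guarantee that they denote the intended
  extensions.\<close>

theorem proposition5p9:
  fixes scl :: "'k::real_normed_field \<Rightarrow> 'v::{topological_ab_group_add, t2_space} \<Rightarrow> 'v"
    and V0 V1 :: "'v set"
    and R :: real and z :: 'k
    and \<Lambda> \<Lambda>' g :: "'v \<Rightarrow> 'v \<Rightarrow> 'k"
    and sclW :: "'k
      \<Rightarrow> 'w::{topological_ab_group_add, uniform_topological_group_add, complete_uniform_space, t2_space} \<Rightarrow> 'w"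
    and \<iota> :: "('k, 'v) tensor \<Rightarrow> 'w"
    and star_\<Lambda> star_\<Lambda>' :: "'w \<Rightarrow> 'w \<Rightarrow> 'w" and E :: "'w \<Rightarrow> 'w"
  assumes V: "graded_lc_space scl V0 V1"
    and R: "R \<ge> 1/2"
    and \<Lambda>: "bilinear_form scl \<Lambda>" "even_form V0 V1 \<Lambda>" "continuous_on UNIV (\<lambda>(v, w). \<Lambda> v w)"
    and \<Lambda>': "bilinear_form scl \<Lambda>'" "even_form V0 V1 \<Lambda>'" "continuous_on UNIV (\<lambda>(v, w). \<Lambda>' v w)"
    and antisym: "antisym_part V0 V1 \<Lambda> = antisym_part V0 V1 \<Lambda>'"
    and W: "is_weyl_completion scl V0 V1 R sclW \<iota>"
    and star_\<Lambda>: "star_\<Lambda> = cont_ext2 \<iota> (sym_alg scl V0 V1) (star scl V0 V1 \<Lambda> z)"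
    and star_\<Lambda>': "star_\<Lambda>' = cont_ext2 \<iota> (sym_alg scl V0 V1) (star scl V0 V1 \<Lambda>' z)"
    and g: "g = \<Lambda>' - \<Lambda>"
    and E: "E = cont_ext \<iota> (sym_alg scl V0 V1) (exp_Delta scl V0 V1 g z)"
  shows "g = sym_part V0 V1 \<Lambda>' - sym_part V0 V1 \<Lambda>
    \<and> is_cont_ext2 \<iota> (sym_alg scl V0 V1) (star scl V0 V1 \<Lambda> z) star_\<Lambda>
    \<and> is_cont_ext2 \<iota> (sym_alg scl V0 V1) (star scl V0 V1 \<Lambda>' z) star_\<Lambda>'
    \<and> is_cont_ext \<iota> (sym_alg scl V0 V1) (exp_Delta scl V0 V1 g z) E
    \<and> lc_algebra_iso sclW star_\<Lambda> star_\<Lambda>' E"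
proof -
  interpret weyl_completion scl V0 V1 R sclW \<iota>
    by (intro weyl_completion.intro V weyl_completion_axioms.intro R W)
  have eL: "eform \<Lambda>" and eL': "eform \<Lambda>'" using \<Lambda> \<Lambda>' by (simp_all add: eform_def)
  have g_apply: "g v w = \<Lambda>' v w - \<Lambda> v w" for v w by (simp add: g minus_apply)
  have eg: "eform g"
    using \<Lambda> \<Lambda>' unfolding eform_def bilinear_form_def even_form_def Vector_Spaces.linear_iff
    by (auto simp: g_apply algebra_simps)
  have cg: "continuous_on UNIV (\<lambda>(v, w). g v w)"
    using continuous_on_diff[OF \<Lambda>'(3) \<Lambda>(3)] by (simp add: case_prod_unfold g_apply)
  have "\<Lambda> v w - graded_flip V0 V1 \<Lambda> v w = \<Lambda>' v w - graded_flip V0 V1 \<Lambda>' v w" for v w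
    using fun_cong[OF fun_cong[OF antisym, of v], of w] unfolding antisym_part_def
    by (metis divide_cancel_right zero_neq_numeral)
  \<comment> \<open>The difference \<open>g\<close> equals its own graded flip. On homogeneous
    vectors the flip is the Koszul sign times the exchanged value, which yields
    \<open>gsym g\<close>.\<close>
  then have flip: "g v w = graded_flip V0 V1 \<Lambda>' v w - graded_flip V0 V1 \<Lambda> v w" for v w
    by (simp add: g_apply algebra_simps)
  have gs: "gsym g"
    unfolding gsym_def
  proof (intro ballI)
    fix a b assume "a \<in> V0 \<union> V1" "b \<in> V0 \<union> V1"
    moreover have "g a b = graded_flip V0 V1 g a b"
      unfolding flip[of a b] by (simp add: graded_flip_def g_apply)
    ultimately show "g a b = koszul_sign a b * g b a"
      using par_V0 par_V1 eform_zero[OF eg]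
      by (cases "a = 0 \<or> b = 0") (auto simp: graded_flip_def koszul_sign_def)
  qed
  have Lg: "\<Lambda> + g = \<Lambda>'" by (simp add: g)
  have "g = sym_part V0 V1 \<Lambda>' - sym_part V0 V1 \<Lambda>"
  proof (intro ext)
    fix v w
    have "g v w = (g v w + g v w) / 2" by simp
    also have "\<dots> = (g v w + (graded_flip V0 V1 \<Lambda>' v w - graded_flip V0 V1 \<Lambda> v w)) / 2" by (simp only: flip[symmetric])
    also have "\<dots> = (sym_part V0 V1 \<Lambda>' - sym_part V0 V1 \<Lambda>) v w"
      by (simp add: sym_part_def g_apply minus_apply diff_divide_distrib add_divide_distrib)
    finally show "g v w = (sym_part V0 V1 \<Lambda>' - sym_part V0 V1 \<Lambda>) v w" .
  qed
  moreover have "is_cont_ext2 \<iota> (sym_alg scl V0 V1) (star scl V0 V1 \<Lambda> z) star_\<Lambda>"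
    unfolding star_\<Lambda> by (rule is_cont_ext2_star[OF eL \<Lambda>(3)])
  moreover have "is_cont_ext2 \<iota> (sym_alg scl V0 V1) (star scl V0 V1 \<Lambda>' z) star_\<Lambda>'"
    unfolding star_\<Lambda>' by (rule is_cont_ext2_star[OF eL' \<Lambda>'(3)])
  moreover have "is_cont_ext \<iota> (sym_alg scl V0 V1) (exp_Delta scl V0 V1 g z) E"
    unfolding E by (rule is_cont_ext_exp_Delta[OF eg gs cg])
  moreover have "lc_algebra_iso sclW star_\<Lambda> star_\<Lambda>' E"
    using exp_Delta_iso[OF eL \<Lambda>(3) eg gs cg, of z] unfolding star_\<Lambda> star_\<Lambda>' E Lg .
  ultimately show ?thesis by blast
qed

end
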